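(* Let $p$ be an odd prime, let $q$ be a prime factor of $p-1$, and let $k$ be an integer which is divisible by some prime larger than $p$ but is not divisible by $p$. Then the Jacobian of the curve $$y^q=x(x-1)\cdots(x-(p-1))+k^q$$ has Mordell–Weil rank at least $p-1$ over $\mathbb Q$.
   Context: The curve given by an equation $y^q=F(x)$ means the smooth projective model over $\mathbb Q$ of the affine curve with this equation. The Mordell–Weil rank over $\mathbb Q$ of its Jacobian $J$ is the rank of the finitely generated abelian group $J(\mathbb Q)$. *)

theory Defs
  imports
    "HOL-Algebra.Algebraic_Closure_Type"
    "HOL-Algebra.Generated_Fields"
    "HOL-Algebra.QuotRing"
    "HOL-Algebra.Free_Abelian_Groups"
    "HOL-Library.Extended_Nat"
begin

section \<open>Rank of an abelian group\<close>

definition int_independent :: "('a, 'm) monoid_scheme \<Rightarrow> 'a set \<Rightarrow> bool"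
  where "int_independent G S \<longleftrightarrow> finite S \<and> S \<subseteq> carrier G \<and>
    (\<forall>a :: 'a \<Rightarrow> int. finprod G (\<lambda>x. x [^]\<^bsub>G\<^esub> a x) S = \<one>\<^bsub>G\<^esub> \<longrightarrow> (\<forall>x\<in>S. a x = 0))"

text \<open>The supremum is taken in \<^typ>\<open>enat\<close>, so the rank is meaningful without knowing that the
  group is finitely generated; for a finitely generated group it is the usual (finite) rank.\<close>

definition abelian_rank :: "('a, 'm) monoid_scheme \<Rightarrow> enat"
  where "abelian_rank G = (SUP S \<in> {S. int_independent G S}. enat (card S))"


section \<open>Curves as function fields\<close>

text \<open>A smooth projective curve over an algebraically closed field \<open>K\<close> is given by its function
  field \<open>L\<close>, a subset of an ambient field \<^typ>\<open>'a\<close>. Its points are the valuation rings of \<open>L\<close>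
  over \<open>K\<close> (the local rings of the curve). Such rings are automatically discrete.\<close>

definition curve_points :: "'a :: field set \<Rightarrow> 'a set \<Rightarrow> 'a set set"
  where "curve_points K L = {V. subring V ring_of_type_algebra \<and> K \<subset> V \<and> V \<subset> L \<and>
    (\<forall>f\<in>L. f \<in> V \<or> inverse f \<in> V)}"

definition val_units :: "'a :: field set \<Rightarrow> 'a set"
  where "val_units V = {u \<in> V. u \<noteq> 0 \<and> inverse u \<in> V}"

definition is_uniformizer :: "'a :: field set \<Rightarrow> 'a \<Rightarrow> bool"
  where "is_uniformizer V t \<longleftrightarrow> t \<in> V \<and> V - val_units V = (\<lambda>g. t * g) ` V"

definition ord_at :: "'a :: field set \<Rightarrow> 'a \<Rightarrow> int"
  where "ord_at V f = (THE n. \<exists>t u. is_uniformizer V t \<and> u \<in> val_units V \<and> f = t powi n * u)"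

definition divisor_group :: "'a :: field set \<Rightarrow> 'a set \<Rightarrow> ('a set \<Rightarrow>\<^sub>0 int) monoid"
  where "divisor_group K L = free_Abelian_group (curve_points K L)"

text \<open>Since \<open>K\<close> is algebraically closed, every point has degree one.\<close>

definition divisor_degree :: "('a set \<Rightarrow>\<^sub>0 int) \<Rightarrow> int"
  where "divisor_degree D = (\<Sum>P\<in>Poly_Mapping.keys D. Poly_Mapping.lookup D P)"

definition principal_divisors :: "'a :: field set \<Rightarrow> 'a set \<Rightarrow> ('a set \<Rightarrow>\<^sub>0 int) set"
  where "principal_divisors K L = {D \<in> carrier (divisor_group K L).
    \<exists>f\<in>L. f \<noteq> 0 \<and> (\<forall>P\<in>curve_points K L. Poly_Mapping.lookup D P = ord_at P f)}"

definition divisor_class_group :: "'a :: field set \<Rightarrow> 'a set \<Rightarrow> ('a set \<Rightarrow>\<^sub>0 int) set monoid"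
  where "divisor_class_group K L = divisor_group K L Mod principal_divisors K L"

text \<open>Principal divisors have degree zero, so all divisors in a class have the same degree.\<close>

definition Pic0 :: "'a :: field set \<Rightarrow> 'a set \<Rightarrow> ('a set \<Rightarrow>\<^sub>0 int) set monoid"
  where "Pic0 K L = (divisor_class_group K L)
    \<lparr>carrier := {c \<in> carrier (divisor_class_group K L). \<exists>D\<in>c. divisor_degree D = 0}\<rparr>"


section \<open>Rational points of the Jacobian\<close>

definition field_automorphisms :: "'a :: field set \<Rightarrow> 'a set \<Rightarrow> ('a \<Rightarrow> 'a) set"
  where "field_automorphisms L M =
    {\<tau> \<in> ring_iso (ring_of_type_algebra\<lparr>carrier := L\<rparr>) (ring_of_type_algebra\<lparr>carrier := L\<rparr>).
      \<forall>z\<in>M. \<tau> z = z}"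

definition divisor_action :: "('a \<Rightarrow> 'a) \<Rightarrow> ('a set \<Rightarrow>\<^sub>0 int) \<Rightarrow> ('a set \<Rightarrow>\<^sub>0 int)"
  where "divisor_action \<tau> = frag_extend (\<lambda>P. frag_of (\<tau> ` P))"

text \<open>Let \<open>C\<close> be a geometrically irreducible smooth projective curve over a perfect field \<open>k\<close> with
  algebraic closure \<open>K\<close>, let \<open>M = k(C)\<close>, and let \<open>L = K(C)\<close>. Restriction to \<open>K\<close> identifies
  \<open>Gal(L/M)\<close> with \<open>Gal(K/k)\<close>, and the inverse is the coefficientwise action of \<open>Gal(K/k)\<close> on
  \<open>K(C)\<close>. The group \<open>J(k)\<close> consists of the Galois-invariant elements of \<open>J(K) = Pic0(C\<^sub>K)\<close>
  (an invariant class need not contain an invariant divisor).\<close>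

definition jacobian_rational_points ::
    "'a :: field set \<Rightarrow> 'a set \<Rightarrow> 'a set \<Rightarrow> ('a set \<Rightarrow>\<^sub>0 int) set monoid"
  where "jacobian_rational_points K L M = (Pic0 K L)
    \<lparr>carrier := {c \<in> carrier (Pic0 K L). \<forall>\<tau>\<in>field_automorphisms L M. divisor_action \<tau> ` c = c}\<rparr>"


section \<open>The curves \<open>y\<^sup>q = F(x)\<close> over the rationals\<close>

text \<open>All function fields are realised inside an algebraic closure of \<open>K(x)\<close>, where \<open>K\<close> is an
  algebraic closure of the rationals.\<close>

type_synonym qbar = "rat alg_closure"
type_synonym ambient = "qbar poly fract alg_closure"

definition ff_const :: "qbar \<Rightarrow> ambient"
  where "ff_const c = to_ac (to_fract [:c:])"

definition ff_x :: ambient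
  where "ff_x = to_ac (to_fract [:0, 1:])"

definition ff_y :: "nat \<Rightarrow> rat poly \<Rightarrow> ambient"
  where "ff_y q F = (SOME y. y ^ q = to_ac (to_fract (map_poly to_ac F)))"

lemma ff_y_power:
  assumes "q > 0"
  shows "ff_y q F ^ q = to_ac (to_fract (map_poly to_ac F))"
proof -
  have "\<exists>y :: ambient. y ^ q = to_ac (to_fract (map_poly to_ac F))"
    using nth_root_exists[OF assms] by blast
  thus ?thesis
    unfolding ff_y_def by (rule someI_ex)
qed

text \<open>If \<open>Y\<^sup>q - F(x)\<close> is irreducible over \<open>K(x)\<close> (for instance if \<open>q\<close> is coprime to the degree of
  \<open>F\<close>), then the two fields below are the function fields over \<open>K\<close> and over the rationals of the
  curve \<open>y\<^sup>q = F(x)\<close>, whichever \<open>q\<close>-th root \<^const>\<open>ff_y\<close> is; the rationals, as the prime field,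
  lie in both.\<close>

definition geometric_function_field :: "nat \<Rightarrow> rat poly \<Rightarrow> ambient set"
  where "geometric_function_field q F =
    generate_field ring_of_type_algebra (range ff_const \<union> {ff_x, ff_y q F})"

definition rational_function_field :: "nat \<Rightarrow> rat poly \<Rightarrow> ambient set"
  where "rational_function_field q F = generate_field ring_of_type_algebra {ff_x, ff_y q F}"

definition superelliptic_jacobian :: "nat \<Rightarrow> rat poly \<Rightarrow> (ambient set \<Rightarrow>\<^sub>0 int) set monoid"
  where "superelliptic_jacobian q F = jacobian_rational_points (range ff_const)
    (geometric_function_field q F) (rational_function_field q F)"

definition mordell_weil_rank :: "nat \<Rightarrow> rat poly \<Rightarrow> enat"
  where "mordell_weil_rank q F = abelian_rank (superelliptic_jacobian q F)"

end

theory Submission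
  imports Defs
begin

text \<open>The rank is produced by the classes of \<open>P i - P (p - 1)\<close> for \<open>i < p - 1\<close>, where \<open>P i\<close> is the
  rational point \<open>(i, k)\<close>. What has to be shown is that a function \<open>f\<close> whose divisor on the affine
  part of the curve is \<open>\<Sum>a i \<cdot> P i\<close> has all \<open>a i\<close> equal. The function \<open>y - k\<close> has \<open>a i = 1\<close> for all \<open>i\<close>,
  so by descent it suffices to prove two facts about such \<open>f\<close>.

  First, the \<open>a i\<close> are congruent modulo \<open>q\<close>. Let \<open>l > p\<close> be a prime divisor of \<open>k\<close>. Modulo \<open>l\<close> the
  equation becomes \<open>y ^ q = x (x - 1) \<cdots> (x - (p - 1))\<close> and the points \<open>P i\<close> become ramified over
  the line. Comparing the norm of \<open>f\<close> with the summands of \<open>f = \<Sum>r j * y ^ j\<close>, whose values at such a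
  point are distinct modulo \<open>q\<close>, yields \<open>a i = j\<close> modulo \<open>q\<close> for one \<open>j\<close> independent of \<open>i\<close>.

  Secondly, if all \<open>a i\<close> are divisible by \<open>q\<close>, then \<open>f\<close> is a constant times a \<open>q\<close>-th power. Let \<open>tau\<close>
  generate the Galois group of \<open>y ^ q = F x\<close> over the line. Since \<open>(1 - tau) ^ q\<close> vanishes
  modulo \<open>q\<close>-th powers, it is enough to treat \<open>f\<close> for which \<open>f / tau f\<close> is a constant times a
  \<open>q\<close>-th power. By Hilbert 90 such an \<open>f\<close> is, modulo \<open>q\<close>-th powers, a product of factors \<open>x - a\<close> over
  roots \<open>a\<close> of \<open>F\<close>. The Galois group of \<open>F\<close> is transitive even over the \<open>q\<close>-th roots of unity,
  as \<open>F\<close> is an Artin--Schreier polynomial modulo \<open>p\<close> and \<open>q < p\<close>, and this forces the exponents to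
  agree, so that the product is a power of \<open>F = y ^ q\<close>.\<close>

section \<open>Valuation rings\<close>

text \<open>Everything is phrased through valuation rings and the relation \<open>val_eq\<close>;
  neither an abstract value group nor an integral model of the curve is constructed. Reduction
  modulo a prime takes place in characteristic 0: \<open>gauss_valuation\<close> describes a rank
  two valuation, in which \<open>c * z ^ n\<close> has as value the pair (value of \<open>c\<close>
  at \<open>B\<close>, \<open>n\<close>), ordered lexicographically. For \<open>B = UNIV\<close> the
  first entry disappears and the ordinary points of the curve remain, so the same lemmas serve both
  purposes.

  The hypotheses enter as follows. \<open>l > p\<close> keeps 0, ..., p - 1 distinct modulo
  \<open>l\<close>. As \<open>p\<close> does not divide \<open>k\<close>, the reduction x^p - x +
  k^q of \<open>F\<close> modulo \<open>p\<close> has no root in the prime field, which makes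
  \<open>F\<close> irreducible over the rationals. As \<open>q < p\<close>, the two primes are
  coprime; the curve is then totally ramified over infinity, and the affine orders determine a
  function up to a constant.

  The functions have coefficients in an algebraic closure. That the points (i, k) are rational is
  exploited through \<open>sigmas\<close>: its elements preserve the divisor of \<open>f\<close> and
  hence multiply \<open>f\<close> by constants.\<close>

locale subring_set =
  fixes R :: "'a::field set"
  assumes one_closed [simp, intro]: "1 \<in> R"
    and diff_closed [intro]: "a \<in> R \<Longrightarrow> b \<in> R \<Longrightarrow> a - b \<in> R"
    and mult_closed [intro]: "a \<in> R \<Longrightarrow> b \<in> R \<Longrightarrow> a * b \<in> R"
begin

lemma zero_closed [simp, intro]: "0 \<in> R"
  using diff_closed[OF one_closed one_closed] by simp

lemma uminus_closed [intro]: "a \<in> R \<Longrightarrow> - a \<in> R"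
  using diff_closed[OF zero_closed] by simp

lemma add_closed [intro]: "a \<in> R \<Longrightarrow> b \<in> R \<Longrightarrow> a + b \<in> R"
  using diff_closed[OF _ uminus_closed] by simp

lemma power_closed [intro]: "a \<in> R \<Longrightarrow> a ^ n \<in> R"
  by (induction n) auto

lemma sum_closed [intro]: "(\<And>i. i \<in> I \<Longrightarrow> f i \<in> R) \<Longrightarrow> sum f I \<in> R"
  by (induction I rule: infinite_finite_induct) auto

lemma prod_closed [intro]: "(\<And>i. i \<in> I \<Longrightarrow> f i \<in> R) \<Longrightarrow> prod f I \<in> R"
  by (induction I rule: infinite_finite_induct) auto

lemma of_nat_closed [simp, intro]: "of_nat n \<in> R"
  by (induction n) auto

lemma of_int_closed [simp, intro]: "of_int n \<in> R"
  by (cases n rule: int_cases2) auto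

end

locale subfield_set = subring_set +
  assumes inverse_closed [intro]: "a \<in> R \<Longrightarrow> inverse a \<in> R"
begin

lemma divide_closed [intro]: "a \<in> R \<Longrightarrow> b \<in> R \<Longrightarrow> a / b \<in> R"
  by (simp add: divide_inverse inverse_closed mult_closed)

lemma powi_closed [intro]: "a \<in> R \<Longrightarrow> a powi n \<in> R"
  by (auto simp: power_int_def inverse_closed power_closed)

end

section \<open>Maximal ideal, units and comparison of values\<close>

definition max_ideal :: "'a::field set \<Rightarrow> 'a set"
  where "max_ideal V = V - val_units V"

text \<open>Equality of values without a value group: \<open>f\<close> and \<open>g\<close> generate
  the same fractional ideal of \<open>V\<close>. Both are nonzero whenever this holds, because 0 is
  not a unit.\<close>

definition val_eq :: "'a::field set \<Rightarrow> 'a \<Rightarrow> 'a \<Rightarrow> bool"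
  where "val_eq V f g \<longleftrightarrow> f / g \<in> val_units V"

text \<open>The trivial valuation \<open>V = L\<close> is allowed. For the constants it occurs as
  \<open>B = UNIV\<close>, where reduction is the identity.\<close>

locale valuation_ring = L: subfield_set L + subring_set V for L V :: "'a::field set" +
  assumes subset: "V \<subseteq> L"
    and total: "f \<in> L \<Longrightarrow> f \<in> V \<or> inverse f \<in> V"
begin

lemma unitD: "u \<in> val_units V \<Longrightarrow> u \<in> V" "u \<in> val_units V \<Longrightarrow> u \<noteq> 0"
  "u \<in> val_units V \<Longrightarrow> inverse u \<in> V"
  by (auto simp: val_units_def)

lemma unit_one [simp, intro]: "1 \<in> val_units V"
  by (auto simp: val_units_def)

lemma unit_mult [intro]: "u \<in> val_units V \<Longrightarrow> v \<in> val_units V \<Longrightarrow> u * v \<in> val_units V"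
  by (auto simp: val_units_def)

lemma unit_inverse [intro]: "u \<in> val_units V \<Longrightarrow> inverse u \<in> val_units V"
  by (auto simp: val_units_def)

lemma unit_uminus [intro]: "u \<in> val_units V \<Longrightarrow> - u \<in> val_units V"
  by (auto simp: val_units_def)

lemma unit_divide [intro]: "u \<in> val_units V \<Longrightarrow> v \<in> val_units V \<Longrightarrow> u / v \<in> val_units V"
  by (simp add: divide_inverse unit_inverse unit_mult)

lemma unit_power [intro]: "u \<in> val_units V \<Longrightarrow> u ^ n \<in> val_units V"
  by (induction n) auto

lemma unit_powi [intro]: "u \<in> val_units V \<Longrightarrow> u powi n \<in> val_units V"
  by (auto simp: power_int_def)

lemma max_idealI: "m \<in> V \<Longrightarrow> inverse m \<notin> V \<Longrightarrow> m \<in> max_ideal V"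
  by (auto simp: max_ideal_def val_units_def)

lemma zero_max_ideal [simp, intro]: "0 \<in> max_ideal V"
  by (auto simp: max_ideal_def val_units_def)

lemma max_idealD: "m \<in> max_ideal V \<Longrightarrow> m \<in> V"
  "m \<in> max_ideal V \<Longrightarrow> m \<notin> val_units V"
  "m \<in> max_ideal V \<Longrightarrow> m \<noteq> 0 \<Longrightarrow> inverse m \<notin> V"
  by (auto simp: max_ideal_def val_units_def)

lemma unit_or_max_ideal: "f \<in> V \<Longrightarrow> f \<in> val_units V \<or> f \<in> max_ideal V"
  by (auto simp: max_ideal_def)

lemma not_in_ring: "f \<in> L \<Longrightarrow> f \<notin> V \<Longrightarrow> inverse f \<in> max_ideal V"
  using total by (auto intro!: max_idealI)

lemma one_not_max_ideal [simp]: "1 \<notin> max_ideal V"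
  by (auto simp: max_ideal_def)

lemma max_ideal_mult [intro]:
  assumes "m \<in> max_ideal V" "v \<in> V"
  shows "m * v \<in> max_ideal V"
proof (cases "m * v = 0")
  case False
  have "inverse (m * v) \<notin> V"
  proof
    assume "inverse (m * v) \<in> V"
    from mult_closed[OF this \<open>v \<in> V\<close>] have "inverse m \<in> V"
      using False by (simp add: field_simps)
    thus False using max_idealD(3)[OF assms(1)] False by auto
  qed
  thus ?thesis using max_idealI[of "m * v"] mult_closed[OF max_idealD(1)[OF assms(1)] assms(2)] by blast
qed auto

lemma max_ideal_mult' [intro]: "v \<in> V \<Longrightarrow> m \<in> max_ideal V \<Longrightarrow> v * m \<in> max_ideal V"
  using max_ideal_mult[of m v] by (simp add: mult.commute)

lemma max_ideal_add [intro]: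
  assumes "a \<in> max_ideal V" "b \<in> max_ideal V"
  shows "a + b \<in> max_ideal V"
proof (cases "a = 0 \<or> b = 0")
  case False
  hence "a / b \<in> L" using assms max_idealD(1) subset by blast
  from total[OF this] show ?thesis
  proof
    assume "a / b \<in> V"
    hence "b * (a / b + 1) \<in> max_ideal V" using assms by blast
    thus ?thesis using False by (simp add: field_simps)
  next
    assume "inverse (a / b) \<in> V"
    hence "a * (inverse (a / b) + 1) \<in> max_ideal V" using assms by blast
    thus ?thesis using False by (simp add: field_simps)
  qed
qed (use assms in auto)

lemma max_ideal_uminus [intro]: "a \<in> max_ideal V \<Longrightarrow> - a \<in> max_ideal V"
  using max_ideal_mult[of a "-1"] by auto

lemma max_ideal_diff [intro]: "a \<in> max_ideal V \<Longrightarrow> b \<in> max_ideal V \<Longrightarrow> a - b \<in> max_ideal V"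
  using max_ideal_add[of a "-b"] by auto

lemma max_ideal_sum [intro]: "(\<And>i. i \<in> I \<Longrightarrow> f i \<in> max_ideal V) \<Longrightarrow> sum f I \<in> max_ideal V"
  by (induction I rule: infinite_finite_induct) auto

lemma max_ideal_power [intro]: "a \<in> max_ideal V \<Longrightarrow> n > 0 \<Longrightarrow> a ^ n \<in> max_ideal V"
  using max_idealD(1) by (cases n) auto

lemma unit_add_max_ideal [intro]:
  assumes "u \<in> val_units V" "m \<in> max_ideal V"
  shows "u + m \<in> val_units V"
proof (rule ccontr)
  assume "u + m \<notin> val_units V"
  moreover have "u + m \<in> V" using assms unitD max_idealD by blast
  ultimately have "u + m \<in> max_ideal V" using unit_or_max_ideal by blast
  from max_ideal_diff[OF this assms(2)] show False
    using max_idealD(2) assms(1) by auto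
qed

lemma prime_max_ideal: "a \<in> V \<Longrightarrow> b \<in> V \<Longrightarrow> a * b \<in> max_ideal V \<Longrightarrow> a \<in> max_ideal V \<or> b \<in> max_ideal V"
  using unit_or_max_ideal unit_mult max_idealD(2) by blast

lemma prime_max_ideal_prod:
  "finite I \<Longrightarrow> (\<And>i. i \<in> I \<Longrightarrow> f i \<in> V) \<Longrightarrow> prod f I \<in> max_ideal V \<Longrightarrow> \<exists>i\<in>I. f i \<in> max_ideal V"
proof (induction I rule: finite_induct)
  case (insert i I)
  thus ?case using prime_max_ideal[of "f i" "prod f I"] prod_closed[of I f] by auto
qed auto

lemma root_closed:
  assumes "u \<in> L" "u ^ n \<in> V" "n > 0"
  shows "u \<in> V"
proof (rule ccontr)
  assume u: "u \<notin> V"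
  from not_in_ring[OF assms(1) u] have "inverse u \<in> max_ideal V" .
  hence "u ^ n * (inverse u) ^ n \<in> max_ideal V" using assms by blast
  moreover have "u \<noteq> 0" using u by auto
  ultimately show False by (simp flip: power_mult_distrib)
qed

lemma root_unit:
  assumes "u \<in> L" "u ^ n \<in> val_units V" "n > 0"
  shows "u \<in> val_units V"
  using root_closed[of u n] root_closed[of "inverse u" n] assms L.inverse_closed unitD[OF assms(2)]
  by (auto simp: val_units_def power_inverse)

lemma root_max_ideal:
  assumes "u \<in> L" "u ^ n \<in> max_ideal V" "n > 0"
  shows "u \<in> max_ideal V"
  using root_closed[of u n] assms max_idealD unit_or_max_ideal unit_power by blast

lemma val_eq_nonzero: "val_eq V f g \<Longrightarrow> f \<noteq> 0" "val_eq V f g \<Longrightarrow> g \<noteq> 0"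
  by (auto simp: val_eq_def val_units_def)

lemma val_eq_refl [simp, intro]: "f \<noteq> 0 \<Longrightarrow> val_eq V f f"
  by (auto simp: val_eq_def)

lemma val_eq_sym: "val_eq V f g \<Longrightarrow> val_eq V g f"
  using unit_inverse[of "f / g"] by (auto simp: val_eq_def)

lemma val_eq_trans [trans]: "val_eq V f g \<Longrightarrow> val_eq V g h \<Longrightarrow> val_eq V f h"
  using unit_mult[of "f / g" "g / h"] val_eq_nonzero[of g h] by (auto simp: val_eq_def)

lemma val_eq_mult: "val_eq V f g \<Longrightarrow> val_eq V f' g' \<Longrightarrow> val_eq V (f * f') (g * g')"
  using unit_mult[of "f / g" "f' / g'"] by (auto simp: val_eq_def)

lemma val_eq_inverse: "val_eq V f g \<Longrightarrow> val_eq V (inverse f) (inverse g)"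
  using unit_inverse[of "f / g"] by (auto simp: val_eq_def field_simps)

lemma val_eq_divide: "val_eq V f g \<Longrightarrow> val_eq V f' g' \<Longrightarrow> val_eq V (f / f') (g / g')"
  by (simp add: divide_inverse val_eq_inverse val_eq_mult)

lemma val_eq_power: "val_eq V f g \<Longrightarrow> val_eq V (f ^ n) (g ^ n)"
  using unit_power[of "f / g"] by (auto simp: val_eq_def power_divide)

lemma val_eq_powi: "val_eq V f g \<Longrightarrow> val_eq V (f powi n) (g powi n)"
  using unit_powi[of "f / g"] by (auto simp: val_eq_def power_int_divide_distrib)

lemma val_eq_prod: "finite I \<Longrightarrow> (\<And>i. i \<in> I \<Longrightarrow> val_eq V (f i) (g i)) \<Longrightarrow> val_eq V (prod f I) (prod g I)"
  by (induction I rule: finite_induct) (auto intro: val_eq_mult)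

lemma val_eq_one_iff: "val_eq V f 1 \<longleftrightarrow> f \<in> val_units V"
  by (auto simp: val_eq_def)

lemma val_eq_unit_mult: "u \<in> val_units V \<Longrightarrow> f \<noteq> 0 \<Longrightarrow> val_eq V (u * f) f"
  by (auto simp: val_eq_def)

lemma val_eq_add:
  assumes "f \<noteq> 0" "m / f \<in> max_ideal V"
  shows "val_eq V (f + m) f"
  using unit_add_max_ideal[OF unit_one assms(2)] assms(1) by (simp add: val_eq_def add_divide_distrib)

lemma val_eq_ring_iff: "val_eq V f g \<Longrightarrow> f \<in> V \<longleftrightarrow> g \<in> V"
  by (metis val_eq_def mult_closed nonzero_eq_divide_eq unitD(1) val_eq_nonzero(1,2) val_eq_sym)

lemma val_eq_units_iff: "val_eq V f g \<Longrightarrow> f \<in> val_units V \<longleftrightarrow> g \<in> val_units V"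
  using val_eq_one_iff val_eq_sym val_eq_trans by blast

lemma val_eq_max_ideal_iff: "val_eq V f g \<Longrightarrow> f \<in> max_ideal V \<longleftrightarrow> g \<in> max_ideal V"
  using val_eq_units_iff val_eq_ring_iff by (auto simp: max_ideal_def)

lemma val_eq_root:
  assumes "val_eq V (f ^ n) (g ^ n)" "n > 0" "f \<in> L" "g \<in> L"
  shows "val_eq V f g"
  using assms root_unit[of "f / g" n] L.divide_closed by (auto simp: val_eq_def power_divide)

lemma max_ideal_powi:
  assumes "t \<in> max_ideal V" "t \<noteq> 0"
  shows "t powi n \<in> V \<longleftrightarrow> n \<ge> 0" and "t powi n \<in> val_units V \<longleftrightarrow> n = 0"
    and "t powi n \<in> max_ideal V \<longleftrightarrow> n > 0"
proof -
  have pos: "t powi n \<in> max_ideal V" if "n > 0" for n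
    using that assms(1) by (auto simp: power_int_def)
  have neg: "t powi n \<notin> V" if "n < 0" for n
  proof -
    have "t powi (- n) \<in> max_ideal V" using pos[of "-n"] that by auto
    hence "inverse (t powi (- n)) \<notin> V" using assms by (auto dest!: max_idealD(3))
    thus ?thesis by (simp add: power_int_minus)
  qed
  consider "n < 0" | "n = 0" | "n > 0" by linarith
  hence "(t powi n \<in> V \<longleftrightarrow> n \<ge> 0) \<and> (t powi n \<in> val_units V \<longleftrightarrow> n = 0) \<and> (t powi n \<in> max_ideal V \<longleftrightarrow> n > 0)"
  proof cases
    case 1
    thus ?thesis using neg[of n] by (auto simp: max_ideal_def val_units_def)
  next
    case 3
    thus ?thesis using pos[of n] by (auto simp: max_ideal_def)
  qed auto
  thus "t powi n \<in> V \<longleftrightarrow> n \<ge> 0" and "t powi n \<in> val_units V \<longleftrightarrow> n = 0"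
    and "t powi n \<in> max_ideal V \<longleftrightarrow> n > 0" by auto
qed

lemma val_eq_powi_iff:
  assumes "t \<in> max_ideal V" "t \<noteq> 0"
  shows "val_eq V (t powi m) (t powi n) \<longleftrightarrow> m = n"
  using max_ideal_powi(2)[OF assms, of "m - n"] assms by (simp add: val_eq_def power_int_diff)

text \<open>Values are totally ordered, so among finitely many nonzero elements with pairwise
  different values one has the strictly least value; dividing the others by it gives
  nonunits.\<close>

lemma dominant_exists:
  assumes "finite J" "J \<noteq> {}" "\<And>j. j \<in> J \<Longrightarrow> T j \<in> L" "\<And>j. j \<in> J \<Longrightarrow> T j \<noteq> 0"
    and "\<And>i j. i \<in> J \<Longrightarrow> j \<in> J \<Longrightarrow> i \<noteq> j \<Longrightarrow> \<not> val_eq V (T i) (T j)"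
  shows "\<exists>i\<in>J. \<forall>j\<in>J - {i}. T j / T i \<in> max_ideal V"
  using assms
proof (induction J rule: finite_ne_induct)
  case (insert a J)
  then obtain i where i: "i \<in> J" "\<forall>j\<in>J - {i}. T j / T i \<in> max_ideal V" by auto
  have nz: "T a \<noteq> 0" "T i \<noteq> 0" using insert i by auto
  have "T a / T i \<in> L" using insert.prems(1) i(1) by auto
  moreover have "\<not> val_eq V (T a) (T i)" using insert i by auto
  ultimately consider "T a / T i \<in> max_ideal V" | "T i / T a \<in> max_ideal V"
    using unit_or_max_ideal not_in_ring[of "T a / T i"] by (auto simp: val_eq_def)
  thus ?case
  proof cases
    case 1
    thus ?thesis using i by (intro bexI[of _ i]) auto
  next
    case 2
    have "T j / T a \<in> max_ideal V" if "j \<in> J" for j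
    proof (cases "j = i")
      case False
      hence "T j / T i * (T i / T a) \<in> max_ideal V"
        using i(2) that 2 max_idealD(1)[OF 2] by blast
      thus ?thesis using nz by simp
    qed (use 2 in auto)
    thus ?thesis by (intro bexI[of _ a]) auto
  qed
qed auto

text \<open>The ultrametric inequality: divided by the dominant term, the sum is a unit plus a
  nonunit. The unit coefficients \<open>u\<close> provide for conjugates under \<open>tau\<close>,
  whose summands differ by powers of \<open>zeta\<close>.\<close>

lemma dominant_sum:
  assumes "finite J" "i \<in> J" "\<forall>j\<in>J - {i}. T j / T i \<in> max_ideal V" "T i \<noteq> 0"
    and "\<And>j. j \<in> J \<Longrightarrow> u j \<in> val_units V"
  shows "val_eq V (\<Sum>j\<in>J. u j * T j) (T i)"
proof -
  have "(\<Sum>j\<in>J. u j * T j) / T i = u i + (\<Sum>j\<in>J - {i}. u j * (T j / T i))"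
    using assms by (simp add: sum.remove[of J i] add_divide_distrib sum_divide_distrib)
  moreover have "(\<Sum>j\<in>J - {i}. u j * (T j / T i)) \<in> max_ideal V"
    using assms unitD(1) by (intro max_ideal_sum) blast
  ultimately show ?thesis using assms(2,5) unfolding val_eq_def by auto
qed

end

lemma (in valuation_ring) valuation_ring_vimage:
  assumes "\<And>a b. g (a - b) = g a - g b" "\<And>a b. g (a * b) = g a * g b" "g 1 = 1"
    "\<And>a. g (inverse a) = inverse (g a)" "subfield_set L'" "\<And>a. a \<in> L' \<Longrightarrow> g a \<in> L"
  shows "valuation_ring L' {f \<in> L'. g f \<in> V}"
proof -
  interpret L': subfield_set L' by fact
  show ?thesis
    using assms total[of "g f" for f] L'.diff_closed L'.mult_closed by unfold_locales (auto simp: L'.inverse_closed)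
qed

subsection \<open>Existence of valuation rings\<close>

text \<open>Chevalley's argument: such a maximal subring is a valuation ring.\<close>

definition coeffs_in :: "'a::zero set \<Rightarrow> 'a poly set"
  where "coeffs_in R = {P. \<forall>n. Polynomial.coeff P n \<in> R}"

locale subring_max = subring_set W for W :: "'a::field set" +
  fixes z :: 'a
  assumes z: "z \<in> W" "inverse z \<notin> W"
    and maximal: "\<And>W'. subring_set W' \<Longrightarrow> W \<subseteq> W' \<Longrightarrow> inverse z \<notin> W' \<Longrightarrow> W' = W"
begin

lemma z_nonzero: "z \<noteq> 0" using z by auto

lemma adjoin_subring: "subring_set {poly P u | P. P \<in> coeffs_in W}" "W \<subseteq> {poly P u | P. P \<in> coeffs_in W}"
  "u \<in> {poly P u | P. P \<in> coeffs_in W}"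
proof -
  show "subring_set {poly P u | P. P \<in> coeffs_in W}"
  proof
    show "1 \<in> {poly P u |P. P \<in> coeffs_in W}"
      by (auto intro!: exI[of _ 1] simp: coeffs_in_def one_pCons coeff_pCons split: nat.splits)
    fix a b assume "a \<in> {poly P u |P. P \<in> coeffs_in W}" "b \<in> {poly P u |P. P \<in> coeffs_in W}"
    then obtain P Q where PQ: "a = poly P u" "b = poly Q u" "P \<in> coeffs_in W" "Q \<in> coeffs_in W" by auto
    show "a - b \<in> {poly P u |P. P \<in> coeffs_in W}"
      using PQ by (auto intro!: exI[of _ "P - Q"] simp: coeffs_in_def diff_closed)
    show "a * b \<in> {poly P u |P. P \<in> coeffs_in W}"
      using PQ by (auto intro!: exI[of _ "P * Q"] simp: coeffs_in_def coeff_mult sum_closed mult_closed)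
  qed
  show "W \<subseteq> {poly P u | P. P \<in> coeffs_in W}"
  proof
    fix w assume "w \<in> W"
    thus "w \<in> {poly P u | P. P \<in> coeffs_in W}"
      by (auto intro!: exI[of _ "[:w:]"] simp: coeffs_in_def coeff_pCons split: nat.splits)
  qed
  show "u \<in> {poly P u | P. P \<in> coeffs_in W}"
    by (auto intro!: exI[of _ "[:0, 1:]"] simp: coeffs_in_def coeff_pCons split: nat.splits)
qed

lemma adjoin_contains_inverse:
  assumes "u \<notin> W"
  obtains P where "P \<in> coeffs_in W" "inverse z = poly P u"
  using maximal[OF adjoin_subring(1,2)[of u]] adjoin_subring(3)[of u] assms by auto

text \<open>This says that \<open>z\<close> lies in the Jacobson radical of \<open>W\<close>. If the
  inverse of \<open>w = 1 - z * a\<close> were missing, adjoining it would produce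
  \<open>inverse z\<close>, so that \<open>w ^ n * inverse z\<close> is in \<open>W\<close> for some
  \<open>n\<close>; the definition of \<open>w\<close> then removes the factors \<open>w\<close> one
  by one.\<close>

lemma one_minus_inverse:
  assumes "a \<in> W"
  shows "inverse (1 - z * a) \<in> W"
proof (rule ccontr)
  define u where "u = inverse (1 - z * a)"
  assume "inverse (1 - z * a) \<notin> W"
  then obtain P where P: "P \<in> coeffs_in W" "inverse z = poly P u"
    using adjoin_contains_inverse u_def by metis
  define w where "w = 1 - z * a"
  have w0: "w \<noteq> 0"
    using \<open>inverse (1 - z * a) \<notin> W\<close> by (auto simp: w_def)
  have wW: "w \<in> W" using assms z by (auto simp: w_def)
  have "w ^ Polynomial.degree P * poly P u = (\<Sum>i\<le>Polynomial.degree P. Polynomial.coeff P i * w ^ (Polynomial.degree P - i))"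
    unfolding poly_altdef u_def w_def[symmetric] sum_distrib_left
    using w0 by (intro sum.cong) (auto simp: field_simps power_diff)
  also have "\<dots> \<in> W" using P wW by (auto simp: coeffs_in_def)
  finally have *: "w ^ n * inverse z \<in> W" if "n = Polynomial.degree P" for n
    using P that by simp
  have "w ^ n * inverse z \<in> W \<Longrightarrow> inverse z \<in> W" for n
  proof (induction n)
    case (Suc n)
    have "w ^ n * inverse z = w ^ Suc n * inverse z + a * w ^ n"
      using z_nonzero by (simp add: w_def field_simps)
    thus ?case using Suc assms wW by auto
  qed auto
  thus False using * z by auto
qed

text \<open>A relation 1 = z P(u) is the obstruction to adjoining \<open>u\<close>: it says that
  \<open>inverse z\<close> lies in \<open>W[u]\<close>.\<close>

definition zrel :: "'a \<Rightarrow> 'a poly \<Rightarrow> bool"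
  where "zrel u P \<longleftrightarrow> P \<in> coeffs_in W \<and> z * poly P u = 1"

text \<open>Chevalley's degree reduction. In the relation for \<open>inverse u\<close>, the constant
  coefficient \<open>a\<close> moves to the other side, where \<open>1 - z * a\<close> is
  invertible. Multiplication by a power of \<open>u\<close> expresses \<open>u ^ n\<close> by lower
  powers and so removes the leading term of \<open>P\<close>. Relations of minimal degree for
  \<open>u\<close> and \<open>inverse u\<close> therefore cannot coexist.\<close>

lemma zrel_lower:
  assumes "zrel u P" "zrel (inverse u) Q" "u \<noteq> 0" "Polynomial.degree Q \<le> Polynomial.degree P"
    "Polynomial.degree P > 0"
  shows "\<exists>P'. zrel u P' \<and> Polynomial.degree P' < Polynomial.degree P"
proof -
  define n where "n = Polynomial.degree P"
  obtain N where nN: "n = Suc N" using assms(5) by (cases n) (auto simp: n_def)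
  define m where "m = Polynomial.degree Q"
  obtain a Q1 where Q1: "Q = pCons a Q1" by (cases Q)
  have aW: "a \<in> W" and Q1W: "Polynomial.coeff Q1 i \<in> W" for i
    using assms(2) spec[of "\<lambda>n. Polynomial.coeff Q n \<in> W" 0] spec[of "\<lambda>n. Polynomial.coeff Q n \<in> W" "Suc i"]
    by (auto simp: Q1 zrel_def coeffs_in_def)
  define c where "c = inverse (1 - z * a)"
  have cW: "c \<in> W" using one_minus_inverse aW by (auto simp: c_def)
  have "1 - z * a \<noteq> 0"
  proof
    assume "1 - z * a = 0"
    hence "inverse z = a" using z_nonzero by (simp add: field_simps)
    thus False using aW z by auto
  qed
  hence c: "c * (1 - z * a) = 1" by (simp add: c_def)
  have degQ1: "Polynomial.degree Q1 \<le> m - 1"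
    by (auto simp: Q1 m_def)
  have "z * poly Q (inverse u) = 1" using assms by (auto simp: zrel_def)
  hence "z * (inverse u * poly Q1 (inverse u)) = 1 - z * a"
    by (simp add: Q1 algebra_simps)
  hence "z * c * (inverse u * poly Q1 (inverse u)) = 1"
    using c by (metis mult.assoc mult.commute)
  hence "z * c * poly Q1 (inverse u) = u" using assms(3) by (simp add: field_simps)
  hence un: "u ^ n = z * c * (\<Sum>i\<le>N. Polynomial.coeff Q1 i * u ^ (N - i))"
  proof -
    have "Polynomial.degree Q1 \<le> N" using degQ1 assms(4) nN unfolding m_def n_def by linarith
    hence "poly Q1 (inverse u) = (\<Sum>i\<le>N. Polynomial.coeff Q1 i * inverse u ^ i)"
      unfolding poly_altdef by (intro sum.mono_neutral_left) (auto intro: coeff_eq_0)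
    hence "u ^ (N) * poly Q1 (inverse u) = (\<Sum>i\<le>N. Polynomial.coeff Q1 i * u ^ (N - i))"
      using assms(3) by (auto simp: sum_distrib_left power_diff power_inverse field_simps intro!: sum.cong)
    moreover have "u ^ n = u ^ (N) * (z * c * poly Q1 (inverse u))"
      using \<open>z * c * poly Q1 (inverse u) = u\<close> by (simp add: nN)
    ultimately show ?thesis by (simp add: mult_ac)
  qed
  define R where "R = (\<Sum>i\<le>N. Polynomial.monom (Polynomial.coeff Q1 i) (N - i))"
  define P' where "P' = P - Polynomial.monom (Polynomial.coeff P n) n
     + Polynomial.smult (z * c * Polynomial.coeff P n) R"
  have R: "poly R u = (\<Sum>i\<le>N. Polynomial.coeff Q1 i * u ^ (N - i))"
    unfolding R_def by (simp only: poly_sum poly_monom)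
  have RW: "R \<in> coeffs_in W" using Q1W by (auto simp: R_def coeffs_in_def Polynomial.coeff_sum coeff_monom)
  have "poly P' u = poly P u" by (simp add: P'_def poly_monom R un)
  moreover have "P' \<in> coeffs_in W"
    using assms(1) RW z cW by (auto simp: P'_def zrel_def coeffs_in_def coeff_monom add_closed mult_closed)
  moreover have "Polynomial.degree P' < n"
  proof -
    have "Polynomial.coeff P' i = 0" if "i \<ge> n" for i
    proof -
      have "Polynomial.coeff R i = 0" using that
        unfolding R_def Polynomial.coeff_sum coeff_monom by (intro sum.neutral) (auto simp: nN)
      moreover have "Polynomial.coeff P i = 0" if "i \<noteq> n" using that \<open>i \<ge> n\<close>
        by (auto simp: n_def intro: coeff_eq_0)
      ultimately show ?thesis by (auto simp: P'_def coeff_monom)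
    qed
    hence "Polynomial.degree P' \<le> N" by (intro degree_le) (auto simp: nN)
    thus ?thesis by (simp add: nN)
  qed
  ultimately show ?thesis using assms(1) by (auto simp: zrel_def n_def)
qed

lemma is_valuation_ring: "valuation_ring UNIV W"
proof
  show "u \<in> W \<or> inverse u \<in> W" for u
  proof (rule ccontr)
    assume u: "\<not> (u \<in> W \<or> inverse u \<in> W)"
    have ex: "\<exists>P. zrel v P" if "v \<notin> W" for v
      using adjoin_contains_inverse[OF that] z_nonzero unfolding zrel_def
      by (metis right_inverse)
    obtain P where P: "zrel u P" "\<And>P'. zrel u P' \<Longrightarrow> Polynomial.degree P \<le> Polynomial.degree P'"
      using ex_has_least_nat[of "zrel u" _ Polynomial.degree] ex[of u] u by blast
    obtain Q where Q: "zrel (inverse u) Q" "\<And>Q'. zrel (inverse u) Q' \<Longrightarrow> Polynomial.degree Q \<le> Polynomial.degree Q'"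
      using ex_has_least_nat[of "zrel (inverse u)" _ Polynomial.degree] ex[of "inverse u"] u by blast
    have pos: "Polynomial.degree P > 0" if "zrel v P" for v P
    proof (rule ccontr)
      assume "\<not> Polynomial.degree P > 0"
      then obtain c where "P = [:c:]" by (auto elim: degree_eq_zeroE)
      hence "c \<in> W" "z * c = 1" using that
        by (auto simp: zrel_def coeffs_in_def dest!: spec[of _ 0])
      thus False using z z_nonzero by (metis inverse_unique)
    qed
    have u0: "u \<noteq> 0" using u by auto
    show False
    proof (cases "Polynomial.degree Q \<le> Polynomial.degree P")
      case True
      thus ?thesis using zrel_lower[OF P(1) Q(1) u0] P pos by fastforce
    next
      case False
      thus ?thesis using zrel_lower[of "inverse u" Q P] P(1) Q u0 pos by fastforce
    qed
  qed
qed auto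

end

text \<open>Instead of a prime ideal, a single element \<open>z\<close> is prescribed to be a
  nonunit: Zorn's lemma is applied to the subrings that avoid \<open>inverse z\<close>, a condition
  inherited by unions of chains.\<close>

theorem valuation_ring_exists:
  fixes z :: "'a::field"
  assumes R: "subring_set R" and z: "z \<in> R" "inverse z \<notin> R"
  obtains W where "valuation_ring UNIV W" "R \<subseteq> W" "z \<in> max_ideal W"
proof -
  define A where "A = {W. subring_set W \<and> R \<subseteq> W \<and> inverse z \<notin> W}"
  have "\<exists>M\<in>A. \<forall>W\<in>A. M \<subseteq> W \<longrightarrow> W = M"
  proof (rule subset_Zorn_nonempty)
    show "A \<noteq> {}" using assms by (auto simp: A_def)
    fix C assume C: "C \<noteq> {}" "subset.chain A C"
    have sr: "subring_set W" if "W \<in> C" for W using that C by (auto simp: A_def subset.chain_def)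
    have two: "\<exists>W\<in>C. a \<in> W \<and> b \<in> W" if "a \<in> \<Union>C" "b \<in> \<Union>C" for a b
    proof -
      from that obtain A B where "A \<in> C" "a \<in> A" "B \<in> C" "b \<in> B" by blast
      moreover from this have "A \<subseteq> B \<or> B \<subseteq> A" using C(2) by (auto simp: subset.chain_def)
      ultimately show ?thesis by blast
    qed
    have "subring_set (\<Union>C)"
    proof
      show "1 \<in> \<Union>C" using C(1) sr subring_set.one_closed by fastforce
      fix a b assume "a \<in> \<Union>C" "b \<in> \<Union>C"
      then obtain W where W: "W \<in> C" "a \<in> W" "b \<in> W" using two by blast
      show "a - b \<in> \<Union>C" using W subring_set.diff_closed[OF sr[OF W(1)]] by blast
      show "a * b \<in> \<Union>C" using W subring_set.mult_closed[OF sr[OF W(1)]] by blast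
    qed
    thus "\<Union>C \<in> A" using C by (auto simp: A_def subset.chain_def)
  qed
  then obtain M where M: "M \<in> A" "\<And>W. W \<in> A \<Longrightarrow> M \<subseteq> W \<Longrightarrow> W = M" by auto
  interpret subring_set M using M by (auto simp: A_def)
  interpret subring_max M z
    by unfold_locales (use M z in \<open>auto simp: A_def\<close>)
  interpret V: valuation_ring UNIV M by (rule is_valuation_ring)
  show ?thesis
    using that[of M] M(1) z V.max_idealI is_valuation_ring by (auto simp: A_def)
qed

section \<open>Extension of field embeddings\<close>

locale field_embedding =
  fixes g :: "'a::field \<Rightarrow> 'b::field"
  assumes hom_one [simp]: "g 1 = 1"
    and hom_diff [simp]: "g (a - b) = g a - g b"
    and hom_mult [simp]: "g (a * b) = g a * g b"
begin

lemma hom_zero [simp]: "g 0 = 0"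
  using hom_diff[of 0 0] by simp

lemma hom_uminus [simp]: "g (- a) = - g a"
  using hom_diff[of 0 a] by simp

lemma hom_add [simp]: "g (a + b) = g a + g b"
  using hom_diff[of a "- b"] by simp

lemma hom_eq_zero_iff [simp]: "g a = 0 \<longleftrightarrow> a = 0"
proof
  assume *: "g a = 0"
  show "a = 0"
  proof (rule ccontr)
    assume "a \<noteq> 0"
    thus False using hom_mult[of a "inverse a"] * by simp
  qed
qed auto

lemma hom_eq_iff [simp]: "g a = g b \<longleftrightarrow> a = b"
  using hom_eq_zero_iff[of "a - b"] unfolding hom_diff by simp

lemma hom_inverse [simp]: "g (inverse a) = inverse (g a)"
proof (cases "a = 0")
  case False
  thus ?thesis using hom_mult[of a "inverse a"] by (intro inverse_unique[symmetric]) simp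
qed auto

lemma hom_divide [simp]: "g (a / b) = g a / g b"
  by (simp add: divide_inverse)

lemma hom_power [simp]: "g (a ^ n) = g a ^ n"
  by (induction n) auto

lemma hom_powi [simp]: "g (a powi n) = g a powi n"
  by (simp add: power_int_def)

lemma hom_sum: "g (sum f I) = (\<Sum>i\<in>I. g (f i))"
  by (induction I rule: infinite_finite_induct) auto

lemma hom_prod: "g (prod f I) = (\<Prod>i\<in>I. g (f i))"
  by (induction I rule: infinite_finite_induct) auto

lemma hom_of_nat [simp]: "g (of_nat n) = of_nat n"
  by (induction n) auto

lemma hom_of_int [simp]: "g (of_int n) = of_int n"
  by (cases n rule: int_cases2) auto

lemma map_poly_hom_mult: "map_poly g (P * Q) = map_poly g P * map_poly g Q"
  by (auto simp: poly_eq_iff coeff_map_poly coeff_mult hom_sum)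

lemma map_poly_hom_add: "map_poly g (P + Q) = map_poly g P + map_poly g Q"
  by (auto simp: poly_eq_iff coeff_map_poly)

lemma map_poly_hom_prod: "map_poly g (prod f I) = (\<Prod>i\<in>I. map_poly g (f i))"
  by (induction I rule: infinite_finite_induct) (auto simp: map_poly_hom_mult)

lemma degree_map_poly_hom: "Polynomial.degree (map_poly g P) = Polynomial.degree P"
  by (simp add: degree_map_poly)

lemma hom_poly: "g (poly P a) = poly (map_poly g P) (g a)"
  by (simp add: poly_altdef hom_sum coeff_map_poly degree_map_poly)

end

lemma field_embedding_comp: "field_embedding f \<Longrightarrow> field_embedding g \<Longrightarrow> field_embedding (f \<circ> g)"
  by (simp add: field_embedding_def)

lemma field_embedding_id: "field_embedding id"
  by (simp add: field_embedding_def)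

lemma field_embedding_funpow: "field_embedding (g :: 'a::field \<Rightarrow> 'a) \<Longrightarrow> field_embedding (g ^^ n)"
  by (induction n) (auto intro: field_embedding_comp field_embedding_id)

text \<open>An embedding of a subring into a field is represented by its graph.\<close>

locale partial_embedding =
  fixes G :: "('a::field \<times> 'b::field) set"
  assumes one: "(1, 1) \<in> G"
    and diff: "(a, b) \<in> G \<Longrightarrow> (c, d) \<in> G \<Longrightarrow> (a - c, b - d) \<in> G"
    and mult: "(a, b) \<in> G \<Longrightarrow> (c, d) \<in> G \<Longrightarrow> (a * c, b * d) \<in> G"
    and zero_iff: "(a, b) \<in> G \<Longrightarrow> a = 0 \<longleftrightarrow> b = 0"
begin

lemma zero: "(0, 0) \<in> G" using diff[OF one one] by simp

lemma uminus: "(a, b) \<in> G \<Longrightarrow> (- a, - b) \<in> G" using diff[OF zero] by simp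

lemma add: "(a, b) \<in> G \<Longrightarrow> (c, d) \<in> G \<Longrightarrow> (a + c, b + d) \<in> G"
  using diff[OF _ uminus] by simp

lemma power: "(a, b) \<in> G \<Longrightarrow> (a ^ n, b ^ n) \<in> G"
  by (induction n) (auto intro: one mult)

lemma sum: "(\<And>i. i \<in> I \<Longrightarrow> (f i, h i) \<in> G) \<Longrightarrow> (sum f I, sum h I) \<in> G"
  by (induction I rule: infinite_finite_induct) (auto intro: zero add)

lemma unique: "(a, b) \<in> G \<Longrightarrow> (a, c) \<in> G \<Longrightarrow> b = c"
  using diff[of a b a c] zero_iff[of 0 "b - c"] by auto

definition poly_rel :: "'a poly \<Rightarrow> 'b poly \<Rightarrow> bool"
  where "poly_rel P Q \<longleftrightarrow> (\<forall>n. (Polynomial.coeff P n, Polynomial.coeff Q n) \<in> G)"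

lemma poly_rel_diff: "poly_rel P Q \<Longrightarrow> poly_rel P' Q' \<Longrightarrow> poly_rel (P - P') (Q - Q')"
  by (auto simp: poly_rel_def diff)

lemma poly_rel_add: "poly_rel P Q \<Longrightarrow> poly_rel P' Q' \<Longrightarrow> poly_rel (P + P') (Q + Q')"
  by (auto simp: poly_rel_def add)

lemma poly_rel_mult: "poly_rel P Q \<Longrightarrow> poly_rel P' Q' \<Longrightarrow> poly_rel (P * P') (Q * Q')"
  by (auto simp: poly_rel_def coeff_mult intro!: sum mult)

lemma poly_rel_pCons: "(a, b) \<in> G \<Longrightarrow> poly_rel P Q \<Longrightarrow> poly_rel (pCons a P) (pCons b Q)"
  by (auto simp: poly_rel_def coeff_pCons split: nat.splits)

lemma poly_rel_0: "poly_rel 0 0"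
  by (auto simp: poly_rel_def zero)

lemma poly_rel_monom: "(a, b) \<in> G \<Longrightarrow> poly_rel (Polynomial.monom a n) (Polynomial.monom b n)"
  by (auto simp: poly_rel_def coeff_monom zero)

lemma poly_rel_eq_0_iff: "poly_rel P Q \<Longrightarrow> P = 0 \<longleftrightarrow> Q = 0"
  using zero_iff by (auto simp: poly_rel_def poly_eq_iff)

lemma poly_rel_degree: "poly_rel P Q \<Longrightarrow> Polynomial.degree P = Polynomial.degree Q"
proof -
  assume "poly_rel P Q"
  hence "Polynomial.coeff P n = 0 \<longleftrightarrow> Polynomial.coeff Q n = 0" for n
    using zero_iff by (auto simp: poly_rel_def)
  thus ?thesis by (simp add: Polynomial.degree_def)
qed

lemma poly_rel_lead_coeff: "poly_rel P Q \<Longrightarrow> (Polynomial.lead_coeff P, Polynomial.lead_coeff Q) \<in> G"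
  by (metis poly_rel_def poly_rel_degree)

definition adjoin :: "'a \<Rightarrow> 'b \<Rightarrow> ('a \<times> 'b) set"
  where "adjoin a b = {(poly P a, poly Q b) | P Q. poly_rel P Q}"

text \<open>The hypothesis says that \<open>a\<close> and \<open>b\<close> satisfy corresponding
  polynomial equations. Applied to differences of polynomials, it makes the assignment of
  \<open>poly Q b\<close> to \<open>poly P a\<close> well defined and injective.\<close>

lemma adjoin_partial_embedding:
  assumes "\<And>P Q. poly_rel P Q \<Longrightarrow> poly P a = 0 \<longleftrightarrow> poly Q b = 0"
  shows "partial_embedding (adjoin a b)" "G \<subseteq> adjoin a b" "(a, b) \<in> adjoin a b"
proof -
  show "partial_embedding (adjoin a b)"
  proof
    show "(1, 1) \<in> adjoin a b"
      unfolding adjoin_def using poly_rel_pCons[OF one poly_rel_0]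
      by (intro CollectI exI[of _ "[:1:]"]) auto
    fix u v u' v' assume "(u, v) \<in> adjoin a b" "(u', v') \<in> adjoin a b"
    then obtain P Q P' Q' where PQ: "u = poly P a" "v = poly Q b" "u' = poly P' a" "v' = poly Q' b"
      "poly_rel P Q" "poly_rel P' Q'" by (auto simp: adjoin_def)
    show "(u - u', v - v') \<in> adjoin a b"
      unfolding adjoin_def using PQ poly_rel_diff by (intro CollectI exI[of _ "P - P'"] exI[of _ "Q - Q'"]) auto
    show "(u * u', v * v') \<in> adjoin a b"
      unfolding adjoin_def using PQ poly_rel_mult by (intro CollectI exI[of _ "P * P'"] exI[of _ "Q * Q'"]) auto
  qed (use assms in \<open>auto simp: adjoin_def\<close>)
  show "G \<subseteq> adjoin a b"
  proof
    fix x assume "x \<in> G"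
    thus "x \<in> adjoin a b" unfolding adjoin_def
      using poly_rel_pCons[of "fst x" "snd x", OF _ poly_rel_0]
      by (intro CollectI exI[of _ "[:fst x:]"] exI[of _ "[:snd x:]"]) auto
  qed
  show "(a, b) \<in> adjoin a b"
    unfolding adjoin_def using poly_rel_pCons[OF zero poly_rel_pCons[OF one poly_rel_0]]
    by (intro CollectI exI[of _ "[:0, 1:]"]) auto
qed

end

theorem partial_embedding_max_exists:
  assumes "partial_embedding G"
  obtains M where "partial_embedding M" "G \<subseteq> M"
    "\<And>M'. partial_embedding M' \<Longrightarrow> M \<subseteq> M' \<Longrightarrow> M' = M"
proof -
  define A where "A = {M. partial_embedding M \<and> G \<subseteq> M}"
  have "\<exists>M\<in>A. \<forall>M'\<in>A. M \<subseteq> M' \<longrightarrow> M' = M"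
  proof (rule subset_Zorn_nonempty)
    show "A \<noteq> {}" using assms by (auto simp: A_def)
    fix C assume C: "C \<noteq> {}" "subset.chain A C"
    have pe: "partial_embedding M" if "M \<in> C" for M using that C by (auto simp: A_def subset.chain_def)
    have "partial_embedding (\<Union>C)"
    proof
      show "(1, 1) \<in> \<Union>C" using C(1) pe partial_embedding.one by fastforce
      fix a b c d assume ab: "(a, b) \<in> \<Union>C"
      show "a = 0 \<longleftrightarrow> b = 0" using ab pe partial_embedding.zero_iff by blast
      assume "(c, d) \<in> \<Union>C"
      with ab obtain A B where "A \<in> C" "(a, b) \<in> A" "B \<in> C" "(c, d) \<in> B" by blast
      moreover from this have "A \<subseteq> B \<or> B \<subseteq> A" using C(2) by (auto simp: subset.chain_def)
      ultimately obtain W where W: "W \<in> C" "(a, b) \<in> W" "(c, d) \<in> W" by blast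
      show "(a - c, b - d) \<in> \<Union>C" using W partial_embedding.diff[OF pe[OF W(1)]] by blast
      show "(a * c, b * d) \<in> \<Union>C" using W partial_embedding.mult[OF pe[OF W(1)]] by blast
    qed
    moreover from C obtain M where "M \<in> C" "G \<subseteq> M" by (auto simp: A_def subset.chain_def)
    ultimately show "\<Union>C \<in> A" by (auto simp: A_def)
  qed
  then obtain M where M: "M \<in> A" "\<And>M'. M' \<in> A \<Longrightarrow> M \<subseteq> M' \<Longrightarrow> M' = M" by auto
  show ?thesis
    by (rule that[of M]) (use M in \<open>auto simp: A_def\<close>)
qed

locale partial_embedding_max = partial_embedding G for G :: "('a::field \<times> 'b::alg_closed_field) set" +
  assumes maximal: "partial_embedding M' \<Longrightarrow> G \<subseteq> M' \<Longrightarrow> M' = G"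
begin

lemma memI:
  assumes "\<And>P Q. poly_rel P Q \<Longrightarrow> poly P a = 0 \<longleftrightarrow> poly Q b = 0"
  shows "(a, b) \<in> G"
  using maximal[of "adjoin a b"] adjoin_partial_embedding[OF assms] by auto

text \<open>Multiplication by \<open>a ^ n\<close>, with \<open>n\<close> the degree, turns a
  polynomial relation for \<open>inverse a\<close> into one for \<open>a\<close>. Hence the domain
  of a maximal partial embedding is a field.\<close>

lemma inverse_mem:
  assumes "(a, b) \<in> G"
  shows "(inverse a, inverse b) \<in> G"
proof (cases "a = 0")
  case False
  hence b: "b \<noteq> 0" using assms zero_iff by auto
  show ?thesis
  proof (rule memI)
    fix P Q assume PQ: "poly_rel P Q"
    define n where "n = Polynomial.degree P"
    have n: "n = Polynomial.degree Q" using PQ poly_rel_degree by (simp add: n_def)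
    have "poly P (inverse a) * a ^ n = (\<Sum>i\<le>n. Polynomial.coeff P i * a ^ (n - i))"
      unfolding poly_altdef n_def[symmetric] sum_distrib_right
      using False by (intro sum.cong) (auto simp: field_simps power_diff)
    moreover have "poly Q (inverse b) * b ^ n = (\<Sum>i\<le>n. Polynomial.coeff Q i * b ^ (n - i))"
      unfolding poly_altdef n[symmetric] sum_distrib_right
      using b by (intro sum.cong) (auto simp: field_simps power_diff)
    moreover have "(\<Sum>i\<le>n. Polynomial.coeff P i * a ^ (n - i), \<Sum>i\<le>n. Polynomial.coeff Q i * b ^ (n - i)) \<in> G"
      using PQ assms by (intro sum mult power) (auto simp: poly_rel_def)
    ultimately have "poly P (inverse a) * a ^ n = 0 \<longleftrightarrow> poly Q (inverse b) * b ^ n = 0"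
      using zero_iff by metis
    thus "poly P (inverse a) = 0 \<longleftrightarrow> poly Q (inverse b) = 0" using False b by simp
  qed
next
  case True
  hence "b = 0" using zero_iff[OF assms] by simp
  with True show ?thesis using zero by simp
qed

lemma poly_rel_division:
  assumes "poly_rel P Q" "poly_rel S T" "S \<noteq> 0"
  shows "\<exists>P1 Q1 P2 Q2. poly_rel P1 Q1 \<and> poly_rel P2 Q2 \<and> P = S * P1 + P2 \<and> Q = T * Q1 + Q2 \<and>
     (P2 = 0 \<or> Polynomial.degree P2 < Polynomial.degree S)"
  using assms(1)
proof (induction "Polynomial.degree P" arbitrary: P Q rule: less_induct)
  case less
  show ?case
  proof (cases "P = 0 \<or> Polynomial.degree P < Polynomial.degree S")
    case True
    show ?thesis
      by (rule exI[of _ 0], rule exI[of _ 0], rule exI[of _ P], rule exI[of _ Q])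
        (use True less poly_rel_0 in auto)
  next
    case False
    define n where "n = Polynomial.degree P - Polynomial.degree S"
    define u where "u = Polynomial.lead_coeff P / Polynomial.lead_coeff S"
    define v where "v = Polynomial.lead_coeff Q / Polynomial.lead_coeff T"
    have uv: "(u, v) \<in> G" unfolding u_def v_def divide_inverse
      using less(2) assms(2) by (intro mult inverse_mem poly_rel_lead_coeff)
    have u: "u \<noteq> 0" using False assms by (auto simp: u_def)
    define M where "M = Polynomial.monom u n"
    define N where "N = Polynomial.monom v n"
    have MN: "poly_rel M N" using uv by (simp add: M_def N_def poly_rel_monom)
    have rel: "poly_rel (P - S * M) (Q - T * N)"
      by (intro poly_rel_diff poly_rel_mult less assms MN)
    have deg: "Polynomial.degree (S * M) = Polynomial.degree P"
      using u False assms(3) by (simp add: M_def degree_mult_eq degree_monom_eq n_def)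
    have lc: "Polynomial.lead_coeff (S * M) = Polynomial.lead_coeff P"
    proof -
      have "Polynomial.lead_coeff M = u" using degree_monom_eq[OF u, of n] by (simp add: M_def)
      thus ?thesis unfolding lead_coeff_mult using assms(3) by (simp add: u_def)
    qed
    have "P - S * M = 0 \<or> Polynomial.degree (P - S * M) < Polynomial.degree P"
      using deg lc by (metis Polynomial.coeff_diff eq_iff_diff_eq_0 degree_diff_le le_neq_implies_less leading_coeff_0_iff order_refl)
    thus ?thesis
    proof
      assume 0: "P - S * M = 0"
      hence "Q - T * N = 0" using rel poly_rel_eq_0_iff by blast
      with 0 show ?thesis
        by (intro exI[of _ M] exI[of _ N] exI[of _ 0]) (auto simp: MN poly_rel_0)
    next
      assume "Polynomial.degree (P - S * M) < Polynomial.degree P"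
      from less(1)[OF this rel] obtain P1 Q1 P2 Q2 where *: "poly_rel P1 Q1" "poly_rel P2 Q2"
        "P - S * M = S * P1 + P2" "Q - T * N = T * Q1 + Q2" "P2 = 0 \<or> Polynomial.degree P2 < Polynomial.degree S"
        by blast
      have "P = S * (M + P1) + P2" "Q = T * (N + Q1) + Q2"
        using *(3,4) by (simp_all add: algebra_simps)
      thus ?thesis using * poly_rel_add[OF MN *(1)] by blast
    qed
  qed
qed

text \<open>The classical extension to an algebraic element: take a polynomial \<open>S\<close> of
  least degree that kills \<open>a\<close>, carry its coefficients over to \<open>T\<close> and send
  \<open>a\<close> to a root \<open>b\<close> of \<open>T\<close>. The claim \<open>key\<close> is
  the minimality of \<open>T\<close> for \<open>b\<close>: a smaller related polynomial killing
  \<open>b\<close> would lead to a proper factorization of \<open>S\<close>.\<close>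

lemma algebraic_mem:
  assumes "P \<noteq> 0" "P \<in> coeffs_in (Domain G)" "poly P a = 0"
  shows "a \<in> Domain G"
proof -
  define f where "f c = (SOME d. (c, d) \<in> G)" for c
  have f: "(c, f c) \<in> G" if "c \<in> Domain G" for c
    using that unfolding f_def by (metis Domain.cases someI)
  have f0: "f 0 = 0" using f[of 0] zero zero_iff by blast
  have "poly_rel P (map_poly f P)"
    using assms(2) f f0 by (auto simp: poly_rel_def coeffs_in_def coeff_map_poly)
  moreover define A where "A S \<longleftrightarrow> S \<noteq> 0 \<and> poly S a = 0 \<and> (\<exists>T. poly_rel S T)" for S
  ultimately have "A P" using assms by blast
  then obtain S where "A S" and minA: "\<And>S'. A S' \<Longrightarrow> Polynomial.degree S \<le> Polynomial.degree S'"
    using ex_has_least_nat[of A P Polynomial.degree] by blast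
  hence S: "S \<noteq> 0" "poly S a = 0" "\<exists>T. poly_rel S T" by (auto simp: A_def)
  have min: "Polynomial.degree S \<le> Polynomial.degree S'" if "S' \<noteq> 0" "poly S' a = 0" "\<exists>T. poly_rel S' T" for S'
    using minA[of S'] that by (auto simp: A_def)
  from S(3) obtain T where T: "poly_rel S T" by blast
  have degS: "Polynomial.degree S > 0"
    using S(1,2) by (auto elim!: degree_eq_zeroE intro!: Nat.gr0I)
  then obtain b where b: "poly T b = 0"
    using alg_closed_imp_poly_has_root[of T] poly_rel_degree[OF T] by auto
  have T0: "T \<noteq> 0" using S(1) T poly_rel_eq_0_iff by blast
  have key: "S' = 0" if S': "poly_rel S' T'" "poly T' b = 0" "Polynomial.degree S' < Polynomial.degree S" for S' T'
  proof (rule ccontr)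
    assume "S' \<noteq> 0"
    define D where "D U \<longleftrightarrow> U \<noteq> 0 \<and> (\<exists>T'. poly T' b = 0 \<and> poly_rel U T') \<and> Polynomial.degree U < Polynomial.degree S" for U
    have "D S'" using \<open>S' \<noteq> 0\<close> S' by (auto simp: D_def)
    then obtain U where "D U" and minD: "\<And>S'. D S' \<Longrightarrow> Polynomial.degree U \<le> Polynomial.degree S'"
      using ex_has_least_nat[of D S' Polynomial.degree] by blast
    hence U: "U \<noteq> 0" "\<exists>T'. poly T' b = 0 \<and> poly_rel U T'" "Polynomial.degree U < Polynomial.degree S"
      by (auto simp: D_def)
    have minU: "Polynomial.degree U \<le> Polynomial.degree S'" if "S' \<noteq> 0" "\<exists>T'. poly T' b = 0 \<and> poly_rel S' T'"
      "Polynomial.degree S' < Polynomial.degree S" for S'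
      using minD[of S'] that by (auto simp: D_def)
    from U(2) obtain U' where U': "poly U' b = 0" "poly_rel U U'" by blast
    obtain P1 Q1 P2 Q2 where *: "poly_rel P1 Q1" "poly_rel P2 Q2" "S = U * P1 + P2" "T = U' * Q1 + Q2"
      "P2 = 0 \<or> Polynomial.degree P2 < Polynomial.degree U"
      using poly_rel_division[OF T U'(2) U(1)] by blast
    have "poly Q2 b = 0" using *(4) b U'(1) by simp
    hence "P2 = 0" using minU[of P2] *(2,5) U(3) by fastforce
    hence SU: "S = U * P1" using * by simp
    hence "P1 \<noteq> 0" using S by auto
    hence degs: "Polynomial.degree S = Polynomial.degree U + Polynomial.degree P1"
      using U SU by (simp add: degree_mult_eq)
    have "poly U a = 0 \<or> poly P1 a = 0" using S(2) SU by simp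
    thus False
    proof
      assume "poly U a = 0"
      thus False using min[of U] U U' by fastforce
    next
      assume "poly P1 a = 0"
      hence "Polynomial.degree U = 0" using min[of P1] \<open>P1 \<noteq> 0\<close> *(1) degs by fastforce
      hence "Polynomial.degree U' = 0" using poly_rel_degree U' by simp
      then obtain c where "U' = [:c:]" by (auto elim: degree_eq_zeroE)
      moreover have "U' \<noteq> 0" using U U' poly_rel_eq_0_iff by blast
      ultimately show False using U'(1) by simp
    qed
  qed
  have "(a, b) \<in> G"
  proof (rule memI)
    fix P Q assume PQ: "poly_rel P Q"
    obtain P1 Q1 P2 Q2 where *: "poly_rel P1 Q1" "poly_rel P2 Q2" "P = S * P1 + P2" "Q = T * Q1 + Q2"
      "P2 = 0 \<or> Polynomial.degree P2 < Polynomial.degree S"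
      using poly_rel_division[OF PQ T S(1)] by blast
    have "poly P a = 0 \<longleftrightarrow> poly P2 a = 0" using * S by simp
    also have "\<dots> \<longleftrightarrow> P2 = 0" using min[of P2] * by fastforce
    also have "\<dots> \<longleftrightarrow> poly Q2 b = 0"
      using key[OF *(2)] *(5) poly_rel_eq_0_iff[OF *(2)] by auto
    also have "\<dots> \<longleftrightarrow> poly Q b = 0" using * b by simp
    finally show "poly P a = 0 \<longleftrightarrow> poly Q b = 0" .
  qed
  thus ?thesis by auto
qed

lemma embedding_exists:
  assumes "Domain G = UNIV"
  obtains g where "field_embedding g" "\<And>a b. (a, b) \<in> G \<Longrightarrow> g a = b"
proof -
  define g where "g c = (SOME d. (c, d) \<in> G)" for c
  have g: "(c, g c) \<in> G" for c
    using assms unfolding g_def by (metis Domain.cases UNIV_I someI)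
  show ?thesis
  proof (rule that[of g])
    show "field_embedding g"
      by unfold_locales (metis unique g one diff mult)+
    show "g a = b" if "(a, b) \<in> G" for a b using unique[OF g that] .
  qed
qed

end

section \<open>The ambient field\<close>

instance fract :: ("{idom, ring_char_0}") field_char_0
proof
  have "of_nat n = (to_fract (of_nat n) :: 'a fract)" for n
    by (induction n) auto
  thus "inj (of_nat :: nat \<Rightarrow> 'a fract)" by (auto simp: inj_def)
qed

definition eval_x :: "qbar poly \<Rightarrow> ambient"
  where "eval_x P = to_ac (to_fract P)"

lemma eval_x_simps [simp]: "eval_x 0 = 0" "eval_x 1 = 1" "eval_x (P + Q) = eval_x P + eval_x Q"
  "eval_x (P - Q) = eval_x P - eval_x Q" "eval_x (P * Q) = eval_x P * eval_x Q"
  "eval_x P = 0 \<longleftrightarrow> P = 0" "eval_x P = eval_x Q \<longleftrightarrow> P = Q"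
  by (simp_all add: eval_x_def)

lemma eval_x_prod_mset: "eval_x (\<Prod>i\<in>#A. f i) = (\<Prod>i\<in>#A. eval_x (f i))"
  by (induction A) auto

lemma eval_x_prod: "eval_x (\<Prod>i\<in>A. f i) = (\<Prod>i\<in>A. eval_x (f i))"
  by (induction A rule: infinite_finite_induct) auto

lemma ff_const_conv: "ff_const c = eval_x [:c:]" and ff_x_conv: "ff_x = eval_x [:0, 1:]"
  by (simp_all add: ff_const_def ff_x_def eval_x_def)

interpretation ff_const: field_embedding ff_const
proof
  show "ff_const 1 = 1" by (simp add: ff_const_conv flip: one_pCons)
  show "ff_const (a - b) = ff_const a - ff_const b" for a b
    by (simp add: ff_const_conv flip: eval_x_simps)
  show "ff_const (a * b) = ff_const a * ff_const b" for a b
    by (simp add: ff_const_conv mult.commute flip: eval_x_simps)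
qed

lemma eval_x_conv: "eval_x P = poly (map_poly ff_const P) ff_x"
proof (induction P)
  case (pCons a P)
  have "eval_x (pCons a P) = eval_x ([:a:] + [:0, 1:] * P)" by (simp)
  also have "\<dots> = ff_const a + ff_x * eval_x P" by (simp only: eval_x_simps ff_const_conv ff_x_conv)
  finally show ?case using pCons by (simp add: map_poly_pCons)
qed auto

lemma eval_x_linear: "eval_x [:- b, 1:] = ff_x - ff_const b"
  by (simp add: eval_x_conv map_poly_pCons)

lemma ff_x_neq_const [simp]: "ff_x - ff_const b \<noteq> 0"
  by (simp flip: eval_x_linear)

lemma ff_x_neq_const' [simp]: "ff_x \<noteq> ff_const b"
  using ff_x_neq_const[of b] by auto

lemma eval_x_smult: "eval_x (Polynomial.smult c P) = ff_const c * eval_x P"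
  by (simp add: ff_const_conv flip: eval_x_simps(5))

lemma ff_x_nonzero [simp]: "ff_x \<noteq> 0"
  using ff_x_neq_const[of 0] by simp

definition rat_funs :: "ambient set"
  where "rat_funs = range to_ac"

interpretation rat_funs: subfield_set rat_funs
proof
  show "1 \<in> rat_funs" unfolding rat_funs_def by (metis to_ac_1 rangeI)
qed (auto simp: rat_funs_def simp flip: to_ac_diff to_ac_mult to_ac_inverse)

lemma eval_x_in_rat_funs [simp, intro]: "eval_x P \<in> rat_funs"
  by (auto simp: eval_x_def rat_funs_def)

lemma ff_const_in_rat_funs [simp, intro]: "ff_const c \<in> rat_funs"
  and ff_x_in_rat_funs [simp, intro]: "ff_x \<in> rat_funs"
  by (auto simp: ff_const_conv ff_x_conv)

lemma rat_funs_fraction: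
  assumes "r \<in> rat_funs"
  obtains P Q where "r = eval_x P / eval_x Q" "Q \<noteq> 0"
proof -
  from assms obtain r' where r': "r = to_ac r'" by (auto simp: rat_funs_def)
  obtain P Q where "r' = Fract P Q" "Q \<noteq> 0" by (cases r') auto
  thus ?thesis using that r' by (simp add: Fract_conv_to_fract eval_x_def)
qed

text \<open>Every nonzero element of K(x) has this form, as the constants are algebraically closed.
  Exponents 0 on \<open>S\<close> are allowed and values of \<open>n\<close> outside
  \<open>S\<close> are ignored, so two functions can be brought to a common
  \<open>S\<close>.\<close>

definition rat_fun :: "qbar \<Rightarrow> qbar set \<Rightarrow> (qbar \<Rightarrow> int) \<Rightarrow> ambient"
  where "rat_fun c S n = ff_const c * (\<Prod>b\<in>S. (ff_x - ff_const b) powi n b)"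

lemma rat_fun_in_rat_funs [simp, intro]: "rat_fun c S n \<in> rat_funs"
  unfolding rat_fun_def by (intro rat_funs.mult_closed rat_funs.prod_closed rat_funs.powi_closed) auto

lemma rat_fun_eq_0_iff [simp]: "finite S \<Longrightarrow> rat_fun c S n = 0 \<longleftrightarrow> c = 0"
  by (auto simp: rat_fun_def)

lemma rat_fun_superset:
  assumes "finite S'" "S \<subseteq> S'"
  shows "rat_fun c S n = rat_fun c S' (\<lambda>b. if b \<in> S then n b else 0)"
  unfolding rat_fun_def using assms
  by (intro arg_cong[of _ _ "\<lambda>t. ff_const c * t"] prod.mono_neutral_cong_left) auto

lemma rat_fun_divide:
  assumes "finite S"
  shows "rat_fun c S n / rat_fun d S m = rat_fun (c / d) S (\<lambda>b. n b - m b)"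
  using assms by (simp add: rat_fun_def power_int_diff prod_dividef)

lemma polynomial_rat_fun:
  assumes "P \<noteq> 0"
  obtains c S n where "finite S" "c \<noteq> 0" "eval_x P = rat_fun c S n"
proof -
  obtain A where A: "P = Polynomial.smult (Polynomial.lead_coeff P) (\<Prod>x\<in>#A. [:-x, 1:])"
    using alg_closed_imp_factorization[OF assms] by blast
  have "eval_x P = ff_const (Polynomial.lead_coeff P) * (\<Prod>b\<in>#A. ff_x - ff_const b)"
    by (subst A) (simp only: eval_x_smult eval_x_prod_mset eval_x_linear)
  also have "(\<Prod>b\<in>#A. ff_x - ff_const b) = (\<Prod>b\<in>set_mset A. (ff_x - ff_const b) powi int (count A b))"
    by (simp add: image_prod_mset_multiplicity)
  finally have "eval_x P = rat_fun (Polynomial.lead_coeff P) (set_mset A) (\<lambda>b. int (count A b))"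
    by (simp add: rat_fun_def)
  thus ?thesis using that[of "set_mset A" "Polynomial.lead_coeff P"] assms by auto
qed

lemma rat_fun_exists:
  assumes "r \<in> rat_funs" "r \<noteq> 0"
  obtains c S n where "finite S" "c \<noteq> 0" "r = rat_fun c S n"
proof -
  obtain P Q where PQ: "r = eval_x P / eval_x Q" "Q \<noteq> 0" using rat_funs_fraction[OF assms(1)] .
  hence "P \<noteq> 0" using assms(2) by auto
  obtain c S n where P: "finite S" "c \<noteq> 0" "eval_x P = rat_fun c S n"
    using polynomial_rat_fun[OF \<open>P \<noteq> 0\<close>] .
  obtain d T m where Q: "finite T" "d \<noteq> 0" "eval_x Q = rat_fun d T m"
    using polynomial_rat_fun[OF \<open>Q \<noteq> 0\<close>] .
  have 1: "rat_fun c S n = rat_fun c (S \<union> T) (\<lambda>b. if b \<in> S then n b else 0)"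
    by (rule rat_fun_superset) (use P Q in auto)
  have 2: "rat_fun d T m = rat_fun d (S \<union> T) (\<lambda>b. if b \<in> T then m b else 0)"
    by (rule rat_fun_superset) (use P Q in auto)
  have "r = rat_fun (c / d) (S \<union> T) (\<lambda>b. (if b \<in> S then n b else 0) - (if b \<in> T then m b else 0))"
    unfolding PQ(1) P(3) Q(3) 1 2 by (rule rat_fun_divide) (use P Q in auto)
  thus ?thesis using that[of "S \<union> T" "c / d"] P Q by simp
qed

section \<open>Gauss valuations\<close>

lemma prod_powi: "(z :: 'a :: field) \<noteq> 0 \<Longrightarrow> (\<Prod>i\<in>I. z powi f i) = z powi (\<Sum>i\<in>I. f i)"
  by (induction I rule: infinite_finite_induct) (auto simp: power_int_add)

text \<open>The element \<open>z\<close> has infinitesimally small positive value: compared to any constant that is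
  not a unit of \<open>B\<close>, all powers of \<open>z\<close> are negligible.\<close>

locale gauss_valuation = valuation_ring L V + B: valuation_ring UNIV B
  for L V :: "ambient set" and B :: "qbar set" +
  fixes z :: ambient
  assumes rat_funs_subset: "rat_funs \<subseteq> L"
    and const_closed: "c \<in> B \<Longrightarrow> ff_const c \<in> V"
    and z_in: "z \<in> L"
    and z_nonzero: "z \<noteq> 0"
    and z_max_ideal: "z \<in> max_ideal V"
    and small: "c \<in> max_ideal B \<Longrightarrow> ff_const c / z ^ n \<in> max_ideal V"
begin

lemma ff_x_in [simp, intro]: "ff_x \<in> L"
  using rat_funs_subset by auto

lemma const_unit: "c \<in> val_units B \<Longrightarrow> ff_const c \<in> val_units V"
  using const_closed[of c] const_closed[of "inverse c"] by (auto simp: val_units_def)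

lemma const_max_ideal: "c \<in> max_ideal B \<Longrightarrow> ff_const c \<in> max_ideal V"
  using small[of c 0] by simp

lemma const_cases:
  obtains "c \<in> val_units B" | "c \<in> max_ideal B" | "c \<noteq> 0" "c \<notin> B" "inverse c \<in> max_ideal B"
  using B.not_in_ring[of c] B.unit_or_max_ideal[of c] by auto

lemma const_times_z_max_ideal:
  assumes "c \<in> max_ideal B"
  shows "ff_const c * z powi e \<in> max_ideal V"
proof (cases "e \<ge> 0")
  case True
  hence "z powi e \<in> V" using max_ideal_powi(1)[OF z_max_ideal z_nonzero] by blast
  thus ?thesis using const_max_ideal[OF assms] by blast
next
  case False
  thus ?thesis using small[OF assms, of "nat (- e)"]
    by (simp add: power_int_def divide_inverse power_inverse)
qed

lemma const_times_z_unit_iff: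
  assumes "c \<noteq> 0"
  shows "ff_const c * z powi e \<in> val_units V \<longleftrightarrow> c \<in> val_units B \<and> e = 0"
proof (cases rule: const_cases[of c])
  case 1
  hence "ff_const c * z powi e \<in> val_units V \<longleftrightarrow> z powi e \<in> val_units V"
    using val_eq_units_iff[OF val_eq_unit_mult[OF const_unit[OF 1]]] z_nonzero by simp
  thus ?thesis using 1 max_ideal_powi(2)[OF z_max_ideal z_nonzero] by simp
next
  case 2
  thus ?thesis using const_times_z_max_ideal[OF 2, of e] max_idealD(2) B.max_idealD(2) by blast
next
  case 3
  have "inverse (ff_const c * z powi e) = ff_const (inverse c) * z powi (- e)"
    by (simp add: power_int_minus)
  hence "inverse (ff_const c * z powi e) \<in> max_ideal V" using const_times_z_max_ideal[OF 3(3), of "- e"] by metis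
  hence "ff_const c * z powi e \<notin> val_units V"
    using unit_inverse max_idealD(2) by blast
  thus ?thesis using 3 by (auto simp: val_units_def)
qed

lemma const_times_z_ring_iff:
  assumes "c \<in> val_units B"
  shows "ff_const c * z powi e \<in> V \<longleftrightarrow> e \<ge> 0"
  using val_eq_ring_iff[OF val_eq_unit_mult[OF const_unit[OF assms]], of "z powi e"] z_nonzero
    max_ideal_powi(1)[OF z_max_ideal z_nonzero] by simp

text \<open>Values are lexicographic: no power of \<open>z\<close> compensates a constant that is
  not a unit of \<open>B\<close>, so the two parts can be read off separately.\<close>

lemma const_times_z_eq:
  assumes "val_eq V (ff_const c * z powi e) (ff_const d * z powi e')" "c \<noteq> 0" "d \<noteq> 0"
  shows "val_eq B c d" "e = e'"
proof -
  have "ff_const (c / d) * z powi (e - e') \<in> val_units V"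
    using assms z_nonzero by (simp add: val_eq_def power_int_diff)
  thus "val_eq B c d" "e = e'" using const_times_z_unit_iff[of "c / d"] assms by (auto simp: val_eq_def)
qed

end

text \<open>The coefficient of \<open>x - b\<close> of least value at \<open>B\<close>: the leading
  one if \<open>b\<close> is integral, and the constant one otherwise.\<close>

definition const_part :: "qbar set \<Rightarrow> qbar \<Rightarrow> qbar"
  where "const_part B b = (if b \<in> B then 1 else - b)"

text \<open>A constant with the value of the Gauss norm of \<open>rat_fun c S n\<close>. It does not
  involve the point of the reduced line at which the function is studied, which permits comparisons
  between different points.\<close>

definition gauss_const :: "qbar set \<Rightarrow> qbar \<Rightarrow> qbar set \<Rightarrow> (qbar \<Rightarrow> int) \<Rightarrow> qbar"
  where "gauss_const B c S n = c * (\<Prod>b\<in>S. const_part B b powi n b)"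

lemma gauss_const_nonzero: "finite S \<Longrightarrow> c \<noteq> 0 \<Longrightarrow> 0 \<in> B \<Longrightarrow> gauss_const B c S n \<noteq> 0"
  by (auto simp: gauss_const_def const_part_def)

lemma gauss_const_UNIV [simp]: "gauss_const UNIV c S n = c"
  by (simp add: gauss_const_def const_part_def)

context gauss_valuation
begin

lemma rat_fun_val_eq:
  assumes "finite S" "c \<noteq> 0"
    and "\<And>b. b \<in> S \<Longrightarrow> val_eq V (ff_x - ff_const b) (ff_const (const_part B b) * z powi e b)"
  shows "val_eq V (rat_fun c S n) (ff_const (gauss_const B c S n) * z powi (\<Sum>b\<in>S. e b * n b))"
proof -
  have "val_eq V ((ff_x - ff_const b) powi n b) (ff_const (const_part B b powi n b) * z powi (e b * n b))"
    if "b \<in> S" for b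
    using val_eq_powi[OF assms(3)[OF that], of "n b"] by (simp add: power_int_mult_distrib power_int_mult)
  hence "val_eq V (\<Prod>b\<in>S. (ff_x - ff_const b) powi n b) (\<Prod>b\<in>S. ff_const (const_part B b powi n b) * z powi (e b * n b))"
    by (intro val_eq_prod assms)
  hence "val_eq V (rat_fun c S n) (ff_const c * (\<Prod>b\<in>S. ff_const (const_part B b powi n b) * z powi (e b * n b)))"
    unfolding rat_fun_def using assms(2) by (intro val_eq_mult) auto
  also have "(\<Prod>b\<in>S. ff_const (const_part B b powi n b) * z powi (e b * n b)) =
      ff_const (\<Prod>b\<in>S. const_part B b powi n b) * z powi (\<Sum>b\<in>S. e b * n b)"
    using z_nonzero by (simp add: prod.distrib ff_const.hom_prod prod_powi)
  finally show ?thesis by (simp add: gauss_const_def mult_ac)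
qed

lemma outside_B:
  assumes "b \<notin> B" "ff_x * ff_const (inverse b) \<in> max_ideal V"
  shows "val_eq V (ff_x - ff_const b) (ff_const (const_part B b))"
proof -
  have "b \<noteq> 0" using assms by auto
  hence "val_eq V (ff_const (- b) + ff_x) (ff_const (- b))"
    using max_ideal_uminus[OF assms(2)] by (intro val_eq_add) (auto simp: divide_inverse)
  thus ?thesis using assms by (simp add: const_part_def)
qed

end

locale gauss_valuation_at = gauss_valuation L V B z
  for L V B z +
  fixes a :: qbar
  assumes z_eq: "z = ff_x - ff_const a" and a_in: "a \<in> B"
begin

lemma ff_x_ring: "ff_x \<in> V"
  using add_closed[OF max_idealD(1)[OF z_max_ideal] const_closed[OF a_in]] by (simp add: z_eq)

text \<open>In \<open>x - b = z + (a - b)\<close> the constant is negligible against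
  \<open>z\<close> if \<open>a\<close> and \<open>b\<close> reduce to the same point, and it
  dominates otherwise.\<close>

lemma linear_val_eq:
  "val_eq V (ff_x - ff_const b) (ff_const (const_part B b) * z powi (if b - a \<in> max_ideal B then 1 else 0))"
proof -
  consider "b - a \<in> max_ideal B" "b \<in> B" | "b - a \<in> val_units B" "b \<in> B" | "b \<notin> B" "inverse b \<in> max_ideal B" "b - a \<notin> max_ideal B"
    using B.unit_or_max_ideal[of "b - a"] B.not_in_ring[of b] B.diff_closed[OF _ a_in, of b] B.max_idealD(1)[of "b - a"]
      B.add_closed[OF _ a_in, of "b - a"] by auto
  thus ?thesis
  proof cases
    case 1
    have "ff_const (a - b) / z ^ 1 \<in> max_ideal V"
      using B.max_ideal_uminus[OF 1(1)] by (intro small) simp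
    hence "val_eq V (z + ff_const (a - b)) z" using z_nonzero by (intro val_eq_add) auto
    thus ?thesis using 1 by (simp add: z_eq const_part_def)
  next
    case 2
    have "ff_const (a - b) + z \<in> val_units V"
      using B.unit_uminus[OF 2(1)] z_max_ideal by (intro unit_add_max_ideal const_unit) auto
    moreover have "b - a \<notin> max_ideal B" using 2 B.max_idealD(2) by blast
    ultimately show ?thesis using 2 by (simp add: z_eq const_part_def val_eq_one_iff)
  next
    case 3
    have "ff_x * ff_const (inverse b) \<in> max_ideal V"
      using const_max_ideal[OF 3(2)] ff_x_ring by blast
    thus ?thesis using 3 outside_B[of b] by simp
  qed
qed

text \<open>The exponent of \<open>z\<close> is the order of the reduced function at the reduction
  of \<open>a\<close>, to which all zeros and poles reducing to that point contribute.\<close>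

lemma rat_fun_val_eq_at:
  assumes "finite S" "c \<noteq> 0"
  shows "val_eq V (rat_fun c S n)
    (ff_const (gauss_const B c S n) * z powi (\<Sum>b\<in>{b\<in>S. b - a \<in> max_ideal B}. n b))"
proof -
  have "(\<Sum>b\<in>S. (if b - a \<in> max_ideal B then 1 else 0) * n b) = (\<Sum>b\<in>{b\<in>S. b - a \<in> max_ideal B}. n b)"
    using assms(1) by (simp add: sum.inter_filter if_distrib[of "\<lambda>t. t * _"] cong: if_cong)
  thus ?thesis
    using rat_fun_val_eq[OF assms linear_val_eq, of n] by simp
qed

end

locale gauss_valuation_inf = gauss_valuation L V B z
  for L V B z +
  assumes z_eq: "z = inverse ff_x"
begin

lemma linear_val_eq:
  "val_eq V (ff_x - ff_const b) (ff_const (const_part B b) * z powi (if b \<in> B then - 1 else 0))"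
proof (cases "b \<in> B")
  case True
  have "- ff_const b * z \<in> max_ideal V"
    using const_closed[OF True] z_max_ideal by (intro max_ideal_mult') auto
  hence "val_eq V (ff_x + (- ff_const b)) ff_x"
    by (intro val_eq_add) (auto simp: z_eq divide_inverse)
  thus ?thesis using True by (simp add: const_part_def z_eq power_int_minus)
next
  case False
  hence "ff_const (inverse b) / z ^ 1 \<in> max_ideal V"
    using B.not_in_ring[of b] by (intro small) auto
  hence "ff_x * ff_const (inverse b) \<in> max_ideal V"
    by (simp add: z_eq field_simps)
  thus ?thesis using False outside_B[of b] by simp
qed

text \<open>Zeros and poles outside \<open>B\<close> reduce to infinity and drop out of the degree
  of the reduced function.\<close>

lemma rat_fun_val_eq_inf:
  assumes "finite S" "c \<noteq> 0"
  shows "val_eq V (rat_fun c S n)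
    (ff_const (gauss_const B c S n) * z powi (- (\<Sum>b\<in>S \<inter> B. n b)))"
proof -
  have "(\<Sum>b\<in>S. (if b \<in> B then - 1 else 0) * n b) = - (\<Sum>b\<in>S \<inter> B. n b)"
  proof -
    have "(\<Sum>b\<in>S. (if b \<in> B then - 1 else 0) * n b) = (\<Sum>b\<in>S. - (if b \<in> B then n b else 0))"
      by (intro sum.cong) auto
    thus ?thesis using assms(1) by (simp add: sum_negf sum.inter_restrict)
  qed
  thus ?thesis
    using rat_fun_val_eq[OF assms linear_val_eq, of n] by simp
qed

end

text \<open>Chevalley's theorem, applied to the ring generated by \<open>B\<close>, \<open>z\<close>
  and all quotients of nonunits of \<open>B\<close> by powers of \<open>z\<close>. The hypothesis on
  \<open>z\<close>, transcendence over the constants, ensures that \<open>inverse z\<close> is not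
  in this ring.\<close>

lemma gauss_valuation_exists:
  assumes "valuation_ring UNIV B" and z: "\<And>P. P \<noteq> 0 \<Longrightarrow> poly (map_poly ff_const P) z \<noteq> 0"
  obtains V where "gauss_valuation UNIV V B z"
proof -
  interpret B: valuation_ring UNIV B by fact
  define E where "E P = poly (map_poly ff_const P) z" for P
  have E_add: "E (P + Q) = E P + E Q" for P Q
    unfolding E_def by (subst poly_add[symmetric], rule arg_cong[of _ _ "\<lambda>P. poly P z"]) (auto simp: poly_eq_iff coeff_map_poly)
  have E_diff: "E (P - Q) = E P - E Q" for P Q
    unfolding E_def by (subst Polynomial.poly_diff[symmetric], rule arg_cong[of _ _ "\<lambda>P. poly P z"]) (auto simp: poly_eq_iff coeff_map_poly)
  have E_mult: "E (P * Q) = E P * E Q" for P Q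
    unfolding E_def by (subst poly_mult[symmetric], rule arg_cong[of _ _ "\<lambda>P. poly P z"]) (auto simp: poly_eq_iff coeff_map_poly coeff_mult ff_const.hom_sum)
  have E_eq: "E P = E Q \<longleftrightarrow> P = Q" for P Q
    using z[of "P - Q"] E_diff[of P Q] by (auto simp: E_def)
  have E_monom: "E (Polynomial.monom c n) = ff_const c * z ^ n" for c n
    unfolding E_def by (simp add: map_poly_monom poly_monom)
  have z0: "z \<noteq> 0" using z[of "[:0, 1:]"] by (auto simp: map_poly_pCons)
  \<comment> \<open>Numerators over \<open>z ^ N\<close>: coefficients of index below
    \<open>N\<close> belong to negative powers of \<open>z\<close> and must be nonunits of
    \<open>B\<close>.\<close>
  define good where "good P N \<longleftrightarrow> P \<in> coeffs_in B \<and> (\<forall>j<N. Polynomial.coeff P j \<in> max_ideal B)" for P and N :: nat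
  have good_mult: "good (P * Q) (N + M)" if "good P N" "good Q M" for P Q N M
  proof -
    have *: "Polynomial.coeff P i * Polynomial.coeff Q (j - i) \<in> max_ideal B" if "j < N + M" "i \<le> j" for i j
    proof (cases "i < N")
      case False
      hence "j - i < M" using that by simp
      thus ?thesis using \<open>good P N\<close> \<open>good Q M\<close> unfolding good_def coeffs_in_def by blast
    qed (use \<open>good P N\<close> \<open>good Q M\<close> in \<open>unfold good_def coeffs_in_def, blast\<close>)
    have "(\<Sum>i\<le>j. Polynomial.coeff P i * Polynomial.coeff Q (j - i)) \<in> max_ideal B" if "j < N + M" for j
      using *[OF that] by (intro B.max_ideal_sum) auto
    moreover have "(\<Sum>i\<le>j. Polynomial.coeff P i * Polynomial.coeff Q (j - i)) \<in> B" for j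
      using that by (intro B.sum_closed B.mult_closed) (auto simp: good_def coeffs_in_def)
    ultimately show ?thesis by (auto simp: good_def coeffs_in_def coeff_mult)
  qed
  have good_shift: "good (P * Polynomial.monom 1 M) (N + M)" if "good P N" for P N M
    by (rule good_mult[OF that]) (auto simp: good_def coeffs_in_def coeff_monom)
  have good_diff: "good (P - Q) N" if "good P N" "good Q N" for P Q N
    using that by (auto simp: good_def coeffs_in_def B.diff_closed B.max_ideal_diff)
  define R where "R = {w. \<exists>P N. good P N \<and> w * z ^ N = E P}"
  have R_monom: "ff_const c * z powi (int n - int N) \<in> R" if "c \<in> B" "n < N \<Longrightarrow> c \<in> max_ideal B" for c n N
  proof -
    have "ff_const c * z powi (int n - int N) * z ^ N = E (Polynomial.monom c n)"
      using z0 by (simp add: E_monom power_int_diff)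
    moreover have "good (Polynomial.monom c n) N"
      using that B.max_idealD(1) by (auto simp: good_def coeffs_in_def coeff_monom)
    ultimately show ?thesis by (auto simp: R_def)
  qed
  have sub: "subring_set R"
  proof
    show "1 \<in> R" using R_monom[of 1 0 0] by simp
    fix v w assume "v \<in> R" "w \<in> R"
    then obtain P Q N M where PQ: "good P N" "good Q M" "v * z ^ N = E P" "w * z ^ M = E Q"
      by (auto simp: R_def)
    have "v * w * z ^ (N + M) = E (P * Q)"
      unfolding E_mult PQ(3,4)[symmetric] by (simp add: power_add)
    thus "v * w \<in> R" using good_mult[OF PQ(1,2)] by (auto simp: R_def)
    have "(v - w) * z ^ (N + M) = E (P * Polynomial.monom 1 M - Q * Polynomial.monom 1 N)"
      unfolding E_mult E_diff E_monom PQ(3,4)[symmetric] by (simp add: power_add algebra_simps)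
    moreover have "good (P * Polynomial.monom 1 M - Q * Polynomial.monom 1 N) (N + M)"
      using good_shift[OF PQ(1), of M] good_shift[OF PQ(2), of N] by (intro good_diff) (auto simp: add.commute)
    ultimately show "v - w \<in> R" by (auto simp: R_def)
  qed
  have zR: "z \<in> R" using R_monom[of 1 1 0] by simp
  have "inverse z \<notin> R"
  proof
    assume "inverse z \<in> R"
    then obtain P N where P: "good P N" "inverse z * z ^ N = E P" by (auto simp: R_def)
    have "E (Polynomial.monom 1 1 * P) = E (Polynomial.monom 1 N)"
      using z0 by (simp only: E_mult P(2)[symmetric] E_monom) simp
    hence *: "Polynomial.monom 1 1 * P = Polynomial.monom 1 N" by (simp add: E_eq)
    have "Polynomial.coeff (Polynomial.monom 1 1 * P) N = 1" unfolding * by simp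
    hence "N > 0" "Polynomial.coeff P (N - 1) = 1"
      by (auto simp: coeff_monom_mult split: if_splits)
    thus False using P(1) B.one_not_max_ideal unfolding good_def by (metis diff_less less_one)
  qed
  from valuation_ring_exists[OF sub zR this] obtain V where V: "valuation_ring UNIV V" "R \<subseteq> V" "z \<in> max_ideal V" .
  interpret V: valuation_ring UNIV V by fact
  have "gauss_valuation UNIV V B z"
  proof
    show "ff_const c \<in> V" if "c \<in> B" for c using R_monom[OF that, of 0 0] V(2) by auto
    \<comment> \<open>One more factor \<open>z\<close> in the denominator still gives an element of
      \<open>R\<close>; multiplying it by \<open>z\<close> leads into the maximal ideal.\<close>
    show "ff_const c / z ^ n \<in> max_ideal V" if "c \<in> max_ideal B" for c n
    proof -
      have "ff_const c / z ^ Suc n \<in> R"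
        using R_monom[of c 0 "Suc n"] that B.max_idealD(1)[OF that] by (simp add: power_int_minus divide_inverse del: power_Suc of_nat_Suc)
      hence "ff_const c / z ^ Suc n * z \<in> max_ideal V" using V(2,3) by blast
      thus ?thesis using z0 by simp
    qed
  qed (use z0 V in auto)
  thus ?thesis using that by blast
qed

lemma gauss_valuation_at_exists:
  assumes "valuation_ring UNIV B" "a \<in> B"
  obtains V where "gauss_valuation_at UNIV V B (ff_x - ff_const a) a"
proof -
  have "poly (map_poly ff_const P) (ff_x - ff_const a) \<noteq> 0" if "P \<noteq> 0" for P
  proof -
    have "poly (map_poly ff_const P) (ff_x - ff_const a) = eval_x (pcompose P [:- a, 1:])"
    proof (induction P)
      case (pCons c P)
      have "eval_x (pcompose (pCons c P) [:- a, 1:]) = eval_x ([:c:] + [:- a, 1:] * pcompose P [:- a, 1:])"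
        by (simp only: pcompose_pCons)
      also have "\<dots> = ff_const c + (ff_x - ff_const a) * eval_x (pcompose P [:- a, 1:])"
        by (simp only: eval_x_simps ff_const_conv[symmetric] eval_x_linear)
      finally show ?case using pCons by (simp add: map_poly_pCons)
    qed auto
    thus ?thesis using that pcompose_eq_0[of P "[:- a, 1:]"] by auto
  qed
  from gauss_valuation_exists[OF assms(1) this] obtain V where "gauss_valuation UNIV V B (ff_x - ff_const a)" by blast
  thus ?thesis using that assms(2) by (simp add: gauss_valuation_at_def gauss_valuation_at_axioms_def)
qed

lemma gauss_valuation_inf_exists:
  assumes "valuation_ring UNIV B"
  obtains V where "gauss_valuation_inf UNIV V B (inverse ff_x)"
proof -
  have "poly (map_poly ff_const P) (inverse ff_x) \<noteq> 0" if "P \<noteq> 0" for P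
  proof -
    have "poly (reflect_poly (map_poly ff_const P)) ff_x = eval_x (reflect_poly P)"
      unfolding eval_x_conv by (rule arg_cong[of _ _ "\<lambda>P. poly P ff_x"])
        (auto simp: poly_eq_iff coeff_map_poly coeff_reflect_poly degree_map_poly)
    moreover have "reflect_poly P \<noteq> 0" using that by (simp add: reflect_poly_eq_0_iff)
    ultimately have "poly (reflect_poly (map_poly ff_const P)) ff_x \<noteq> 0" by simp
    thus ?thesis by (simp add: poly_reflect_poly_nz)
  qed
  from gauss_valuation_exists[OF assms this] obtain V where "gauss_valuation UNIV V B (inverse ff_x)" by blast
  thus ?thesis using that by (simp add: gauss_valuation_inf_def gauss_valuation_inf_axioms_def)
qed

section \<open>Places of the constants and the roots of \<open>F\<close>\<close>

lemma padic_ring_exists: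
  assumes "prime (l :: nat)"
  obtains B :: "'a::field_char_0 set" where "valuation_ring UNIV B" "of_nat l \<in> max_ideal B"
proof -
  define R where "R = range (of_int :: int \<Rightarrow> 'a)"
  have "subring_set R"
    by unfold_locales (auto simp: R_def image_iff simp flip: of_int_diff of_int_mult intro: exI[of _ 1])
  moreover have "of_nat l \<in> R" unfolding R_def by (metis of_int_of_nat_eq rangeI)
  moreover have "inverse (of_nat l) \<notin> R"
  proof
    assume "inverse (of_nat l) \<in> R"
    then obtain n where n: "inverse (of_nat l) = (of_int n :: 'a)" by (auto simp: R_def)
    have "(of_nat l :: 'a) \<noteq> 0" using assms prime_gt_0_nat by auto
    hence "of_int (n * int l) = (1 :: 'a)" using n by (simp flip: n)
    hence "n * int l = 1" by (metis of_int_eq_1_iff)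
    hence "int l dvd 1" by (metis dvd_triv_right)
    thus False using assms by (auto simp: prime_nat_iff)
  qed
  ultimately show ?thesis using valuation_ring_exists[of R "of_nat l"] that by blast
qed

locale padic_ring = valuation_ring UNIV B for B :: "'a::field_char_0 set" +
  fixes l :: nat
  assumes prime_l: "prime l" and l_in: "of_nat l \<in> max_ideal B"
begin

lemma of_int_max_ideal_iff: "of_int n \<in> max_ideal B \<longleftrightarrow> int l dvd n"
proof
  assume "int l dvd n"
  then obtain m where "n = int l * m" by auto
  moreover have "of_nat l * of_int m \<in> max_ideal B" using l_in by blast
  ultimately show "of_int n \<in> max_ideal B" by simp
next
  assume n: "of_int n \<in> max_ideal B"
  show "int l dvd n"
  proof (rule ccontr)
    assume "\<not> int l dvd n"
    hence "coprime (int l) n" using prime_l by (simp add: prime_imp_coprime)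
    then obtain u v where "u * int l + v * n = 1" using bezout_int[of "int l" n] by auto
    hence "of_int u * of_nat l + of_int v * of_int n = (1 :: 'a)"
      by (metis of_int_1 of_int_add of_int_mult of_int_of_nat_eq)
    moreover have "of_int u * of_nat l + of_int v * of_int n \<in> max_ideal B"
      using l_in n by (intro max_ideal_add max_ideal_mult') auto
    ultimately show False by simp
  qed
qed

lemma of_int_unit_iff: "of_int n \<in> val_units B \<longleftrightarrow> \<not> int l dvd n"
  using of_int_max_ideal_iff[of n] unit_or_max_ideal[of "of_int n"] max_idealD(2) by auto

text \<open>In lowest terms an integral rational number has a denominator prime to \<open>l\<close>,
  which can be inverted modulo \<open>l\<close>.\<close>

lemma of_rat_congruent_int:
  assumes "of_rat r \<in> B"
  obtains n :: int where "of_rat r - of_int n \<in> max_ideal B"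
proof -
  obtain a b where ab: "r = of_int a / of_int b" "b \<noteq> 0" "coprime a b"
    by (cases r) (auto simp: Fract_of_int_quotient)
  have r: "of_rat r = (of_int a / of_int b :: 'a)" using ab by (simp add: of_rat_divide)
  have b: "\<not> int l dvd b"
  proof
    assume *: "int l dvd b"
    hence "\<not> int l dvd a" using ab(3) prime_l
      by (metis coprime_common_divisor not_prime_unit prime_nat_int_transfer)
    hence "of_int a \<in> val_units B" using of_int_unit_iff by blast
    moreover have "(of_int a :: 'a) = of_rat r * of_int b" unfolding r using ab(2) by simp
    moreover have "of_rat r * of_int b \<in> max_ideal B"
      using assms * of_int_max_ideal_iff by blast
    ultimately show False using max_idealD(2) by metis
  qed
  hence "coprime (int l) b" using prime_l by (simp add: prime_imp_coprime)
  then obtain u v where uv: "u * int l + v * b = 1" using bezout_int[of "int l" b] by auto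
  have eq: "1 - v * b = u * int l" using uv by simp
  have "of_rat r - of_int (a * v) = (of_int (a * (1 - v * b)) / of_int b :: 'a)"
    using ab(2) by (simp add: r field_simps)
  also have "\<dots> = of_int (a * (u * int l)) * inverse (of_int b)"
    unfolding eq by (simp add: divide_inverse)
  also have "\<dots> \<in> max_ideal B"
  proof (rule max_ideal_mult)
    show "of_int (a * (u * int l)) \<in> max_ideal B" unfolding of_int_max_ideal_iff by simp
    show "inverse (of_int b) \<in> B" using b of_int_unit_iff[of b] unitD(3) by blast
  qed
  finally show ?thesis using that by blast
qed

end

section \<open>The polynomial \<open>F\<close> and its reductions modulo \<open>p\<close> and
  \<open>l\<close>\<close>

locale curve =
  fixes p q :: nat and k :: int
  assumes prime_p: "prime p" and odd_p: "odd p"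
    and prime_q: "prime q" and q_dvd: "q dvd p - 1"
    and large_prime: "\<exists>l :: nat. prime l \<and> l > p \<and> int l dvd k"
    and k_p: "\<not> int p dvd k"
begin

lemma p_gt_2: "p > 2"
  using odd_p prime_p by (metis even_numeral le_neq_implies_less prime_ge_2_nat)

lemma q_gt_0 [simp]: "q > 0" using prime_q prime_gt_0_nat by blast

lemma q_gt_1: "q > 1" using prime_q prime_gt_1_nat by blast

lemma q_less_p: "q < p"
  using q_dvd p_gt_2 by (metis dvd_imp_le less_le_trans diff_less less_trans zero_less_diff le_less_trans
    less_imp_diff_less nat_neq_iff not_less one_less_numeral_iff semiring_norm(76) zero_less_one)

lemma k_nonzero [simp]: "k \<noteq> 0" using k_p by auto

lemma coprime_pq: "coprime p q"
  using prime_p prime_q q_less_p primes_coprime[of p q] by auto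

definition F :: "rat poly"
  where "F = (\<Prod>i<p. [:- of_nat i, 1:]) + [:of_int (k ^ q):]"

definition FK :: "qbar poly"
  where "FK = (\<Prod>i<p. [:- of_nat i, 1:]) + [:of_int (k ^ q):]"

definition G :: "'a::comm_ring_1 \<Rightarrow> 'a"
  where "G a = (\<Prod>i<p. a - of_nat i)"

lemma poly_FK: "poly FK a = G a + of_int (k ^ q)"
  by (simp add: FK_def G_def poly_prod)

lemma degree_prod_linear: "Polynomial.degree (\<Prod>i<n. [:- of_nat i, 1 :: 'a::idom:]) = n"
  by (subst degree_prod_eq_sum_degree) auto

lemma monic_prod_linear: "Polynomial.lead_coeff (\<Prod>i<n. [:- of_nat i, 1 :: 'a::idom:]) = 1"
  by (simp add: lead_coeff_prod)

lemma degree_FK: "Polynomial.degree FK = p" and lead_coeff_FK: "Polynomial.lead_coeff FK = 1"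
  and degree_F: "Polynomial.degree F = p"
proof -
  show d: "Polynomial.degree FK = p" unfolding FK_def using p_gt_2
    by (subst degree_add_eq_left) (auto simp: degree_prod_linear)
  show "Polynomial.degree F = p" unfolding F_def using p_gt_2
    by (subst degree_add_eq_left) (auto simp: degree_prod_linear)
  have "Polynomial.coeff FK p = 1"
    using monic_prod_linear[of p, where 'a = qbar] p_gt_2
    by (simp add: FK_def degree_prod_linear coeff_pCons split: nat.splits)
  thus "Polynomial.lead_coeff FK = 1" by (simp add: d)
qed

lemma FK_nonzero [simp]: "FK \<noteq> 0" using degree_FK p_gt_2 by auto

definition roots :: "qbar set"
  where "roots = {a. poly FK a = 0}"

lemma finite_roots [simp, intro]: "finite roots"
  unfolding roots_def by (rule poly_roots_finite) simp

lemma FK_factorization: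
  obtains A where "size A = p" "FK = (\<Prod>a\<in>#A. [:- a, 1:])" "set_mset A = roots"
proof -
  obtain A where A: "size A = p" "FK = (\<Prod>a\<in>#A. [:- a, 1:])"
    using alg_closed_imp_factorization[of FK] lead_coeff_FK degree_FK by auto
  have "poly FK x = 0 \<longleftrightarrow> x \<in># A" for x
    by (subst A(2)) (auto simp: poly_prod_mset prod_mset_zero_iff)
  thus ?thesis using that[of A] A by (auto simp: roots_def)
qed

end

locale curve_place = curve + B: padic_ring B l for B :: "qbar set" and l
begin

text \<open>A nonintegral \<open>a\<close> would have the same value as each \<open>a - i\<close>,
  so that \<open>a ^ p\<close> would have the value of the integer \<open>- (k ^ q)\<close>.\<close>

lemma root_integral:
  assumes "a \<in> roots"
  shows "a \<in> B"
proof (rule ccontr)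
  assume a: "a \<notin> B"
  hence m: "inverse a \<in> max_ideal B" by (intro B.not_in_ring) auto
  have a0: "a \<noteq> 0" using a by auto
  have "val_eq B (a - of_nat i) a" if "i < p" for i
  proof -
    have "- of_nat i / a \<in> max_ideal B" unfolding divide_inverse using m by (intro B.max_ideal_mult') auto
    from B.val_eq_add[OF a0 this] show ?thesis by simp
  qed
  hence "val_eq B (G a) (\<Prod>i<p. a)" unfolding G_def by (intro B.val_eq_prod) auto
  moreover have "G a = - of_int (k ^ q)" using assms by (simp add: roots_def poly_FK add_eq_0_iff2)
  ultimately have "val_eq B (- of_int (k ^ q)) (a ^ p)" by simp
  hence "a ^ p \<in> B" using B.val_eq_ring_iff B.of_int_closed[of "k ^ q"] B.uminus_closed by blast
  thus False using B.root_closed[of a p] a p_gt_2 by auto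
qed

text \<open>\<open>F\<close> splits over the constants, so a nonunit value of the product forces one
  factor \<open>a - b\<close> into the maximal ideal.\<close>

lemma near_root:
  assumes "a \<in> B" "poly FK a \<in> max_ideal B"
  shows "\<exists>b\<in>roots. b - a \<in> max_ideal B"
proof -
  obtain A where A: "size A = p" "FK = (\<Prod>a\<in>#A. [:- a, 1:])" "set_mset A = roots"
    using FK_factorization .
  have "poly FK a = (\<Prod>b\<in>#A. a - b)" unfolding A(2) by (simp add: poly_prod_mset)
  also have "\<dots> = (\<Prod>b\<in>roots. (a - b) ^ count A b)"
    using A(3) by (simp add: image_prod_mset_multiplicity)
  finally have "(\<Prod>b\<in>roots. (a - b) ^ count A b) \<in> max_ideal B" using assms by simp
  then obtain b where b: "b \<in> roots" "(a - b) ^ count A b \<in> max_ideal B"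
    using B.prime_max_ideal_prod[of roots "\<lambda>b. (a - b) ^ count A b"] assms(1) root_integral by blast
  have "count A b > 0" using b(1) A(3) by auto
  hence "a - b \<in> max_ideal B" using B.root_max_ideal[OF _ b(2)] by auto
  thus ?thesis using b(1) B.max_ideal_uminus[of "a - b"] by auto
qed

text \<open>If \<open>F\<close> has \<open>p\<close> pairwise incongruent approximate roots, then these are the reductions of its
  roots, which are therefore distinct.\<close>

lemma reduction_of_roots:
  assumes a: "\<And>i. i < p \<Longrightarrow> a i \<in> B" "\<And>i. i < p \<Longrightarrow> poly FK (a i) \<in> max_ideal B"
    and inc: "\<And>i j. i < j \<Longrightarrow> j < p \<Longrightarrow> a j - a i \<notin> max_ideal B"
  shows "card roots = p" "\<exists>f. bij_betw f {..<p} roots \<and> (\<forall>i<p. f i - a i \<in> max_ideal B)"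
proof -
  obtain f where f: "\<And>i. i < p \<Longrightarrow> f i \<in> roots" "\<And>i. i < p \<Longrightarrow> f i - a i \<in> max_ideal B"
    using near_root[OF a] by metis
  have ne: "f i \<noteq> f j" if "i < j" "j < p" for i j
  proof
    assume "f i = f j"
    moreover have "(f i - a i) - (f j - a j) \<in> max_ideal B" using that by (intro B.max_ideal_diff f) auto
    ultimately show False using inc[OF that] by simp
  qed
  have inj: "inj_on f {..<p}"
    by (rule inj_onI) (metis lessThan_iff ne nat_neq_iff)
  have le: "card roots \<le> p" unfolding roots_def using card_poly_roots_bound[of FK] degree_FK by simp
  have "p \<le> card roots" using card_inj_on_le[OF inj, of roots] f by auto
  with le show c: "card roots = p" by simp
  have "f ` {..<p} = roots"
    using inj c f by (intro card_subset_eq) (auto simp: card_image)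
  thus "\<exists>f. bij_betw f {..<p} roots \<and> (\<forall>i<p. f i - a i \<in> max_ideal B)"
    using inj f by (auto simp: bij_betw_def)
qed

end

context curve
begin

lemma padic_place:
  obtains B where "curve_place p q k B p"
  using padic_ring_exists[OF prime_p, where 'a = qbar] that curve_axioms prime_p
  by (metis curve_place.intro padic_ring.intro padic_ring_axioms.intro)

lemma ladic_place:
  obtains B l where "curve_place p q k B l" "l > p" "int l dvd k"
proof -
  obtain l :: nat where l: "prime l" "l > p" "int l dvd k" using large_prime by auto
  obtain B :: "qbar set" where "valuation_ring UNIV B" "of_nat l \<in> max_ideal B"
    using padic_ring_exists[OF l(1)] .
  thus ?thesis using that l curve_axioms by (metis curve_place.intro padic_ring.intro padic_ring_axioms.intro)
qed

text \<open>Modulo \<open>l\<close> the constant \<open>k ^ q\<close> disappears, so 0, ..., p - 1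
  are approximate roots; they stay distinct because \<open>l > p\<close>.\<close>

lemma ladic_roots:
  assumes "curve_place p q k B l" "l > p" "int l dvd k"
  shows "\<exists>f. bij_betw f {..<p} roots \<and> (\<forall>i<p. f i - of_nat i \<in> max_ideal B)"
proof -
  interpret curve_place p q k B l by fact
  show ?thesis
  proof (rule reduction_of_roots(2))
    fix i assume i: "i < p"
    have "G (of_nat i :: qbar) = 0" using i by (auto simp: G_def)
    thus "poly FK (of_nat i) \<in> max_ideal B"
      unfolding poly_FK using assms(3) B.of_int_max_ideal_iff[of "k ^ q"] dvd_trans[OF assms(3) dvd_power[of q k]] by simp
  next
    fix i j :: nat assume ij: "i < j" "j < p"
    have "\<not> int l dvd int (j - i)" using ij assms(2) by (auto dest: zdvd_imp_le)
    thus "of_nat j - of_nat i \<notin> max_ideal B" using B.of_int_max_ideal_iff[of "int (j - i)"] ij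
      by (simp add: of_nat_diff)
  qed auto
qed

text \<open>Modulo \<open>p\<close> the polynomial \<open>F\<close> is invariant under \<open>x \<mapsto> x + 1\<close> (it is an Artin--Schreier
  polynomial), so its roots form a coset of the prime field.\<close>

lemma padic_roots:
  assumes "curve_place p q k B p" "a \<in> roots"
  shows "card roots = p" "\<exists>f. bij_betw f {..<p} roots \<and> (\<forall>i<p. f i - (a + of_nat i) \<in> max_ideal B)"
proof -
  interpret curve_place p q k B p by fact
  obtain p' where p': "p = Suc p'" using p_gt_2 by (cases p) auto
  have aB: "a \<in> B" using root_integral assms by simp
  \<comment> \<open>All factors of \<open>G (b + 1)\<close> and \<open>G b\<close> agree except for
    \<open>b + 1\<close> and \<open>b - (p - 1)\<close>, which differ by \<open>p\<close>.\<close>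
  have step: "G (b + 1) - G b \<in> max_ideal B" if "b \<in> B" for b :: qbar
  proof -
    have 1: "G (b + 1) = (b + 1) * (\<Prod>i<p'. b - of_nat i)"
    proof -
      have "G (b + 1) = (\<Prod>i<Suc p'. b + 1 - of_nat i)" by (simp only: G_def flip: p')
      thus ?thesis by (subst (asm) prod.lessThan_Suc_shift) simp
    qed
    have 2: "G b = (\<Prod>i<p'. b - of_nat i) * (b - of_nat p')"
    proof -
      have "G b = (\<Prod>i<Suc p'. b - of_nat i)" by (simp only: G_def flip: p')
      thus ?thesis by simp
    qed
    have "G (b + 1) - G b = (\<Prod>i<p'. b - of_nat i) * of_nat p"
      unfolding 1 2 by (simp add: algebra_simps p')
    also have "\<dots> \<in> max_ideal B" using that by (intro B.max_ideal_mult' B.l_in B.prod_closed) auto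
    finally show ?thesis .
  qed
  have FKa: "poly FK (a + of_nat i) \<in> max_ideal B" for i
  proof (induction i)
    case 0
    thus ?case using assms(2) by (simp add: roots_def)
  next
    case (Suc i)
    have "poly FK (a + of_nat (Suc i)) = poly FK (a + of_nat i) + (G (a + of_nat i + 1) - G (a + of_nat i))"
      by (simp add: poly_FK algebra_simps)
    also have "\<dots> \<in> max_ideal B" using aB by (intro B.max_ideal_add Suc step) auto
    finally show ?case .
  qed
  have inc: "(a + of_nat j) - (a + of_nat i) \<notin> max_ideal B" if "i < j" "j < p" for i j
  proof -
    have "\<not> int p dvd int (j - i)" using that by (auto dest: zdvd_imp_le)
    thus ?thesis using B.of_int_max_ideal_iff[of "int (j - i)"] that by (simp add: of_nat_diff)
  qed
  note * = reduction_of_roots[of "\<lambda>i. a + of_nat i", OF _ FKa inc]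
  show "card roots = p" using *(1) aB by auto
  show "\<exists>f. bij_betw f {..<p} roots \<and> (\<forall>i<p. f i - (a + of_nat i) \<in> max_ideal B)"
    using *(2) aB by auto
qed

lemma roots_nonempty: "roots \<noteq> {}"
  using alg_closed_imp_poly_has_root[of FK] degree_FK p_gt_2 by (auto simp: roots_def)

text \<open>Separability of \<open>F\<close> is inherited from its reduction at any place above
  \<open>p\<close>.\<close>

lemma card_roots: "card roots = p"
  using padic_place padic_roots(1) roots_nonempty by (metis ex_in_conv)

lemma FK_eq: "FK = (\<Prod>a\<in>roots. [:- a, 1:])"
proof -
  obtain A where A: "size A = p" "FK = (\<Prod>a\<in>#A. [:- a, 1:])" "set_mset A = roots"
    using FK_factorization .
  have "mset_set roots \<subseteq># A" unfolding A(3)[symmetric] by (rule mset_set_set_mset_msubset)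
  moreover have "size (mset_set roots) = size A" using A(1) card_roots by simp
  ultimately have "A = mset_set roots"
    by (metis mset_subset_size nat_neq_iff subset_mset.le_imp_less_or_eq)
  thus ?thesis using A by (simp add: prod_unfold_prod_mset)
qed

text \<open>Modulo \<open>p\<close> the product \<open>G\<close> vanishes on the prime field, so a
  root of \<open>F\<close> reducing there would force \<open>p\<close> to divide
  \<open>k ^ q\<close>.\<close>

lemma root_not_near_int:
  assumes "curve_place p q k B p" "a \<in> roots"
  shows "a - of_int n \<notin> max_ideal B"
proof
  interpret curve_place p q k B p by fact
  assume n: "a - of_int n \<in> max_ideal B"
  define i where "i = nat (n mod int p)"
  have i: "i < p" "int p dvd n - int i" using p_gt_2
    by (auto simp: i_def nat_less_iff simp flip: mod_eq_dvd_iff)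
  have "of_int (n - int i) \<in> max_ideal B" using i(2) B.of_int_max_ideal_iff by blast
  from B.max_ideal_add[OF n this] have "a - of_nat i \<in> max_ideal B" by simp
  moreover have "(\<Prod>j\<in>{..<p} - {i}. a - of_nat j) \<in> B"
    using root_integral[OF assms(2)] by (intro B.prod_closed) auto
  ultimately have "(a - of_nat i) * (\<Prod>j\<in>{..<p} - {i}. a - of_nat j) \<in> max_ideal B" by blast
  also have "(a - of_nat i) * (\<Prod>j\<in>{..<p} - {i}. a - of_nat j) = G a"
    unfolding G_def using i(1) by (subst prod.remove[of _ i]) auto
  also have "G a = of_int (- (k ^ q))" using assms(2) by (simp add: roots_def poly_FK add_eq_0_iff2)
  finally have "int p dvd k ^ q" using B.of_int_max_ideal_iff[of "- (k ^ q)"] by simp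
  hence "int p dvd k" using prime_p prime_dvd_power by (metis prime_nat_int_transfer)
  thus False using k_p by simp
qed

lemma sum_roots_coeff:
  "Polynomial.coeff (\<Prod>a\<in>#A. [:- a, 1 :: 'a::idom:]) (size A) = 1 \<and>
   Polynomial.degree (\<Prod>a\<in>#A. [:- a, 1 :: 'a::idom:]) = size A \<and>
   (A \<noteq> {#} \<longrightarrow> Polynomial.coeff (\<Prod>a\<in>#A. [:- a, 1:]) (size A - 1) = - sum_mset A)"
proof (induction A)
  case (add x A)
  define P where "P = (\<Prod>a\<in>#A. [:- a, 1 :: 'a:])"
  have P: "Polynomial.coeff P (size A) = 1" "Polynomial.degree P = size A"
    "A \<noteq> {#} \<Longrightarrow> Polynomial.coeff P (size A - 1) = - sum_mset A" using add by (auto simp: P_def)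
  have "Polynomial.degree ([:- x, 1:] * P) = Suc (size A)"
    using P by (subst degree_mult_eq) auto
  moreover have "Polynomial.coeff ([:- x, 1:] * P) (Suc (size A)) = 1"
    using P by (simp add: coeff_eq_0)
  moreover have "Polynomial.coeff ([:- x, 1:] * P) (size A) = - x - sum_mset A"
  proof (cases "A = {#}")
    case False
    then obtain n where "size A = Suc n" by (cases "size A") auto
    thus ?thesis using P False by simp
  qed (simp add: P_def)
  ultimately show ?case by (simp add: P_def)
qed auto

lemma of_rat_qbar: "of_rat r = (to_ac r :: qbar)"
  by (cases r) (simp add: Fract_of_int_quotient of_rat_divide)

lemma map_poly_F: "map_poly to_ac F = FK"
proof -
  interpret to_ac: field_embedding "to_ac :: rat \<Rightarrow> qbar" by unfold_locales auto
  show ?thesis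
    by (simp add: F_def FK_def to_ac.map_poly_hom_add to_ac.map_poly_hom_prod map_poly_pCons)
qed

text \<open>The roots of a factor of degree \<open>d\<close> of \<open>F\<close> sum up to \<open>d a + n\<close> modulo \<open>p\<close>, where \<open>a\<close> is one of
  them and \<open>n\<close> is an integer; if the factor is rational and \<open>0 < d < p\<close>, then \<open>a\<close> reduces to
  the prime field.\<close>

lemma rational_poly_vanishes_on_roots:
  assumes "a \<in> roots" "b \<in> roots" "poly (map_poly to_ac P) a = 0"
  shows "poly (map_poly to_ac (P :: rat poly)) b = 0"
proof (cases "P = 0")
  case False
  interpret to_ac: field_embedding "to_ac :: rat \<Rightarrow> qbar" by unfold_locales auto
  \<comment> \<open>A minimal polynomial \<open>M\<close> of \<open>a\<close> divides
    \<open>F\<close>. If its degree is \<open>p\<close>, it has all roots of \<open>F\<close>; a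
    smaller degree will be contradictory.\<close>
  define A where "A M \<longleftrightarrow> M \<noteq> 0 \<and> poly (map_poly to_ac M) a = 0" for M :: "rat poly"
  have "A P" using False assms by (simp add: A_def)
  then obtain M where "A M" and min: "\<And>M'. A M' \<Longrightarrow> Polynomial.degree M \<le> Polynomial.degree M'"
    using ex_has_least_nat[of A P Polynomial.degree] by blast
  hence M: "M \<noteq> 0" "poly (map_poly to_ac M) a = 0" by (auto simp: A_def)
  have dvd: "M dvd N" if "poly (map_poly to_ac N) a = 0" for N
  proof (rule ccontr)
    assume "\<not> M dvd N"
    hence "N mod M \<noteq> 0" by (simp add: dvd_eq_mod_eq_0)
    have "poly (map_poly to_ac (N div M * M + N mod M)) a = 0" using that by simp
    hence "poly (map_poly to_ac (N mod M)) a = 0"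
      using M(2) by (simp only: to_ac.map_poly_hom_add to_ac.map_poly_hom_mult poly_add poly_mult) simp
    hence "A (N mod M)" using \<open>N mod M \<noteq> 0\<close> by (simp add: A_def)
    from min[OF this] show False using degree_mod_less[OF M(1), of N] \<open>N mod M \<noteq> 0\<close> by auto
  qed
  have F_map: "map_poly to_ac F = FK" by (rule map_poly_F)
  have "M dvd F" using assms(1) by (intro dvd) (simp add: F_map roots_def)
  then obtain C where C: "F = M * C" by auto
  have C0: "C \<noteq> 0" using C degree_F p_gt_2 by auto
  have deg: "p = Polynomial.degree M + Polynomial.degree C"
    using C M(1) C0 degree_F by (simp add: degree_mult_eq)
  define d where "d = Polynomial.degree M"
  have M_b: "poly (map_poly to_ac M) b = 0"
  proof (cases "d = p")
    case True
    then obtain c where c: "C = [:c:]" "c \<noteq> 0" using deg C0 by (auto simp: d_def elim: degree_eq_zeroE)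
    hence "FK = map_poly to_ac M * [:to_ac c:]"
      unfolding F_map[symmetric] C to_ac.map_poly_hom_mult c(1) by (simp only: map_poly_pCons to_ac_0 map_poly_0)
    hence "poly FK b = poly (map_poly to_ac M) b * to_ac c" by simp
    thus ?thesis using assms(2) \<open>c \<noteq> 0\<close> by (simp add: roots_def)
  next
    case False
    define M' where "M' = map_poly to_ac M"
    have M'0: "M' \<noteq> 0" using M(1) by (simp add: M'_def map_poly_eq_0_iff)
    have degM': "Polynomial.degree M' = d" by (simp add: M'_def d_def to_ac.degree_map_poly_hom)
    obtain S where S: "size S = d" "M' = Polynomial.smult (Polynomial.lead_coeff M') (\<Prod>x\<in>#S. [:-x, 1:])"
      using alg_closed_imp_factorization[OF M'0] degM' by auto
    have M'_root: "poly M' x = 0 \<longleftrightarrow> x \<in># S" for x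
      using M'0 by (subst S(2)) (auto simp: poly_prod_mset prod_mset_zero_iff)
    have "a \<in># S" using M(2) M'_root by (simp add: M'_def)
    hence d: "d > 0" "S \<noteq> {#}" using S(1) by (auto intro!: Nat.gr0I)
    have S_roots: "x \<in> roots" if "x \<in># S" for x
      using M'_root[of x] that C by (simp add: roots_def M'_def F_map[symmetric] to_ac.map_poly_hom_mult)
    have "Polynomial.coeff M' (d - 1) = Polynomial.lead_coeff M' * (- sum_mset S)"
      using sum_roots_coeff[of S] S(1) d by (subst S(2)) simp
    hence "sum_mset S = to_ac (- Polynomial.coeff M (d - 1) / Polynomial.lead_coeff M)"
      using M'0 degM' M(1) leading_coeff_0_iff[of M] by (simp add: M'_def coeff_map_poly to_ac.degree_map_poly_hom field_simps)
    then obtain r where r: "sum_mset S = of_rat r" by (metis of_rat_qbar)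
    obtain B where pl: "curve_place p q k B p" using padic_place .
    interpret curve_place p q k B p by fact
    obtain f where f: "bij_betw f {..<p} roots" "\<And>i. i < p \<Longrightarrow> f i - (a + of_nat i) \<in> max_ideal B"
      using padic_roots(2)[OF pl assms(1)] by auto
    have near: "\<exists>n::int. x - (a + of_int n) \<in> max_ideal B" if x: "x \<in> roots" for x
    proof -
      obtain i where "i < p" "x = f i" using f(1) x by (auto simp: bij_betw_def)
      thus ?thesis using f(2)[of i] by (intro exI[of _ "int i"]) auto
    qed
    have "\<exists>n::int. sum_mset T - (of_nat (size T) * a + of_int n) \<in> max_ideal B"
      if "\<And>x. x \<in># T \<Longrightarrow> x \<in> roots" for T
      using that
    proof (induction T)
      case (add x T)
      then obtain n where n: "sum_mset T - (of_nat (size T) * a + of_int n) \<in> max_ideal B" by auto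
      obtain m where "x - (a + of_int m) \<in> max_ideal B" using near[of x] add by auto
      from B.max_ideal_add[OF n this]
      have "sum_mset (add_mset x T) - (of_nat (size (add_mset x T)) * a + of_int (n + m)) \<in> max_ideal B"
        by (simp add: algebra_simps)
      thus ?case by blast
    qed (auto intro: exI[of _ 0])
    from this[of S] S_roots obtain n where n: "sum_mset S - (of_nat d * a + of_int n) \<in> max_ideal B"
      using S(1) by auto
    \<comment> \<open>The sum of the roots of \<open>M\<close> is rational and integral, hence
      congruent to an integer. Since \<open>d\<close> is invertible modulo \<open>p\<close>, the
      root \<open>a\<close> itself is then congruent to an integer.\<close>
    have "sum_mset S \<in> B"
      using S_roots root_integral by (induction S) auto
    then obtain n' where "sum_mset S - of_int n' \<in> max_ideal B"
      using B.of_rat_congruent_int[of r] r by auto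
    from B.max_ideal_diff[OF this n] have da: "of_nat d * a - of_int (n' - n) \<in> max_ideal B"
      by (simp add: algebra_simps)
    have "d < p" using False deg d_def by simp
    hence "coprime (int d) (int p)" using d(1) prime_p
      by (metis coprime_commute coprime_int_iff dvd_imp_le not_le prime_imp_coprime)
    then obtain u v where uv: "u * int d + v * int p = 1" using bezout_int[of "int d" "int p"] by auto
    have "of_int u * (of_nat d * a - of_int (n' - n)) + of_int v * a * of_nat p \<in> max_ideal B"
      using root_integral[OF assms(1)] by (intro B.max_ideal_add B.max_ideal_mult' da B.l_in) auto
    also have "of_int u * (of_nat d * a - of_int (n' - n)) + of_int v * a * of_nat p =
      of_int (u * int d + v * int p) * a - of_int (u * (n' - n))" by (simp add: algebra_simps)
    finally have "a - of_int (u * (n' - n)) \<in> max_ideal B" using uv by simp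
    thus ?thesis using root_not_near_int[OF pl assms(1)] by blast
  qed
  obtain D where "P = M * D" using dvd[OF assms(3)] by auto
  thus ?thesis using M_b by (simp add: to_ac.map_poly_hom_mult)
qed auto

end

section \<open>Automorphisms of the function field\<close>

lemma of_rat_ambient: "ff_const (to_ac r) = of_rat r"
  by (cases r) (simp add: Fract_of_int_quotient of_rat_divide)

text \<open>Constants are algebraic over the rationals, and the ambient field is algebraic over
  K(x). So a maximal partial embedding is defined everywhere once it is defined at
  \<open>x\<close>.\<close>

lemma full_domain:
  fixes G :: "(ambient \<times> ambient) set"
  assumes "partial_embedding_max G" and x: "ff_x \<in> Domain G"
  shows "Domain G = UNIV"
proof -
  interpret partial_embedding_max G by fact
  interpret D: subfield_set "Domain G"
  proof
    show "1 \<in> Domain G" using one by blast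
    show "a - b \<in> Domain G" "a * b \<in> Domain G" if "a \<in> Domain G" "b \<in> Domain G" for a b
      using that diff mult by (meson Domain.simps)+
    show "inverse a \<in> Domain G" if "a \<in> Domain G" for a
      using that inverse_mem by (meson Domain.simps)
  qed
  have const: "ff_const c \<in> Domain G" for c
  proof -
    obtain P :: "rat poly" where P: "P \<noteq> 0" "poly (map_poly to_ac P) c = 0"
      using alg_closure_algebraic .
    define P' where "P' = map_poly ff_const (map_poly to_ac P)"
    show ?thesis
    proof (rule algebraic_mem)
      show "P' \<noteq> 0" using P(1) by (simp add: P'_def map_poly_eq_0_iff)
      show "poly P' (ff_const c) = 0"
        using ff_const.hom_poly[of "map_poly to_ac P" c] P(2) by (simp add: P'_def)
      have "of_rat r \<in> Domain G" for r
        by (cases r) (simp add: Fract_of_int_quotient of_rat_divide D.divide_closed)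
      thus "P' \<in> coeffs_in (Domain G)"
        by (auto simp: P'_def coeffs_in_def coeff_map_poly of_rat_ambient)
    qed
  qed
  have eval: "eval_x P \<in> Domain G" for P
    unfolding eval_x_conv poly_altdef
    by (intro D.sum_closed D.mult_closed D.power_closed x) (simp add: coeff_map_poly const)
  have rat: "r \<in> Domain G" if "r \<in> rat_funs" for r
    using rat_funs_fraction[OF that] eval D.divide_closed by metis
  have "z \<in> Domain G" for z
  proof -
    obtain P where P: "P \<noteq> 0" "poly (map_poly to_ac P) z = 0"
      using alg_closure_algebraic .
    show ?thesis
      by (rule algebraic_mem[OF _ _ P(2)])
        (use P rat in \<open>auto simp: coeffs_in_def coeff_map_poly rat_funs_def map_poly_eq_0_iff\<close>)
  qed
  thus ?thesis by auto
qed

lemma extend_to_ambient: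
  fixes G :: "(ambient \<times> ambient) set"
  assumes "partial_embedding G" "(ff_x, b) \<in> G"
  obtains g where "field_embedding g" "\<And>a b. (a, b) \<in> G \<Longrightarrow> g a = b"
proof -
  obtain M where M: "partial_embedding M" "G \<subseteq> M" "\<And>M'. partial_embedding M' \<Longrightarrow> M \<subseteq> M' \<Longrightarrow> M' = M"
    using partial_embedding_max_exists[OF assms(1)] by blast
  interpret partial_embedding_max M
    using M by (simp add: partial_embedding_max_def partial_embedding_max_axioms_def)
  have "Domain M = UNIV" using M(2) assms(2) by (intro full_domain partial_embedding_max_axioms) auto
  then obtain g where "field_embedding g" "\<And>a b. (a, b) \<in> M \<Longrightarrow> g a = b" using embedding_exists by blast
  thus ?thesis using that M(2) by blast
qed

lemma UNIV_valuation_ring: "valuation_ring UNIV (UNIV :: 'a::field set)"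
  by unfold_locales auto

lemma max_ideal_UNIV [simp]: "max_ideal (UNIV :: 'a::field set) = {0}"
  and val_units_UNIV [simp]: "val_units (UNIV :: 'a::field set) = {u. u \<noteq> 0}"
  by (auto simp: max_ideal_def val_units_def)

context curve
begin

section \<open>The function \<open>Y\<close>, roots of unity and the span of the powers of
  \<open>Y\<close>\<close>

definition Y :: ambient where "Y = ff_y q F"

lemma Y_power: "Y ^ q = eval_x FK"
  using ff_y_power[OF q_gt_0, of F] by (simp add: Y_def eval_x_def map_poly_F)

lemma FK_rat_fun: "eval_x FK = rat_fun 1 roots (\<lambda>_. 1)"
  unfolding FK_eq eval_x_prod eval_x_linear rat_fun_def by simp

lemma Y_nonzero [simp]: "Y \<noteq> 0"
proof
  assume "Y = 0"
  hence "eval_x FK = 0" using Y_power by (simp flip: Y_power)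
  thus False by simp
qed

text \<open>As \<open>q\<close> is prime, every nontrivial \<open>q\<close>-th root of unity is
  primitive.\<close>

definition zeta :: qbar where "zeta = (SOME z. z ^ q = 1 \<and> z \<noteq> 1)"

lemma zeta: "zeta ^ q = 1" "zeta \<noteq> 1"
proof -
  define P :: "qbar poly" where "P = (\<Sum>i<q. Polynomial.monom 1 i)"
  have "Polynomial.coeff P (q - 1) = 1" using q_gt_0 by (simp add: P_def Polynomial.coeff_sum)
  hence "Polynomial.degree P \<ge> q - 1" by (intro le_degree) auto
  hence "Polynomial.degree P > 0" using q_gt_1 by simp
  then obtain z where "poly P z = 0" using alg_closed_imp_poly_has_root by blast
  hence z: "(\<Sum>i<q. z ^ i) = 0" by (simp add: P_def poly_sum poly_monom)
  have "(z - 1) * (\<Sum>i<q. z ^ i) = z ^ q - 1" by (simp add: power_diff_1_eq)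
  hence "z ^ q = 1" using z by simp
  moreover have "z \<noteq> 1" using z q_gt_1 by auto
  ultimately have "\<exists>z::qbar. z ^ q = 1 \<and> z \<noteq> 1" by blast
  from someI_ex[OF this] show "zeta ^ q = 1" "zeta \<noteq> 1" by (simp_all add: zeta_def)
qed

lemma zeta_nonzero [simp]: "zeta \<noteq> 0"
proof
  assume "zeta = 0"
  thus False using zeta(1) q_gt_0 by (simp add: power_0_left)
qed

lemma zeta_power_eq_1_iff: "zeta ^ n = 1 \<longleftrightarrow> q dvd n"
proof
  assume "q dvd n"
  thus "zeta ^ n = 1" using zeta(1) by (auto simp: power_mult)
next
  assume n: "zeta ^ n = 1"
  show "q dvd n"
  proof (rule ccontr)
    assume "\<not> q dvd n"
    hence "coprime (int q) (int n)" using prime_q by (simp add: prime_imp_coprime)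
    then obtain u v where uv: "u * int q + v * int n = 1" using bezout_int[of "int q" "int n"] by auto
    have "zeta = zeta powi (int q * u + int n * v)" using uv by (simp add: mult.commute)
    also have "\<dots> = (zeta ^ q) powi u * (zeta ^ n) powi v"
      by (simp add: power_int_add power_int_mult)
    finally show False using zeta n by simp
  qed
qed

lemma zeta_powi_eq_1_iff: "zeta powi n = 1 \<longleftrightarrow> int q dvd n"
proof (cases n rule: int_cases2)
  case (nonneg m)
  thus ?thesis using zeta_power_eq_1_iff[of m] by simp
next
  case (nonpos m)
  thus ?thesis using zeta_power_eq_1_iff[of m] by (simp add: power_int_minus)
qed

lemma sum_zeta_powi: "(\<Sum>s<q. zeta powi (int s * n)) = (if int q dvd n then of_nat q else 0)"
proof (cases "int q dvd n")
  case True
  hence "zeta powi (int s * n) = 1" for s by (simp add: zeta_powi_eq_1_iff)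
  thus ?thesis using True by simp
next
  case False
  define w where "w = zeta powi n"
  have w: "w \<noteq> 1" "w ^ q = 1" using False zeta_powi_eq_1_iff zeta_powi_eq_1_iff[of "n * int q"]
    by (auto simp: w_def power_int_mult)
  have "zeta powi (int s * n) = w ^ s" for s
    by (simp add: w_def power_int_mult mult.commute)
  hence "(w - 1) * (\<Sum>s<q. zeta powi (int s * n)) = w ^ q - 1" by (simp add: power_diff_1_eq)
  thus ?thesis using w False by simp
qed

lemma root_of_unity:
  fixes w :: ambient
  assumes "w ^ q = 1"
  obtains e where "e < q" "w = ff_const zeta ^ e"
proof -
  define P :: "ambient poly" where "P = Polynomial.monom 1 q + [:- 1:]"
  have deg: "Polynomial.degree P = q"
    unfolding P_def using q_gt_0 by (subst degree_add_eq_left) (auto simp: degree_monom_eq)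
  hence P0: "P \<noteq> 0" using q_gt_0 by (metis degree_0 less_irrefl)
  define E where "E = (\<lambda>e. ff_const zeta ^ e) ` {..<q}"
  have "inj_on (\<lambda>e. ff_const zeta ^ e) {..<q}"
  proof (rule linorder_inj_onI)
    fix i j assume ij: "i < j" "i \<in> {..<q}" "j \<in> {..<q}"
    show "ff_const zeta ^ i \<noteq> ff_const zeta ^ j"
    proof
      assume "ff_const zeta ^ i = ff_const zeta ^ j"
      hence "zeta ^ i = zeta ^ j" by (simp flip: ff_const.hom_power)
      also have "zeta ^ j = zeta ^ i * zeta ^ (j - i)" using ij by (simp flip: power_add)
      finally have "zeta ^ (j - i) = 1" by simp
      thus False using ij zeta_power_eq_1_iff[of "j - i"] by (auto dest: dvd_imp_le)
    qed
  qed auto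
  hence "card E = q" by (simp add: E_def card_image)
  moreover have "E \<subseteq> {w. poly P w = 0}"
  proof
    fix w assume "w \<in> E"
    then obtain e where "w = ff_const zeta ^ e" by (auto simp: E_def)
    hence "w ^ q = ff_const ((zeta ^ q) ^ e)" by (simp flip: power_mult add: mult.commute)
    thus "w \<in> {w. poly P w = 0}" using zeta by (simp add: P_def poly_monom)
  qed
  moreover have "finite {w. poly P w = 0}" "card {w. poly P w = 0} \<le> q"
    using poly_roots_finite[OF P0] card_poly_roots_bound[OF P0] deg by auto
  ultimately have "E = {w. poly P w = 0}" by (intro card_seteq) auto
  thus ?thesis using that assms by (auto simp: E_def P_def poly_monom)
qed

text \<open>The function field K(x, Y), described as a span in order to have coefficients at hand.
  Closure under products and inverses follows later, from the equation \<open>Y ^ q = F\<close> and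
  from the norm.\<close>

definition L :: "ambient set"
  where "L = {\<Sum>j<q. r j * Y ^ j | r. \<forall>j. r j \<in> rat_funs}"

lemma L_I: "(\<And>j. r j \<in> rat_funs) \<Longrightarrow> (\<Sum>j<q. r j * Y ^ j) \<in> L"
  unfolding L_def by blast

end

text \<open>A place where \<open>F\<close> has a value prime to \<open>q\<close> (with respect to \<open>z\<close>); then the summands of
  \<open>\<Sum>j<q. r j * Y ^ j\<close> have pairwise distinct values.\<close>

locale ramified_place = curve p q k + gauss_valuation L' V B z
  for p q k L' V B z +
  fixes e :: int
  assumes Y_in: "Y \<in> L'" and Y_val: "val_eq V (Y ^ q) (z powi e)" and coprime_e: "coprime e (int q)"
    and rat_val: "\<And>r. r \<in> rat_funs \<Longrightarrow> r \<noteq> 0 \<Longrightarrow> \<exists>c n. c \<noteq> 0 \<and> val_eq V r (ff_const c * z powi n)"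
begin

text \<open>The value of \<open>Y\<close> itself need not be that of some
  \<open>c * z powi n\<close>. The value of \<open>Y ^ q\<close> is, so summands are compared
  through their \<open>q\<close>-th powers.\<close>

lemma term_val:
  assumes "val_eq V r (ff_const c * z powi n)"
  shows "val_eq V ((r * Y ^ j) ^ q) (ff_const (c ^ q) * z powi (int q * n + e * int j))"
proof -
  have "val_eq V (r ^ q * (Y ^ q) ^ j) ((ff_const c * z powi n) ^ q * (z powi e) ^ j)"
    by (intro val_eq_mult val_eq_power assms Y_val)
  also have "r ^ q * (Y ^ q) ^ j = (r * Y ^ j) ^ q"
  proof -
    have "(Y ^ q) ^ j = (Y ^ j) ^ q" by (metis power_mult mult.commute)
    thus ?thesis by (simp only: power_mult_distrib)
  qed
  also have "(ff_const c * z powi n) ^ q * (z powi e) ^ j = ff_const (c ^ q) * z powi (int q * n + e * int j)"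
  proof -
    have "(z powi m) ^ i = z powi (m * int i)" for m i by (metis power_int_mult power_int_of_nat)
    thus ?thesis
      using z_nonzero by (simp only: power_mult_distrib power_int_add ff_const.hom_power mult.assoc mult.commute[of "int q"] simp_thms)
  qed
  finally show ?thesis .
qed

lemma exponent_inj:
  assumes "int q * n + e * int i = int q * m + e * int j" "i < q" "j < q"
  shows "i = j"
proof -
  have "e * (int i - int j) = int q * (m - n)" using assms(1) by (simp add: algebra_simps)
  hence "int q dvd e * (int i - int j)" by simp
  hence "int q dvd int i - int j"
    using coprime_e by (simp add: coprime_commute coprime_dvd_mult_right_iff)
  hence "\<bar>int i - int j\<bar> \<ge> int q \<or> int i - int j = 0"
    using dvd_imp_le_int[of "int i - int j" "int q"] by auto
  thus ?thesis using assms(2,3) by auto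
qed

lemma terms_inequivalent:
  assumes "r \<in> rat_funs" "r \<noteq> 0" "s \<in> rat_funs" "s \<noteq> 0" "i < q" "j < q"
    and "val_eq V (r * Y ^ i) (s * Y ^ j)"
  shows "i = j"
proof -
  obtain c n where c: "c \<noteq> 0" "val_eq V r (ff_const c * z powi n)" using rat_val assms by blast
  obtain d m where d: "d \<noteq> 0" "val_eq V s (ff_const d * z powi m)" using rat_val assms by blast
  have "val_eq V (ff_const (c ^ q) * z powi (int q * n + e * int i)) ((r * Y ^ i) ^ q)"
    using val_eq_sym term_val c by blast
  also have "val_eq V ((r * Y ^ i) ^ q) ((s * Y ^ j) ^ q)" by (intro val_eq_power assms)
  also have "val_eq V ((s * Y ^ j) ^ q) (ff_const (d ^ q) * z powi (int q * m + e * int j))"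
    using term_val d by blast
  finally have "int q * n + e * int i = int q * m + e * int j"
    by (rule const_times_z_eq(2)) (use c d in auto)
  thus ?thesis using exponent_inj assms by blast
qed

definition dominant :: "(nat \<Rightarrow> ambient) \<Rightarrow> nat \<Rightarrow> bool"
  where "dominant r i \<longleftrightarrow> i < q \<and> r i \<noteq> 0 \<and>
    (\<forall>j<q. j \<noteq> i \<longrightarrow> r j * Y ^ j / (r i * Y ^ i) \<in> max_ideal V)"

lemma ex_dominant:
  assumes "\<And>j. r j \<in> rat_funs" "j < q" "r j \<noteq> 0"
  shows "\<exists>i. dominant r i"
proof -
  define J where "J = {j. j < q \<and> r j \<noteq> 0}"
  have "\<exists>i\<in>J. \<forall>j\<in>J - {i}. (r j * Y ^ j) / (r i * Y ^ i) \<in> max_ideal V"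
  proof (rule dominant_exists)
    show "r j * Y ^ j \<in> L'" for j :: nat
      using assms(1)[of j] rat_funs_subset Y_in by (intro L.mult_closed L.power_closed) auto
    show "\<not> val_eq V (r i * Y ^ i) (r j * Y ^ j)" if "i \<in> J" "j \<in> J" "i \<noteq> j" for i j
      using that terms_inequivalent[of "r i" "r j" i j] assms(1) by (auto simp: J_def)
  qed (use assms in \<open>auto simp: J_def\<close>)
  then obtain i where i: "i \<in> J" "\<forall>j\<in>J - {i}. (r j * Y ^ j) / (r i * Y ^ i) \<in> max_ideal V" by blast
  have "r j * Y ^ j / (r i * Y ^ i) \<in> max_ideal V" if "j < q" "j \<noteq> i" for j :: nat
    using i that by (cases "r j = 0") (auto simp: J_def)
  thus ?thesis using i(1) by (auto simp: dominant_def J_def)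
qed

lemma dominant_val_eq:
  assumes "dominant r i" "\<And>j. u j \<in> val_units V"
  shows "val_eq V (\<Sum>j<q. u j * (r j * Y ^ j)) (r i * Y ^ i)"
  using assms by (intro dominant_sum) (auto simp: dominant_def)

end

context curve
begin

text \<open>\<open>F\<close> is monic of degree \<open>p\<close> with integral roots, so
  \<open>Y ^ q\<close> has a pole of order \<open>p\<close> at infinity even after reduction, and
  \<open>p\<close> is prime to \<open>q\<close>.\<close>

lemma ramified_place_inf:
  assumes "gauss_valuation_inf L' V B (inverse ff_x)" "roots \<subseteq> B" "Y \<in> L'"
  shows "ramified_place p q k L' V B (inverse ff_x) (- int p)"
proof -
  interpret gauss_valuation_inf L' V B "inverse ff_x" by fact
  show ?thesis
  proof unfold_locales
    have "gauss_const B 1 roots (\<lambda>_. 1) = 1" using assms(2) by (auto simp: gauss_const_def const_part_def intro!: prod.neutral)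
    moreover have "roots \<inter> B = roots" using assms(2) by auto
    ultimately show "val_eq V (Y ^ q) (inverse ff_x powi - int p)"
      using rat_fun_val_eq_inf[of roots 1 "\<lambda>_. 1"] by (simp add: Y_power FK_rat_fun card_roots)
    show "coprime (- int p) (int q)" using coprime_pq by simp
    show "\<exists>c n. c \<noteq> 0 \<and> val_eq V r (ff_const c * inverse ff_x powi n)" if r: "r \<in> rat_funs" "r \<noteq> 0" for r
    proof -
      obtain c S n where "finite S" "c \<noteq> 0" "r = rat_fun c S n" using rat_fun_exists[OF r] .
      thus ?thesis using rat_fun_val_eq_inf[of S c n] gauss_const_nonzero[of S c B n] B.zero_closed by blast
    qed
  qed (fact assms(3))
qed

text \<open>The hypothesis \<open>one\<close> says that \<open>b\<close> reduces to a simple root of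
  the reduction of \<open>F\<close>, i.e. to a branch point.\<close>

lemma ramified_place_at:
  assumes "gauss_valuation_at L' V B (ff_x - ff_const b) b" "roots \<subseteq> B" "Y \<in> L'"
    and one: "card {a\<in>roots. a - b \<in> max_ideal B} = 1"
  shows "ramified_place p q k L' V B (ff_x - ff_const b) 1"
proof -
  interpret gauss_valuation_at L' V B "ff_x - ff_const b" b by fact
  show ?thesis
  proof unfold_locales
    have "gauss_const B 1 roots (\<lambda>_. 1) = 1" using assms(2) by (auto simp: gauss_const_def const_part_def intro!: prod.neutral)
    thus "val_eq V (Y ^ q) ((ff_x - ff_const b) powi 1)"
      using rat_fun_val_eq_at[of roots 1 "\<lambda>_. 1"] one by (simp add: Y_power FK_rat_fun)
    show "\<exists>c n. c \<noteq> 0 \<and> val_eq V r (ff_const c * (ff_x - ff_const b) powi n)" if r: "r \<in> rat_funs" "r \<noteq> 0" for r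
    proof -
      obtain c S n where "finite S" "c \<noteq> 0" "r = rat_fun c S n" using rat_fun_exists[OF r] .
      thus ?thesis using rat_fun_val_eq_at[of S c n] gauss_const_nonzero[of S c B n] B.zero_closed by blast
    qed
  qed (use assms(3) in auto)
qed

text \<open>At infinity the nonzero summands have pairwise different values and cannot cancel. In
  other words, \<open>Y ^ q - F\<close> is irreducible over K(x).\<close>

lemma Y_independent:
  assumes "\<And>j. r j \<in> rat_funs" "(\<Sum>j<q. r j * Y ^ j) = 0" "j < q"
  shows "r j = 0"
proof (rule ccontr)
  assume "r j \<noteq> 0"
  obtain V where "gauss_valuation_inf UNIV V UNIV (inverse ff_x)"
    using gauss_valuation_inf_exists[OF UNIV_valuation_ring] .
  then interpret ramified_place p q k UNIV V UNIV "inverse ff_x" "- int p"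
    by (rule ramified_place_inf) auto
  obtain i where i: "dominant r i" using ex_dominant[of r j] assms(1,3) \<open>r j \<noteq> 0\<close> by blast
  have "val_eq V (\<Sum>j<q. 1 * (r j * Y ^ j)) (r i * Y ^ i)" by (rule dominant_val_eq[OF i]) auto
  from val_eq_nonzero(1)[OF this] show False using assms(2) by simp
qed

lemma Y_independent_iff:
  assumes "\<And>j. r j \<in> rat_funs"
  shows "(\<Sum>j<q. r j * Y ^ j) = 0 \<longleftrightarrow> (\<forall>j<q. r j = 0)"
proof
  assume "(\<Sum>j<q. r j * Y ^ j) = 0"
  thus "\<forall>j<q. r j = 0" using Y_independent[of r] assms by blast
qed (intro sum.neutral, simp)

text \<open>Reduction modulo \<open>w ^ q = F\<close>, with exponents written as
  \<open>m * q + j\<close>, \<open>j < q\<close>. It is stated for an arbitrary root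
  \<open>w\<close> so that \<open>Y\<close> and \<open>zeta * Y\<close> can be compared.\<close>

lemma poly_regroup:
  fixes w :: ambient
  assumes "w ^ q = eval_x FK" "q * N > Polynomial.degree P"
  shows "poly P w = (\<Sum>j<q. (\<Sum>m<N. Polynomial.coeff P (m * q + j) * eval_x FK ^ m) * w ^ j)"
proof -
  have "poly P w = (\<Sum>i<N * q. Polynomial.coeff P i * w ^ i)"
    unfolding poly_altdef using assms(2)
    by (intro sum.mono_neutral_left) (auto simp: mult.commute intro: coeff_eq_0)
  also have "\<dots> = (\<Sum>m<N. \<Sum>i=m * q..<m * q + q. Polynomial.coeff P i * w ^ i)"
    by (rule sum.nat_group[symmetric])
  also have "\<dots> = (\<Sum>m<N. \<Sum>j<q. Polynomial.coeff P (m * q + j) * w ^ (m * q + j))"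
  proof (rule sum.cong[OF refl])
    fix m assume "m \<in> {..<N}"
    show "(\<Sum>i=m * q..<m * q + q. Polynomial.coeff P i * w ^ i) = (\<Sum>j<q. Polynomial.coeff P (m * q + j) * w ^ (m * q + j))"
      using sum.shift_bounds_nat_ivl[of "\<lambda>i. Polynomial.coeff P i * w ^ i" 0 "m * q" q]
      by (simp add: add.commute lessThan_atLeast0)
  qed
  also have "\<dots> = (\<Sum>m<N. \<Sum>j<q. Polynomial.coeff P (m * q + j) * eval_x FK ^ m * w ^ j)"
  proof -
    have "w ^ (m * q + j) = eval_x FK ^ m * w ^ j" for m j
      by (simp add: power_add mult.commute[of m] power_mult assms(1))
    thus ?thesis by (simp only: mult.assoc)
  qed
  also have "\<dots> = (\<Sum>j<q. (\<Sum>m<N. Polynomial.coeff P (m * q + j) * eval_x FK ^ m) * w ^ j)"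
    by (subst sum.swap) (simp add: sum_distrib_right)
  finally show ?thesis .
qed

text \<open>After regrouping, a polynomial over K(x) vanishes at \<open>Y\<close> iff all its
  coefficients do. At \<open>zeta * Y\<close> the coefficients are only multiplied by powers of
  \<open>zeta\<close>, so the condition is the same.\<close>

lemma tau_exists:
  obtains g where "field_embedding g" "\<And>r. r \<in> rat_funs \<Longrightarrow> g r = r" "g Y = ff_const zeta * Y"
proof -
  define G where "G = {(r, r) | r. r \<in> rat_funs}"
  interpret G: partial_embedding G
    by unfold_locales (auto simp: G_def)
  have cond: "poly P Y = 0 \<longleftrightarrow> poly Q (ff_const zeta * Y) = 0" if "G.poly_rel P Q" for P Q
  proof -
    have "(Polynomial.coeff P n, Polynomial.coeff Q n) \<in> G" for n using that by (simp add: G.poly_rel_def)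
    hence PQ: "P = Q" "\<And>n. Polynomial.coeff P n \<in> rat_funs"
      by (auto simp: G_def poly_eq_iff)
    define N where "N = Suc (Polynomial.degree P)"
    define S where "S j = (\<Sum>m<N. Polynomial.coeff P (m * q + j) * eval_x FK ^ m)" for j
    have N: "q * N > Polynomial.degree P"
      unfolding N_def using q_gt_0 by (metis Suc_le_eq le_trans mult_le_mono1 nat_mult_1 Suc_leI One_nat_def)
    have S: "S j \<in> rat_funs" for j unfolding S_def using PQ(2) by auto
    have z: "(ff_const zeta * Y) ^ q = eval_x FK"
      using zeta by (simp add: power_mult_distrib Y_power flip: ff_const.hom_power)
    have "poly P Y = (\<Sum>j<q. S j * Y ^ j)"
      unfolding S_def by (rule poly_regroup[OF Y_power N])
    hence 1: "poly P Y = 0 \<longleftrightarrow> (\<forall>j<q. S j = 0)"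
      by (simp only: Y_independent_iff[OF S])
    have "poly P (ff_const zeta * Y) = (\<Sum>j<q. S j * (ff_const zeta * Y) ^ j)"
      unfolding S_def by (rule poly_regroup[OF z N])
    hence "poly P (ff_const zeta * Y) = (\<Sum>j<q. (S j * ff_const zeta ^ j) * Y ^ j)"
      by (simp only: power_mult_distrib mult.assoc)
    moreover have S': "S j * ff_const zeta ^ j \<in> rat_funs" for j
      using S by (intro rat_funs.mult_closed rat_funs.power_closed) auto
    ultimately have 2: "poly P (ff_const zeta * Y) = 0 \<longleftrightarrow> (\<forall>j<q. S j = 0)"
      by (simp add: Y_independent_iff[OF S'])
    show ?thesis using 1 2 PQ(1) by simp
  qed
  define G1 where "G1 = G.adjoin Y (ff_const zeta * Y)"
  have G1: "partial_embedding G1" "G \<subseteq> G1" "(Y, ff_const zeta * Y) \<in> G1"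
    unfolding G1_def using G.adjoin_partial_embedding[OF cond] by blast+
  have rat: "(r, r) \<in> G1" if "r \<in> rat_funs" for r using that G1(2) by (auto simp: G_def)
  obtain g where "field_embedding g" "\<And>a b. (a, b) \<in> G1 \<Longrightarrow> g a = b"
    using extend_to_ambient[OF G1(1) rat[OF ff_x_in_rat_funs]] by blast
  thus ?thesis using that[of g] rat G1(3) by blast
qed

definition tau :: "ambient \<Rightarrow> ambient"
  where "tau = (SOME g. field_embedding g \<and> (\<forall>r\<in>rat_funs. g r = r) \<and> g Y = ff_const zeta * Y)"

lemma tau: "field_embedding tau" "r \<in> rat_funs \<Longrightarrow> tau r = r" "tau Y = ff_const zeta * Y"
proof -
  have "\<exists>g. field_embedding g \<and> (\<forall>r\<in>rat_funs. g r = r) \<and> g Y = ff_const zeta * Y"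
    using tau_exists by metis
  from someI_ex[OF this] show "field_embedding tau" "r \<in> rat_funs \<Longrightarrow> tau r = r" "tau Y = ff_const zeta * Y"
    by (auto simp: tau_def)
qed

sublocale tau: field_embedding tau by (fact tau(1))

sublocale tau_n: field_embedding "tau ^^ n" for n by (rule field_embedding_funpow[OF tau(1)])

lemma tau_n_rat [simp]: "r \<in> rat_funs \<Longrightarrow> (tau ^^ n) r = r"
  by (induction n) (auto simp: tau)

lemma tau_n_Y: "(tau ^^ n) Y = ff_const zeta ^ n * Y"
  by (induction n) (auto simp: tau)

lemma tau_n_sum:
  "(\<And>j. r j \<in> rat_funs) \<Longrightarrow> (tau ^^ n) (\<Sum>j<q. r j * Y ^ j) = (\<Sum>j<q. ff_const zeta ^ (n * j) * (r j * Y ^ j))"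
  by (simp add: tau_n.hom_sum tau_n_Y power_mult_distrib mult_ac flip: power_mult)

text \<open>Lifts of the Galois action on the constants that fix \<open>x\<close> and
  \<open>Y\<close>; fixing both is consistent since \<open>F\<close> has rational
  coefficients.\<close>

definition sigmas :: "(ambient \<Rightarrow> ambient) set"
  where "sigmas = {g. field_embedding g \<and> g ff_x = ff_x \<and> g Y = Y}"

text \<open>The embedding is prescribed at \<open>a\<close>, where irreducibility of
  \<open>F\<close> makes \<open>b\<close> an admissible image, then at \<open>x\<close>, and is
  finally extended to the ambient field.\<close>

lemma sigmas_transitive:
  assumes "a \<in> roots" "b \<in> roots"
  obtains g where "g \<in> sigmas" "g (ff_const a) = ff_const b"
proof -
  define G :: "(ambient \<times> ambient) set" where "G = {(of_rat r, of_rat r) | r. True}"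
  interpret G: partial_embedding G
  proof
    have "(of_rat 1, of_rat 1) \<in> G" unfolding G_def by blast
    thus "(1, 1) \<in> G" by simp
    fix a b c d :: ambient assume "(a, b) \<in> G"
    then obtain r where r: "a = of_rat r" "b = of_rat r" by (auto simp: G_def)
    thus "a = 0 \<longleftrightarrow> b = 0" by simp
    assume "(c, d) \<in> G"
    then obtain s where s: "c = of_rat s" "d = of_rat s" by (auto simp: G_def)
    have "(of_rat (r - s), of_rat (r - s)) \<in> G" "(of_rat (r * s), of_rat (r * s)) \<in> G" unfolding G_def by blast+
    thus "(a - c, b - d) \<in> G" "(a * c, b * d) \<in> G" by (simp_all add: r s of_rat_diff of_rat_mult)
  qed
  note vanish = rational_poly_vanishes_on_roots
  have cond: "poly P (ff_const a) = 0 \<longleftrightarrow> poly Q (ff_const b) = 0" if "G.poly_rel P Q" for P Q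
  proof -
    have "(Polynomial.coeff P n, Polynomial.coeff Q n) \<in> G" for n using that by (simp add: G.poly_rel_def)
    hence *: "\<exists>r. Polynomial.coeff P n = of_rat r \<and> Polynomial.coeff Q n = of_rat r" for n
      by (simp add: G_def)
    have PQ: "P = Q" by (rule poly_eqI) (metis *)
    have rat: "\<exists>r. Polynomial.coeff P n = of_rat r" for n using * by blast
    define f where "f t = (SOME r. t = (of_rat r :: ambient))" for t
    have f: "of_rat (f t) = t" if "\<exists>r. t = of_rat r" for t
      using someI_ex[OF that] by (simp add: f_def)
    have "f 0 = 0" using f[of 0] by (metis of_rat_0 of_rat_eq_0_iff)
    hence "map_poly ff_const (map_poly to_ac (map_poly f P)) = P"
      using rat f by (auto simp: poly_eq_iff coeff_map_poly of_rat_ambient)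
    then obtain R where R: "P = map_poly ff_const (map_poly to_ac R)" by metis
    have "poly P (ff_const c) = ff_const (poly (map_poly to_ac R) c)" for c
      unfolding R by (simp add: ff_const.hom_poly)
    thus ?thesis using vanish[OF assms] vanish[OF assms(2,1)] PQ by auto
  qed
  define G1 where "G1 = G.adjoin (ff_const a) (ff_const b)"
  have G1: "partial_embedding G1" "G \<subseteq> G1" "(ff_const a, ff_const b) \<in> G1"
    unfolding G1_def using G.adjoin_partial_embedding[OF cond] by blast+
  interpret G1: partial_embedding G1 by fact
  interpret K: subring_set "range ff_const"
  proof
    show "1 \<in> range ff_const" using ff_const.hom_one by (metis rangeI)
  qed (auto simp flip: ff_const.hom_diff ff_const.hom_mult)
  have G1_const: "u \<in> range ff_const \<and> v \<in> range ff_const" if "(u, v) \<in> G1" for u v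
  proof -
    have "poly P (ff_const c) \<in> range ff_const" if "\<And>n. Polynomial.coeff P n \<in> range ff_const" for P c
      unfolding poly_altdef using that by (intro K.sum_closed K.mult_closed K.power_closed) auto
    moreover have "of_rat r \<in> range ff_const" for r using of_rat_ambient by (metis rangeI)
    ultimately have *: "poly P (ff_const c) \<in> range ff_const" if "\<And>n. \<exists>r. Polynomial.coeff P n = of_rat r" for P c
      using that by metis
    obtain P Q where PQ: "u = poly P (ff_const a)" "v = poly Q (ff_const b)" "G.poly_rel P Q"
      using \<open>(u, v) \<in> G1\<close> unfolding G1_def G.adjoin_def by blast
    have "(Polynomial.coeff P n, Polynomial.coeff Q n) \<in> G" for n using PQ(3) by (simp add: G.poly_rel_def)
    hence "\<exists>r. Polynomial.coeff P n = of_rat r" "\<exists>r. Polynomial.coeff Q n = of_rat r" for n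
      unfolding G_def by blast+
    thus ?thesis using * PQ by blast
  qed
  have x0: "poly P ff_x = 0 \<longleftrightarrow> P = 0" if "\<And>n. Polynomial.coeff P n \<in> range ff_const" for P
  proof -
    define f where "f = inv_into UNIV ff_const"
    have f: "f (ff_const c) = c" for c unfolding f_def by (simp add: inj_def)
    have "map_poly ff_const (map_poly f P) = P"
    proof (rule poly_eqI)
      fix n
      have "f 0 = 0" using f[of 0] by simp
      thus "Polynomial.coeff (map_poly ff_const (map_poly f P)) n = Polynomial.coeff P n"
        using that[of n] f by (auto simp: coeff_map_poly)
    qed
    then obtain R where "P = map_poly ff_const R" by metis
    thus ?thesis using eval_x_conv[of R] by (metis eval_x_simps(6) map_poly_0 eval_x_simps(1) poly_0)
  qed
  have cond1: "poly P ff_x = 0 \<longleftrightarrow> poly Q ff_x = 0" if "G1.poly_rel P Q" for P Q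
  proof -
    have "(Polynomial.coeff P n, Polynomial.coeff Q n) \<in> G1" for n using that by (simp add: G1.poly_rel_def)
    hence "Polynomial.coeff P n \<in> range ff_const" "Polynomial.coeff Q n \<in> range ff_const" for n
      using G1_const by blast+
    thus ?thesis using x0 G1.poly_rel_eq_0_iff[OF that] by simp
  qed
  define G2 where "G2 = G1.adjoin ff_x ff_x"
  have G2: "partial_embedding G2" "G1 \<subseteq> G2" "(ff_x, ff_x) \<in> G2"
    unfolding G2_def using G1.adjoin_partial_embedding[OF cond1] by blast+
  obtain g where g: "field_embedding g" "\<And>u v. (u, v) \<in> G2 \<Longrightarrow> g u = v"
    using extend_to_ambient[OF G2(1,3)] by blast
  interpret g: field_embedding g by fact
  have gx: "g ff_x = ff_x" and ga: "g (ff_const a) = ff_const b" using g(2) G1(3) G2 by auto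
  have gFK: "g (eval_x FK) = eval_x FK"
  proof -
    have "eval_x FK = (\<Prod>i<p. ff_x - of_nat i) + of_int (k ^ q)"
      unfolding FK_def eval_x_simps eval_x_prod eval_x_linear by (simp add: ff_const_conv[symmetric])
    thus ?thesis by (simp add: g.hom_prod gx)
  qed
  \<comment> \<open>The extension need not fix \<open>Y\<close>, but \<open>g Y\<close> is again a
    \<open>q\<close>-th root of \<open>F\<close>. A power of \<open>tau\<close>, which fixes
    \<open>x\<close> and the constants, repairs this.\<close>
  have "(g Y / Y) ^ q = 1"
    using gFK by (simp add: power_divide Y_power flip: g.hom_power)
  then obtain e where e: "e < q" "g Y / Y = ff_const zeta ^ e" using root_of_unity by blast
  have "(tau ^^ (q - e)) (g Y) = Y"
  proof -
    have "g Y = ff_const zeta ^ e * Y" using e by (simp add: field_simps)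
    hence "(tau ^^ (q - e)) (g Y) = ff_const (zeta ^ (e + (q - e))) * Y"
      by (simp add: tau_n_Y power_add mult_ac rat_funs.power_closed)
    thus ?thesis using e zeta by simp
  qed
  hence "tau ^^ (q - e) \<circ> g \<in> sigmas"
    using field_embedding_comp[OF tau_n.field_embedding_axioms g(1)] gx by (simp add: sigmas_def)
  moreover have "(tau ^^ (q - e) \<circ> g) (ff_const a) = ff_const b" using ga by simp
  ultimately show ?thesis using that by blast
qed

end

section \<open>The function field and its affine places\<close>

lemma algebraic_over_const:
  assumes "P \<noteq> 0" "poly (map_poly ff_const P) z = 0"
  shows "z \<in> range ff_const"
proof -
  obtain A where A: "P = Polynomial.smult (Polynomial.lead_coeff P) (\<Prod>x\<in>#A. [:-x, 1:])"
    using alg_closed_imp_factorization[OF assms(1)] by blast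
  define c where "c = Polynomial.lead_coeff P"
  have "map_poly ff_const (Polynomial.smult c Q) = Polynomial.smult (ff_const c) (map_poly ff_const Q)" for c Q
    by (simp add: poly_eq_iff coeff_map_poly)
  moreover have "map_poly ff_const (\<Prod>x\<in>#A. [:-x, 1:]) = (\<Prod>x\<in>#A. [:- ff_const x, 1:])"
    by (induction A) (simp_all add: ff_const.map_poly_hom_mult map_poly_pCons del: mult_pCons_left)
  ultimately have "map_poly ff_const P = Polynomial.smult (ff_const c) (\<Prod>x\<in>#A. [:- ff_const x, 1:])"
    using A by (metis c_def)
  hence "ff_const c * (\<Prod>x\<in>#A. z - ff_const x) = 0"
    using assms(2) by (simp add: poly_prod_mset)
  thus ?thesis using assms(1) by (auto simp: c_def prod_mset_zero_iff)
qed

context curve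
begin

lemma L_alt: "L = {poly P Y | P. P \<in> coeffs_in rat_funs}"
proof safe
  fix f assume "f \<in> L"
  then obtain r where r: "f = (\<Sum>j<q. r j * Y ^ j)" "\<And>j. r j \<in> rat_funs" by (auto simp: L_def)
  define P where "P = (\<Sum>j<q. Polynomial.monom (r j) j)"
  have "f = poly P Y" by (simp add: P_def poly_sum poly_monom r(1))
  moreover have "P \<in> coeffs_in rat_funs"
    using r(2) by (auto simp: P_def coeffs_in_def Polynomial.coeff_sum coeff_monom intro!: rat_funs.sum_closed)
  ultimately show "\<exists>P. f = poly P Y \<and> P \<in> coeffs_in rat_funs" by blast
next
  fix P assume P: "P \<in> coeffs_in rat_funs"
  define N where "N = Suc (Polynomial.degree P)"
  have "q * N > Polynomial.degree P"
    using mult_le_mono1[of 1 q N] q_gt_0 by (simp add: N_def)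
  from poly_regroup[OF Y_power this] show "poly P Y \<in> L"
    using P by (auto simp: coeffs_in_def intro!: L_I)
qed

sublocale L: subring_set L
proof
  show "1 \<in> L" unfolding L_alt
    by (intro CollectI exI[of _ 1]) (auto simp: coeffs_in_def coeff_pCons one_pCons split: nat.splits)
  fix f g assume "f \<in> L" "g \<in> L"
  then obtain P Q where PQ: "f = poly P Y" "g = poly Q Y" "P \<in> coeffs_in rat_funs" "Q \<in> coeffs_in rat_funs"
    by (auto simp: L_alt)
  show "f - g \<in> L" unfolding L_alt using PQ
    by (intro CollectI exI[of _ "P - Q"]) (auto simp: coeffs_in_def rat_funs.diff_closed)
  show "f * g \<in> L" unfolding L_alt using PQ
    by (intro CollectI exI[of _ "P * Q"]) (auto simp: coeffs_in_def coeff_mult intro!: rat_funs.sum_closed rat_funs.mult_closed)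
qed

lemma rat_funs_subset_L: "rat_funs \<subseteq> L"
proof
  fix r assume "r \<in> rat_funs"
  thus "r \<in> L" unfolding L_alt
    by (intro CollectI exI[of _ "[:r:]"]) (auto simp: coeffs_in_def coeff_pCons split: nat.splits)
qed

lemma const_L [simp, intro]: "ff_const c \<in> L" and ff_x_L [simp, intro]: "ff_x \<in> L"
  using rat_funs_subset_L by auto

lemma Y_L [simp, intro]: "Y \<in> L"
  unfolding L_alt by (intro CollectI exI[of _ "[:0, 1:]"]) (auto simp: coeffs_in_def coeff_pCons split: nat.splits)

lemma embedding_L:
  assumes g: "field_embedding g" "\<And>r. r \<in> rat_funs \<Longrightarrow> g r \<in> rat_funs" "g Y \<in> L" and f: "f \<in> L"
  shows "g f \<in> L"
proof -
  interpret g: field_embedding g by fact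
  obtain r where r: "f = (\<Sum>j<q. r j * Y ^ j)" "\<And>j. r j \<in> rat_funs" using f by (auto simp: L_def)
  show ?thesis unfolding r(1) g.hom_sum
    using g r(2) rat_funs_subset_L by (intro L.sum_closed) (auto intro!: L.mult_closed L.power_closed)
qed

lemma tau_L: "f \<in> L \<Longrightarrow> (tau ^^ n) f \<in> L"
  by (rule embedding_L[OF tau_n.field_embedding_axioms]) (auto simp: tau_n_Y intro!: L.mult_closed L.power_closed)

lemma tau_q: "f \<in> L \<Longrightarrow> (tau ^^ q) f = f"
proof -
  assume "f \<in> L"
  then obtain r where r: "f = (\<Sum>j<q. r j * Y ^ j)" "\<And>j. r j \<in> rat_funs" by (auto simp: L_def)
  have "ff_const zeta ^ (q * j) = 1" for j
    using zeta by (simp add: power_mult flip: ff_const.hom_power)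
  thus ?thesis unfolding r(1) by (simp add: tau_n_sum r(2))
qed

text \<open>Orthogonality of characters: summing the conjugates with weights
  \<open>zeta powi (- s j)\<close> isolates one summand.\<close>

lemma component:
  assumes "\<And>j. r j \<in> rat_funs" "j < q"
  shows "(\<Sum>s<q. ff_const (zeta powi (- int (s * j))) * (tau ^^ s) (\<Sum>i<q. r i * Y ^ i)) = of_nat q * (r j * Y ^ j)"
proof -
  have "ff_const (zeta powi (- int (s * j))) * ff_const zeta ^ (s * i) = ff_const (zeta powi (int s * (int i - int j)))" for s i
  proof -
    have "int s * (int i - int j) = - int (s * j) + int (s * i)" by (simp add: algebra_simps)
    thus ?thesis by (simp only: power_int_add zeta_nonzero ff_const.hom_mult simp_thms power_int_of_nat ff_const.hom_power)
  qed
  hence "(\<Sum>s<q. ff_const (zeta powi (- int (s * j))) * (tau ^^ s) (\<Sum>i<q. r i * Y ^ i)) =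
    (\<Sum>s<q. \<Sum>i<q. ff_const (zeta powi (int s * (int i - int j))) * (r i * Y ^ i))"
    by (simp only: tau_n_sum[OF assms(1)] sum_distrib_left mult.assoc[symmetric])
  also have "\<dots> = (\<Sum>i<q. ff_const (\<Sum>s<q. zeta powi (int s * (int i - int j))) * (r i * Y ^ i))"
    by (subst sum.swap) (simp only: ff_const.hom_sum sum_distrib_right)
  also have "\<dots> = (\<Sum>i<q. if i = j then of_nat q * (r i * Y ^ i) else 0)"
  proof (rule sum.cong[OF refl])
    fix i assume i: "i \<in> {..<q}"
    have "int q dvd int i - int j \<longleftrightarrow> i = j"
    proof -
      have "\<bar>int i - int j\<bar> < int q" using i assms(2) by auto
      thus ?thesis using dvd_imp_le_int[of "int i - int j" "int q"] by auto
    qed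
    thus "ff_const (\<Sum>s<q. zeta powi (int s * (int i - int j))) * (r i * Y ^ i) =
        (if i = j then of_nat q * (r i * Y ^ i) else 0)"
      by (simp add: sum_zeta_powi)
  qed
  also have "\<dots> = of_nat q * (r j * Y ^ j)" using assms(2) by simp
  finally show ?thesis .
qed

lemma tau_fixed_rat:
  assumes "f \<in> L" "tau f = f"
  shows "f \<in> rat_funs"
proof -
  obtain r where r: "f = (\<Sum>j<q. r j * Y ^ j)" "\<And>j. r j \<in> rat_funs" using assms(1) by (auto simp: L_def)
  have "(tau ^^ s) f = f" for s by (induction s) (auto simp: assms(2))
  hence "of_nat q * f = of_nat q * r 0" using component[of r 0] r(2) q_gt_0 unfolding r(1)[symmetric] by simp
  thus ?thesis using r(2) q_gt_0 by simp
qed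

definition Norm :: "ambient \<Rightarrow> ambient"
  where "Norm f = (\<Prod>s<q. (tau ^^ s) f)"

lemma Norm_rat:
  assumes "f \<in> L"
  shows "Norm f \<in> rat_funs"
proof (rule tau_fixed_rat)
  show "Norm f \<in> L" unfolding Norm_def using assms tau_L by auto
  obtain q' where q': "q = Suc q'" using q_gt_0 by (cases q) auto
  have "tau (Norm f) = (\<Prod>s<q. (tau ^^ Suc s) f)" by (simp add: Norm_def tau.hom_prod)
  also have "\<dots> = (\<Prod>s<Suc q'. (tau ^^ Suc s) f)" by (simp only: q')
  also have "\<dots> = (\<Prod>s<q'. (tau ^^ Suc s) f) * (tau ^^ Suc q') f" by (rule prod.lessThan_Suc)
  also have "(tau ^^ Suc q') f = (tau ^^ 0) f" using tau_q[OF assms] by (simp add: q')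
  also have "(\<Prod>s<q'. (tau ^^ Suc s) f) * (tau ^^ 0) f = (\<Prod>s<Suc q'. (tau ^^ s) f)"
    unfolding prod.lessThan_Suc_shift[of "\<lambda>s. (tau ^^ s) f"] by (rule mult.commute)
  also have "\<dots> = Norm f" by (simp only: Norm_def q'[symmetric])
  finally show "tau (Norm f) = Norm f" .
qed

lemma Norm_mult: "Norm (f * g) = Norm f * Norm g"
  by (simp add: Norm_def prod.distrib)

lemma Norm_eq_0_iff [simp]: "Norm f = 0 \<longleftrightarrow> f = 0"
  using q_gt_0 unfolding Norm_def by (auto intro: exI[of _ 0])

sublocale L: subfield_set L
proof
  fix f assume f: "f \<in> L"
  show "inverse f \<in> L"
  proof (cases "f = 0")
    case False
    have "Norm f = f * (\<Prod>s\<in>{..<q} - {0}. (tau ^^ s) f)"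
      unfolding Norm_def by (subst prod.remove[of _ 0]) auto
    hence "inverse f = (\<Prod>s\<in>{..<q} - {0}. (tau ^^ s) f) * inverse (Norm f)"
      using False Norm_eq_0_iff[of f] by (simp add: field_simps)
    moreover have "inverse (Norm f) \<in> L" using Norm_rat[OF f] rat_funs_subset_L by blast
    ultimately show ?thesis using tau_L[OF f] by auto
  qed auto
qed

text \<open>\<open>V\<close> is the local ring of a point above \<open>x = a\<close>. For
  \<open>B = UNIV\<close> the condition \<open>small\<close> concerns only the constant 0, while
  \<open>const_closed\<close> puts all constants into \<open>V\<close>.\<close>

definition affine :: "ambient set \<Rightarrow> qbar \<Rightarrow> bool"
  where "affine V a \<longleftrightarrow> gauss_valuation_at L V UNIV (ff_x - ff_const a) a"

end

section \<open>Points above a finite point of the line, and their conjugates\<close>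

locale affine_place = curve p q k + gauss_valuation_at "curve.L p q k" V UNIV "ff_x - ff_const a" a
  for p q k V a
begin

lemma const_ring [simp, intro]: "ff_const c \<in> V"
  by (rule const_closed) simp

lemma const_units [simp, intro]: "c \<noteq> 0 \<Longrightarrow> ff_const c \<in> val_units V"
  by (rule const_unit) simp

lemma const_max_ideal_iff [simp]: "ff_const c \<in> max_ideal V \<longleftrightarrow> c = 0"
  using const_units[of c] max_idealD(2) by auto

lemma rat_fun_val:
  assumes "finite S" "c \<noteq> 0"
  shows "val_eq V (rat_fun c S n) ((ff_x - ff_const a) powi (if a \<in> S then n a else 0))"
proof -
  have "{b\<in>S. b - a \<in> max_ideal UNIV} = (if a \<in> S then {a} else {})" by auto
  hence "(\<Sum>b\<in>{b\<in>S. b - a \<in> max_ideal UNIV}. n b) = (if a \<in> S then n a else 0)" by simp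
  with rat_fun_val_eq_at[OF assms, of n] have "val_eq V (rat_fun c S n) (ff_const c * (ff_x - ff_const a) powi (if a \<in> S then n a else 0))"
    by (simp only: gauss_const_UNIV)
  also have "val_eq V \<dots> ((ff_x - ff_const a) powi (if a \<in> S then n a else 0))"
    using assms(2) by (intro val_eq_unit_mult const_units) auto
  finally show ?thesis .
qed

lemma eval_x_ring: "eval_x P \<in> V"
  unfolding eval_x_conv poly_altdef
  by (intro sum_closed mult_closed power_closed ff_x_ring) (simp add: coeff_map_poly)

lemma eval_x_cong: "eval_x P - ff_const (poly P a) \<in> max_ideal V"
proof (induction P)
  case (pCons c P)
  have "eval_x (pCons c P) - ff_const (poly (pCons c P) a) =
    (ff_x - ff_const a) * eval_x P + ff_const a * (eval_x P - ff_const (poly P a))"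
    by (simp add: eval_x_conv map_poly_pCons algebra_simps)
  also have "\<dots> \<in> max_ideal V" using z_max_ideal eval_x_ring pCons by blast
  finally show ?case .
qed auto

lemma Y_ring: "Y \<in> V"
  using root_closed[of Y q] Y_power eval_x_ring by simp

lemma Y_value: "a \<in> roots \<Longrightarrow> val_eq V (Y ^ q) (ff_x - ff_const a)"
  "a \<notin> roots \<Longrightarrow> Y \<in> val_units V"
proof -
  have *: "val_eq V (Y ^ q) ((ff_x - ff_const a) powi (if a \<in> roots then 1 else 0))"
    unfolding Y_power FK_rat_fun by (rule rat_fun_val) auto
  show "a \<in> roots \<Longrightarrow> val_eq V (Y ^ q) (ff_x - ff_const a)" using * by simp
  assume "a \<notin> roots"
  hence "Y ^ q \<in> val_units V" using * by (simp add: val_eq_one_iff)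
  thus "Y \<in> val_units V" using root_unit[of Y q] by simp
qed

text \<open>The polynomial X^q - F(a) splits over the constants and is a nonunit at
  \<open>Y\<close>, so one of its linear factors is. Thus \<open>V\<close> lies above a point
  \<open>(a, c)\<close> of the affine curve.\<close>

lemma Y_residue: "\<exists>c. c ^ q = poly FK a \<and> Y - ff_const c \<in> max_ideal V"
proof -
  define P where "P = Polynomial.monom 1 q + [:- poly FK a:]"
  have deg: "Polynomial.degree P = q"
    unfolding P_def using q_gt_0 by (subst degree_add_eq_left) (auto simp: degree_monom_eq)
  hence P0: "P \<noteq> 0" using q_gt_0 by (metis degree_0 less_irrefl)
  obtain A where A: "P = Polynomial.smult (Polynomial.lead_coeff P) (\<Prod>x\<in>#A. [:-x, 1:])"
    using alg_closed_imp_factorization[OF P0] by blast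
  have P_root: "poly P c = 0 \<longleftrightarrow> c \<in># A" for c
    using P0 by (subst A) (auto simp: poly_prod_mset prod_mset_zero_iff)
  define E where "E c P = poly (map_poly ff_const P) c" for c P
  have E_mult: "E c (P * Q) = E c P * E c Q" for c P Q by (simp add: E_def ff_const.map_poly_hom_mult)
  have "E Y (\<Prod>x\<in>#A. [:-x, 1:]) = (\<Prod>x\<in>#A. Y - ff_const x)"
    by (induction A) (simp_all add: E_mult del: mult_pCons_left, simp_all add: E_def map_poly_pCons)
  moreover have "E Y (Polynomial.smult c Q) = ff_const c * E Y Q" for c Q
    using E_mult[of Y "[:c:]" Q] by (simp add: E_def map_poly_pCons)
  ultimately have "E Y P = ff_const (Polynomial.lead_coeff P) * (\<Prod>x\<in>#A. Y - ff_const x)"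
    using A by metis
  moreover have "E Y P = Y ^ q - ff_const (poly FK a)"
    by (simp add: E_def P_def ff_const.map_poly_hom_add map_poly_monom poly_monom map_poly_pCons)
  moreover have "Y ^ q - ff_const (poly FK a) \<in> max_ideal V" unfolding Y_power by (rule eval_x_cong)
  ultimately have "ff_const (Polynomial.lead_coeff P) * (\<Prod>x\<in>#A. Y - ff_const x) \<in> max_ideal V" by simp
  moreover have "(\<Prod>x\<in>#A. Y - ff_const x) = (\<Prod>x\<in>set_mset A. (Y - ff_const x) ^ count A x)"
    by (simp add: image_prod_mset_multiplicity)
  ultimately have m: "ff_const (Polynomial.lead_coeff P) * (\<Prod>x\<in>set_mset A. (Y - ff_const x) ^ count A x) \<in> max_ideal V"
    by simp
  have in_V: "Y - ff_const x \<in> V" for x using Y_ring by blast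
  have "(\<Prod>x\<in>set_mset A. (Y - ff_const x) ^ count A x) \<in> V"
    using in_V by (intro prod_closed power_closed)
  hence "(\<Prod>x\<in>set_mset A. (Y - ff_const x) ^ count A x) \<in> max_ideal V"
    using prime_max_ideal[OF const_ring _ m] P0 by simp
  then obtain x where x: "x \<in># A" "(Y - ff_const x) ^ count A x \<in> max_ideal V"
    using prime_max_ideal_prod[of "set_mset A" "\<lambda>x. (Y - ff_const x) ^ count A x"] in_V by blast
  have "Y - ff_const x \<in> max_ideal V"
    using root_max_ideal[OF _ x(2)] x(1) by auto
  moreover have "x ^ q = poly FK a" using P_root[of x] x(1) by (simp add: P_def poly_monom)
  ultimately show ?thesis by blast
qed

end

text \<open>The conjugate of a point under \<open>g\<close>, formed as a preimage since embeddings
  of the ambient field are not assumed surjective.\<close>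

definition pullback :: "ambient set \<Rightarrow> (ambient \<Rightarrow> ambient) \<Rightarrow> ambient set \<Rightarrow> ambient set"
  where "pullback M g V = {f \<in> M. g f \<in> V}"

context curve
begin

lemma affine_place_iff: "affine V a \<longleftrightarrow> affine_place p q k V a"
  by (simp add: affine_def affine_place_def curve_axioms)

lemma affineD: "affine V a \<Longrightarrow> affine_place p q k V a"
  by (simp add: affine_place_iff)

lemma affine_exists: "\<exists>V. affine V a"
proof -
  obtain W where "gauss_valuation_at UNIV W UNIV (ff_x - ff_const a) a"
    using gauss_valuation_at_exists[OF UNIV_valuation_ring] by blast
  then interpret W: gauss_valuation_at UNIV W UNIV "ff_x - ff_const a" a .
  have max: "max_ideal (W \<inter> L) = max_ideal W \<inter> L"
    by (auto simp: max_ideal_def val_units_def)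
  have "gauss_valuation_at L (W \<inter> L) UNIV (ff_x - ff_const a) a"
  proof unfold_locales
    show "f \<in> W \<inter> L \<or> inverse f \<in> W \<inter> L" if "f \<in> L" for f using W.total[of f] that by auto
    show "c \<in> max_ideal UNIV \<Longrightarrow> ff_const c / (ff_x - ff_const a) ^ n \<in> max_ideal (W \<inter> L)" for c n
      unfolding max using W.small[of c n] by auto
    show "ff_x - ff_const a \<in> max_ideal (W \<inter> L)" unfolding max using W.z_max_ideal by auto
    show "ff_const c \<in> W \<inter> L" for c using W.const_closed[of c] by auto
  qed (use rat_funs_subset_L in auto)
  thus ?thesis by (auto simp: affine_def)
qed

lemma affineI:
  assumes "valuation_ring L V" "\<And>c. ff_const c \<in> V" "ff_x - ff_const a \<in> max_ideal V"
  shows "affine V a"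
proof -
  interpret V: valuation_ring L V by fact
  show ?thesis unfolding affine_def
    by unfold_locales (use assms rat_funs_subset_L in auto)
qed

end

lemma pullback_units:
  assumes "field_embedding g" "subfield_set M"
  shows "val_units (pullback M g V) = {f \<in> M. g f \<in> val_units V}"
proof -
  interpret g: field_embedding g by fact
  interpret M: subfield_set M by fact
  show ?thesis by (auto simp: val_units_def pullback_def)
qed

lemma pullback_max_ideal:
  assumes "field_embedding g" "subfield_set M"
  shows "max_ideal (pullback M g V) = {f \<in> M. g f \<in> max_ideal V}"
  unfolding max_ideal_def pullback_units[OF assms] by (auto simp: pullback_def)

lemma pullback_val_eq:
  assumes "field_embedding g" "subfield_set M" "f \<in> M" "h \<in> M"
  shows "val_eq (pullback M g V) f h \<longleftrightarrow> val_eq V (g f) (g h)"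
proof -
  interpret g: field_embedding g by fact
  interpret M: subfield_set M by fact
  show ?thesis unfolding val_eq_def pullback_units[OF assms(1,2)] using assms(3,4) by (auto simp: M.divide_closed)
qed

context curve
begin

lemma pullback_affine:
  assumes g: "field_embedding g" "\<And>f. f \<in> L \<Longrightarrow> g f \<in> L" "\<And>c. g (ff_const c) \<in> range ff_const"
    and "affine V a" "g ff_x = ff_x" "g (ff_const b) = ff_const a"
  shows "affine (pullback L g V) b"
proof -
  interpret affine_place p q k V a using assms(4) by (rule affineD)
  interpret g: field_embedding g by fact
  have g_const: "g (ff_const c) \<in> V" for c using g(3)[of c] by auto
  show ?thesis
  proof (rule affineI)
    show "valuation_ring L (pullback L g V)" unfolding pullback_def
      by (rule valuation_ring_vimage) (use g L.subfield_set_axioms in auto)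
    show "ff_const c \<in> pullback L g V" for c using g_const by (auto simp: pullback_def)
    show "ff_x - ff_const b \<in> max_ideal (pullback L g V)"
      unfolding pullback_max_ideal[OF g(1) L.subfield_set_axioms]
      using z_max_ideal assms(5,6) by auto
  qed
qed

lemma pullback_tau:
  assumes "affine V a"
  shows "affine (pullback L (tau ^^ n) V) a"
  using assms by (intro pullback_affine) (auto simp: tau_n.field_embedding_axioms tau_L)

section \<open>Functions whose affine zeros and poles are among the points
  \<open>(i, k)\<close>\<close>

lemma nonroot_special: "poly FK a = of_int (k ^ q) \<longleftrightarrow> (\<exists>i<p. a = of_nat i)"
  by (auto simp: poly_FK G_def)

text \<open>The function \<open>f\<close> has order \<open>a i\<close> at the point \<open>(i, k)\<close> and no other zeros or poles in the affine
  part of the curve.\<close>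

definition divisor_witness :: "(nat \<Rightarrow> int) \<Rightarrow> ambient \<Rightarrow> bool"
  where "divisor_witness a f \<longleftrightarrow> f \<in> L \<and> f \<noteq> 0 \<and> (\<forall>V b. affine V b \<longrightarrow>
    (\<forall>i<p. b = of_nat i \<longrightarrow> Y - of_int k \<in> max_ideal V \<longrightarrow> val_eq V f ((ff_x - ff_const b) powi a i)) \<and>
    (Y - of_int k \<notin> max_ideal V \<longrightarrow> f \<in> val_units V))"

lemma witnessD:
  assumes "divisor_witness a f"
  shows "f \<in> L" "f \<noteq> 0"
    "affine V (of_nat i) \<Longrightarrow> i < p \<Longrightarrow> Y - of_int k \<in> max_ideal V \<Longrightarrow> val_eq V f ((ff_x - of_nat i) powi a i)"
    "affine V b \<Longrightarrow> Y - of_int k \<notin> max_ideal V \<Longrightarrow> f \<in> val_units V"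
  using assms unfolding divisor_witness_def by fastforce+

lemma special_point:
  assumes "affine V b" "Y - of_int k \<in> max_ideal V"
  shows "\<exists>i<p. b = of_nat i"
proof -
  interpret affine_place p q k V b using assms(1) by (rule affineD)
  obtain c where c: "c ^ q = poly FK b" "Y - ff_const c \<in> max_ideal V" using Y_residue by blast
  from max_ideal_diff[OF assms(2) c(2)] have "ff_const (c - of_int k) \<in> max_ideal V" by simp
  hence "c = of_int k" unfolding const_max_ideal_iff by simp
  hence "poly FK b = of_int (k ^ q)" using c(1) by simp
  thus ?thesis by (simp only: nonroot_special)
qed

lemma witness_mult:
  assumes "divisor_witness a f" "divisor_witness b g"
  shows "divisor_witness (\<lambda>i. a i + b i) (f * g)"
  unfolding divisor_witness_def
proof (intro conjI allI impI)
  show "f * g \<in> L" "f * g \<noteq> 0" using witnessD(1,2)[OF assms(1)] witnessD(1,2)[OF assms(2)] by auto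
  fix V c assume V: "affine V c"
  interpret affine_place p q k V c using V by (rule affineD)
  show "f * g \<in> val_units V" if "Y - of_int k \<notin> max_ideal V"
    using witnessD(4)[OF assms(1) V that] witnessD(4)[OF assms(2) V that] by blast
  fix i assume i: "i < p" "c = of_nat i" "Y - of_int k \<in> max_ideal V"
  show "val_eq V (f * g) ((ff_x - ff_const c) powi (a i + b i))"
    using val_eq_mult[OF witnessD(3)[OF assms(1)] witnessD(3)[OF assms(2)], of i i] i V
ff_x_neq_const[of "of_nat i"] by (simp add: power_int_add)
qed

lemma witness_inverse:
  assumes "divisor_witness a f"
  shows "divisor_witness (\<lambda>i. - a i) (inverse f)"
  unfolding divisor_witness_def
proof (intro conjI allI impI)
  show "inverse f \<in> L" "inverse f \<noteq> 0" using witnessD(1,2)[OF assms(1)] by auto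
  fix V c assume V: "affine V c"
  interpret affine_place p q k V c using V by (rule affineD)
  show "inverse f \<in> val_units V" if "Y - of_int k \<notin> max_ideal V"
    using witnessD(4)[OF assms(1) V that] by blast
  fix i assume i: "i < p" "c = of_nat i" "Y - of_int k \<in> max_ideal V"
  show "val_eq V (inverse f) ((ff_x - ff_const c) powi (- a i))"
    using val_eq_inverse[OF witnessD(3)[OF assms(1)], of i] i V
    by (simp add: power_int_minus)
qed

lemma witness_power:
  assumes "divisor_witness a f"
  shows "divisor_witness (\<lambda>i. m * a i) (f powi m)"
  unfolding divisor_witness_def
proof (intro conjI allI impI)
  show "f powi m \<in> L" "f powi m \<noteq> 0" using witnessD(1,2)[OF assms(1)] by auto
  fix V c assume V: "affine V c"
  interpret affine_place p q k V c using V by (rule affineD)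
  show "f powi m \<in> val_units V" if "Y - of_int k \<notin> max_ideal V"
    using witnessD(4)[OF assms(1) V that] by blast
  fix i assume i: "i < p" "c = of_nat i" "Y - of_int k \<in> max_ideal V"
  show "val_eq V (f powi m) ((ff_x - ff_const c) powi (m * a i))"
    using val_eq_powi[OF witnessD(3)[OF assms(1)], of i m] i V
    by (simp add: power_int_mult mult.commute[of m])
qed

lemma FK_minus_const: "eval_x FK - of_int (k ^ q) = rat_fun 1 (of_nat ` {..<p}) (\<lambda>_. 1)"
proof -
  have "eval_x FK = (\<Prod>i<p. ff_x - of_nat i) + of_int (k ^ q)"
    unfolding FK_def eval_x_simps eval_x_prod eval_x_linear by (simp add: ff_const_conv[symmetric])
  thus ?thesis by (simp add: rat_fun_def prod.reindex inj_on_def)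
qed

text \<open>The product of \<open>Y - k\<close> and \<open>U\<close> is \<open>F - k ^ q\<close>,
  i.e. the product of all \<open>x - i\<close>. At \<open>(i, k)\<close> the cofactor
  \<open>U\<close> takes the nonzero value \<open>q * k ^ (q - 1)\<close>, so \<open>Y - k\<close>
  has the order of \<open>x - i\<close> there.\<close>

lemma witness_Y: "divisor_witness (\<lambda>_. 1) (Y - of_int k)"
  unfolding divisor_witness_def
proof (intro conjI allI impI)
  show "Y - of_int k \<in> L" by blast
  show "Y - of_int k \<noteq> 0"
  proof
    assume "Y - of_int k = 0"
    hence "eval_x FK - of_int (k ^ q) = 0" by (simp add: Y_power[symmetric])
    thus False unfolding FK_minus_const by simp
  qed
  fix V c assume V: "affine V c"
  interpret affine_place p q k V c using V by (rule affineD)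
  show "Y - of_int k \<in> val_units V" if "Y - of_int k \<notin> max_ideal V"
    using that Y_ring unit_or_max_ideal[of "Y - of_int k"] by blast
  fix i assume i: "i < p" "c = of_nat i" "Y - of_int k \<in> max_ideal V"
  define U where "U = (\<Sum>j<q. (of_int k) ^ (q - Suc j) * Y ^ j)"
  have "Y ^ q - of_int k ^ q = (Y - of_int k) * U"
    unfolding U_def by (rule power_diff_sumr2)
  moreover have "U \<in> val_units V"
  proof -
    have "Y ^ j - of_int k ^ j \<in> max_ideal V" for j
      unfolding power_diff_sumr2 using i(3) Y_ring by (intro max_ideal_mult sum_closed) auto
    hence "of_int k ^ (q - Suc j) * (Y ^ j - of_int k ^ j) \<in> max_ideal V" for j by blast
    hence "(\<Sum>j<q. of_int k ^ (q - Suc j) * (Y ^ j - of_int k ^ j)) \<in> max_ideal V" by blast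
    moreover have "U = ff_const (of_nat q * of_int k ^ (q - 1)) + (\<Sum>j<q. of_int k ^ (q - Suc j) * (Y ^ j - of_int k ^ j))"
    proof -
      have "(\<Sum>j<q. of_int k ^ (q - Suc j) * of_int k ^ j) = (\<Sum>j<q. (of_int k :: ambient) ^ (q - 1))"
        by (intro sum.cong) (auto simp flip: power_add)
      hence "(\<Sum>j<q. of_int k ^ (q - Suc j) * of_int k ^ j) = ff_const (of_nat q * of_int k ^ (q - 1))" by simp
      thus ?thesis unfolding U_def by (simp only: right_diff_distrib sum_subtractf) simp
    qed
    moreover have "ff_const (of_nat q * of_int k ^ (q - 1)) \<in> val_units V"
      by (rule const_units) (use q_gt_0 in auto)
    ultimately show ?thesis using unit_add_max_ideal by simp
  qed
  hence "val_eq V (U * (Y - of_int k)) (Y - of_int k)"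
    using \<open>Y - of_int k \<noteq> 0\<close> by (intro val_eq_unit_mult)
  ultimately have "val_eq V (Y ^ q - of_int k ^ q) (Y - of_int k)" by (simp add: mult.commute)
  moreover have "val_eq V (Y ^ q - of_int k ^ q) ((ff_x - ff_const c) powi 1)"
    using rat_fun_val[of "of_nat ` {..<p}" 1 "\<lambda>_. 1"] i unfolding FK_minus_const[symmetric] Y_power by simp
  ultimately show "val_eq V (Y - of_int k) ((ff_x - ff_const c) powi 1)"
    using val_eq_sym val_eq_trans by blast
qed

end

section \<open>Reduction modulo a large prime factor of \<open>k\<close>\<close>

context curve
begin

definition special :: "qbar set" where "special = of_nat ` {..<p}"

lemma finite_special [simp, intro]: "finite special"
  by (simp add: special_def)

lemma special_not_root: "i < p \<Longrightarrow> of_nat i \<notin> roots"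
  using nonroot_special[of "of_nat i"] by (auto simp: roots_def)

lemma zeta_inj:
  assumes "zeta ^ s = zeta ^ t" "s < q" "t < q"
  shows "s = t"
proof (rule ccontr)
  have *: False if "zeta ^ s = zeta ^ t" "s < t" "t < q" for s t
  proof -
    have "zeta ^ (s + (t - s)) = zeta ^ s" using that by simp
    hence "zeta ^ (t - s) = 1" unfolding power_add by simp
    thus False using zeta_power_eq_1_iff[of "t - s"] that by (auto dest: dvd_imp_le)
  qed
  assume "s \<noteq> t"
  thus False using *[of s t] *[of t s] assms by (cases s t rule: linorder_cases) auto
qed

text \<open>Exactly one of the \<open>q\<close> points above \<open>x = i\<close> is \<open>(i, k)\<close>.\<close>

lemma unique_conjugate:
  assumes "affine V (of_nat i)" "i < p"
  shows "\<exists>t<q. \<forall>s<q. (tau ^^ s) (Y - of_int k) \<in> max_ideal V \<longleftrightarrow> s = t"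
proof -
  interpret affine_place p q k V "of_nat i" using assms(1) by (rule affineD)
  obtain c where c: "c ^ q = poly FK (of_nat i)" "Y - ff_const c \<in> max_ideal V" using Y_residue by blast
  have ck: "c ^ q = of_int k ^ q" using c(1) assms(2) nonroot_special[of "of_nat i"] by auto
  have "c ^ q \<noteq> 0" unfolding ck by simp
  hence c0: "c \<noteq> 0" using q_gt_0 by (metis zero_power)
  have e: "(of_int k / c) ^ q = 1" using ck c0 by (simp add: power_divide)
  have "ff_const (of_int k / c) ^ q = 1" unfolding ff_const.hom_power[symmetric] e by simp
  then obtain t where t: "t < q" "ff_const (of_int k / c) = ff_const zeta ^ t" using root_of_unity by metis
  have kc: "of_int k = zeta ^ t * c"
    using t(2) c0 unfolding ff_const.hom_power[symmetric] ff_const.hom_eq_iff by (simp add: field_simps)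
  have tau_Y: "(tau ^^ s) (Y - of_int k) = ff_const (zeta ^ s) * Y - ff_const (zeta ^ t * c)" for s
    using kc by (simp add: tau_n_Y flip: ff_const.hom_of_int)
  have Yu: "Y \<in> val_units V" using Y_value(2) special_not_root[OF assms(2)] by blast
  have "(tau ^^ t) (Y - of_int k) = ff_const (zeta ^ t) * (Y - ff_const c)"
    unfolding tau_Y by (simp add: algebra_simps)
  hence 1: "(tau ^^ t) (Y - of_int k) \<in> max_ideal V" using c(2) const_ring by auto
  have "s = t" if s: "s < q" "(tau ^^ s) (Y - of_int k) \<in> max_ideal V" for s
  proof -
    have "(tau ^^ s) (Y - of_int k) - (tau ^^ t) (Y - of_int k) = ff_const (zeta ^ s - zeta ^ t) * Y"
      unfolding tau_Y by (simp add: algebra_simps)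
    hence "ff_const (zeta ^ s - zeta ^ t) * Y \<in> max_ideal V" using max_ideal_diff[OF s(2) 1] by simp
    hence "ff_const (zeta ^ s - zeta ^ t) \<in> max_ideal V"
      using prime_max_ideal[OF const_ring unitD(1)[OF Yu]] max_idealD(2) Yu by blast
    hence "zeta ^ s = zeta ^ t" unfolding const_max_ideal_iff by simp
    thus "s = t" using zeta_inj s(1) t(1) by blast
  qed
  thus ?thesis using 1 t(1) by blast
qed

text \<open>Above \<open>x = i\<close> exactly one conjugate of \<open>f\<close> has order
  \<open>a i\<close> and the others are units; above other finite points all conjugates are units.
  This determines the divisor of the norm on the affine line.\<close>

lemma Norm_witness:
  assumes "divisor_witness a f"
  obtains C n where "C \<noteq> 0" "Norm f = rat_fun C special n" "\<And>i. i < p \<Longrightarrow> n (of_nat i) = a i"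
proof -
  note f = witnessD[OF assms]
  have "Norm f \<noteq> 0" using f(2) by simp
  obtain c S0 n0 where S0: "finite S0" "c \<noteq> 0" "Norm f = rat_fun c S0 n0"
    using rat_fun_exists[OF Norm_rat[OF f(1)] \<open>Norm f \<noteq> 0\<close>] .
  define S where "S = S0 \<union> special"
  define n where "n = (\<lambda>b. if b \<in> S0 then n0 b else 0)"
  have S: "finite S" "special \<subseteq> S" using S0 by (auto simp: S_def)
  have S3: "Norm f = rat_fun c S n"
    unfolding S0(3) n_def by (rule rat_fun_superset) (use S0 in \<open>auto simp: S_def\<close>)
  have V_s: "val_eq V ((tau ^^ s) f) ((ff_x - of_nat i) powi a i)"
    if "affine V (of_nat i)" "i < p" "(tau ^^ s) (Y - of_int k) \<in> max_ideal V" for V s i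
  proof -
    have "Y - of_int k \<in> max_ideal (pullback L (tau ^^ s) V)"
      unfolding pullback_max_ideal[OF tau_n.field_embedding_axioms L.subfield_set_axioms] using that(3) by blast
    from f(3)[OF pullback_tau[OF that(1)] that(2) this]
    have "val_eq (pullback L (tau ^^ s) V) f ((ff_x - of_nat i) powi a i)" .
    thus ?thesis
      by (subst (asm) pullback_val_eq[OF tau_n.field_embedding_axioms L.subfield_set_axioms f(1)])
        (auto intro!: L.powi_closed L.diff_closed)
  qed
  have V_u: "(tau ^^ s) f \<in> val_units V"
    if "affine V b" "(tau ^^ s) (Y - of_int k) \<notin> max_ideal V" for V s b
  proof -
    have "Y - of_int k \<notin> max_ideal (pullback L (tau ^^ s) V)"
      unfolding pullback_max_ideal[OF tau_n.field_embedding_axioms L.subfield_set_axioms] using that(2) by blast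
    from f(4)[OF pullback_tau[OF that(1)] this] show ?thesis
      unfolding pullback_units[OF tau_n.field_embedding_axioms L.subfield_set_axioms] by blast
  qed
  have n_special: "n (of_nat i) = a i" if i: "i < p" for i
  proof -
    obtain V where V: "affine V (of_nat i)" using affine_exists by blast
    interpret affine_place p q k V "of_nat i" using V by (rule affineD)
    obtain t where t: "t < q" "\<And>s. s < q \<Longrightarrow> (tau ^^ s) (Y - of_int k) \<in> max_ideal V \<longleftrightarrow> s = t"
      using unique_conjugate[OF V i] by blast
    have "val_eq V (Norm f) (\<Prod>s<q. (ff_x - of_nat i) powi (if s = t then a i else 0))"
      unfolding Norm_def
    proof (rule val_eq_prod)
      fix s assume "s \<in> {..<q}"
      thus "val_eq V ((tau ^^ s) f) ((ff_x - of_nat i) powi (if s = t then a i else 0))"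
        using V_s[OF V i, of s] V_u[OF V, of s] t(2)[of s] by (simp add: val_eq_one_iff)
    qed simp
    also have "(\<Prod>s<q. (ff_x - of_nat i) powi (if s = t then a i else 0)) = (ff_x - of_nat i) powi a i"
      using z_nonzero t(1) by (simp add: prod_powi)
    finally have "val_eq V (Norm f) ((ff_x - of_nat i) powi a i)" .
    moreover have "val_eq V (Norm f) ((ff_x - of_nat i) powi n (of_nat i))"
      using rat_fun_val[OF S(1) S0(2), of n] S(2) S3 i by (auto simp: special_def)
    ultimately have "val_eq V ((ff_x - of_nat i) powi n (of_nat i)) ((ff_x - of_nat i) powi a i)"
      using val_eq_sym val_eq_trans by blast
    thus ?thesis using val_eq_powi_iff[OF z_max_ideal z_nonzero] by simp
  qed
  have n_other: "n b = 0" if b: "b \<in> S" "b \<notin> special" for b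
  proof -
    obtain V where V: "affine V b" using affine_exists by blast
    interpret affine_place p q k V b using V by (rule affineD)
    have "(tau ^^ s) (Y - of_int k) \<notin> max_ideal V" for s
    proof
      assume "(tau ^^ s) (Y - of_int k) \<in> max_ideal V"
      hence "Y - of_int k \<in> max_ideal (pullback L (tau ^^ s) V)"
        unfolding pullback_max_ideal[OF tau_n.field_embedding_axioms L.subfield_set_axioms] by blast
      from special_point[OF pullback_tau[OF V] this] show False using b(2) by (auto simp: special_def)
    qed
    hence "(tau ^^ s) f \<in> val_units V" for s using V_u[OF V] by blast
    hence "val_eq V (Norm f) (\<Prod>s<q. 1)" unfolding Norm_def by (intro val_eq_prod) (auto simp: val_eq_one_iff)
    moreover have "val_eq V (Norm f) ((ff_x - ff_const b) powi n b)"
      using rat_fun_val[OF S(1) S0(2), of n] S3 b by auto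
    ultimately have "(ff_x - ff_const b) powi n b \<in> val_units V" using val_eq_units_iff by (auto simp: val_eq_one_iff)
    thus ?thesis using max_ideal_powi(2)[OF z_max_ideal z_nonzero] by simp
  qed
  have "rat_fun c S n = rat_fun c special n"
    unfolding rat_fun_def using S n_other
    by (intro arg_cong[of _ _ "\<lambda>t. ff_const c * t"] prod.mono_neutral_right) auto
  thus ?thesis using that[of c n] S0(2) S3 n_special by simp
qed

text \<open>Coefficients of a function without affine poles are polynomials, i.e. K[x, Y] is
  integrally closed. With \<open>f\<close> its conjugates are regular, hence so is each
  \<open>r j * Y ^ j\<close>. At a root of \<open>F\<close> its \<open>q\<close>-th power has the
  value of \<open>(x - b) powi (q * n b + j)\<close>, and \<open>j < q\<close> excludes a negative
  \<open>n b\<close>.\<close>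

lemma regular_component:
  assumes r: "\<And>j. r j \<in> rat_funs" and j: "j < q"
    and reg: "\<And>V b. affine V b \<Longrightarrow> (\<Sum>i<q. r i * Y ^ i) \<in> V"
    and rep: "r j = rat_fun c S n" "finite S" "c \<noteq> 0" and b: "b \<in> S"
  shows "n b \<ge> 0"
proof -
  define f where "f = (\<Sum>i<q. r i * Y ^ i)"
  have fL: "f \<in> L" unfolding f_def by (rule L_I) (rule r)
  obtain V where V: "affine V b" using affine_exists by blast
  interpret affine_place p q k V b using V by (rule affineD)
  have "(tau ^^ s) f \<in> V" for s
    using reg[OF pullback_tau[OF V, of s]] by (simp add: pullback_def f_def)
  hence "(\<Sum>s<q. ff_const (zeta powi (- int (s * j))) * (tau ^^ s) f) \<in> V"
    by (intro sum_closed mult_closed const_ring) auto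
  hence "of_nat q * (r j * Y ^ j) \<in> V"
    unfolding f_def component[OF r j] .
  moreover have "ff_const (of_nat q) \<in> val_units V" using q_gt_0 by (intro const_units) auto
  ultimately have "r j * Y ^ j \<in> V"
    using mult_closed[of "of_nat q * (r j * Y ^ j)" "inverse (of_nat q)"] unitD(3) q_gt_0 by (auto simp: field_simps)
  hence *: "(r j * Y ^ j) ^ q \<in> V" by blast
  have rv: "val_eq V (r j) ((ff_x - ff_const b) powi n b)"
    using rat_fun_val[OF rep(2,3), of n] b rep(1) by simp
  show ?thesis
  proof (cases "b \<in> roots")
    case False
    hence "Y ^ j \<in> val_units V" using Y_value(2) by blast
    hence "val_eq V (r j * Y ^ j) ((ff_x - ff_const b) powi n b * 1)"
      by (intro val_eq_mult rv) (simp add: val_eq_one_iff)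
    hence "(ff_x - ff_const b) powi n b \<in> V" using \<open>r j * Y ^ j \<in> V\<close> val_eq_ring_iff by simp
    thus ?thesis using max_ideal_powi(1)[OF z_max_ideal z_nonzero] by simp
  next
    case True
    have "(Y ^ j) ^ q = (Y ^ q) ^ j" by (metis power_mult mult.commute)
    hence "val_eq V ((r j * Y ^ j) ^ q) (((ff_x - ff_const b) powi n b) ^ q * (ff_x - ff_const b) ^ j)"
      unfolding power_mult_distrib
      by (intro val_eq_mult val_eq_power rv) (auto intro: val_eq_power Y_value(1)[OF True])
    also have "((ff_x - ff_const b) powi n b) ^ q * (ff_x - ff_const b) ^ j = (ff_x - ff_const b) powi (n b * int q + int j)"
      using z_nonzero by (simp add: power_int_add power_int_mult)
    finally have "(ff_x - ff_const b) powi (n b * int q + int j) \<in> V" using * val_eq_ring_iff by blast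
    hence "n b * int q + int j \<ge> 0" using max_ideal_powi(1)[OF z_max_ideal z_nonzero] by simp
    hence "n b * int q > - int q" using j by linarith
    hence "int q * (n b + 1) > 0" by (simp add: algebra_simps)
    hence "n b + 1 > 0" using zero_less_mult_pos[of "int q" "n b + 1"] q_gt_0 by simp
    thus ?thesis by simp
  qed
qed

end

context ramified_place
begin

lemma zeta_unit: "ff_const zeta \<in> val_units V"
  by (rule const_unit, rule B.root_unit[of zeta q]) (auto simp: zeta)

text \<open>The powers of \<open>zeta\<close> that \<open>tau\<close> introduces are units, so all
  conjugates have the same dominant summand.\<close>

lemma Norm_val_eq:
  assumes "\<And>j. r j \<in> rat_funs" "dominant r d"
  shows "val_eq V (Norm (\<Sum>j<q. r j * Y ^ j)) ((r d * Y ^ d) ^ q)"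
proof -
  have "val_eq V ((tau ^^ s) (\<Sum>j<q. r j * Y ^ j)) (r d * Y ^ d)" for s
    unfolding tau_n_sum[OF assms(1)] using zeta_unit by (intro dominant_val_eq assms(2)) auto
  hence "val_eq V (Norm (\<Sum>j<q. r j * Y ^ j)) (\<Prod>s<q. r d * Y ^ d)"
    unfolding Norm_def by (intro val_eq_prod) auto
  thus ?thesis by simp
qed

lemma term_over_dominant:
  assumes "dominant r d" "j < q"
  shows "r j * Y ^ j / (r d * Y ^ d) \<in> V"
  using assms max_idealD(1) by (cases "j = d") (auto simp: dominant_def)

text \<open>A summand can fall short of the dominant one in its constant or in its exponent of
  \<open>z\<close>. If its constant has the value prescribed by the norm, only the exponent is left,
  which gives the inequality.\<close>

lemma term_vs_Norm:
  assumes r: "\<And>j. r j \<in> rat_funs" and d: "dominant r d" and j: "j < q"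
    and N: "val_eq V (Norm (\<Sum>j<q. r j * Y ^ j)) (ff_const C * z powi m)" "C \<noteq> 0"
    and rj: "val_eq V (r j) (ff_const c * z powi n)" "c \<noteq> 0"
  shows "j = d \<Longrightarrow> val_eq B (c ^ q) C" "j = d \<Longrightarrow> int q * n + e * int j = m"
    "val_eq B (c ^ q) C \<Longrightarrow> int q * n + e * int j \<ge> m"
proof -
  have 1: "val_eq V ((r d * Y ^ d) ^ q) (ff_const C * z powi m)"
    using val_eq_trans[OF val_eq_sym[OF Norm_val_eq[OF r d]] N(1)] .
  have 2: "val_eq V ((r j * Y ^ j) ^ q) (ff_const (c ^ q) * z powi (int q * n + e * int j))"
    by (rule term_val[OF rj(1)])
  show "j = d \<Longrightarrow> val_eq B (c ^ q) C" "j = d \<Longrightarrow> int q * n + e * int j = m"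
  proof -
    assume "j = d"
    hence *: "val_eq V (ff_const (c ^ q) * z powi (int q * n + e * int j)) (ff_const C * z powi m)"
      using 1 val_eq_trans[OF val_eq_sym[OF 2]] by simp
    show "val_eq B (c ^ q) C" by (rule const_times_z_eq(1)[OF *]) (use rj N in auto)
    show "int q * n + e * int j = m" by (rule const_times_z_eq(2)[OF *]) (use rj N in auto)
  qed
  assume cC: "val_eq B (c ^ q) C"
  have "(r j * Y ^ j / (r d * Y ^ d)) ^ q \<in> V" using term_over_dominant[OF d j] by blast
  moreover have "val_eq V ((r j * Y ^ j / (r d * Y ^ d)) ^ q)
     (ff_const (c ^ q) * z powi (int q * n + e * int j) / (ff_const C * z powi m))"
    unfolding power_divide by (intro val_eq_divide 1 2)
  moreover have "ff_const (c ^ q) * z powi (int q * n + e * int j) / (ff_const C * z powi m) =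
     ff_const (c ^ q / C) * z powi (int q * n + e * int j - m)"
    using z_nonzero N(2) by (simp add: power_int_diff)
  ultimately have "ff_const (c ^ q / C) * z powi (int q * n + e * int j - m) \<in> V"
    using val_eq_ring_iff by metis
  thus "int q * n + e * int j \<ge> m"
    using const_times_z_ring_iff[of "c ^ q / C"] cC by (simp add: val_eq_def)
qed

end

context curve
begin

text \<open>Modulo \<open>l\<close> the points \<open>(i, k)\<close> become the ramification points \<open>(i, 0)\<close>. If the divisor
  \<open>\<Sum>a i \<cdot> (i, 0) - N \<cdot> \<infinity>\<close> of the reduction of \<open>f = \<Sum>r j * Y ^ j\<close> is attained by the \<open>j\<close>-th
  summand at infinity, then counting zeros shows that this summand attains it everywhere.\<close>

lemma witness_congruent_aux:
  assumes wit: "divisor_witness a f" and pos: "\<And>i. i < p \<Longrightarrow> a i \<ge> 0"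
  shows "\<exists>j. \<forall>i<p. int q dvd a i - j"
proof -
  obtain B l where pl: "curve_place p q k B l" and l: "l > p" "int l dvd k" using ladic_place .
  interpret curve_place p q k B l by (rule pl)
  have VB: "valuation_ring UNIV B" by (rule B.valuation_ring_axioms)
  have rootsB: "roots \<subseteq> B" using root_integral by blast
  have specialB: "special \<subseteq> B" by (auto simp: special_def)
  have int_far: "of_nat j - of_nat i \<notin> max_ideal B" if "i \<noteq> j" "i < p" "j < p" for i j :: nat
  proof -
    have "\<not> int l dvd int j - int i"
      using that l(1) dvd_imp_le_int[of "int j - int i" "int l"] by auto
    thus ?thesis using B.of_int_max_ideal_iff[of "int j - int i"] by simp
  qed
  note f = witnessD[OF wit]
  obtain r where r: "f = (\<Sum>j<q. r j * Y ^ j)" "\<And>j. r j \<in> rat_funs" using f(1) by (auto simp: L_def)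
  obtain C n where N: "C \<noteq> 0" "Norm f = rat_fun C special n" "\<And>i. i < p \<Longrightarrow> n (of_nat i) = a i"
    using Norm_witness[OF wit] by blast
  have gC: "gauss_const B C special n = C"
    using specialB by (auto simp: gauss_const_def const_part_def intro!: prod.neutral)
  have reg: "(\<Sum>j<q. r j * Y ^ j) \<in> V" if V: "affine V b" for V b
  proof (cases "Y - of_int k \<in> max_ideal V")
    case True
    interpret affine_place p q k V b using V by (rule affineD)
    obtain i where i: "i < p" "b = of_nat i" using special_point[OF V True] by blast
    have "val_eq V f ((ff_x - of_nat i) powi a i)" using f(3)[of V i] i V True by simp
    moreover have "(ff_x - of_nat i) powi a i \<in> V"
      using max_ideal_powi(1)[OF z_max_ideal z_nonzero, of "a i"] pos[OF i(1)] i(2) by simp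
    ultimately show ?thesis using val_eq_ring_iff r(1) by blast
  next
    case False
    thus ?thesis using f(4)[OF V] r(1) by (simp add: val_units_def)
  qed
  have "\<exists>j<q. r j \<noteq> 0"
  proof (rule ccontr)
    assume "\<not> (\<exists>j<q. r j \<noteq> 0)"
    hence "f = 0" unfolding r(1) by (intro sum.neutral) auto
    thus False using f(2) by simp
  qed
  then obtain j0 where j0: "j0 < q" "r j0 \<noteq> 0" by blast
  \<comment> \<open>The index \<open>j\<close> is chosen by dominance at infinity, with respect to
    the place \<open>B\<close> above \<open>l\<close>.\<close>
  obtain W where W: "gauss_valuation_inf UNIV W B (inverse ff_x)"
    using gauss_valuation_inf_exists[OF VB] .
  interpret W: gauss_valuation_inf UNIV W B "inverse ff_x" by (rule W)
  interpret R: ramified_place p q k UNIV W B "inverse ff_x" "- int p"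
    by (rule ramified_place_inf[OF W rootsB UNIV_I])
  obtain j where j: "R.dominant r j" using R.ex_dominant[of r j0] r(2) j0 by blast
  hence jq: "j < q" "r j \<noteq> 0" by (auto simp: R.dominant_def)
  obtain c S m where rep: "finite S" "c \<noteq> 0" "r j = rat_fun c S m"
    using rat_fun_exists[OF r(2) jq(2)] .
  define g where "g = gauss_const B c S m"
  have g0: "g \<noteq> 0" using gauss_const_nonzero[OF rep(1,2)] by (simp add: g_def)
  have m: "m b \<ge> 0" if "b \<in> S" for b
    using regular_component[where r = r and j = j and c = c and S = S and n = m and b = b]
      r(2) jq(1) reg rep that by blast
  have "special \<inter> B = special" using specialB by auto
  hence NW: "val_eq W (Norm (\<Sum>j<q. r j * Y ^ j)) (ff_const C * inverse ff_x powi - (\<Sum>b\<in>special. n b))"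
    using W.rat_fun_val_eq_inf[of special C n] N(1,2) gC unfolding r(1)[symmetric] by simp
  have rW: "val_eq W (r j) (ff_const g * inverse ff_x powi - (\<Sum>b\<in>S \<inter> B. m b))"
    using W.rat_fun_val_eq_inf[OF rep(1,2), of m] unfolding g_def rep(3) .
  \<comment> \<open>\<open>g\<close> and \<open>C\<close> are independent of the point of the line.
    So this comparison, obtained at infinity, can be used at every \<open>x = i\<close>.\<close>
  have gC': "val_eq B (g ^ q) C"
    by (rule R.term_vs_Norm(1)[OF r(2) j jq(1) NW N(1) rW g0 refl])
  have inf: "int q * (- (\<Sum>b\<in>S \<inter> B. m b)) + (- int p) * int j = - (\<Sum>b\<in>special. n b)"
    by (rule R.term_vs_Norm(2)[OF r(2) j jq(1) NW N(1) rW g0 refl])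
  have sum_a: "(\<Sum>b\<in>special. n b) = (\<Sum>i<p. a i)"
    unfolding special_def using N(3) by (subst sum.reindex) (auto simp: inj_on_def)
  define M where "M i = (\<Sum>b\<in>{b\<in>S. b - of_nat i \<in> max_ideal B}. m b)" for i :: nat
  \<comment> \<open>The value of the \<open>j\<close>-th summand at \<open>x = i\<close> is at least
    that of the dominant summand there, whichever it is; \<open>M i\<close> is the order at
    \<open>i\<close> of the reduction of \<open>r j\<close>.\<close>
  have fin: "int q * M i + int j \<ge> a i" if i: "i < p" for i
  proof -
    obtain W' where W': "gauss_valuation_at UNIV W' B (ff_x - ff_const (of_nat i)) (of_nat i)"
      using gauss_valuation_at_exists[OF VB, of "of_nat i"] by blast
    interpret W': gauss_valuation_at UNIV W' B "ff_x - ff_const (of_nat i)" "of_nat i" by (rule W')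
    obtain h where h: "bij_betw h {..<p} roots" "\<And>i. i < p \<Longrightarrow> h i - of_nat i \<in> max_ideal B"
      using ladic_roots[OF pl l] by blast
    have "{b\<in>roots. b - of_nat i \<in> max_ideal B} = {h i}"
    proof (intro equalityI subsetI)
      fix b assume b: "b \<in> {b\<in>roots. b - of_nat i \<in> max_ideal B}"
      then obtain i' where i': "i' < p" "b = h i'" using h(1) by (auto simp: bij_betw_def)
      have "(h i' - of_nat i) - (h i' - of_nat i') \<in> max_ideal B"
        by (rule B.max_ideal_diff) (use b i' h(2) in auto)
      hence "i' = i" using int_far[of i i'] i i'(1) by auto
      thus "b \<in> {h i}" using i' by simp
    qed (use h i in \<open>auto simp: bij_betw_def\<close>)
    hence "card {b\<in>roots. b - of_nat i \<in> max_ideal B} = 1" by simp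
    then interpret R': ramified_place p q k UNIV W' B "ff_x - ff_const (of_nat i)" 1
      by (rule ramified_place_at[OF W' rootsB UNIV_I])
    obtain d where d: "R'.dominant r d" using R'.ex_dominant[of r j0] r(2) j0 by blast
    have "{b\<in>special. b - of_nat i \<in> max_ideal B} = {of_nat i}"
    proof (intro equalityI subsetI)
      fix b assume b: "b \<in> {b\<in>special. b - of_nat i \<in> max_ideal B}"
      then obtain i' where i': "i' < p" "b = of_nat i'" by (auto simp: special_def)
      thus "b \<in> {of_nat i}" using int_far[of i i'] b i by auto
    qed (use i in \<open>auto simp: special_def\<close>)
    hence NW': "val_eq W' (Norm (\<Sum>j<q. r j * Y ^ j)) (ff_const C * (ff_x - ff_const (of_nat i)) powi a i)"
      using W'.rat_fun_val_eq_at[of special C n] N gC i unfolding r(1)[symmetric] by simp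
    have rW': "val_eq W' (r j) (ff_const g * (ff_x - ff_const (of_nat i)) powi M i)"
      using W'.rat_fun_val_eq_at[OF rep(1,2), of m] unfolding g_def rep(3) M_def .
    show ?thesis using R'.term_vs_Norm(3)[OF r(2) d jq(1) NW' N(1) rW' g0 gC'] by simp
  qed
  \<comment> \<open>The zeros of \<open>r j\<close> reducing to some \<open>i < p\<close> are among
    its integral zeros. Leaving out the rest can only lower the sum, as \<open>m\<close> is
    nonnegative.\<close>
  have "(\<Sum>i<p. M i) \<le> (\<Sum>b\<in>S \<inter> B. m b)"
  proof -
    have "(\<Sum>i<p. M i) = sum m (\<Union>i\<in>{..<p}. {b\<in>S. b - of_nat i \<in> max_ideal B})"
      unfolding M_def
    proof (rule sum.UNION_disjoint[symmetric])
      show "\<forall>i\<in>{..<p}. \<forall>j\<in>{..<p}. i \<noteq> j \<longrightarrow>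
          {b\<in>S. b - of_nat i \<in> max_ideal B} \<inter> {b\<in>S. b - of_nat j \<in> max_ideal B} = {}"
      proof (intro ballI impI equals0I)
        fix i j b assume ij: "i \<in> {..<p}" "j \<in> {..<p}" "i \<noteq> j"
          "b \<in> {b\<in>S. b - of_nat i \<in> max_ideal B} \<inter> {b\<in>S. b - of_nat j \<in> max_ideal B}"
        have "(b - of_nat i) - (b - of_nat j) \<in> max_ideal B" by (rule B.max_ideal_diff) (use ij in auto)
        thus False using int_far[of i j] ij by auto
      qed
    qed (use rep(1) in auto)
    also have "\<dots> \<le> (\<Sum>b\<in>S \<inter> B. m b)"
    proof (rule sum_mono2)
      show "(\<Union>i\<in>{..<p}. {b\<in>S. b - of_nat i \<in> max_ideal B}) \<subseteq> S \<inter> B"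
      proof safe
        fix b i assume "b - of_nat i \<in> max_ideal B"
        from B.add_closed[OF B.max_idealD(1)[OF this] B.of_nat_closed[of i]] show "b \<in> B" by simp
      qed
    qed (use rep(1) m in auto)
    finally show ?thesis .
  qed
  hence "int q * (\<Sum>i<p. M i) \<le> int q * (\<Sum>b\<in>S \<inter> B. m b)" by (intro mult_left_mono) auto
  \<comment> \<open>By \<open>inf\<close> the sum of all \<open>a i\<close> is \<open>p * j\<close>
    plus \<open>q\<close> times the number of integral zeros of \<open>r j\<close>. The inequalities
    \<open>fin\<close>, added up, already reach this total, so each is an equality.\<close>
  hence "(\<Sum>i<p. int q * M i + int j) \<le> (\<Sum>i<p. a i)"
    using inf sum_a by (simp add: sum.distrib sum_distrib_left)
  hence "(\<Sum>i<p. int q * M i + int j - a i) = 0"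
    using sum_mono[of "{..<p}" a "\<lambda>i. int q * M i + int j"] fin by (simp add: sum_subtractf)
  hence *: "\<forall>i\<in>{..<p}. int q * M i + int j - a i = 0"
    using fin by (subst (asm) sum_nonneg_eq_0_iff) auto
  have "a i - int j = int q * M i" if "i < p" for i
    using bspec[OF *, of i] that by simp
  thus ?thesis by (intro exI[of _ "int j"]) auto
qed

text \<open>A power of \<open>Y - k\<close> raises all \<open>a i\<close> by the same
  \<open>M\<close>, chosen large enough to make them nonnegative; differences are
  unaffected.\<close>

lemma witness_congruent:
  assumes "divisor_witness a f" "i < p" "j < p"
  shows "int q dvd a i - a j"
proof -
  define M where "M = (\<Sum>i<p. \<bar>a i\<bar>)"
  have "divisor_witness (\<lambda>i. a i + M * 1) (f * (Y - of_int k) powi M)"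
    by (intro witness_mult assms(1) witness_power witness_Y)
  moreover have "a i + M * 1 \<ge> 0" if "i < p" for i
    using member_le_sum[of i "{..<p}" "\<lambda>i. \<bar>a i\<bar>"] that by (auto simp: M_def)
  ultimately obtain c where "\<forall>i<p. int q dvd a i + M * 1 - c" using witness_congruent_aux by blast
  hence "int q dvd a i + M * 1 - c" "int q dvd a j + M * 1 - c" using assms(2,3) by blast+
  from dvd_diff[OF this] show ?thesis by simp
qed

end

section \<open>Discreteness of the places\<close>

text \<open>Discreteness in terms of \<open>val_eq\<close>. The definition of
  \<open>curve_points\<close> does not include it, so it has to be established for each point before
  \<open>ord_at\<close> can be evaluated.\<close>

definition uniformizes :: "ambient set \<Rightarrow> ambient set \<Rightarrow> ambient \<Rightarrow> bool"
  where "uniformizes M V t \<longleftrightarrow> t \<in> M \<and> t \<noteq> 0 \<and> t \<in> max_ideal V \<and>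
    (\<forall>f\<in>M. f \<noteq> 0 \<longrightarrow> (\<exists>n. val_eq V f (t powi n)))"

lemma (in ramified_place) uniformizer_exists:
  assumes "B = UNIV" "L \<subseteq> L'"
  shows "\<exists>t\<in>L. val_eq V (t ^ q) z \<or> z \<notin> L" and
    "t \<in> L \<Longrightarrow> val_eq V (t ^ q) z \<Longrightarrow> uniformizes L V t"
proof -
  have *: "ff_const c \<in> val_units V" if "c \<noteq> 0" for c using const_unit[of c] that assms(1) by simp
  obtain a b where ab: "a * int q + b * e = 1" using coprime_e bezout_int[of "int q" e]
    by (metis coprime_commute coprime_imp_gcd_eq_1)
  have "val_eq V ((z powi a * Y powi b) ^ q) z"
  proof -
    have "(Y powi b) ^ q = (Y ^ q) powi b" by (metis mult.commute power_int_mult power_int_of_nat)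
    hence "val_eq V ((z powi a * Y powi b) ^ q) ((z powi a) ^ q * (z powi e) powi b)"
      unfolding power_mult_distrib using z_nonzero by (intro val_eq_mult) (auto intro: val_eq_powi Y_val)
    also have "(z powi a) ^ q * (z powi e) powi b = z powi (a * int q + b * e)"
      using z_nonzero by (simp add: power_int_add power_int_mult mult.commute[of b])
    finally show ?thesis using ab by simp
  qed
  thus "\<exists>t\<in>L. val_eq V (t ^ q) z \<or> z \<notin> L" by (cases "z \<in> L") auto
  assume t: "t \<in> L" "val_eq V (t ^ q) z"
  have t0: "t \<noteq> 0" using t(2) q_gt_0 z_nonzero val_eq_nonzero(1) by (metis zero_power)
  show "uniformizes L V t"
    unfolding uniformizes_def
  proof (intro conjI ballI impI)
    show "t \<in> max_ideal V"
      using root_max_ideal[of t q] t assms(2) val_eq_max_ideal_iff[OF t(2)] z_max_ideal by auto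
    fix f assume f: "f \<in> L" "f \<noteq> 0"
    then obtain r where r: "f = (\<Sum>j<q. r j * Y ^ j)" "\<And>j. r j \<in> rat_funs" by (auto simp: L_def)
    have "\<exists>j<q. r j \<noteq> 0"
    proof (rule ccontr)
      assume "\<not> (\<exists>j<q. r j \<noteq> 0)"
      hence "f = 0" unfolding r(1) by (intro sum.neutral) auto
      thus False using f(2) by simp
    qed
    then obtain d where d: "dominant r d" using ex_dominant[of r] r(2) by blast
    have "val_eq V (\<Sum>j<q. 1 * (r j * Y ^ j)) (r d * Y ^ d)" by (rule dominant_val_eq[OF d]) auto
    hence fd: "val_eq V f (r d * Y ^ d)" by (simp add: r(1))
    have "r d \<noteq> 0" using d by (simp add: dominant_def)
    then obtain c n where c: "c \<noteq> 0" "val_eq V (r d) (ff_const c * z powi n)"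
      using rat_val[OF r(2)] by blast
    define m where "m = int q * n + e * int d"
    have "val_eq V ((r d * Y ^ d) ^ q) (ff_const (c ^ q) * z powi m)"
      unfolding m_def by (rule term_val[OF c(2)])
    also have "val_eq V (ff_const (c ^ q) * z powi m) (z powi m)"
      using * c(1) z_nonzero by (intro val_eq_unit_mult) auto
    also have "val_eq V (z powi m) ((t ^ q) powi m)" using val_eq_powi val_eq_sym t(2) by blast
    also have "(t ^ q) powi m = (t powi m) ^ q" by (metis mult.commute power_int_mult power_int_of_nat)
    finally have "val_eq V (r d * Y ^ d) (t powi m)"
    proof (rule val_eq_root)
      show "r d * Y ^ d \<in> L'" using r(2) rat_funs_subset Y_in by blast
      show "t powi m \<in> L'" using t(1) assms(2) by blast
    qed simp
    thus "\<exists>n. val_eq V f (t powi n)" using fd val_eq_trans by blast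
  qed (use t t0 in auto)
qed

context affine_place
begin

lemma ramified_uniformizer:
  assumes "a \<in> roots"
  shows "uniformizes L V Y"
proof -
  have "{b \<in> roots. b - a \<in> max_ideal UNIV} = {a}" using assms by auto
  hence "card {b \<in> roots. b - a \<in> max_ideal UNIV} = 1" by simp
  then interpret R: ramified_place p q k L V UNIV "ff_x - ff_const a" 1
    by (intro ramified_place_at gauss_valuation_at_axioms) auto
  show ?thesis by (rule R.uniformizer_exists(2)) (use Y_value(1)[OF assms] in auto)
qed

text \<open>The cofactor of \<open>Y - c\<close> in \<open>Y ^ q - c ^ q\<close>. If
  \<open>c ^ q = F(b)\<close>, multiplication by it turns \<open>Y - c\<close> into a multiple of
  \<open>x - b\<close>.\<close>

definition conj_factor :: "qbar \<Rightarrow> ambient"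
  where "conj_factor c = (\<Sum>j<q. ff_const c ^ (q - Suc j) * Y ^ j)"

lemma conj_factor_mult: "(Y - ff_const c) * conj_factor c = Y ^ q - ff_const c ^ q"
  unfolding conj_factor_def by (rule power_diff_sumr2[symmetric])

lemma conj_factor_unit:
  assumes "Y - ff_const c \<in> max_ideal V" "c \<noteq> 0"
  shows "conj_factor c \<in> val_units V"
proof -
  have "Y ^ j - ff_const c ^ j \<in> max_ideal V" for j
    unfolding power_diff_sumr2 using assms(1) Y_ring by (intro max_ideal_mult sum_closed) auto
  hence "ff_const c ^ (q - Suc j) * (Y ^ j - ff_const c ^ j) \<in> max_ideal V" for j by blast
  hence "(\<Sum>j<q. ff_const c ^ (q - Suc j) * (Y ^ j - ff_const c ^ j)) \<in> max_ideal V" by blast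
  moreover have "conj_factor c = ff_const (of_nat q * c ^ (q - 1)) + (\<Sum>j<q. ff_const c ^ (q - Suc j) * (Y ^ j - ff_const c ^ j))"
  proof -
    have "(\<Sum>j<q. ff_const c ^ (q - Suc j) * ff_const c ^ j) = (\<Sum>j<q. ff_const c ^ (q - 1))"
      by (intro sum.cong) (auto simp flip: power_add)
    hence "(\<Sum>j<q. ff_const c ^ (q - Suc j) * ff_const c ^ j) = ff_const (of_nat q * c ^ (q - 1))" by simp
    thus ?thesis unfolding conj_factor_def by (simp only: right_diff_distrib sum_subtractf) simp
  qed
  moreover have "ff_const (of_nat q * c ^ (q - 1)) \<in> val_units V"
    by (rule const_units) (use q_gt_0 assms(2) in auto)
  ultimately show ?thesis using unit_add_max_ideal by simp
qed

end

section \<open>The coordinate ring K[x, Y] and the points with nonzero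
  \<open>y\<close>-coordinate\<close>

context curve
begin

definition coord_ring :: "ambient set"
  where "coord_ring = {poly P Y | P. P \<in> coeffs_in (range eval_x)}"

lemma coord_ring_conj: "g \<in> coord_ring \<Longrightarrow> (tau ^^ s) g \<in> coord_ring"
proof -
  assume "g \<in> coord_ring"
  then obtain P where P: "g = poly P Y" "P \<in> coeffs_in (range eval_x)" by (auto simp: coord_ring_def)
  define Q where "Q = (\<Sum>i\<le>Polynomial.degree P. Polynomial.monom (Polynomial.coeff P i * ff_const zeta ^ (s * i)) i)"
  have P_rat: "Polynomial.coeff P i \<in> rat_funs" for i
  proof -
    have "Polynomial.coeff P i \<in> range eval_x" using P(2) by (simp add: coeffs_in_def)
    thus ?thesis by auto
  qed
  have sr: "subring_set (range eval_x)"
  proof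
    show "1 \<in> range eval_x" by (metis eval_x_simps(2) rangeI)
  qed (auto simp flip: eval_x_simps)
  have "(tau ^^ s) g = poly Q Y"
    unfolding P(1) poly_altdef[of P]
    by (simp add: Q_def poly_sum poly_monom tau_n.hom_sum tau_n_Y P_rat power_mult_distrib mult_ac flip: power_mult)
  moreover have "Polynomial.coeff Q n \<in> range eval_x" for n
    unfolding Q_def Polynomial.coeff_sum coeff_monom using P(2)
    by (auto simp: coeffs_in_def ff_const_conv intro!: subring_set.sum_closed[OF sr] subring_set.mult_closed[OF sr]
        subring_set.power_closed[OF sr] subring_set.zero_closed[OF sr])
  ultimately show ?thesis by (auto simp: coord_ring_def coeffs_in_def)
qed

lemma coord_ring_fraction:
  assumes "f \<in> L"
  obtains g D where "g \<in> coord_ring" "D \<noteq> 0" "f = g / eval_x D"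
proof -
  obtain r where r: "f = (\<Sum>j<q. r j * Y ^ j)" "\<And>j. r j \<in> rat_funs" using assms by (auto simp: L_def)
  have "\<exists>P Q. r j = eval_x P / eval_x Q \<and> Q \<noteq> 0" for j using rat_funs_fraction[OF r(2)] by metis
  then obtain P Q where PQ: "\<And>j. r j = eval_x (P j) / eval_x (Q j)" "\<And>j. Q j \<noteq> 0" by metis
  define D where "D = (\<Prod>j<q. Q j)"
  define S where "S = (\<Sum>j<q. Polynomial.monom (eval_x (P j * (\<Prod>i\<in>{..<q} - {j}. Q i))) j)"
  have D0: "D \<noteq> 0" using PQ(2) by (simp add: D_def)
  have "r j * eval_x D = eval_x (P j * (\<Prod>i\<in>{..<q} - {j}. Q i))" if "j < q" for j
  proof -
    have "D = Q j * (\<Prod>i\<in>{..<q} - {j}. Q i)" unfolding D_def using that by (subst prod.remove[of _ j]) auto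
    thus ?thesis using PQ[of j] by simp
  qed
  hence "f * eval_x D = poly S Y"
    unfolding r(1) S_def poly_sum poly_monom sum_distrib_right by (intro sum.cong) (auto simp: mult_ac)
  moreover have "poly S Y \<in> coord_ring"
    unfolding coord_ring_def
  proof (intro CollectI exI conjI)
    have "Polynomial.coeff S n \<in> range eval_x" for n
    proof -
      have "Polynomial.coeff S n = (if n < q then eval_x (P n * (\<Prod>i\<in>{..<q} - {n}. Q i)) else eval_x 0)"
        unfolding S_def Polynomial.coeff_sum coeff_monom by auto
      thus ?thesis by (metis rangeI)
    qed
    thus "S \<in> coeffs_in (range eval_x)" by (auto simp: coeffs_in_def)
  qed simp
  ultimately show ?thesis using that[of "poly S Y" D] D0 by (simp add: field_simps)
qed

text \<open>The maximal ideal of the local ring at a point \<open>(b, c)\<close> with \<open>c \<noteq> 0\<close> is generated by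
  \<open>x - b\<close>, because \<open>conj_factor c\<close> is a unit there.\<close>

lemma local_division:
  assumes "affine V b" "c ^ q = poly FK b" "g \<in> coord_ring"
  shows "\<exists>d g'. g' \<in> coord_ring \<and> affine_place.conj_factor p q k c * (g - ff_const d) = (ff_x - ff_const b) * g'"
proof -
  interpret affine_place p q k V b using assms(1) by (rule affineD)
  have sr: "subring_set (range eval_x)"
  proof
    show "1 \<in> range eval_x" by (metis eval_x_simps(2) rangeI)
  qed (auto simp flip: eval_x_simps)
  interpret C: subring_set coord_ring
  proof
    show "1 \<in> coord_ring" unfolding coord_ring_def
      by (intro CollectI exI[of _ 1]) (auto simp: coeffs_in_def coeff_pCons one_pCons subring_set.zero_closed[OF sr]
        subring_set.one_closed[OF sr] split: nat.splits)
    fix f g assume "f \<in> coord_ring" "g \<in> coord_ring"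
    then obtain P Q where PQ: "f = poly P Y" "g = poly Q Y" "P \<in> coeffs_in (range eval_x)" "Q \<in> coeffs_in (range eval_x)"
      by (auto simp: coord_ring_def)
    show "f - g \<in> coord_ring" unfolding coord_ring_def using PQ
      by (intro CollectI exI[of _ "P - Q"]) (auto simp: coeffs_in_def intro!: subring_set.diff_closed[OF sr])
    show "f * g \<in> coord_ring" unfolding coord_ring_def using PQ
      by (intro CollectI exI[of _ "P * Q"]) (auto simp: coeffs_in_def coeff_mult
        intro!: subring_set.sum_closed[OF sr] subring_set.mult_closed[OF sr])
  qed
  have eval_C: "eval_x P \<in> coord_ring" for P unfolding coord_ring_def
    by (intro CollectI exI[of _ "[:eval_x P:]"]) (auto simp: coeffs_in_def coeff_pCons subring_set.zero_closed[OF sr] split: nat.splits)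
  have Y_C: "Y \<in> coord_ring" unfolding coord_ring_def
    by (intro CollectI exI[of _ "[:0, 1:]"]) (auto simp: coeffs_in_def coeff_pCons
        subring_set.zero_closed[OF sr] subring_set.one_closed[OF sr] split: nat.splits)
  have const_C: "ff_const d \<in> coord_ring" for d using eval_C[of "[:d:]"] by (simp add: ff_const_conv)
  define U where "U = conj_factor c"
  have U_C: "U \<in> coord_ring" unfolding U_def conj_factor_def
    using const_C Y_C by (intro C.sum_closed C.mult_closed C.power_closed)
  have lin: "\<exists>R'. eval_x R - ff_const (poly R b) = (ff_x - ff_const b) * eval_x R'" for R
  proof -
    have "poly (R - [:poly R b:]) b = 0" by simp
    then obtain R' where "R - [:poly R b:] = [:- b, 1:] * R'" unfolding poly_eq_0_iff_dvd by blast
    hence "eval_x (R - [:poly R b:]) = eval_x ([:- b, 1:] * R')" by simp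
    thus ?thesis unfolding eval_x_simps eval_x_linear ff_const_conv by blast
  qed
  obtain F1 where F1: "U * (Y - ff_const c) = (ff_x - ff_const b) * eval_x F1"
    using lin[of FK] conj_factor_mult[of c] assms(2)
    by (auto simp: U_def Y_power mult.commute simp flip: ff_const.hom_power)
  obtain P where P: "g = poly P Y" "P \<in> coeffs_in (range eval_x)" using assms(3) by (auto simp: coord_ring_def)
  have "\<exists>d g'. g' \<in> coord_ring \<and> U * (poly P Y - ff_const d) = (ff_x - ff_const b) * g'"
    using P(2)
  proof (induction P)
    case 0
    show ?case by (intro exI[of _ 0]) auto
  next
    case (pCons a P)
    have "Polynomial.coeff P n \<in> range eval_x" for n
      using pCons.prems by (auto simp: coeffs_in_def dest: spec[of _ "Suc n"])
    hence "P \<in> coeffs_in (range eval_x)" by (simp add: coeffs_in_def)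
    then obtain d g' where g': "g' \<in> coord_ring" "U * (poly P Y - ff_const d) = (ff_x - ff_const b) * g'"
      using pCons.IH by blast
    obtain R where R: "a = eval_x R" using pCons.prems by (auto simp: coeffs_in_def dest: spec[of _ 0])
    obtain R' where R': "eval_x R - ff_const (poly R b) = (ff_x - ff_const b) * eval_x R'" using lin by blast
    have mem: "U * eval_x R' + Y * g' + ff_const d * eval_x F1 \<in> coord_ring"
      using U_C eval_C Y_C g'(1) const_C by (intro C.add_closed C.mult_closed)
    have "U * (poly (pCons a P) Y - ff_const (poly R b + c * d)) =
      U * (eval_x R - ff_const (poly R b)) + Y * (U * (poly P Y - ff_const d)) + ff_const d * (U * (Y - ff_const c))"
      by (simp add: R algebra_simps)
    also have "\<dots> = (ff_x - ff_const b) * (U * eval_x R' + Y * g' + ff_const d * eval_x F1)"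
      unfolding R' g'(2) F1 by (simp add: algebra_simps)
    finally show ?case using mem by blast
  qed
  thus ?thesis using P(1) by (simp add: U_def)
qed

text \<open>\<open>local_division\<close> splits off factors \<open>x - b\<close> until a nonzero
  residue remains. The exponent comes from identities in the coordinate ring and is thus the same
  for all valuation rings above \<open>(b, c)\<close>; this yields discreteness and uniqueness of
  the point at once.\<close>

lemma unramified_order:
  assumes V: "affine V b" "Y - ff_const c \<in> max_ideal V" and c: "c ^ q = poly FK b" "c \<noteq> 0"
    and f: "f \<in> L" "f \<noteq> 0"
  shows "\<exists>n. \<forall>V'. affine V' b \<longrightarrow> Y - ff_const c \<in> max_ideal V' \<longrightarrow> val_eq V' f ((ff_x - ff_const b) powi n)"
proof -
  interpret affine_place p q k V b using V(1) by (rule affineD)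
  define U where "U = conj_factor c"
  have coord_V: "g \<in> V'" if gC: "g \<in> coord_ring" and "affine V' b" for g V'
  proof -
    interpret V': affine_place p q k V' b using \<open>affine V' b\<close> by (rule affineD)
    obtain P where P: "g = poly P Y" "P \<in> coeffs_in (range eval_x)" using gC by (auto simp: coord_ring_def)
    have "Polynomial.coeff P n \<in> V'" for n
    proof -
      have "Polynomial.coeff P n \<in> range eval_x" using P(2) by (simp add: coeffs_in_def)
      then obtain R where "Polynomial.coeff P n = eval_x R" by blast
      thus ?thesis using V'.eval_x_ring[of R] by simp
    qed
    thus ?thesis unfolding P(1) poly_altdef by (intro V'.sum_closed V'.mult_closed V'.power_closed V'.Y_ring)
  qed
  have U: "U \<in> val_units V'" if "affine V' b" "Y - ff_const c \<in> max_ideal V'" for V'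
  proof -
    interpret V': affine_place p q k V' b using that(1) by (rule affineD)
    show ?thesis unfolding U_def using V'.conj_factor_unit[OF that(2) c(2)] .
  qed
  \<comment> \<open>\<open>N\<close> bounds the order of \<open>g\<close> at the given
    \<open>V\<close> and makes the process terminate.\<close>
  have main: "\<exists>n::nat. \<forall>V'. affine V' b \<longrightarrow> Y - ff_const c \<in> max_ideal V' \<longrightarrow> val_eq V' g ((ff_x - ff_const b) ^ n)"
    if "g \<in> coord_ring" "g \<noteq> 0" "(ff_x - ff_const b) ^ N / g \<in> V" for g N
    using that
  proof (induction N arbitrary: g)
    case (0 g)
    show ?case
    proof (intro exI[of _ 0] allI impI)
      fix V' assume V': "affine V' b" "Y - ff_const c \<in> max_ideal V'"
      interpret V': affine_place p q k V' b using V'(1) by (rule affineD)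
      obtain d g' where g': "g' \<in> coord_ring" "U * (g - ff_const d) = (ff_x - ff_const b) * g'"
        using local_division[OF V(1) c(1) 0(1)] by (auto simp: U_def)
      have "d \<noteq> 0"
      proof
        assume "d = 0"
        hence "U * g = (ff_x - ff_const b) * g'" using g'(2) by simp
        hence "U * g \<in> max_ideal V" using z_max_ideal coord_V[OF g'(1) V(1)] by auto
        hence "g \<in> max_ideal V" using U[OF V] coord_V[OF 0(1) V(1)] prime_max_ideal[of U g] max_idealD(2)
          by (auto simp: val_units_def max_ideal_def)
        moreover have "inverse g \<in> V" using 0(3) by (simp add: divide_inverse)
        ultimately show False using 0(2) max_idealD(3) by blast
      qed
      have "U * (g - ff_const d) \<in> max_ideal V'"
        unfolding g'(2) using V'.z_max_ideal coord_V[OF g'(1) V'(1)] by auto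
      moreover have "g - ff_const d \<in> V'" using coord_V[OF 0(1) V'(1)] by auto
      ultimately have "g - ff_const d \<in> max_ideal V'"
        using U[OF V'] V'.prime_max_ideal[of U "g - ff_const d"] V'.max_idealD(2) V'.unitD(1) by blast
      hence "ff_const d + (g - ff_const d) \<in> val_units V'" using V'.const_units[OF \<open>d \<noteq> 0\<close>] by blast
      thus "val_eq V' g ((ff_x - ff_const b) ^ 0)" by (simp add: V'.val_eq_one_iff)
    qed
  next
    case (Suc N g)
    obtain d g' where g': "g' \<in> coord_ring" "U * (g - ff_const d) = (ff_x - ff_const b) * g'"
      using local_division[OF V(1) c(1) Suc.prems(1)] by (auto simp: U_def)
    show ?case
    proof (cases "d = 0")
      case False
      show ?thesis
      proof (intro exI[of _ 0] allI impI)
        fix V' assume V': "affine V' b" "Y - ff_const c \<in> max_ideal V'"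
        interpret V': affine_place p q k V' b using V'(1) by (rule affineD)
        have "U * (g - ff_const d) \<in> max_ideal V'"
          unfolding g'(2) using V'.z_max_ideal coord_V[OF g'(1) V'(1)] by auto
        moreover have "g - ff_const d \<in> V'" using coord_V[OF Suc.prems(1) V'(1)] by auto
        ultimately have "g - ff_const d \<in> max_ideal V'"
          using U[OF V'] V'.prime_max_ideal[of U "g - ff_const d"] V'.max_idealD(2) V'.unitD(1) by blast
        hence "ff_const d + (g - ff_const d) \<in> val_units V'" using V'.const_units[OF False] by blast
        thus "val_eq V' g ((ff_x - ff_const b) ^ 0)" by (simp add: V'.val_eq_one_iff)
      qed
    next
      case True
      have U0: "U \<noteq> 0" "inverse U \<in> V" using U[OF V] unitD by auto
      have g_eq: "g = (ff_x - ff_const b) * g' / U" using g'(2) True U0(1) by (simp add: field_simps)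
      have g'0: "g' \<noteq> 0" using Suc.prems(2) g_eq by auto
      have "w ^ N / g' = w ^ Suc N / (w * g' / U) * inverse U" if "w \<noteq> 0" for w
        using U0(1) g'0 that by (simp add: field_simps)
      from this[OF z_nonzero] have eq: "(ff_x - ff_const b) ^ N / g' = (ff_x - ff_const b) ^ Suc N / g * inverse U"
        unfolding g_eq .
      have "(ff_x - ff_const b) ^ N / g' \<in> V" unfolding eq by (rule mult_closed[OF Suc.prems(3) U0(2)])
      from Suc.IH[OF g'(1) g'0 this] obtain n where n: "\<And>V'. affine V' b \<Longrightarrow> Y - ff_const c \<in> max_ideal V' \<Longrightarrow>
        val_eq V' g' ((ff_x - ff_const b) ^ n)" by blast
      show ?thesis
      proof (intro exI[of _ "Suc n"] allI impI)
        fix V' assume V': "affine V' b" "Y - ff_const c \<in> max_ideal V'"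
        interpret V': affine_place p q k V' b using V'(1) by (rule affineD)
        have "val_eq V' ((ff_x - ff_const b) * g' / U) ((ff_x - ff_const b) * (ff_x - ff_const b) ^ n / 1)"
          by (intro V'.val_eq_divide V'.val_eq_mult n V' V'.val_eq_refl) (use U[OF V'] V'.val_eq_one_iff in auto)
        thus "val_eq V' g ((ff_x - ff_const b) ^ Suc n)" using g_eq by simp
      qed
    qed
  qed
  obtain g D where gD: "g \<in> coord_ring" "D \<noteq> 0" "f = g / eval_x D" using coord_ring_fraction[OF f(1)] .
  have g0: "g \<noteq> 0" using gD(3) f(2) by auto
  have gL: "g \<in> L"
  proof -
    have "g = f * eval_x D" using gD by simp
    thus ?thesis using f(1) rat_funs_subset_L by auto
  qed
  obtain C S n where N: "finite S" "C \<noteq> 0" "Norm g = rat_fun C S n"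
    using rat_fun_exists[OF Norm_rat[OF gL]] g0 Norm_eq_0_iff by metis
  define m where "m = (if b \<in> S then n b else 0)"
  have Nv: "val_eq V (Norm g) ((ff_x - ff_const b) powi m)"
    unfolding N(3) m_def by (rule rat_fun_val[OF N(1,2)])
  have conj_V: "(tau ^^ s) g \<in> V" for s using coord_V[OF coord_ring_conj[OF gD(1)] V(1)] .
  have "Norm g \<in> V" unfolding Norm_def using conj_V by blast
  hence "m \<ge> 0" using val_eq_ring_iff[OF Nv] max_ideal_powi(1)[OF z_max_ideal z_nonzero] by simp
  \<comment> \<open>The bound comes from the norm: the other conjugates of \<open>g\<close> are
    regular, so the order of \<open>g\<close> is at most that of \<open>Norm g\<close>, a function
    of \<open>x\<close> alone.\<close>
  have "Norm g / g = (\<Prod>s\<in>{..<q} - {0}. (tau ^^ s) g)"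
    unfolding Norm_def using g0 by (subst prod.remove[of _ 0]) auto
  hence "Norm g / g \<in> V" using conj_V by auto
  moreover have "val_eq V (Norm g / g) ((ff_x - ff_const b) powi m / g)"
    using g0 by (intro val_eq_divide Nv) auto
  ultimately have "(ff_x - ff_const b) powi m / g \<in> V" using val_eq_ring_iff by blast
  hence "(ff_x - ff_const b) ^ nat m / g \<in> V" using \<open>m \<ge> 0\<close> by (simp add: power_int_def)
  from main[OF gD(1) g0 this] obtain n1 where n1: "\<And>V'. affine V' b \<Longrightarrow> Y - ff_const c \<in> max_ideal V' \<Longrightarrow>
      val_eq V' g ((ff_x - ff_const b) ^ n1)" by blast
  obtain d T n2 where D: "finite T" "d \<noteq> 0" "eval_x D = rat_fun d T n2" using polynomial_rat_fun[OF gD(2)] .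
  show ?thesis
  proof (intro exI[of _ "int n1 - (if b \<in> T then n2 b else 0)"] allI impI)
    fix V' assume V': "affine V' b" "Y - ff_const c \<in> max_ideal V'"
    interpret V': affine_place p q k V' b using V'(1) by (rule affineD)
    have "val_eq V' (g / eval_x D) ((ff_x - ff_const b) ^ n1 / (ff_x - ff_const b) powi (if b \<in> T then n2 b else 0))"
      unfolding D(3) by (intro V'.val_eq_divide n1 V' V'.rat_fun_val D)
    thus "val_eq V' f ((ff_x - ff_const b) powi (int n1 - (if b \<in> T then n2 b else 0)))"
      using gD(3) z_nonzero by (simp add: power_int_diff)
  qed
qed

lemma unramified_uniformizer:
  assumes "affine V b" "b \<notin> roots"
  shows "uniformizes L V (ff_x - ff_const b)"
proof -
  interpret affine_place p q k V b using assms(1) by (rule affineD)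
  obtain c where c: "c ^ q = poly FK b" "Y - ff_const c \<in> max_ideal V" using Y_residue by blast
  have "c \<noteq> 0" using c(1) assms(2) q_gt_0 by (auto simp: roots_def zero_power)
  show ?thesis unfolding uniformizes_def
  proof (intro conjI ballI impI z_nonzero z_max_ideal z_in)
    fix f assume f: "f \<in> L" "f \<noteq> 0"
    show "\<exists>n. val_eq V f ((ff_x - ff_const b) powi n)"
      using unramified_order[OF assms(1) c(2,1) \<open>c \<noteq> 0\<close> f] assms(1) c(2) by blast
  qed
qed

lemma affine_uniformizer:
  assumes "affine V b"
  shows "\<exists>t. uniformizes L V t"
  using unramified_uniformizer[OF assms] affine_place.ramified_uniformizer[OF affineD[OF assms]] by blast

lemma unramified_place_unique:
  assumes "affine V b" "affine V' b" "Y - ff_const c \<in> max_ideal V" "Y - ff_const c \<in> max_ideal V'"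
    and "c ^ q = poly FK b" "c \<noteq> 0"
  shows "V = V'"
proof -
  have "V \<subseteq> V'" if V: "affine V b" "affine V' b" "Y - ff_const c \<in> max_ideal V" "Y - ff_const c \<in> max_ideal V'" for V V'
  proof
    interpret affine_place p q k V b using V(1) by (rule affineD)
    interpret V': affine_place p q k V' b using V(2) by (rule affineD)
    fix f assume f: "f \<in> V"
    show "f \<in> V'"
    proof (cases "f = 0")
      case False
      obtain n where n: "\<And>V'. affine V' b \<Longrightarrow> Y - ff_const c \<in> max_ideal V' \<Longrightarrow> val_eq V' f ((ff_x - ff_const b) powi n)"
        using unramified_order[OF V(1,3) assms(5,6)] f False subset by blast
      have "n \<ge> 0" using val_eq_ring_iff[OF n[OF V(1,3)]] f max_ideal_powi(1)[OF z_max_ideal z_nonzero] by simp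
      thus ?thesis using V'.val_eq_ring_iff[OF n[OF V(2,4)]] V'.max_ideal_powi(1)[OF V'.z_max_ideal z_nonzero] by simp
    qed auto
  qed
  thus ?thesis using assms(1-4) by blast
qed

lemma infinite_uniformizer:
  assumes "gauss_valuation_inf L V UNIV (inverse ff_x)"
  shows "\<exists>t. uniformizes L V t"
proof -
  interpret R: ramified_place p q k L V UNIV "inverse ff_x" "- int p"
    by (rule ramified_place_inf[OF assms]) auto
  have "inverse ff_x \<in> L" by auto
  thus ?thesis using R.uniformizer_exists by blast
qed

end

section \<open>The Galois action on the roots of \<open>F\<close>\<close>

text \<open>Constants are algebraic over the rationals, which every embedding fixes.\<close>

lemma embedding_const:
  assumes "field_embedding (g :: ambient \<Rightarrow> ambient)"
  shows "g (ff_const c) \<in> range ff_const"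
proof -
  interpret g: field_embedding g by fact
  obtain P :: "rat poly" where P: "P \<noteq> 0" "poly (map_poly to_ac P) c = 0"
    using alg_closure_algebraic .
  define P' where "P' = map_poly ff_const (map_poly to_ac P)"
  have "g (of_rat r) = of_rat r" for r by (cases r) (simp add: Fract_of_int_quotient of_rat_divide)
  hence fix_P': "map_poly g P' = P'"
    by (simp add: P'_def poly_eq_iff coeff_map_poly of_rat_ambient)
  have "poly P' (ff_const c) = 0"
    using ff_const.hom_poly[of "map_poly to_ac P" c] P(2) by (simp add: P'_def)
  hence "poly P' (g (ff_const c)) = 0"
    using g.hom_poly[of P' "ff_const c"] fix_P' by simp
  thus ?thesis unfolding P'_def by (rule algebraic_over_const[rotated]) (use P(1) in \<open>simp add: map_poly_eq_0_iff\<close>)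
qed

definition const_action :: "(ambient \<Rightarrow> ambient) \<Rightarrow> qbar \<Rightarrow> qbar"
  where "const_action g c = inv_into UNIV ff_const (g (ff_const c))"

lemma ff_const_action: "field_embedding g \<Longrightarrow> ff_const (const_action g c) = g (ff_const c)"
  unfolding const_action_def by (rule f_inv_into_f) (rule embedding_const)

lemma const_action_eqI: "g (ff_const c) = ff_const d \<Longrightarrow> const_action g c = d"
  unfolding const_action_def by (simp add: inv_into_f_eq inj_def)

lemma const_action_embedding:
  assumes "field_embedding g"
  shows "field_embedding (const_action g)"
proof -
  interpret g: field_embedding g by fact
  show ?thesis
    by unfold_locales (rule const_action_eqI, simp add: ff_const_action[OF assms])+
qed

lemma const_action_comp:
  "field_embedding g \<Longrightarrow> field_embedding h \<Longrightarrow> const_action (g \<circ> h) = const_action g \<circ> const_action h"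
  by (rule ext, rule const_action_eqI) (simp add: ff_const_action)

lemma const_action_id: "const_action id = id"
  by (rule ext, rule const_action_eqI) simp

lemma const_action_funpow: "field_embedding g \<Longrightarrow> const_action (g ^^ n) = const_action g ^^ n"
  by (induction n) (simp_all add: const_action_comp field_embedding_funpow const_action_id)

context curve
begin

lemma sigmasD: "g \<in> sigmas \<Longrightarrow> field_embedding g" "g \<in> sigmas \<Longrightarrow> g ff_x = ff_x" "g \<in> sigmas \<Longrightarrow> g Y = Y"
  by (auto simp: sigmas_def)

lemma sigmas_comp: "g \<in> sigmas \<Longrightarrow> h \<in> sigmas \<Longrightarrow> g \<circ> h \<in> sigmas"
  by (auto simp: sigmas_def intro: field_embedding_comp)

lemma sigmas_id: "id \<in> sigmas"
  by (auto simp: sigmas_def field_embedding_id)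

lemma sigmas_funpow: "g \<in> sigmas \<Longrightarrow> g ^^ n \<in> sigmas"
  by (induction n) (auto intro: sigmas_comp sigmas_id)

lemma const_action_FK:
  assumes "field_embedding g"
  shows "const_action g (poly FK a) = poly FK (const_action g a)"
proof -
  interpret g: field_embedding "const_action g" by (rule const_action_embedding[OF assms])
  show ?thesis by (simp add: poly_FK G_def g.hom_prod)
qed

lemma const_action_roots:
  assumes "field_embedding g" "a \<in> roots"
  shows "const_action g a \<in> roots"
proof -
  interpret g: field_embedding "const_action g" by (rule const_action_embedding[OF assms(1)])
  show ?thesis using const_action_FK[OF assms(1), of a] assms(2) by (simp add: roots_def)
qed

lemma root_of_unity_qbar: "(c :: qbar) ^ q = 1 \<Longrightarrow> \<exists>e<q. c = zeta ^ e"
  using root_of_unity[of "ff_const c"] by (metis ff_const.hom_eq_iff ff_const.hom_one ff_const.hom_power)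

text \<open>The action is injective on the finite set of roots of \<open>F\<close> and powers of
  \<open>zeta\<close>, so some positive power \<open>N + 1\<close> of it is trivial there. Hence
  \<open>g ^^ N\<close> serves as an inverse of \<open>g\<close>, and \<open>sigmas\<close> can be
  treated like a group although its elements are not assumed invertible.\<close>

lemma const_action_finite_order:
  assumes "field_embedding g"
  obtains N where "const_action g ((const_action g ^^ N) zeta) = zeta"
    "\<And>a. a \<in> roots \<Longrightarrow> (const_action g ^^ N) (const_action g a) = a"
    "\<And>a. a \<in> roots \<Longrightarrow> const_action g ((const_action g ^^ N) a) = a"
    "(const_action g ^^ N) (const_action g zeta) = zeta"
proof -
  define s where "s = const_action g"
  interpret s: field_embedding s unfolding s_def by (rule const_action_embedding[OF assms])
  define Z where "Z = roots \<union> (\<lambda>e. zeta ^ e) ` {..<q}"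
  have finZ: "finite Z" by (simp add: Z_def)
  have sZ: "s z \<in> Z" if zz: "z \<in> Z" for z
  proof (cases "z \<in> roots")
    case True
    thus ?thesis using const_action_roots[OF assms] by (simp add: s_def Z_def)
  next
    case False
    then obtain e where e: "z = zeta ^ e" using zz by (auto simp: Z_def)
    have "(s z) ^ q = s ((zeta ^ q) ^ e)" unfolding e s.hom_power by (simp flip: power_mult add: mult.commute)
    hence "(s z) ^ q = 1" using zeta by simp
    thus ?thesis using root_of_unity_qbar unfolding Z_def by blast
  qed
  have "\<exists>n>0. (s ^^ n) z = z" if "z \<in> Z" for z
  proof -
    have "(s ^^ n) z \<in> Z" for n by (induction n) (auto simp: that sZ)
    hence "finite {y. \<exists>n. y = (s ^^ n) z}" by (intro finite_subset[OF _ finZ]) auto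
    moreover have "inj s" by (simp add: inj_def)
    ultimately show ?thesis using funpow_inj_finite by metis
  qed
  then obtain n where n: "\<And>z. z \<in> Z \<Longrightarrow> n z > 0" "\<And>z. z \<in> Z \<Longrightarrow> (s ^^ n z) z = z" by metis
  define M where "M = (\<Prod>z\<in>Z. n z)"
  have "M > 0" unfolding M_def using n(1) by (intro prod_pos) auto
  then obtain N where N: "M = Suc N" by (cases M) auto
  have fixM: "(s ^^ M) z = z" if "z \<in> Z" for z
  proof -
    have "n z dvd M" unfolding M_def by (rule dvd_prodI[OF finZ that])
    then obtain m where "M = n z * m" by (rule dvdE)
    moreover have "((s ^^ n z) ^^ i) z = z" for i using n(2)[OF that] by (induction i) auto
    ultimately show ?thesis by (simp flip: funpow_mult)
  qed
  have "zeta ^ 1 \<in> Z" using q_gt_1 unfolding Z_def by blast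
  hence zZ: "zeta \<in> Z" by simp
  show ?thesis
  proof (rule that[of N])
    show "const_action g ((const_action g ^^ N) zeta) = zeta" using fixM[OF zZ] by (simp add: N s_def)
    show "(const_action g ^^ N) (const_action g zeta) = zeta" using fixM[OF zZ] by (simp only: N s_def funpow_Suc_right comp_def)
    fix a assume "a \<in> roots"
    hence a: "a \<in> Z" by (simp add: Z_def)
    show "(const_action g ^^ N) (const_action g a) = a" using fixM[OF a] by (simp only: N s_def funpow_Suc_right comp_def)
    show "const_action g ((const_action g ^^ N) a) = a" using fixM[OF a] by (simp add: N s_def)
  qed
qed

text \<open>Fixing \<open>zeta\<close> makes these embeddings commute with \<open>tau\<close> on
  \<open>L\<close>.\<close>

definition sigmas1 :: "(ambient \<Rightarrow> ambient) set"
  where "sigmas1 = {g \<in> sigmas. const_action g zeta = zeta}"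

lemma zeta_conjugate: "field_embedding g \<Longrightarrow> \<exists>e<q. const_action g zeta = zeta ^ e"
proof -
  assume g: "field_embedding g"
  interpret g: field_embedding "const_action g" by (rule const_action_embedding[OF g])
  show ?thesis using root_of_unity_qbar[of "const_action g zeta"] zeta(1) by (simp flip: g.hom_power)
qed

text \<open>The group fixing \<open>zeta\<close> is normal with a quotient of order less than \<open>q < p\<close>. Its orbits on the
  \<open>p\<close> roots of \<open>F\<close> have the same size, so there is only one.\<close>

lemma sigmas1_transitive:
  assumes a: "a \<in> roots" and b: "b \<in> roots"
  shows "\<exists>g\<in>sigmas1. const_action g a = b"
proof -
  define orb where "orb x = (\<lambda>g. const_action g x) ` sigmas1" for x
  have orb_roots: "orb x \<subseteq> roots" if "x \<in> roots" for x
    using that const_action_roots sigmasD(1) by (auto simp: orb_def sigmas1_def)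
  have comp1: "g \<circ> h \<in> sigmas1" if "g \<in> sigmas1" "h \<in> sigmas1" for g h
    using that sigmas_comp by (auto simp: sigmas1_def const_action_comp sigmasD(1))
  have id1: "id \<in> sigmas1" by (simp add: sigmas1_def sigmas_id const_action_id)
  have pow1: "g ^^ n \<in> sigmas1" if "g \<in> sigmas1" for g n
  proof (induction n)
    case 0
    show ?case unfolding funpow.simps by (rule id1)
  next
    case (Suc n)
    show ?case unfolding funpow.simps by (rule comp1[OF that Suc])
  qed
  have orb_self: "x \<in> orb x" for x
    unfolding orb_def using id1 by (metis const_action_id id_apply image_eqI)
  have orb_trans: "orb y \<subseteq> orb x" if y: "y \<in> orb x" for x y
  proof
    fix z assume "z \<in> orb y"
    then obtain g h where gh: "g \<in> sigmas1" "h \<in> sigmas1" "y = const_action g x" "z = const_action h y"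
      using y by (auto simp: orb_def)
    have "z = const_action (h \<circ> g) x" using gh by (simp add: const_action_comp sigmas1_def sigmasD(1))
    thus "z \<in> orb x" using comp1[OF gh(2,1)] by (auto simp: orb_def)
  qed
  have orb_sym: "x \<in> orb y" if x: "x \<in> roots" and y: "y \<in> orb x" for x y
  proof -
    obtain g where g: "g \<in> sigmas1" "y = const_action g x" using y by (auto simp: orb_def)
    have ge: "field_embedding g" using g(1) sigmasD(1) by (simp add: sigmas1_def)
    obtain N where N: "\<And>a. a \<in> roots \<Longrightarrow> (const_action g ^^ N) (const_action g a) = a"
      using const_action_finite_order[OF ge] by metis
    have "x = const_action (g ^^ N) y" using N[OF x] g(2) by (simp add: const_action_funpow[OF ge])
    thus ?thesis using pow1[OF g(1)] by (auto simp: orb_def)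
  qed
  have orb_eq: "orb x = orb y" if "x \<in> roots" "y \<in> orb x" for x y
    using orb_trans[OF that(2)] orb_trans[OF orb_sym[OF that]] by blast
  \<comment> \<open>Normality: conjugating \<open>h\<close> by \<open>g\<close>, with
    \<open>g ^^ N\<close> as inverse, gives an element that fixes \<open>zeta\<close>, because
    \<open>h\<close> fixes all powers of \<open>zeta\<close>. Hence \<open>g\<close> maps orbits
    into orbits.\<close>
  have conj: "const_action g ` orb x \<subseteq> orb (const_action g x)" if g: "g \<in> sigmas" and x: "x \<in> roots" for g x
  proof safe
    fix y assume "y \<in> orb x"
    then obtain h where h: "h \<in> sigmas1" "y = const_action h x" by (auto simp: orb_def)
    have ge: "field_embedding g" and he: "field_embedding h" using g h sigmasD(1) by (auto simp: sigmas1_def)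
    obtain N where N: "const_action g ((const_action g ^^ N) zeta) = zeta"
      "\<And>a. a \<in> roots \<Longrightarrow> (const_action g ^^ N) (const_action g a) = a"
      using const_action_finite_order[OF ge] by metis
    define h' where "h' = g \<circ> (h \<circ> g ^^ N)"
    have h'_act: "const_action h' = const_action g \<circ> (const_action h \<circ> const_action g ^^ N)"
      by (simp add: h'_def const_action_comp const_action_funpow ge he field_embedding_comp field_embedding_funpow)
    obtain e where e: "(const_action g ^^ N) zeta = zeta ^ e"
      using zeta_conjugate[OF field_embedding_funpow[OF ge, of N]] by (auto simp: const_action_funpow[OF ge])
    interpret hh: field_embedding "const_action h" by (rule const_action_embedding[OF he])
    have "const_action h (zeta ^ e) = zeta ^ e" using h(1) by (simp add: sigmas1_def)
    hence "const_action h' zeta = zeta" using N(1) by (simp add: h'_act e)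
    moreover have "h' \<in> sigmas" unfolding h'_def using g h(1) by (intro sigmas_comp sigmas_funpow) (auto simp: sigmas1_def)
    ultimately have "h' \<in> sigmas1" by (simp add: sigmas1_def)
    moreover have "const_action h' (const_action g x) = const_action g y" using N(2)[OF x] h(2) by (simp add: h'_act)
    ultimately show "const_action g y \<in> orb (const_action g x)" unfolding orb_def by (metis image_eqI)
  qed
  have transitive: "\<exists>g\<in>sigmas. const_action g x = y" if "x \<in> roots" "y \<in> roots" for x y
    using sigmas_transitive[OF that] const_action_eqI by metis
  have fin_orb: "finite (orb x)" if "x \<in> roots" for x using orb_roots[OF that] finite_roots finite_subset by blast
  have card_le: "card (orb x) \<le> card (orb y)" if xy: "x \<in> roots" "y \<in> roots" for x y
  proof -
    obtain g where g: "g \<in> sigmas" "const_action g x = y" using transitive xy by blast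
    interpret gg: field_embedding "const_action g" by (rule const_action_embedding[OF sigmasD(1)[OF g(1)]])
    have "card (orb x) = card (const_action g ` orb x)" by (rule card_image[symmetric]) (simp add: inj_on_def)
    also have "\<dots> \<le> card (orb y)" using conj[OF g(1) xy(1)] g(2) fin_orb[OF xy(2)] by (intro card_mono) auto
    finally show ?thesis .
  qed
  have "card (orb a) * card (orb ` roots) = card (\<Union>(orb ` roots))"
  proof (rule card_partition)
    show "finite (\<Union>(orb ` roots))" using fin_orb by auto
    show "card c = card (orb a)" if "c \<in> orb ` roots" for c
      using that card_le a by (auto intro!: antisym)
    fix c1 c2 assume c: "c1 \<in> orb ` roots" "c2 \<in> orb ` roots" "c1 \<noteq> c2"
    show "c1 \<inter> c2 = {}"
    proof (rule equals0I)
      fix z assume "z \<in> c1 \<inter> c2"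
      thus False using c orb_eq by blast
    qed
  qed auto
  moreover have "\<Union>(orb ` roots) = roots" using orb_roots orb_self by blast
  ultimately have "card (orb a) dvd p" using card_roots by (metis dvd_triv_left)
  hence "card (orb a) = 1 \<or> card (orb a) = p" using prime_p by (simp add: prime_nat_iff)
  thus ?thesis
  proof
    assume "card (orb a) = p"
    hence "orb a = roots" using orb_roots[OF a] card_roots by (intro card_subset_eq) auto
    hence "b \<in> orb a" using b by simp
    thus ?thesis unfolding orb_def by blast
  next
    \<comment> \<open>If \<open>sigmas1\<close> fixed \<open>a\<close>, the image of
      \<open>a\<close> under an element of \<open>sigmas\<close> would be determined by the image of
      \<open>zeta\<close>. The \<open>p\<close> roots would then inject into the \<open>q\<close>
      powers of \<open>zeta\<close>.\<close>
    assume 1: "card (orb a) = 1"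
    have fix_a: "const_action h a = a" if "h \<in> sigmas1" for h
    proof -
      obtain c where "orb a = {c}" using 1 by (auto simp: card_1_singleton_iff)
      moreover have "const_action h a \<in> orb a" using that by (auto simp: orb_def)
      ultimately show ?thesis using orb_self[of a] by auto
    qed
    obtain G where G: "\<And>x. x \<in> roots \<Longrightarrow> G x \<in> sigmas" "\<And>x. x \<in> roots \<Longrightarrow> const_action (G x) a = x"
      using transitive[OF a] by metis
    have "inj_on (\<lambda>x. const_action (G x) zeta) roots"
    proof (rule inj_onI)
      fix x y assume xy: "x \<in> roots" "y \<in> roots" "const_action (G x) zeta = const_action (G y) zeta"
      have ge: "field_embedding (G x)" "field_embedding (G y)" using G(1) xy sigmasD(1) by auto
      obtain N where N: "(const_action (G x) ^^ N) (const_action (G x) zeta) = zeta"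
        "\<And>a. a \<in> roots \<Longrightarrow> const_action (G x) ((const_action (G x) ^^ N) a) = a"
        using const_action_finite_order[OF ge(1)] by metis
      define h where "h = (G x) ^^ N \<circ> G y"
      have h: "const_action h = const_action (G x) ^^ N \<circ> const_action (G y)"
        by (simp add: h_def const_action_comp const_action_funpow ge field_embedding_funpow)
      have "const_action h zeta = zeta" using N(1) xy(3) by (simp add: h)
      moreover have "h \<in> sigmas" unfolding h_def by (intro sigmas_comp sigmas_funpow G xy)
      ultimately have "h \<in> sigmas1" by (simp add: sigmas1_def)
      hence "const_action (G x) (const_action h a) = const_action (G x) a" using fix_a by simp
      moreover have "const_action (G x) (const_action h a) = y" using N(2)[OF xy(2)] G(2)[OF xy(2)] by (simp add: h)
      ultimately show "x = y" using G(2)[OF xy(1)] by simp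
    qed
    moreover have "(\<lambda>x. const_action (G x) zeta) ` roots \<subseteq> (\<lambda>e. zeta ^ e) ` {..<q}"
      using zeta_conjugate G(1) sigmasD(1) by fast
    ultimately have "card roots \<le> card ((\<lambda>e. zeta ^ e) ` {..<q})"
      by (intro card_inj_on_le) auto
    also have "\<dots> \<le> q" using card_image_le[of "{..<q}" "\<lambda>e. zeta ^ e"] by simp
    finally show ?thesis using card_roots q_less_p by simp
  qed
qed

lemma sigma_rat: "g \<in> sigmas \<Longrightarrow> r \<in> rat_funs \<Longrightarrow> g r \<in> rat_funs"
proof -
  assume g: "g \<in> sigmas" and "r \<in> rat_funs"
  interpret g: field_embedding g by (rule sigmasD(1)[OF g])
  obtain P Q where "r = eval_x P / eval_x Q" using rat_funs_fraction[OF \<open>r \<in> rat_funs\<close>] by metis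
  moreover have "g (eval_x P) \<in> rat_funs" for P
  proof -
    have "g (ff_const c) \<in> rat_funs" for c using embedding_const[OF g.field_embedding_axioms, of c] by auto
    thus ?thesis unfolding eval_x_conv poly_altdef g.hom_sum
      by (auto simp: sigmasD(2)[OF g] coeff_map_poly intro!: rat_funs.sum_closed rat_funs.mult_closed rat_funs.power_closed)
  qed
  ultimately show "g r \<in> rat_funs" by auto
qed

lemma sigma_L: "g \<in> sigmas \<Longrightarrow> f \<in> L \<Longrightarrow> g f \<in> L"
  by (rule embedding_L[OF sigmasD(1)]) (auto intro: sigma_rat simp: sigmasD(3))

lemma sigma_tau:
  assumes "g \<in> sigmas1" "f \<in> L"
  shows "g (tau f) = tau (g f)"
proof -
  have g: "g \<in> sigmas" "g (ff_const zeta) = ff_const zeta"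
    using assms(1) ff_const_action[of g zeta] sigmasD(1) by (auto simp: sigmas1_def)
  interpret g: field_embedding g by (rule sigmasD(1)[OF g(1)])
  obtain r where r: "f = (\<Sum>j<q. r j * Y ^ j)" "\<And>j. r j \<in> rat_funs" using assms(2) by (auto simp: L_def)
  show ?thesis
    by (simp add: r g.hom_sum tau.hom_sum tau sigma_rat g sigmasD(3)[OF g(1)])
qed

lemma sigma_pullback:
  assumes "g \<in> sigmas" "affine V (const_action g b)"
  shows "affine (pullback L g V) b"
  using assms sigmasD ff_const_action[of g b]
  by (intro pullback_affine) (auto intro: embedding_const sigma_L)

text \<open>The action maps the finite set of roots of a rational polynomial annihilating
  \<open>c\<close> injectively into itself, hence onto itself.\<close>

lemma const_action_surj:
  assumes "field_embedding g"
  shows "\<exists>b. const_action g b = c"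
proof -
  interpret s: field_embedding "const_action g" by (rule const_action_embedding[OF assms])
  obtain P :: "rat poly" where P: "P \<noteq> 0" "poly (map_poly to_ac P) c = 0"
    using alg_closure_algebraic .
  define Q :: "qbar poly" where "Q = map_poly to_ac P"
  have "const_action g (of_rat r) = of_rat r" for r by (cases r) (simp add: Fract_of_int_quotient of_rat_divide)
  hence "map_poly (const_action g) Q = Q" by (simp add: Q_def poly_eq_iff coeff_map_poly flip: of_rat_qbar)
  hence "poly Q (const_action g b) = 0" if "poly Q b = 0" for b using s.hom_poly[of Q b] that by simp
  hence sub: "const_action g ` {b. poly Q b = 0} \<subseteq> {b. poly Q b = 0}" by auto
  have fin: "finite {b. poly Q b = 0}" using P(1) by (intro poly_roots_finite) (simp add: Q_def map_poly_eq_0_iff)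
  have "const_action g ` {b. poly Q b = 0} = {b. poly Q b = 0}"
    by (rule endo_inj_surj[OF fin sub]) (simp add: inj_on_def)
  moreover have "c \<in> {b. poly Q b = 0}" using P(2) by (simp add: Q_def)
  ultimately show ?thesis by (metis (mono_tags, lifting) imageE)
qed

end

section \<open>Functions whose divisor is divisible by \<open>q\<close>\<close>

lemma prod_powi_distrib: "(\<Prod>i\<in>I. f i :: 'a :: field) powi n = (\<Prod>i\<in>I. f i powi n)"
  by (induction I rule: infinite_finite_induct) (auto simp: power_int_mult_distrib)

context curve
begin

text \<open>The \<open>r j\<close> are polynomials and the norm is constant. At infinity the
  \<open>q\<close>-th power of the \<open>j\<close>-th nonzero summand has order
  \<open>- q * deg (r j) - p * j\<close>, which is at least the order 0 of the norm. This leaves a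
  constant \<open>r 0\<close> only.\<close>

lemma constant_if_trivial_divisor:
  assumes "divisor_witness (\<lambda>_. 0) f"
  shows "f \<in> range ff_const"
proof -
  note f = witnessD[OF assms]
  have unit: "f \<in> val_units V" if V: "affine V b" for V b
  proof (cases "Y - of_int k \<in> max_ideal V")
    case True
    interpret affine_place p q k V b using V by (rule affineD)
    obtain i where "i < p" "b = of_nat i" using special_point[OF V True] by blast
    thus ?thesis using f(3)[of V i] V True by (simp add: val_eq_one_iff)
  qed (use f(4)[OF V] in blast)
  obtain r where r: "f = (\<Sum>j<q. r j * Y ^ j)" "\<And>j. r j \<in> rat_funs" using f(1) by (auto simp: L_def)
  have reg: "(\<Sum>j<q. r j * Y ^ j) \<in> V" if "affine V b" for V b
    using unit[OF that] r(1) by (simp add: val_units_def)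
  obtain C n where N: "C \<noteq> 0" "Norm f = rat_fun C special n" "\<And>i. i < p \<Longrightarrow> n (of_nat i) = 0"
    using Norm_witness[OF assms] by blast
  have "(\<Sum>b\<in>special. n b) = 0" using N(3) by (intro sum.neutral) (auto simp: special_def)
  obtain W where W: "gauss_valuation_inf UNIV W UNIV (inverse ff_x)"
    using gauss_valuation_inf_exists[OF UNIV_valuation_ring] .
  interpret W: gauss_valuation_inf UNIV W UNIV "inverse ff_x" by (rule W)
  interpret R: ramified_place p q k UNIV W UNIV "inverse ff_x" "- int p"
    by (rule ramified_place_inf[OF W]) auto
  have NW: "val_eq W (Norm (\<Sum>j<q. r j * Y ^ j)) (ff_const C * inverse ff_x powi 0)"
    using W.rat_fun_val_eq_inf[of special C n] N(1,2) \<open>(\<Sum>b\<in>special. n b) = 0\<close>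
    unfolding r(1)[symmetric] by simp
  have comp: "\<exists>c S m. c \<noteq> 0 \<and> finite S \<and> r j = rat_fun c S m \<and> (\<forall>b\<in>S. m b \<ge> 0) \<and>
      val_eq W (r j) (ff_const c * inverse ff_x powi - (\<Sum>b\<in>S. m b))" if j: "j < q" "r j \<noteq> 0" for j
  proof -
    obtain c S m where rep: "finite S" "c \<noteq> 0" "r j = rat_fun c S m" using rat_fun_exists[OF r(2) j(2)] .
    have "m b \<ge> 0" if "b \<in> S" for b
      using regular_component[where r = r and j = j and c = c and S = S and n = m and b = b] r(2) j(1) reg rep that
      by blast
    thus ?thesis using W.rat_fun_val_eq_inf[OF rep(1,2), of m] rep by auto
  qed
  have "\<exists>j<q. r j \<noteq> 0"
  proof (rule ccontr)
    assume "\<not> (\<exists>j<q. r j \<noteq> 0)"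
    hence "f = 0" unfolding r(1) by (intro sum.neutral) auto
    thus False using f(2) by simp
  qed
  then obtain d where d: "R.dominant r d" using R.ex_dominant[of r] r(2) by blast
  hence dq: "d < q" "r d \<noteq> 0" by (auto simp: R.dominant_def)
  obtain c S m where rd: "c \<noteq> 0" "finite S" "r d = rat_fun c S m" "\<forall>b\<in>S. m b \<ge> 0"
      "val_eq W (r d) (ff_const c * inverse ff_x powi - (\<Sum>b\<in>S. m b))" using comp[OF dq] by blast
  have "int q * (- (\<Sum>b\<in>S. m b)) + (- int p) * int d = 0"
    by (rule R.term_vs_Norm(2)[OF r(2) d dq(1) NW N(1) rd(5,1) refl])
  moreover have ge0: "(\<Sum>b\<in>S. m b) \<ge> 0" using rd(4) by (intro sum_nonneg) auto
  moreover have "int q * (\<Sum>b\<in>S. m b) \<ge> 0" using ge0 by simp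
  moreover have "int p * int d \<ge> 0" by simp
  ultimately have "int q * (\<Sum>b\<in>S. m b) = 0" "int p * int d = 0" by linarith+
  hence d0: "d = 0" and S0: "(\<Sum>b\<in>S. m b) = 0" using p_gt_2 q_gt_0 by simp_all
  have "\<forall>b\<in>S. m b = 0" using S0 rd(2,4) by (subst (asm) sum_nonneg_eq_0_iff) auto
  hence r0: "r 0 = ff_const c" using rd(3) d0 by (simp add: rat_fun_def)
  have "r j = 0" if j: "j < q" "j \<noteq> 0" for j
  proof (rule ccontr)
    assume "r j \<noteq> 0"
    then obtain c' S' m' where rj: "c' \<noteq> 0" "finite S'" "r j = rat_fun c' S' m'" "\<forall>b\<in>S'. m' b \<ge> 0"
      "val_eq W (r j) (ff_const c' * inverse ff_x powi - (\<Sum>b\<in>S'. m' b))" using comp j by blast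
    have ge: "int q * (- (\<Sum>b\<in>S'. m' b)) + (- int p) * int j \<ge> 0"
      by (rule R.term_vs_Norm(3)[OF r(2) d j(1) NW N(1) rj(5,1)]) (use rj N in \<open>simp add: val_eq_def\<close>)
    have "int q * (\<Sum>b\<in>S'. m' b) \<ge> 0" using rj(4) by (intro mult_nonneg_nonneg sum_nonneg) auto
    moreover have "int p * int j > 0" using p_gt_2 j(2) by simp
    ultimately show False using ge by linarith
  qed
  hence "f = (\<Sum>j<q. if j = 0 then ff_const c else 0)"
    unfolding r(1) using r0 by (intro sum.cong) auto
  thus ?thesis using q_gt_0 by simp
qed

text \<open>The trivial class in the group of nonzero functions modulo constants and
  \<open>q\<close>-th powers.\<close>

definition kummer :: "ambient set"
  where "kummer = {ff_const c * g ^ q | c g. c \<noteq> 0 \<and> g \<in> L \<and> g \<noteq> 0}"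

lemma kummerI: "c \<noteq> 0 \<Longrightarrow> g \<in> L \<Longrightarrow> g \<noteq> 0 \<Longrightarrow> ff_const c * g ^ q \<in> kummer"
  unfolding kummer_def by blast

lemma kummer_const: "c \<noteq> 0 \<Longrightarrow> ff_const c \<in> kummer"
  using kummerI[of c 1] by simp

lemma kummer_power: "g \<in> L \<Longrightarrow> g \<noteq> 0 \<Longrightarrow> g ^ q \<in> kummer"
  using kummerI[of 1 g] by simp

lemma kummer_mult: "f \<in> kummer \<Longrightarrow> g \<in> kummer \<Longrightarrow> f * g \<in> kummer"
proof -
  assume "f \<in> kummer" "g \<in> kummer"
  then obtain c u d v where *: "f = ff_const c * u ^ q" "g = ff_const d * v ^ q" "c \<noteq> 0" "d \<noteq> 0"
    "u \<in> L" "v \<in> L" "u \<noteq> 0" "v \<noteq> 0" unfolding kummer_def by blast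
  have eq: "f * g = ff_const (c * d) * (u * v) ^ q" by (simp add: *(1,2) power_mult_distrib mult_ac)
  show ?thesis unfolding eq by (rule kummerI) (use * in auto)
qed

lemma kummer_inverse: "f \<in> kummer \<Longrightarrow> inverse f \<in> kummer"
proof -
  assume "f \<in> kummer"
  then obtain c u where *: "f = ff_const c * u ^ q" "c \<noteq> 0" "u \<in> L" "u \<noteq> 0" unfolding kummer_def by blast
  have eq: "inverse f = ff_const (inverse c) * (inverse u) ^ q" by (simp add: *(1) power_inverse)
  show ?thesis unfolding eq by (rule kummerI) (use * in auto)
qed

lemma kummer_divide: "f \<in> kummer \<Longrightarrow> g \<in> kummer \<Longrightarrow> f / g \<in> kummer"
  by (simp add: divide_inverse kummer_mult kummer_inverse)

lemma kummer_nonzero: "f \<in> kummer \<Longrightarrow> f \<noteq> 0"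
  by (auto simp: kummer_def)

lemma kummer_sigma: "g \<in> sigmas \<Longrightarrow> f \<in> kummer \<Longrightarrow> g f \<in> kummer"
proof -
  assume g: "g \<in> sigmas" and "f \<in> kummer"
  then obtain c u where *: "f = ff_const c * u ^ q" "c \<noteq> 0" "u \<in> L" "u \<noteq> 0" unfolding kummer_def by blast
  interpret g: field_embedding g by (rule sigmasD(1)[OF g])
  have "g f = ff_const (const_action g c) * g u ^ q"
    by (simp add: *(1) ff_const_action[OF g.field_embedding_axioms])
  moreover have "const_action g c \<noteq> 0"
    using ff_const_action[OF g.field_embedding_axioms, of c] *(2) by auto
  ultimately show ?thesis using kummerI[of "const_action g c" "g u"] sigma_L[OF g *(3)] *(4) by simp
qed

lemma tau_eigenvector:
  assumes "w \<in> L" "tau w = ff_const zeta ^ e * w"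
  shows "w / Y ^ e \<in> rat_funs"
proof (rule tau_fixed_rat)
  show "w / Y ^ e \<in> L" using assms(1) by auto
  have "ff_const zeta \<noteq> 0" by simp
  thus "tau (w / Y ^ e) = w / Y ^ e" using assms(2) by (simp add: tau power_mult_distrib)
qed

lemma root_factors_val:
  assumes "affine V a" "a \<in> roots"
  shows "val_eq V (rat_fun 1 roots m) ((ff_x - ff_const a) powi m a)"
proof -
  interpret affine_place p q k V a using assms(1) by (rule affineD)
  show ?thesis using rat_fun_val[of roots 1 m] assms(2) by simp
qed

text \<open>Kummer theory for \<open>L\<close> over K(x): if the product is a constant times
  \<open>w ^ q\<close>, then \<open>w\<close> is an eigenvector of \<open>tau\<close>, so
  \<open>w = r * Y ^ e\<close> with \<open>r\<close> in K(x). The exponent at each root of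
  \<open>F\<close> is therefore \<open>e\<close> plus a multiple of \<open>q\<close>.\<close>

lemma kummer_exponents:
  assumes "rat_fun 1 roots m \<in> kummer"
  shows "\<exists>e. \<forall>a\<in>roots. int q dvd m a - e"
proof -
  obtain c w where w: "rat_fun 1 roots m = ff_const c * w ^ q" "c \<noteq> 0" "w \<in> L" "w \<noteq> 0"
    using assms unfolding kummer_def by blast
  have "tau (ff_const c * w ^ q) = ff_const c * w ^ q" unfolding w(1)[symmetric] by (rule tau(2)) auto
  hence "(tau w / w) ^ q = 1" using w(2,4) by (simp add: tau power_divide)
  then obtain e where e: "tau w / w = ff_const zeta ^ e" using root_of_unity by blast
  define r where "r = w / Y ^ e"
  have "tau w = ff_const zeta ^ e * w" using e w(4) by (simp add: field_simps)
  hence r_rat: "r \<in> rat_funs" unfolding r_def by (rule tau_eigenvector[OF w(3)])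
  have r0: "r \<noteq> 0" using w(4) by (simp add: r_def)
  obtain d S n where rep: "finite S" "d \<noteq> 0" "r = rat_fun d S n" using rat_fun_exists[OF r_rat r0] .
  have "int q dvd m a - int e" if a: "a \<in> roots" for a
  proof -
    obtain V where V: "affine V a" using affine_exists by blast
    interpret affine_place p q k V a using V by (rule affineD)
    define n' where "n' = (if a \<in> S then n a else 0)"
    have "w ^ q = r ^ q * (Y ^ q) ^ e"
    proof -
      have "(Y ^ q) ^ e = (Y ^ e) ^ q" by (metis mult.commute power_mult)
      thus ?thesis by (simp add: r_def power_divide)
    qed
    moreover have "val_eq V (r ^ q * (Y ^ q) ^ e) (((ff_x - ff_const a) powi n') ^ q * (ff_x - ff_const a) ^ e)"
      unfolding rep(3) n'_def by (intro val_eq_mult val_eq_power rat_fun_val rep Y_value(1)[OF a])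
    moreover have "((ff_x - ff_const a) powi n') ^ q * (ff_x - ff_const a) ^ e = (ff_x - ff_const a) powi (n' * int q + int e)"
      using z_nonzero by (simp add: power_int_add power_int_mult)
    ultimately have wq: "val_eq V (w ^ q) ((ff_x - ff_const a) powi (n' * int q + int e))" by simp
    have "val_eq V (ff_const c * w ^ q) (w ^ q)" using w(2,4) by (intro val_eq_unit_mult) auto
    from val_eq_trans[OF this wq] have "val_eq V (rat_fun 1 roots m) ((ff_x - ff_const a) powi (n' * int q + int e))"
      by (simp add: w(1))
    hence "val_eq V ((ff_x - ff_const a) powi m a) ((ff_x - ff_const a) powi (n' * int q + int e))"
      using root_factors_val[OF V a, of m] val_eq_sym val_eq_trans by blast
    hence "m a = n' * int q + int e" using val_eq_powi_iff[OF z_max_ideal z_nonzero] by simp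
    thus ?thesis by simp
  qed
  thus ?thesis by blast
qed

text \<open>Divisibility of all affine orders by \<open>q\<close>, expressed without a choice of
  uniformizers.\<close>

definition divisible :: "ambient \<Rightarrow> bool"
  where "divisible h \<longleftrightarrow> (\<forall>V b. affine V b \<longrightarrow> (\<exists>t\<in>L. val_eq V h (t ^ q)))"

lemma divisible_divide:
  assumes "divisible f" "divisible g"
  shows "divisible (f / g)"
  unfolding divisible_def
proof (intro allI impI)
  fix V b assume V: "affine V b"
  interpret affine_place p q k V b using V by (rule affineD)
  obtain s t where st: "s \<in> L" "t \<in> L" "val_eq V f (s ^ q)" "val_eq V g (t ^ q)"
    using assms V unfolding divisible_def by meson
  have "val_eq V (f / g) ((s / t) ^ q)" unfolding power_divide by (intro val_eq_divide st)
  thus "\<exists>t\<in>L. val_eq V (f / g) (t ^ q)" using st(1,2) by blast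
qed

lemma divisible_tau:
  assumes "divisible f" "f \<in> L"
  shows "divisible (tau f)"
  unfolding divisible_def
proof (intro allI impI)
  fix V b assume V: "affine V b"
  have "affine (pullback L tau V) b" using pullback_tau[OF V, of 1] by simp
  then obtain t where t: "t \<in> L" "val_eq (pullback L tau V) f (t ^ q)" using assms(1) unfolding divisible_def by blast
  hence "val_eq V (tau f) (tau (t ^ q))"
    using pullback_val_eq[OF tau(1) L.subfield_set_axioms assms(2), of "t ^ q" V] by blast
  moreover have "tau t \<in> L" using tau_L[OF t(1), of 1] by simp
  ultimately show "\<exists>t\<in>L. val_eq V (tau f) (t ^ q)" by auto
qed

lemma Norm_tau: "f \<in> L \<Longrightarrow> Norm (tau f) = Norm f"
proof -
  assume f: "f \<in> L"
  have "Norm (tau f) = tau (Norm f)" by (simp add: Norm_def tau.hom_prod funpow_swap1)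
  thus ?thesis using tau(2)[OF Norm_rat[OF f]] by simp
qed

lemma Norm_const: "Norm (ff_const c) = ff_const c ^ q"
  by (simp add: Norm_def)

text \<open>By means of a Lagrange resolvent of \<open>1\<close>.\<close>

lemma hilbert_90:
  assumes u: "u \<in> L" "Norm u = 1"
  shows "\<exists>s g. g \<in> L \<and> g \<noteq> 0 \<and> u * tau g = ff_const zeta ^ s * g"
proof -
  define U where "U i = (\<Prod>t<i. (tau ^^ t) u)" for i
  have U0: "U 0 = 1" and Uq: "U q = 1" using u(2) by (auto simp: U_def Norm_def)
  have U_Suc: "u * tau (U i) = U (Suc i)" for i
    unfolding U_def prod.lessThan_Suc_shift tau.hom_prod by simp
  have U_L: "U i \<in> L" for i unfolding U_def using tau_L[OF u(1)] by blast
  define w where "w s = (\<Sum>i<q. ff_const (zeta powi (- int (s * i))) * U i)" for s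
  have w_L: "w s \<in> L" for s unfolding w_def using U_L by blast
  \<comment> \<open>The \<open>q\<close> resolvents add up to \<open>q\<close>, so one of them is
    nonzero. Which one is not known, whence the factor \<open>zeta ^ s\<close> in the conclusion; it
    disappears in \<open>q\<close>-th powers.\<close>
  have "(\<Sum>s<q. w s) = (\<Sum>i<q. ff_const (\<Sum>s<q. zeta powi (int s * (- int i))) * U i)"
    unfolding w_def by (subst sum.swap) (simp add: ff_const.hom_sum sum_distrib_right)
  also have "\<dots> = (\<Sum>i<q. if i = 0 then of_nat q * U i else 0)"
  proof (rule sum.cong[OF refl])
    fix i assume "i \<in> {..<q}"
    hence "int q dvd - int i \<longleftrightarrow> i = 0" by (auto dest: dvd_imp_le)
    thus "ff_const (\<Sum>s<q. zeta powi (int s * (- int i))) * U i = (if i = 0 then of_nat q * U i else 0)"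
      by (simp only: sum_zeta_powi) simp
  qed
  also have "\<dots> = of_nat q" using q_gt_0 U0 by simp
  finally have sum_w: "(\<Sum>s<q. w s) = of_nat q" .
  have "\<exists>s<q. w s \<noteq> 0"
  proof (rule ccontr)
    assume "\<not> (\<exists>s<q. w s \<noteq> 0)"
    hence "(\<Sum>s<q. w s) = 0" by (intro sum.neutral) auto
    thus False using sum_w q_gt_0 by simp
  qed
  then obtain s where s: "w s \<noteq> 0" by blast
  define h where "h i = ff_const (zeta powi (- int (s * i))) * U i" for i
  have hq: "h q = h 0"
  proof -
    have "zeta powi (- int (s * q)) = 1" unfolding zeta_powi_eq_1_iff by simp
    thus ?thesis by (simp add: h_def U0 Uq)
  qed
  have "u * tau (w s) = (\<Sum>i<q. ff_const (zeta powi (- int (s * i))) * U (Suc i))"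
    unfolding w_def tau.hom_sum sum_distrib_left
    by (intro sum.cong refl) (simp add: tau mult.left_commute[of u] U_Suc rat_funs.powi_closed flip: ff_const.hom_powi)
  also have "\<dots> = (\<Sum>i<q. ff_const zeta ^ s * h (Suc i))"
  proof (rule sum.cong[OF refl])
    fix i
    have "zeta ^ s * zeta powi (- int (s * Suc i)) = zeta powi (int s + (- int (s * Suc i)))"
      by (subst power_int_add) auto
    also have "int s + (- int (s * Suc i)) = - int (s * i)" by simp
    finally have "zeta powi (- int (s * i)) = zeta ^ s * zeta powi (- int (s * Suc i))" by simp
    thus "ff_const (zeta powi (- int (s * i))) * U (Suc i) = ff_const zeta ^ s * h (Suc i)"
      unfolding h_def by (simp only: ff_const.hom_mult ff_const.hom_power mult.assoc)
  qed
  also have "\<dots> = ff_const zeta ^ s * (\<Sum>i<q. h i)"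
  proof -
    have "(\<Sum>i<q. h (Suc i)) + h 0 = (\<Sum>i<Suc q. h i)"
      unfolding sum.lessThan_Suc_shift by simp
    also have "\<dots> = (\<Sum>i<q. h i) + h q" by simp
    finally show ?thesis using hq by (simp flip: sum_distrib_left)
  qed
  also have "(\<Sum>i<q. h i) = w s" by (simp add: h_def w_def)
  finally show ?thesis using s w_L by blast
qed

lemma uniformized_power:
  assumes "affine V b" "uniformizes L V t" "f \<in> L" "val_eq V (f ^ q) (t powi n)"
  shows "int q dvd n"
proof -
  interpret affine_place p q k V b using assms(1) by (rule affineD)
  have t: "t \<noteq> 0" "t \<in> max_ideal V" using assms(2) by (auto simp: uniformizes_def)
  have "f \<noteq> 0" using val_eq_nonzero(1)[OF assms(4)] q_gt_0 by (metis zero_power)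
  then obtain m where "val_eq V f (t powi m)" using assms(2,3) unfolding uniformizes_def by blast
  from val_eq_power[OF this, of q] have "val_eq V (f ^ q) (t powi (m * int q))" by (simp add: power_int_mult)
  hence "val_eq V (t powi (m * int q)) (t powi n)" using assms(4) val_eq_sym val_eq_trans by blast
  thus ?thesis using val_eq_powi_iff[OF t(2,1)] by auto
qed

text \<open>The class of \<open>h\<close> is annihilated by \<open>1 - tau\<close>, hence it is represented by a product of linear
  factors \<open>x - a\<close> at the roots of \<open>F\<close>. Being invariant under a group that is transitive on the
  roots, this product is a power of \<open>F\<close> up to \<open>q\<close>-th powers.\<close>

lemma kummer_if_tau_fixed:
  assumes h: "h \<in> L" "h \<noteq> 0" "divisible h" "h / tau h \<in> kummer"
    and inv: "\<And>g. g \<in> sigmas1 \<Longrightarrow> g h / h \<in> range ff_const"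
  shows "h \<in> kummer"
proof -
  obtain c u where cu: "h / tau h = ff_const c * u ^ q" "c \<noteq> 0" "u \<in> L" "u \<noteq> 0"
    using h(4) unfolding kummer_def by blast
  have tau_h: "tau h \<in> L" using tau_L[OF h(1), of 1] by simp
  have Norm_power: "Norm (u ^ q) = Norm u ^ q" by (simp add: Norm_def prod_power_distrib)
  have "Norm h = Norm (h / tau h) * Norm (tau h)" unfolding Norm_mult[symmetric] using h(2) by simp
  hence "Norm (h / tau h) = 1" using Norm_tau[OF h(1)] h(2) by simp
  hence "ff_const c ^ q * Norm u ^ q = 1" unfolding cu(1) Norm_mult Norm_const Norm_power .
  \<comment> \<open>The norm of \<open>h / tau h\<close> is 1, so \<open>Norm u\<close> is a
    constant. A \<open>q\<close>-th root of it is moved from \<open>u\<close> into the constant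
    factor, to meet the hypothesis of Hilbert 90.\<close>
  hence "(ff_const c * Norm u) ^ q = 1" by (simp add: power_mult_distrib)
  then obtain e0 where "ff_const c * Norm u = ff_const zeta ^ e0" using root_of_unity by blast
  hence "Norm u = ff_const (zeta ^ e0 / c)" using cu(2) by (simp add: field_simps)
  then obtain \<nu> where \<nu>: "Norm u = ff_const \<nu>" by blast
  have "\<nu> \<noteq> 0" using \<nu> cu(4) Norm_eq_0_iff[of u] by auto
  obtain \<delta> :: qbar where \<delta>: "\<delta> ^ q = \<nu>" using nth_root_exists[OF q_gt_0] by blast
  have \<delta>0: "\<delta> \<noteq> 0" using \<delta> \<open>\<nu> \<noteq> 0\<close> q_gt_0 by (auto simp: zero_power)
  define u1 where "u1 = ff_const (inverse \<delta>) * u"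
  have u1: "u1 \<in> L" "u1 \<noteq> 0" using cu(3,4) \<delta>0 by (auto simp: u1_def)
  have "Norm u1 = ff_const (inverse \<delta>) ^ q * ff_const \<nu>" by (simp only: u1_def Norm_mult Norm_const \<nu>)
  also have "\<dots> = ff_const (inverse (\<delta> ^ q) * \<nu>)" by (simp add: power_inverse)
  finally have "Norm u1 = 1" using \<delta> \<open>\<nu> \<noteq> 0\<close> by simp
  from hilbert_90[OF u1(1) this] obtain s g where g: "g \<in> L" "g \<noteq> 0" "u1 * tau g = ff_const zeta ^ s * g" by blast
  have zq: "ff_const zeta ^ q = 1" unfolding ff_const.hom_power[symmetric] zeta(1) by simp
  have zs: "(ff_const zeta ^ s) ^ q = 1"
    unfolding power_mult[symmetric] mult.commute[of s] by (simp only: power_mult zq power_one)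
  have u1q: "u1 ^ q * tau g ^ q = g ^ q"
    using arg_cong[OF g(3), of "\<lambda>t. t ^ q"] by (simp only: power_mult_distrib zs mult_1)
  define c1 where "c1 = c * \<nu>"
  have c10: "c1 \<noteq> 0" using cu(2) \<open>\<nu> \<noteq> 0\<close> by (simp add: c1_def)
  have "u = ff_const \<delta> * u1" using \<delta>0 by (simp add: u1_def)
  hence "h / tau h = ff_const c1 * u1 ^ q" by (simp add: cu(1) c1_def power_mult_distrib mult_ac flip: \<delta>)
  hence h_eq: "h = ff_const c1 * u1 ^ q * tau h" using h(2) by (simp add: field_simps)
  \<comment> \<open>Division by \<open>g ^ q\<close> preserves the class of \<open>h\<close> and
    leaves \<open>h' = c1 * tau h'\<close>. Iterating \<open>q\<close> times gives
    \<open>c1 ^ q = 1\<close>, so \<open>h'\<close> is an eigenvector of \<open>tau\<close>, hence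
    \<open>Y ^ e\<close> times an element of K(x).\<close>
  define h' where "h' = h / g ^ q"
  have h'L: "h' \<in> L" "h' \<noteq> 0" using h g by (auto simp: h'_def)
  have tau_h': "h' = ff_const c1 * tau h'"
  proof -
    have "h' * g ^ q = h" using g(2) by (simp add: h'_def)
    also have "h = ff_const c1 * u1 ^ q * (tau h' * tau g ^ q)" by (subst h_eq) (simp add: h'_def g(2))
    also have "\<dots> = ff_const c1 * tau h' * (u1 ^ q * tau g ^ q)" by (simp add: mult_ac)
    also have "\<dots> = ff_const c1 * tau h' * g ^ q" by (simp add: u1q)
    finally show ?thesis using g(2) by simp
  qed
  have "h' = ff_const c1 ^ n * (tau ^^ n) h'" for n
  proof (induction n)
    case (Suc n)
    have "tau ((tau ^^ n) h') = (tau ^^ n) (tau h')" by (simp add: funpow_swap1)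
    moreover have "(tau ^^ n) h' = ff_const c1 * (tau ^^ n) (tau h')"
      using arg_cong[OF tau_h', of "tau ^^ n"] by simp
    ultimately show ?case using Suc.IH by (simp add: mult_ac)
  qed simp
  from this[of q] have "h' = ff_const c1 ^ q * h'" using tau_q[OF h'L(1)] by simp
  hence "ff_const (inverse c1) ^ q = 1" using h'L(2) c10 by (simp add: power_inverse)
  then obtain e where e: "ff_const (inverse c1) = ff_const zeta ^ e" using root_of_unity by blast
  have "tau h' = ff_const (inverse c1) * h'" using tau_h' c10 by (simp add: field_simps)
  hence "tau h' = ff_const zeta ^ e * h'" unfolding e .
  from tau_eigenvector[OF h'L(1) this] have r_rat: "h' / Y ^ e \<in> rat_funs" .
  have r0: "h' / Y ^ e \<noteq> 0" using h'L(2) by simp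
  obtain d S0 n0 where rep0: "finite S0" "d \<noteq> 0" "h' / Y ^ e = rat_fun d S0 n0" using rat_fun_exists[OF r_rat r0] .
  define S where "S = S0 \<union> roots"
  define n where "n = (\<lambda>b. if b \<in> S0 then n0 b else 0)"
  have S: "finite S" "roots \<subseteq> S" using rep0 by (auto simp: S_def)
  have r_eq: "h' / Y ^ e = rat_fun d S n"
    unfolding rep0(3) n_def by (rule rat_fun_superset) (use rep0 in \<open>auto simp: S_def\<close>)
  have h'_eq: "h' = rat_fun d S n * Y ^ e" using r_eq by (simp add: field_simps)
  have h'_div: "\<exists>f\<in>L. val_eq V (f ^ q) h'" if V: "affine V b" for V b
  proof -
    interpret affine_place p q k V b using V by (rule affineD)
    obtain t where t: "t \<in> L" "val_eq V h (t ^ q)" using h(3) V unfolding divisible_def by blast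
    have "val_eq V (h / g ^ q) (t ^ q / g ^ q)" using t g by (intro val_eq_divide) auto
    hence "val_eq V ((t / g) ^ q) h'" unfolding h'_def power_divide by (rule val_eq_sym)
    thus ?thesis using t(1) g(1) by blast
  qed
  have nonroot: "int q dvd n b" if b: "b \<in> S" "b \<notin> roots" for b
  proof -
    obtain V where V: "affine V b" using affine_exists by blast
    interpret affine_place p q k V b using V by (rule affineD)
    obtain f where f: "f \<in> L" "val_eq V (f ^ q) h'" using h'_div[OF V] by blast
    have "val_eq V h' ((ff_x - ff_const b) powi n b * 1)" unfolding h'_eq
      using rat_fun_val[OF S(1) rep0(2), of n] b Y_value(2)[OF b(2)]
      by (intro val_eq_mult) (auto simp: val_eq_one_iff)
    from val_eq_trans[OF f(2) this] have "val_eq V (f ^ q) ((ff_x - ff_const b) powi n b)" by simp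
    thus ?thesis by (rule uniformized_power[OF V unramified_uniformizer[OF V b(2)] f(1)])
  qed
  \<comment> \<open>At a ramification point \<open>Y\<close> is a uniformizer and \<open>h'\<close>
    has order \<open>q * n a + e\<close>.\<close>
  have "int q dvd int e"
  proof -
    obtain a where a: "a \<in> roots" using roots_nonempty by blast
    obtain V where V: "affine V a" using affine_exists by blast
    interpret affine_place p q k V a using V by (rule affineD)
    obtain f where f: "f \<in> L" "val_eq V (f ^ q) h'" using h'_div[OF V] by blast
    have "val_eq V (rat_fun d S n) ((ff_x - ff_const a) powi n a)"
      using rat_fun_val[OF S(1) rep0(2), of n] S(2) a by auto
    also have "val_eq V ((ff_x - ff_const a) powi n a) ((Y ^ q) powi n a)"
      using val_eq_powi[OF val_eq_sym[OF Y_value(1)[OF a]]] .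
    finally have "val_eq V h' ((Y ^ q) powi n a * Y ^ e)" unfolding h'_eq by (intro val_eq_mult) auto
    moreover have "(Y ^ q) powi n a * Y ^ e = Y powi (int q * n a + int e)"
      by (simp add: power_int_add power_int_mult)
    ultimately have "val_eq V h' (Y powi (int q * n a + int e))" by simp
    from val_eq_trans[OF f(2) this] have "val_eq V (f ^ q) (Y powi (int q * n a + int e))" .
    hence "int q dvd int q * n a + int e" by (rule uniformized_power[OF V ramified_uniformizer[OF a] f(1)])
    thus ?thesis by (simp add: dvd_add_right_iff)
  qed
  then obtain e' where e': "e = q * e'" by auto
  define P where "P = (\<Prod>b\<in>S - roots. (ff_x - ff_const b) powi (n b div int q))"
  have P: "P \<in> L" "P \<noteq> 0" using S(1) by (auto simp: P_def)
  have "rat_fun d S n = ff_const d * P ^ q * rat_fun 1 roots n"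
  proof -
    have "P ^ q = (\<Prod>b\<in>S - roots. (ff_x - ff_const b) powi n b)"
      unfolding P_def prod_power_distrib
    proof (rule prod.cong[OF refl])
      fix b assume "b \<in> S - roots"
      hence "n b = n b div int q * int q" using nonroot by simp
      thus "((ff_x - ff_const b) powi (n b div int q)) ^ q = (ff_x - ff_const b) powi n b"
        by (metis power_int_mult power_int_of_nat)
    qed
    thus ?thesis unfolding rat_fun_def prod.subset_diff[OF S(2,1)] by (simp add: mult_ac)
  qed
  hence "h = ff_const d * (P * Y ^ e' * g) ^ q * rat_fun 1 roots n"
    using g(2) h'_eq by (simp add: h'_def e' power_mult_distrib field_simps flip: power_mult)
  then obtain t where t: "t \<in> kummer" "h = t * rat_fun 1 roots n"
    using kummerI[OF rep0(2), of "P * Y ^ e' * g"] P g by auto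
  \<comment> \<open>\<open>s\<close> permutes the linear factors, and \<open>m\<close> records the
    change of exponents. By \<open>kummer_exponents\<close> all changes are congruent to one
    \<open>e\<close>; they sum to 0 over the \<open>p\<close> roots, so \<open>q\<close> divides
    \<open>p * e\<close> and hence \<open>e\<close>.\<close>
  have n_inv: "int q dvd n a - n (const_action s a)" if s: "s \<in> sigmas1" and a: "a \<in> roots" for s a
  proof -
    have s': "s \<in> sigmas" using s by (simp add: sigmas1_def)
    interpret s: field_embedding s by (rule sigmasD(1)[OF s'])
    interpret act: field_embedding "const_action s" by (rule const_action_embedding[OF s.field_embedding_axioms])
    have bij: "bij_betw (const_action s) roots roots"
    proof -
      have "const_action s ` roots = roots"
        using const_action_roots[OF s.field_embedding_axioms]
        by (intro endo_inj_surj) (auto simp: inj_on_def)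
      thus ?thesis by (simp add: bij_betw_def inj_on_def)
    qed
    obtain m where m: "\<And>a. a \<in> roots \<Longrightarrow> m (const_action s a) = n a - n (const_action s a)"
    proof
      fix a assume "a \<in> roots"
      thus "(\<lambda>b. n (inv_into roots (const_action s) b) - n b) (const_action s a) = n a - n (const_action s a)"
        using bij by (simp add: bij_betw_def inv_into_f_f)
    qed
    have "s (rat_fun 1 roots n) = (\<Prod>a\<in>roots. (ff_x - ff_const (const_action s a)) powi n a)"
      by (simp add: rat_fun_def s.hom_prod sigmasD(2)[OF s'] ff_const_action[OF s.field_embedding_axioms])
    also have "\<dots> = (\<Prod>a\<in>roots. (ff_x - ff_const (const_action s a)) powi (m (const_action s a) + n (const_action s a)))"
      using m by (intro prod.cong) auto
    also have "\<dots> = (\<Prod>b\<in>roots. (ff_x - ff_const b) powi (m b + n b))"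
      by (rule prod.reindex_bij_betw[OF bij])
    also have "\<dots> = rat_fun 1 roots m * rat_fun 1 roots n"
      by (simp add: rat_fun_def power_int_add prod.distrib)
    finally have "s (rat_fun 1 roots n) = rat_fun 1 roots m * rat_fun 1 roots n" .
    hence "s h = s t * (rat_fun 1 roots m * rat_fun 1 roots n)" by (simp add: t(2))
    hence "rat_fun 1 roots m = s h / h * t / s t"
      using t kummer_nonzero[OF t(1)] by (simp add: field_simps)
    moreover obtain c' where c': "s h / h = ff_const c'" using inv[OF s] by auto
    moreover have "c' \<noteq> 0" using c' h(2) by auto
    ultimately have "rat_fun 1 roots m \<in> kummer"
      using kummer_divide[OF kummer_mult[OF kummer_const t(1)] kummer_sigma[OF s' t(1)]] by metis
    then obtain e where e: "\<And>b. b \<in> roots \<Longrightarrow> int q dvd m b - e" using kummer_exponents by blast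
    have "(\<Sum>b\<in>roots. m b) = (\<Sum>a\<in>roots. m (const_action s a))" by (rule sum.reindex_bij_betw[OF bij, symmetric])
    also have "\<dots> = (\<Sum>a\<in>roots. n a) - (\<Sum>a\<in>roots. n (const_action s a))" using m by (simp add: sum_subtractf)
    also have "(\<Sum>a\<in>roots. n (const_action s a)) = (\<Sum>a\<in>roots. n a)" by (rule sum.reindex_bij_betw[OF bij])
    finally have "(\<Sum>b\<in>roots. m b) = 0" by simp
    moreover have "int q dvd (\<Sum>b\<in>roots. m b - e)" using e by (intro dvd_sum) auto
    ultimately have "int q dvd int p * e" by (simp add: sum_subtractf card_roots)
    hence "int q dvd e" using coprime_pq by (simp add: coprime_commute coprime_dvd_mult_right_iff)
    hence "int q dvd (m (const_action s a) - e) + e"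
      using e const_action_roots[OF s.field_embedding_axioms a] by (intro dvd_add) auto
    thus ?thesis using m[OF a] by simp
  qed
  obtain a0 where a0: "a0 \<in> roots" using roots_nonempty by blast
  have n_const: "int q dvd n a - n a0" if "a \<in> roots" for a
    using sigmas1_transitive[OF that a0] n_inv that by metis
  define N where "N = (\<Prod>a\<in>roots. (ff_x - ff_const a) powi ((n a - n a0) div int q))"
  have N: "N \<in> L" "N \<noteq> 0" by (auto simp: N_def)
  \<comment> \<open>Exponents congruent to \<open>n a0\<close> split off a \<open>q\<close>-th power
    and leave the power \<open>n a0\<close> of \<open>F = Y ^ q\<close>.\<close>
  have "rat_fun 1 roots n = N ^ q * (Y powi n a0) ^ q"
  proof -
    have "(Y powi n a0) ^ q = (Y ^ q) powi n a0" by (metis mult.commute power_int_mult power_int_of_nat)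
    also have "\<dots> = (\<Prod>a\<in>roots. (ff_x - ff_const a)) powi n a0" by (simp add: Y_power FK_rat_fun rat_fun_def)
    also have "\<dots> = (\<Prod>a\<in>roots. (ff_x - ff_const a) powi n a0)"
      by (rule prod_powi_distrib)
    finally have 1: "(Y powi n a0) ^ q = (\<Prod>a\<in>roots. (ff_x - ff_const a) powi n a0)" .
    have "N ^ q = (\<Prod>a\<in>roots. (ff_x - ff_const a) powi (n a - n a0))"
      unfolding N_def prod_power_distrib
    proof (rule prod.cong[OF refl])
      fix a assume "a \<in> roots"
      hence "n a - n a0 = (n a - n a0) div int q * int q" using n_const by simp
      thus "((ff_x - ff_const a) powi ((n a - n a0) div int q)) ^ q = (ff_x - ff_const a) powi (n a - n a0)"
        by (metis power_int_mult power_int_of_nat)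
    qed
    hence "N ^ q * (Y powi n a0) ^ q = (\<Prod>a\<in>roots. (ff_x - ff_const a) powi (n a - n a0) * (ff_x - ff_const a) powi n a0)"
      by (simp add: 1 prod.distrib)
    also have "\<dots> = (\<Prod>a\<in>roots. (ff_x - ff_const a) powi n a)"
      by (intro prod.cong refl) (simp flip: power_int_add)
    finally show ?thesis by (simp add: rat_fun_def)
  qed
  hence "rat_fun 1 roots n \<in> kummer" using N by (auto intro!: kummer_mult kummer_power)
  thus ?thesis unfolding t(2) by (rule kummer_mult[OF t(1)])
qed

definition tau_quotient :: "ambient \<Rightarrow> ambient"
  where "tau_quotient f = f / tau f"

lemma tau_quotient_L: "f \<in> L \<Longrightarrow> tau_quotient f \<in> L"
  unfolding tau_quotient_def using tau_L[of f 1] by auto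

text \<open>The binomial expansion of \<open>(1 - tau) ^ m\<close> in multiplicative
  notation.\<close>

lemma tau_quotient_iterate:
  assumes "f \<noteq> 0"
  shows "(tau_quotient ^^ m) f = (\<Prod>i\<le>m. ((tau ^^ i) f) powi ((- 1) ^ i * int (m choose i)))"
proof (induction m)
  case (Suc m)
  define t where "t i = (tau ^^ i) f" for i
  have t0: "t i \<noteq> 0" for i using assms by (simp add: t_def)
  define E where "E m i = (- 1) ^ i * int (m choose i)" for m i
  define A where "A = (\<Prod>i\<le>m. t i powi E m i)"
  have tau_A: "tau A = (\<Prod>i\<le>m. t (Suc i) powi E m i)"
    by (simp add: A_def t_def tau.hom_prod)
  have E_rec: "E (Suc m) (Suc i) = E m (Suc i) - E m i" for i
    by (simp add: E_def algebra_simps)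
  have "(\<Prod>i\<le>Suc m. t i powi E (Suc m) i) = t 0 powi E (Suc m) 0 * (\<Prod>i\<le>m. t (Suc i) powi E (Suc m) (Suc i))"
    by (rule prod.atMost_Suc_shift)
  also have "\<dots> = t 0 powi E m 0 * (\<Prod>i\<le>m. t (Suc i) powi E m (Suc i)) / tau A"
    unfolding tau_A E_rec using t0 by (simp add: power_int_diff prod_dividef E_def)
  also have "t 0 powi E m 0 * (\<Prod>i\<le>m. t (Suc i) powi E m (Suc i)) = (\<Prod>i\<le>Suc m. t i powi E m i)"
    by (rule prod.atMost_Suc_shift[symmetric])
  also have "\<dots> = A" by (simp add: A_def E_def binomial_eq_0)
  finally have "(\<Prod>i\<le>Suc m. t i powi E (Suc m) i) = tau_quotient A" by (simp add: tau_quotient_def)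
  moreover have "(tau_quotient ^^ m) f = A" using Suc.IH by (simp add: A_def t_def E_def)
  ultimately show ?case by (simp add: t_def E_def del: prod.atMost_Suc)
qed simp

text \<open>Modulo \<open>q\<close>, the operator \<open>(1 - tau) ^ q\<close> is \<open>1 - tau ^ q = 0\<close>.\<close>

lemma tau_quotient_nilpotent:
  assumes f: "f \<in> L" "f \<noteq> 0"
  shows "(tau_quotient ^^ q) f \<in> kummer"
proof -
  define t where "t i = (tau ^^ i) f" for i
  define E where "E i = (- 1) ^ i * int (q choose i)" for i
  define A where "A = (\<Prod>i\<in>{1..<q}. t i powi (E i div int q))"
  have "A \<in> L" "A \<noteq> 0" using f tau_L by (auto simp: A_def t_def)
  have "A ^ q = (\<Prod>i\<in>{1..<q}. t i powi E i)"
    unfolding A_def prod_power_distrib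
  proof (rule prod.cong[OF refl])
    fix i assume i: "i \<in> {1..<q}"
    have "q dvd (q choose i)" using i prime_q by (intro dvd_choose_prime) auto
    hence "int q dvd E i" unfolding E_def by (intro dvd_mult) simp
    hence "E i = E i div int q * int q" by simp
    thus "(t i powi (E i div int q)) ^ q = t i powi E i" by (metis power_int_mult power_int_of_nat)
  qed
  moreover have "{..q} = insert 0 (insert q {1..<q})" using q_gt_0 by auto
  hence "(\<Prod>i\<le>q. t i powi E i) = t 0 powi E 0 * (t q powi E q * (\<Prod>i\<in>{1..<q}. t i powi E i))"
    using q_gt_1 by simp
  ultimately have eq: "(tau_quotient ^^ q) f = f * f powi ((- 1) ^ q) * A ^ q"
    unfolding tau_quotient_iterate[OF f(2)] using tau_q[OF f(1)] by (simp add: t_def E_def)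
  \<comment> \<open>The end terms of the expansion both involve \<open>f\<close>, since
    \<open>tau ^^ q\<close> fixes it. They cancel for odd \<open>q\<close> and give
    \<open>f ^ 2\<close> for \<open>q = 2\<close>.\<close>
  have "f * f powi ((- 1) ^ q) \<in> kummer"
  proof (cases "q = 2")
    case True
    have "f ^ q \<in> kummer" by (rule kummer_power[OF f])
    thus ?thesis using True by (simp add: power2_eq_square)
  next
    case False
    hence "odd q" using prime_q prime_odd_nat[of q] q_gt_1 by auto
    thus ?thesis using f(2) kummer_const[of 1] by (simp add: power_int_minus)
  qed
  thus ?thesis unfolding eq using kummer_power[OF \<open>A \<in> L\<close> \<open>A \<noteq> 0\<close>] by (rule kummer_mult)
qed

text \<open>With \<open>h m\<close> the \<open>m\<close>-fold \<open>tau_quotient\<close> of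
  \<open>f\<close>, the argument runs from \<open>h q\<close>, whose class is trivial, back to
  \<open>h 0 = f\<close>. The hypotheses pass to each \<open>h m\<close>: an embedding that commutes
  with \<open>tau\<close> and multiplies \<open>h m\<close> by a constant fixes the quotient of
  \<open>h m\<close> by its conjugate.\<close>

lemma kummer_if_divisible:
  assumes f: "f \<in> L" "f \<noteq> 0" "divisible f"
    and inv: "\<And>g. g \<in> sigmas1 \<Longrightarrow> g f / f \<in> range ff_const"
  shows "f \<in> kummer"
proof -
  define h where "h m = (tau_quotient ^^ m) f" for m
  have h_Suc: "h (Suc m) = h m / tau (h m)" for m by (simp add: h_def tau_quotient_def)
  have h: "h m \<in> L" "h m \<noteq> 0" "divisible (h m)" "\<And>g. g \<in> sigmas1 \<Longrightarrow> g (h m) / h m \<in> range ff_const" for m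
  proof (induction m)
    case 0
    show "h 0 \<in> L" "h 0 \<noteq> 0" "divisible (h 0)" using f by (simp_all add: h_def)
    show "g (h 0) / h 0 \<in> range ff_const" if "g \<in> sigmas1" for g using inv[OF that] by (simp add: h_def)
  next
    case (Suc m)
    show "h (Suc m) \<in> L" using tau_quotient_L[OF Suc(1)] by (simp add: h_def)
    show "h (Suc m) \<noteq> 0" using Suc(2) by (simp add: h_Suc)
    show "divisible (h (Suc m))" unfolding h_Suc using Suc by (intro divisible_divide divisible_tau)
    fix g assume g: "g \<in> sigmas1"
    interpret g: field_embedding g using g sigmasD(1) by (simp add: sigmas1_def)
    obtain c where c: "g (h m) / h m = ff_const c" using Suc(4)[OF g] by auto
    have "g (h m) \<noteq> 0" using Suc(2) by simp
    hence "c \<noteq> 0" using c Suc(2) by auto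
    have gh: "g (h m) = ff_const c * h m" using c Suc(2) by (simp add: field_simps)
    have "g (h (Suc m)) = h (Suc m)"
      unfolding h_Suc g.hom_divide sigma_tau[OF g Suc(1)] gh using \<open>c \<noteq> 0\<close> by (simp add: tau)
    thus "g (h (Suc m)) / h (Suc m) \<in> range ff_const"
      using \<open>h (Suc m) \<noteq> 0\<close> by (simp, metis ff_const.hom_one rangeI)
  qed
  have "h (q - m) \<in> kummer" if "m \<le> q" for m
    using that
  proof (induction m)
    case 0
    show ?case using tau_quotient_nilpotent[OF f(1,2)] by (simp add: h_def)
  next
    case (Suc m)
    define n where "n = q - Suc m"
    have "q - m = Suc n" using Suc.prems by (simp add: n_def)
    hence "h (Suc n) \<in> kummer" using Suc by simp
    hence "h n / tau (h n) \<in> kummer" unfolding h_Suc .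
    moreover have hn: "h n \<in> L" "h n \<noteq> 0" "divisible (h n)"
      "\<And>g. g \<in> sigmas1 \<Longrightarrow> g (h n) / h n \<in> range ff_const" by (fact h)+
    ultimately have "h n \<in> kummer" using kummer_if_tau_fixed[of "h n"] by blast
    thus ?case by (simp add: n_def)
  qed
  from this[of q] show ?thesis by (simp add: h_def)
qed

section \<open>Relations between the points \<open>(i, k)\<close>\<close>

text \<open>Elements of \<open>sigmas\<close> fix \<open>x\<close>, \<open>Y\<close> and the
  rational numbers, hence the points \<open>(i, k)\<close>.\<close>

lemma witness_sigma:
  assumes "divisor_witness a f" "g \<in> sigmas"
  shows "divisor_witness a (g f)"
  unfolding divisor_witness_def
proof (intro conjI allI impI)
  interpret g: field_embedding g by (rule sigmasD(1)[OF assms(2)])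
  note f = witnessD[OF assms(1)]
  show "g f \<in> L" "g f \<noteq> 0" using f sigma_L[OF assms(2)] by auto
  fix V c assume V: "affine V c"
  obtain b where b: "const_action g b = c" using const_action_surj[OF sigmasD(1)[OF assms(2)]] by blast
  have V': "affine (pullback L g V) b" using sigma_pullback[OF assms(2)] V b by simp
  have Yk: "Y - of_int k \<in> max_ideal (pullback L g V) \<longleftrightarrow> Y - of_int k \<in> max_ideal V"
    unfolding pullback_max_ideal[OF g.field_embedding_axioms L.subfield_set_axioms]
    using sigmasD(3)[OF assms(2)] by auto
  show "g f \<in> val_units V" if "Y - of_int k \<notin> max_ideal V"
    using f(4)[OF V'] Yk that
    unfolding pullback_units[OF g.field_embedding_axioms L.subfield_set_axioms] by blast
  fix i assume i: "i < p" "c = of_nat i" "Y - of_int k \<in> max_ideal V"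
  interpret act: field_embedding "const_action g" by (rule const_action_embedding[OF g.field_embedding_axioms])
  have "const_action g b = const_action g (of_nat i)" using b i(2) by simp
  hence "b = of_nat i" unfolding act.hom_eq_iff .
  hence "val_eq (pullback L g V) f ((ff_x - of_nat i) powi a i)" using f(3) V' i Yk by simp
  hence "val_eq V (g f) (g ((ff_x - of_nat i) powi a i))"
    by (subst (asm) pullback_val_eq[OF g.field_embedding_axioms L.subfield_set_axioms f(1)])
      (auto intro!: L.powi_closed L.diff_closed)
  thus "val_eq V (g f) ((ff_x - ff_const c) powi a i)" using sigmasD(2)[OF assms(2)] i(2) by simp
qed

lemma witness_cong: "divisor_witness a f \<Longrightarrow> (\<And>i. i < p \<Longrightarrow> a i = b i) \<Longrightarrow> divisor_witness b f"
  unfolding divisor_witness_def by simp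

text \<open>For \<open>g\<close> in \<open>sigmas1\<close> the function \<open>g f\<close> has the
  same affine divisor as \<open>f\<close>, so their quotient is a constant. This is the invariance
  that \<open>kummer_if_divisible\<close> asks for.\<close>

lemma witness_root:
  assumes "divisor_witness (\<lambda>i. int q * b i) f"
  shows "\<exists>g. divisor_witness b g"
proof -
  note f = witnessD[OF assms]
  have "divisible f" unfolding divisible_def
  proof (intro allI impI)
    fix V c assume V: "affine V c"
    interpret affine_place p q k V c using V by (rule affineD)
    show "\<exists>t\<in>L. val_eq V f (t ^ q)"
    proof (cases "Y - of_int k \<in> max_ideal V")
      case True
      obtain i where i: "i < p" "c = of_nat i" using special_point[OF V True] by blast
      have "(ff_x - of_nat i) powi (int q * b i) = ((ff_x - of_nat i) powi b i) ^ q"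
        by (metis mult.commute power_int_mult power_int_of_nat)
      hence "val_eq V f (((ff_x - of_nat i) powi b i) ^ q)" using f(3)[of V i] V i True by simp
      moreover have "(ff_x - of_nat i) powi b i \<in> L" by auto
      ultimately show ?thesis by blast
    next
      case False
      thus ?thesis using f(4)[OF V] by (intro bexI[of _ 1]) (auto simp: val_eq_one_iff)
    qed
  qed
  moreover have "g f / f \<in> range ff_const" if g: "g \<in> sigmas1" for g
  proof -
    have "g \<in> sigmas" using g by (simp add: sigmas1_def)
    from witness_mult[OF witness_sigma[OF assms this] witness_inverse[OF assms]]
    show ?thesis using constant_if_trivial_divisor by (simp add: divide_inverse)
  qed
  ultimately have "f \<in> kummer" using f(1,2) by (intro kummer_if_divisible)
  then obtain c g where g: "f = ff_const c * g ^ q" "c \<noteq> 0" "g \<in> L" "g \<noteq> 0" unfolding kummer_def by blast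
  have "divisor_witness b g" unfolding divisor_witness_def
  proof (intro conjI allI impI g)
    fix V a assume V: "affine V a"
    interpret affine_place p q k V a using V by (rule affineD)
    have fg: "val_eq V (g ^ q) f" unfolding g(1) using g by (intro val_eq_sym[OF val_eq_unit_mult]) auto
    show "g \<in> val_units V" if "Y - of_int k \<notin> max_ideal V"
      using root_unit[of g q] f(4)[OF V that] val_eq_units_iff[OF fg] g(3) by simp
    fix i assume i: "i < p" "a = of_nat i" "Y - of_int k \<in> max_ideal V"
    have "(ff_x - of_nat i) powi (int q * b i) = ((ff_x - of_nat i) powi b i) ^ q"
      by (metis mult.commute power_int_mult power_int_of_nat)
    hence "val_eq V (g ^ q) (((ff_x - of_nat i) powi b i) ^ q)"
      using f(3)[of V i] V i val_eq_trans[OF fg] by simp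
    hence "val_eq V g ((ff_x - of_nat i) powi b i)" by (rule val_eq_root) (use g in auto)
    thus "val_eq V g ((ff_x - ff_const a) powi b i)" using i(2) by simp
  qed
  thus ?thesis by blast
qed

text \<open>After division of \<open>f\<close> by \<open>(Y - k) powi a 0\<close> all orders are
  multiples of \<open>q\<close>, and a root can be extracted. This divides the sum of deviations
  from \<open>a 0\<close> by \<open>q\<close>, so the descent ends with deviation 0.\<close>

theorem witness_constant:
  assumes "divisor_witness a f" "i < p"
  shows "a i = a 0"
  using assms
proof (induction "nat (\<Sum>i<p. \<bar>a i - a 0\<bar>)" arbitrary: a f i rule: less_induct)
  case less
  define b where "b i = (a i - a 0) div int q" for i
  have p0: "0 < p" using p_gt_2 by simp
  have qb: "a i - a 0 = int q * b i" if "i < p" for i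
    using witness_congruent[OF less.prems(1) that p0] by (simp add: b_def)
  have "divisor_witness (\<lambda>i. a i + (- a 0) * 1) (f * (Y - of_int k) powi (- a 0))"
    by (intro witness_mult less.prems(1) witness_power witness_Y)
  hence "divisor_witness (\<lambda>i. int q * b i) (f * (Y - of_int k) powi (- a 0))"
    by (rule witness_cong) (simp flip: qb)
  then obtain g where g: "divisor_witness b g" using witness_root by blast
  have b0: "b 0 = 0" by (simp add: b_def)
  have sum: "(\<Sum>i<p. \<bar>a i - a 0\<bar>) = int q * (\<Sum>i<p. \<bar>b i - b 0\<bar>)"
    unfolding sum_distrib_left by (intro sum.cong) (auto simp: qb b0 abs_mult)
  have pos: "(\<Sum>i<p. \<bar>b i - b 0\<bar>) \<ge> 0" by (intro sum_nonneg) auto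
  have "b i = 0"
  proof (cases "(\<Sum>i<p. \<bar>b i - b 0\<bar>) = 0")
    case True
    have "\<bar>b i - b 0\<bar> \<le> (\<Sum>i<p. \<bar>b i - b 0\<bar>)"
      by (rule member_le_sum) (use less.prems(2) in \<open>simp_all only: lessThan_iff abs_ge_zero finite_lessThan\<close>)
    hence "\<bar>b i - b 0\<bar> = 0" unfolding True by (simp only: abs_le_zero_iff abs_eq_0)
    thus ?thesis by (simp add: b0)
  next
    case False
    hence "(\<Sum>i<p. \<bar>b i - b 0\<bar>) > 0" using pos by linarith
    moreover have "1 < int q" using q_gt_1 by simp
    ultimately have "1 * (\<Sum>i<p. \<bar>b i - b 0\<bar>) < int q * (\<Sum>i<p. \<bar>b i - b 0\<bar>)"
      by (intro mult_strict_right_mono)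
    hence "nat (\<Sum>i<p. \<bar>b i - b 0\<bar>) < nat (\<Sum>i<p. \<bar>a i - a 0\<bar>)"
      unfolding sum using pos by (subst nat_less_eq_zless) (simp_all only: mult_1)
    from less.hyps[OF this g less.prems(2)] show ?thesis unfolding b0 .
  qed
  hence "a i - a 0 = 0" using qb[OF less.prems(2)] by (simp only: mult_zero_right)
  thus ?case by simp
qed

end

section \<open>Points of the curve and orders of functions\<close>

lemma type_algebra_ops:
  "carrier (ring_of_type_algebra :: 'a :: field ring) = UNIV"
  "\<zero>\<^bsub>(ring_of_type_algebra :: 'a ring)\<^esub> = 0"
  "\<one>\<^bsub>(ring_of_type_algebra :: 'a ring)\<^esub> = 1"
  "a \<oplus>\<^bsub>(ring_of_type_algebra :: 'a ring)\<^esub> b = a + b"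
  "a \<otimes>\<^bsub>(ring_of_type_algebra :: 'a ring)\<^esub> b = a * b"
  by (simp_all add: ring_of_type_algebra_def)

lemma type_algebra_uminus: "\<ominus>\<^bsub>ring_of_type_algebra\<^esub> a = - (a :: 'a :: field)"
proof -
  interpret ring "ring_of_type_algebra :: 'a ring" by (rule ring_from_type_algebra)
  show ?thesis by (rule minus_equality) (simp_all add: type_algebra_ops)
qed

lemma type_algebra_inverse:
  assumes "a \<noteq> 0"
  shows "inv\<^bsub>ring_of_type_algebra\<^esub> a = inverse (a :: 'a :: field)"
proof -
  interpret cring "ring_of_type_algebra :: 'a ring" by (rule cring_from_type_algebra)
  show ?thesis by (rule comm_inv_char) (use assms in \<open>simp_all add: type_algebra_ops\<close>)
qed

lemma subring_type_algebra_iff: "subring R ring_of_type_algebra \<longleftrightarrow> subring_set (R :: 'a :: field set)"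
proof
  assume R: "subring R ring_of_type_algebra"
  note E = subringE[OF R, unfolded type_algebra_ops type_algebra_uminus]
  show "subring_set R"
  proof
    show "a - b \<in> R" if "a \<in> R" "b \<in> R" for a b using E(7)[OF that(1) E(5)[OF that(2)]] by simp
  qed (use E in auto)
next
  assume "subring_set R"
  then interpret subring_set R .
  interpret ring "ring_of_type_algebra :: 'a ring" by (rule ring_from_type_algebra)
  show "subring R ring_of_type_algebra"
    by (rule subringI) (auto simp: type_algebra_ops type_algebra_uminus)
qed

lemma generate_field_subset:
  assumes "subfield_set R" "H \<subseteq> (R :: 'a :: field set)"
  shows "generate_field ring_of_type_algebra H \<subseteq> R"
proof
  interpret subfield_set R by fact
  show "z \<in> R" if "z \<in> generate_field ring_of_type_algebra H" for z
    using that
    by induction (use assms(2) in \<open>auto simp: type_algebra_ops type_algebra_uminus type_algebra_inverse\<close>)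
qed

lemma subfield_generate_field: "subfield_set (generate_field ring_of_type_algebra (H :: 'a :: field set))"
proof
  note G = generate_field.one[of ring_of_type_algebra H] generate_field.a_inv[of _ ring_of_type_algebra H]
    generate_field.eng_add[of _ ring_of_type_algebra H] generate_field.eng_mult[of _ ring_of_type_algebra H]
    generate_field.m_inv[of _ ring_of_type_algebra H]
  let ?G = "generate_field ring_of_type_algebra H"
  show one: "1 \<in> ?G" using G(1) by (simp add: type_algebra_ops)
  show diff: "a - b \<in> ?G" if "a \<in> ?G" "b \<in> ?G" for a b
    using G(3)[OF that(1) G(2)[OF that(2)]] by (simp add: type_algebra_ops type_algebra_uminus)
  show "a * b \<in> ?G" if "a \<in> ?G" "b \<in> ?G" for a b using G(4)[OF that] by (simp add: type_algebra_ops)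
  show "inverse a \<in> ?G" if "a \<in> ?G" for a
    using G(5)[OF that] diff[OF one one] by (cases "a = 0") (auto simp: type_algebra_ops type_algebra_inverse)
qed

lemma uniformizes_imp_is_uniformizer:
  assumes "valuation_ring M V" "uniformizes M V t"
  shows "is_uniformizer V t"
proof -
  interpret valuation_ring M V by fact
  have t: "t \<in> max_ideal V" "t \<noteq> 0" using assms(2) by (auto simp: uniformizes_def)
  have "m \<in> (*) t ` V" if m: "m \<in> max_ideal V" for m
  proof (cases "m = 0")
    case False
    moreover have "m \<in> M" using m max_idealD(1) subset by blast
    ultimately obtain n where n: "val_eq V m (t powi n)" using assms(2) by (auto simp: uniformizes_def)
    hence "n > 0" using m val_eq_max_ideal_iff[OF n] max_ideal_powi(3)[OF t, of n] by simp
    hence "t powi (n - 1) \<in> V" using max_ideal_powi(1)[OF t, of "n - 1"] by simp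
    moreover have "m / t powi n \<in> V" using n by (simp add: val_eq_def val_units_def)
    ultimately have "m / t powi n * t powi (n - 1) \<in> V" by (intro mult_closed)
    moreover have "m = t * (m / t powi n * t powi (n - 1))" using t(2) by (simp add: power_int_diff)
    ultimately show ?thesis by blast
  qed auto
  moreover have "t * v \<in> max_ideal V" if "v \<in> V" for v using max_ideal_mult[OF t(1) that] .
  ultimately have "max_ideal V = (*) t ` V" by blast
  thus ?thesis using max_idealD(1)[OF t(1)] by (simp add: is_uniformizer_def max_ideal_def)
qed

text \<open>Two uniformizers divide each other in \<open>V\<close> and thus differ by a unit, so the
  exponent in \<open>ord_at\<close> does not depend on the decomposition.\<close>

lemma ord_at_eqI:
  assumes "valuation_ring M V" "uniformizes M V t" "val_eq V f (t powi n)"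
  shows "ord_at V f = n"
proof -
  interpret valuation_ring M V by fact
  have t: "t \<in> max_ideal V" "t \<noteq> 0" using assms(2) by (auto simp: uniformizes_def)
  have t_unif: "is_uniformizer V t" by (rule uniformizes_imp_is_uniformizer) fact+
  show ?thesis unfolding ord_at_def
  proof (rule the_equality)
    have "f = t powi n * (f / t powi n)" using t(2) by simp
    thus "\<exists>t u. is_uniformizer V t \<and> u \<in> val_units V \<and> f = t powi n * u"
      using t_unif assms(3) unfolding val_eq_def by blast
    fix m assume "\<exists>s u. is_uniformizer V s \<and> u \<in> val_units V \<and> f = s powi m * u"
    then obtain s u where s: "is_uniformizer V s" "u \<in> val_units V" "f = s powi m * u" by blast
    have "s \<in> V" and max_s: "max_ideal V = (*) s ` V" and max_t: "max_ideal V = (*) t ` V"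
      using s(1) t_unif by (auto simp: is_uniformizer_def max_ideal_def)
    obtain v where v: "v \<in> V" "t = s * v" using t(1) unfolding max_s by blast
    have "s * 1 \<in> max_ideal V" unfolding max_s using one_closed by blast
    then obtain w where w: "w \<in> V" "s = t * w" unfolding max_t by auto
    have nz: "s \<noteq> 0" "w \<noteq> 0" using v(2) w(2) t(2) by auto
    have "s / t = w" "inverse (s / t) = v" using v w t(2) nz by (simp_all add: field_simps)
    hence "val_eq V s t" using v(1) w(1) t(2) nz by (simp add: val_eq_def val_units_def)
    from val_eq_powi[OF this] have st: "val_eq V (s powi m) (t powi m)" .
    have "val_eq V f (s powi m)" using s(2,3) nz by (simp add: val_eq_def)
    from val_eq_trans[OF val_eq_sym[OF assms(3)] val_eq_trans[OF this st]]
    show "m = n" using val_eq_powi_iff[OF t] by simp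
  qed
qed

lemma val_eq_ord_at:
  assumes "valuation_ring M V" "uniformizes M V t" "f \<in> M" "f \<noteq> 0"
  shows "val_eq V f (t powi ord_at V f)"
proof -
  obtain n where "val_eq V f (t powi n)" using assms(2-4) by (auto simp: uniformizes_def)
  with ord_at_eqI[OF assms(1,2) this] show ?thesis by simp
qed

lemma (in field_embedding) val_units_image: "val_units (g ` V) = g ` val_units V"
  by (force simp: val_units_def simp flip: hom_inverse)

lemma (in field_embedding) val_eq_image:
  assumes "val_eq V a b"
  shows "val_eq (g ` V) (g a) (g b)"
proof -
  have "g (a / b) \<in> g ` val_units V" using assms by (intro imageI) (simp add: val_eq_def)
  thus ?thesis by (simp add: val_eq_def val_units_image)
qed

lemma (in field_embedding) max_ideal_image: "max_ideal (g ` V) = g ` max_ideal V"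
proof -
  have "inj g" by (simp add: inj_def)
  thus ?thesis by (simp add: max_ideal_def val_units_image image_set_diff)
qed

lemma (in field_embedding) valuation_ring_image:
  assumes "valuation_ring M V"
  shows "valuation_ring (g ` M) (g ` V)"
proof -
  interpret valuation_ring M V by fact
  show ?thesis
  proof unfold_locales
    show "1 \<in> g ` V" "1 \<in> g ` M" using one_closed L.one_closed hom_one by (metis imageI)+
    show "g ` V \<subseteq> g ` M" using subset by blast
    show "f \<in> g ` V \<or> inverse f \<in> g ` V" if "f \<in> g ` M" for f
      using that total by (force simp flip: hom_inverse)
  qed (use diff_closed mult_closed L.diff_closed L.mult_closed L.inverse_closed in
      \<open>force simp flip: hom_diff hom_mult hom_inverse\<close>)+
qed

lemma uniformizes_image:
  assumes "field_embedding g" "uniformizes M V t"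
  shows "uniformizes (g ` M) (g ` V) (g t)"
proof -
  interpret g: field_embedding g by fact
  have *: "\<exists>n. val_eq (g ` V) f (g t powi n)" if f: "f \<in> g ` M" "f \<noteq> 0" for f
  proof -
    obtain f' where f': "f = g f'" "f' \<in> M" using f(1) by blast
    hence "f' \<noteq> 0" using f(2) g.hom_zero by metis
    then obtain n where "val_eq V f' (t powi n)" using assms(2) f'(2) unfolding uniformizes_def by blast
    from g.val_eq_image[OF this] show ?thesis unfolding f'(1) g.hom_powi by (rule exI)
  qed
  have t: "t \<in> M" "t \<noteq> 0" "t \<in> max_ideal V" using assms(2) by (simp_all add: uniformizes_def)
  have "g t \<in> g ` M" "g t \<in> max_ideal (g ` V)" unfolding g.max_ideal_image using t by blast+
  moreover have "g t \<noteq> 0" using t(2) g.hom_eq_zero_iff by metis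
  ultimately show ?thesis unfolding uniformizes_def using * by blast
qed

context curve
begin

lemma geometric_function_field: "geometric_function_field q F = L"
proof -
  let ?G = "generate_field ring_of_type_algebra (range ff_const \<union> {ff_x, Y})"
  have "?G \<subseteq> L" by (rule generate_field_subset) (auto simp: L.subfield_set_axioms)
  moreover have "L \<subseteq> ?G"
  proof -
    interpret G: subfield_set ?G by (rule subfield_generate_field)
    have c: "ff_const c \<in> ?G" and x: "ff_x \<in> ?G" and Y: "Y \<in> ?G" for c
      by (auto intro: generate_field.incl)
    have "eval_x P \<in> ?G" for P
      unfolding eval_x_conv poly_altdef
      by (intro G.sum_closed G.mult_closed G.power_closed x) (subst coeff_map_poly, simp, rule c)
    hence rat: "r \<in> ?G" if "r \<in> rat_funs" for r
      using rat_funs_fraction[OF that] G.divide_closed by metis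
    have "(\<Sum>j<q. r j * Y ^ j) \<in> ?G" if "\<forall>j. r j \<in> rat_funs" for r
      using that by (intro G.sum_closed G.mult_closed G.power_closed rat Y) simp
    thus ?thesis unfolding L_def by blast
  qed
  ultimately show ?thesis by (simp add: geometric_function_field_def Y_def)
qed

section \<open>Classification of the points, and automorphisms acting on them\<close>

definition points :: "ambient set set"
  where "points = curve_points (range ff_const) L"

lemma points_iff: "V \<in> points \<longleftrightarrow> valuation_ring L V \<and> range ff_const \<subset> V \<and> V \<subset> L"
proof
  assume V: "V \<in> points"
  then interpret subring_set V by (simp add: points_def curve_points_def subring_type_algebra_iff)
  have "valuation_ring L V"
    by unfold_locales (use V in \<open>auto simp: points_def curve_points_def\<close>)
  thus "valuation_ring L V \<and> range ff_const \<subset> V \<and> V \<subset> L"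
    using V by (simp add: points_def curve_points_def)
next
  assume V: "valuation_ring L V \<and> range ff_const \<subset> V \<and> V \<subset> L"
  then interpret valuation_ring L V by simp
  show "V \<in> points"
    using V total subring_set_axioms by (auto simp: points_def curve_points_def subring_type_algebra_iff)
qed

lemma pointD:
  assumes "V \<in> points"
  shows "valuation_ring L V" "ff_const c \<in> V" "V \<subseteq> L" "V \<noteq> L" "range ff_const \<noteq> V"
  using assms by (auto simp: points_iff)

text \<open>If \<open>x\<close> is regular at \<open>V\<close> and every \<open>x - b\<close> is a
  unit, then K(x) and with it the integral element \<open>Y\<close> lie in \<open>V\<close>, so
  \<open>V\<close> would be all of \<open>L\<close>. If \<open>x\<close> is not regular,
  \<open>1 / x\<close> is a nonunit.\<close>

lemma point_cases:
  assumes "V \<in> points"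
  obtains b where "affine V b" | "gauss_valuation_inf L V UNIV (inverse ff_x)"
proof -
  interpret valuation_ring L V using assms by (rule pointD)
  note c = pointD(2)[OF assms]
  show thesis
  proof (cases "ff_x \<in> V")
    case True
    have "\<exists>b. ff_x - ff_const b \<in> max_ideal V"
    proof (rule ccontr)
      assume "\<not> ?thesis"
      hence unit: "ff_x - ff_const b \<in> val_units V" for b
        using unit_or_max_ideal[OF diff_closed[OF True c]] by blast
      have "rat_fun d S n \<in> V" for d S n
        unfolding rat_fun_def by (intro mult_closed c prod_closed unitD(1) unit_powi unit)
      hence rat: "r \<in> V" if "r \<in> rat_funs" for r
        using rat_fun_exists[OF that] by (cases "r = 0") (auto, metis)
      have "Y \<in> V" by (rule root_closed[of _ q]) (auto simp: Y_power rat)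
      hence "L \<subseteq> V" using rat by (auto simp: L_def)
      thus False using pointD(3,4)[OF assms] by blast
    qed
    thus thesis using affineI[of V] valuation_ring_axioms c that(1) by blast
  next
    case False
    hence "inverse ff_x \<in> max_ideal V" by (intro not_in_ring) auto
    hence "gauss_valuation_inf L V UNIV (inverse ff_x)"
      by unfold_locales (use c rat_funs_subset_L in auto)
    thus thesis by (rule that(2))
  qed
qed

lemma affine_point:
  assumes "affine V b"
  shows "V \<in> points"
proof -
  interpret affine_place p q k V b using assms by (rule affineD)
  have "inverse (ff_x - ff_const b) \<notin> V" using max_idealD(3)[OF z_max_ideal] by simp
  moreover have "inverse (ff_x - ff_const b) \<in> L" by (intro L.inverse_closed L.diff_closed) auto
  moreover have "ff_x \<in> V" "ff_x \<notin> range ff_const" using ff_x_ring by auto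
  ultimately show ?thesis using valuation_ring_axioms subset by (auto simp: points_iff)
qed

lemma point_uniformizer: "V \<in> points \<Longrightarrow> \<exists>t. uniformizes L V t"
  by (erule point_cases) (auto intro: affine_uniformizer infinite_uniformizer)

lemma ord_at_mult:
  assumes "V \<in> points" "f \<in> L" "f \<noteq> 0" "g \<in> L" "g \<noteq> 0"
  shows "ord_at V (f * g) = ord_at V f + ord_at V g"
proof -
  obtain t where t: "uniformizes L V t" using point_uniformizer[OF assms(1)] by blast
  note V = pointD(1)[OF assms(1)]
  interpret valuation_ring L V by (rule V)
  have "t \<noteq> 0" using t by (auto simp: uniformizes_def)
  thus ?thesis
    using val_eq_mult[OF val_eq_ord_at[OF V t assms(2,3)] val_eq_ord_at[OF V t assms(4,5)]]
    by (intro ord_at_eqI[OF V t]) (simp add: power_int_add)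
qed

lemma ord_at_one: "V \<in> points \<Longrightarrow> ord_at V 1 = 0"
  using ord_at_mult[of V 1 1] by simp

lemma ord_at_inverse:
  assumes "V \<in> points" "f \<in> L" "f \<noteq> 0"
  shows "ord_at V (inverse f) = - ord_at V f"
  using ord_at_mult[of V f "inverse f"] ord_at_one[of V] assms L.inverse_closed[of f] by auto

text \<open>An automorphism of \<open>L\<close> is studied through an extension to the ambient field, which maps constants
  to constants.\<close>

definition auts :: "(ambient \<Rightarrow> ambient) set"
  where "auts = {g \<in> sigmas. g ` L = L}"

lemma lift_automorphism:
  assumes "bij_betw s L L" "s 1 = 1" "s ff_x = ff_x" "s Y = Y"
    and "\<And>a b. a \<in> L \<Longrightarrow> b \<in> L \<Longrightarrow> s (a - b) = s a - s b"
    and "\<And>a b. a \<in> L \<Longrightarrow> b \<in> L \<Longrightarrow> s (a * b) = s a * s b"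
  shows "\<exists>g\<in>auts. \<forall>f\<in>L. g f = s f"
proof -
  define G where "G = (\<lambda>f. (f, s f)) ` L"
  have "s 0 = 0" using assms(5)[of 0 0] by simp
  hence zero: "s f = 0 \<longleftrightarrow> f = 0" if "f \<in> L" for f
    using that assms(1) L.zero_closed by (metis bij_betw_def inj_on_eq_iff)
  have "partial_embedding G"
  proof
    show "(1, 1) \<in> G" using assms(2) by (force simp: G_def)
    show "(a - c, b - d) \<in> G" if "(a, b) \<in> G" "(c, d) \<in> G" for a b c d
      using that assms(5) L.diff_closed by (force simp: G_def)
    show "(a * c, b * d) \<in> G" if "(a, b) \<in> G" "(c, d) \<in> G" for a b c d
      using that assms(6) L.mult_closed by (force simp: G_def)
  qed (use zero in \<open>auto simp: G_def\<close>)
  moreover have "(ff_x, ff_x) \<in> G" using assms(3) by (force simp: G_def)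
  ultimately obtain g where g: "field_embedding g" "\<And>a b. (a, b) \<in> G \<Longrightarrow> g a = b"
    using extend_to_ambient by blast
  have gs: "g f = s f" if "f \<in> L" for f using g(2) that by (auto simp: G_def)
  have "g ` L = L" using assms(1) gs by (simp add: bij_betw_def cong: image_cong)
  moreover have "g \<in> sigmas" using g(1) gs assms(3,4) by (simp add: sigmas_def)
  ultimately show ?thesis using gs by (intro bexI[of _ g]) (simp_all add: auts_def)
qed

text \<open>The inverse is formed on \<open>L\<close> and extended anew, as \<open>g\<close> need
  not be surjective on the ambient field.\<close>

lemma aut_inverse:
  assumes "g \<in> auts"
  obtains h where "h \<in> auts" "\<And>f. f \<in> L \<Longrightarrow> h (g f) = f" "\<And>f. f \<in> L \<Longrightarrow> g (h f) = f"
proof -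
  interpret g: field_embedding g using assms by (simp add: auts_def sigmas_def)
  have gL: "g ` L = L" "g ff_x = ff_x" "g Y = Y" using assms by (auto simp: auts_def sigmas_def)
  define s where "s = inv_into L g"
  have inj: "inj_on g L" by (simp add: inj_on_def)
  have gs: "g (s f) = f" "s f \<in> L" if "f \<in> L" for f
    using that gL(1) by (auto simp: s_def f_inv_into_f inv_into_into)
  have sI: "s f = f'" if "g f' = f" "f' \<in> L" for f f'
    using inv_into_f_f[OF inj that(2)] that(1) by (simp add: s_def)
  have "bij_betw s L L" unfolding s_def by (rule bij_betw_inv_into) (simp add: bij_betw_def inj gL)
  moreover have "s 1 = 1" "s ff_x = ff_x" "s Y = Y" by (rule sI; simp add: gL)+
  moreover have "s (a - b) = s a - s b" "s (a * b) = s a * s b" if "a \<in> L" "b \<in> L" for a b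
    by (rule sI; simp add: gs that L.diff_closed L.mult_closed)+
  ultimately have "\<exists>h\<in>auts. \<forall>f\<in>L. h f = s f" by (intro lift_automorphism)
  then obtain h where h: "h \<in> auts" "\<And>f. f \<in> L \<Longrightarrow> h f = s f" by blast
  show thesis
  proof (rule that[OF h(1)])
    fix f assume f: "f \<in> L"
    hence "g f \<in> L" using gL(1) by blast
    thus "h (g f) = f" using h(2) sI[OF refl f] by simp
    show "g (h f) = f" using h(2)[OF f] gs(1)[OF f] by simp
  qed
qed

lemma field_automorphism_aut:
  assumes "s \<in> field_automorphisms L M" "ff_x \<in> M" "Y \<in> M"
  shows "\<exists>g\<in>auts. \<forall>f\<in>L. g f = s f"
proof (rule lift_automorphism)
  have "s \<in> ring_iso (ring_of_type_algebra\<lparr>carrier := L\<rparr>) (ring_of_type_algebra\<lparr>carrier := L\<rparr>)"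
    using assms(1) by (simp add: field_automorphisms_def)
  note E = ring_iso_memE[OF this, simplified, unfolded type_algebra_ops]
  show "bij_betw s L L" "s 1 = 1" by (rule E)+
  show "s ff_x = ff_x" "s Y = Y" using assms by (simp_all add: field_automorphisms_def)
  fix a b assume ab: "a \<in> L" "b \<in> L"
  show "s (a * b) = s a * s b" using E(2)[OF ab] .
  have "s (a - b + b) = s (a - b) + s b" by (rule E(3)) (use ab in auto)
  thus "s (a - b) = s a - s b" by simp
qed

lemma aut_const: "g \<in> auts \<Longrightarrow> g ` range ff_const = range ff_const"
proof -
  assume "g \<in> auts"
  hence g: "field_embedding g" by (simp add: auts_def sigmas_def)
  show ?thesis
    using embedding_const[OF g] const_action_surj[OF g] ff_const_action[OF g]
    by (auto simp: image_iff) (metis rangeI)+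
qed

lemma aut_point:
  assumes "g \<in> auts" "V \<in> points"
  shows "g ` V \<in> points" "f \<in> L \<Longrightarrow> f \<noteq> 0 \<Longrightarrow> ord_at (g ` V) (g f) = ord_at V f"
proof -
  interpret g: field_embedding g using assms by (simp add: auts_def sigmas_def)
  have inj: "inj g" by (simp add: inj_def)
  have gL: "g ` L = L" using assms by (simp add: auts_def)
  have V: "valuation_ring L (g ` V)" using g.valuation_ring_image[OF pointD(1)[OF assms(2)]] gL by simp
  have "range ff_const \<subset> V" "V \<subset> L" using assms(2) by (auto simp: points_iff)
  hence "g ` range ff_const \<subset> g ` V" "g ` V \<subset> g ` L" by (simp_all add: image_strict_mono inj_on_subset[OF inj])
  thus "g ` V \<in> points" using V unfolding points_iff aut_const[OF assms(1)] gL by blast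
  obtain t where t: "uniformizes L V t" using point_uniformizer[OF assms(2)] by blast
  assume f: "f \<in> L" "f \<noteq> 0"
  have "val_eq (g ` V) (g f) (g t powi ord_at V f)"
    using g.val_eq_image[OF val_eq_ord_at[OF pointD(1)[OF assms(2)] t f]] by simp
  thus "ord_at (g ` V) (g f) = ord_at V f"
    using ord_at_eqI[OF V] uniformizes_image[OF g.field_embedding_axioms t] gL by simp
qed

text \<open>The point \<open>(i, k)\<close>.\<close>

definition P :: "nat \<Rightarrow> ambient set"
  where "P i = (SOME V. affine V (of_nat i) \<and> Y - of_int k \<in> max_ideal V)"

lemma P:
  assumes "i < p"
  shows "affine (P i) (of_nat i)" "Y - of_int k \<in> max_ideal (P i)"
proof -
  obtain V where V: "affine V (of_nat i)" using affine_exists by blast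
  then obtain t where t: "(tau ^^ t) (Y - of_int k) \<in> max_ideal V" using unique_conjugate[OF V assms] by blast
  have "Y - of_int k \<in> max_ideal (pullback L (tau ^^ t) V)"
    unfolding pullback_max_ideal[OF tau_n.field_embedding_axioms L.subfield_set_axioms] using t by auto
  hence "\<exists>V. affine V (of_nat i) \<and> Y - of_int k \<in> max_ideal V" using pullback_tau[OF V] by blast
  from someI_ex[OF this] show "affine (P i) (of_nat i)" "Y - of_int k \<in> max_ideal (P i)"
    unfolding P_def by blast+
qed

lemma P_unique:
  assumes "i < p" "affine V (of_nat i)" "Y - of_int k \<in> max_ideal V"
  shows "V = P i"
  by (rule unramified_place_unique[where b = "of_nat i" and c = "of_int k"])
    (use assms P nonroot_special[of "of_nat i"] in auto)

lemma P_inj: "inj_on P {..<p}"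
proof (rule inj_onI)
  fix i j assume ij: "i \<in> {..<p}" "j \<in> {..<p}" "P i = P j"
  interpret affine_place p q k "P i" "of_nat i" by (rule affineD, rule P) (use ij in simp)
  interpret j: affine_place p q k "P i" "of_nat j" unfolding ij(3) by (rule affineD, rule P) (use ij in simp)
  from max_ideal_diff[OF z_max_ideal j.z_max_ideal]
  have "ff_const (of_nat j - of_nat i) \<in> max_ideal (P i)" by simp
  thus "i = j" unfolding const_max_ideal_iff by simp
qed

lemma P_point: "i < p \<Longrightarrow> P i \<in> points"
  using P affine_point by blast

text \<open>An automorphism fixing \<open>x\<close> and \<open>Y\<close> preserves the two
  conditions that single out \<open>P i\<close>; this is the rationality of the point.\<close>

lemma aut_P:
  assumes "g \<in> auts" "i < p"
  shows "g ` P i = P i"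
proof (rule P_unique[OF assms(2)])
  interpret g: field_embedding g using assms by (simp add: auts_def sigmas_def)
  have gx: "g ff_x = ff_x" "g Y = Y" using assms by (auto simp: auts_def sigmas_def)
  note Q = aut_point(1)[OF assms(1) P_point[OF assms(2)]]
  interpret affine_place p q k "P i" "of_nat i" using P assms by (auto intro: affineD)
  show "affine (g ` P i) (of_nat i)"
  proof (rule affineI)
    have "g (ff_x - ff_const (of_nat i)) \<in> max_ideal (g ` P i)"
      unfolding g.max_ideal_image using z_max_ideal by blast
    thus "ff_x - ff_const (of_nat i) \<in> max_ideal (g ` P i)" using gx by simp
  qed (use pointD[OF Q] in auto)
  have "g (Y - of_int k) \<in> max_ideal (g ` P i)"
    unfolding g.max_ideal_image using P(2)[OF assms(2)] by blast
  thus "Y - of_int k \<in> max_ideal (g ` P i)" using gx by simp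
qed

text \<open>Passage from \<open>ord_at\<close> to \<open>divisor_witness\<close>: the points
  \<open>P i\<close> are unramified over the line, so \<open>x - i\<close> is a uniformizer
  there.\<close>

lemma function_with_special_divisor:
  assumes f: "f \<in> L" "f \<noteq> 0"
    and ord: "\<And>V. V \<in> points \<Longrightarrow> V \<notin> P ` {..<p} \<Longrightarrow> ord_at V f = 0"
  shows "divisor_witness (\<lambda>i. ord_at (P i) f) f"
  unfolding divisor_witness_def
proof (intro conjI allI impI f)
  fix V b i assume V: "affine V b" "i < p" "b = of_nat i" "Y - of_int k \<in> max_ideal V"
  hence "V = P i" by (intro P_unique) auto
  moreover have "uniformizes L V (ff_x - ff_const b)"
    using V special_not_root[of i] by (intro unramified_uniformizer) auto
  ultimately show "val_eq V f ((ff_x - ff_const b) powi ord_at (P i) f)"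
    using val_eq_ord_at[OF pointD(1)[OF affine_point[OF V(1)]] _ f] by simp
next
  fix V b assume V: "affine V b" "Y - of_int k \<notin> max_ideal V"
  note V' = affine_point[OF V(1)]
  interpret valuation_ring L V by (rule pointD(1)[OF V'])
  have "V \<notin> P ` {..<p}" using V(2) P(2) by auto
  moreover obtain t where t: "uniformizes L V t" using point_uniformizer[OF V'] by blast
  ultimately have "val_eq V f (t powi 0)" using val_eq_ord_at[OF pointD(1)[OF V'] t f] ord[OF V'] by simp
  thus "f \<in> val_units V" by (simp add: val_eq_one_iff)
qed

lemma special_orders_equal:
  assumes "f \<in> L" "f \<noteq> 0" "\<And>V. V \<in> points \<Longrightarrow> V \<notin> P ` {..<p} \<Longrightarrow> ord_at V f = 0" "i < p"
  shows "ord_at (P i) f = ord_at (P 0) f"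
  using witness_constant[OF function_with_special_divisor[OF assms(1-3)] assms(4)] .

end

section \<open>Divisor classes\<close>

lemma divisor_degree_superset:
  assumes "finite A" "Poly_Mapping.keys D \<subseteq> A"
  shows "divisor_degree D = (\<Sum>V\<in>A. Poly_Mapping.lookup D V)"
  unfolding divisor_degree_def
  by (rule sum.mono_neutral_left) (use assms in \<open>auto simp: in_keys_iff\<close>)

lemma divisor_degree_add: "divisor_degree (D + E) = divisor_degree D + divisor_degree E"
proof -
  let ?A = "Poly_Mapping.keys D \<union> Poly_Mapping.keys E"
  have "Poly_Mapping.keys (D + E) \<subseteq> ?A" by (rule keys_add)
  thus ?thesis by (simp add: divisor_degree_superset[of ?A] lookup_add sum.distrib)
qed

lemma divisor_degree_zero [simp]: "divisor_degree 0 = 0"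
  by (simp add: divisor_degree_def)

lemma divisor_degree_uminus: "divisor_degree (- D) = - divisor_degree D"
  using divisor_degree_add[of D "- D"] by simp

lemma divisor_degree_frag_of: "divisor_degree (frag_of V) = 1"
  by (simp add: divisor_degree_def)

lemma lookup_divisor_action:
  assumes "inj g"
  shows "Poly_Mapping.lookup (divisor_action g D) (g ` V) = Poly_Mapping.lookup D V"
proof -
  have "Poly_Mapping.lookup (divisor_action g D) (g ` V) =
      (\<Sum>W\<in>Poly_Mapping.keys D. if V = W then Poly_Mapping.lookup D W else 0)"
    unfolding divisor_action_def frag_extend_def lookup_sum
    by (intro sum.cong) (auto simp: inj_image_eq_iff[OF assms])
  thus ?thesis by (simp add: in_keys_iff)
qed

lemma keys_divisor_action: "Poly_Mapping.keys (divisor_action g D) \<subseteq> image g ` Poly_Mapping.keys D"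
  unfolding divisor_action_def using keys_frag_extend[of "\<lambda>P. frag_of (g ` P)" D] by auto

lemma divisor_action_add: "divisor_action g (D + E) = divisor_action g D + divisor_action g E"
  by (simp add: divisor_action_def frag_extend_add)

lemma divisor_action_uminus: "divisor_action g (- D) = - divisor_action g D"
  by (simp add: divisor_action_def frag_extend_minus)

context curve
begin

definition Div :: "(ambient set \<Rightarrow>\<^sub>0 int) monoid"
  where "Div = free_Abelian_group points"

definition H :: "(ambient set \<Rightarrow>\<^sub>0 int) set"
  where "H = principal_divisors (range ff_const) L"

lemma Div_simps [simp]: "D \<in> carrier Div \<longleftrightarrow> Poly_Mapping.keys D \<subseteq> points"
  "D \<otimes>\<^bsub>Div\<^esub> E = D + E" "\<one>\<^bsub>Div\<^esub> = 0"
  "Poly_Mapping.keys D \<subseteq> points \<Longrightarrow> inv\<^bsub>Div\<^esub> D = - D"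
  "Poly_Mapping.keys D \<subseteq> points \<Longrightarrow> D [^]\<^bsub>Div\<^esub> (n :: int) = frag_cmul n D"
  by (simp_all add: Div_def)

sublocale Div: comm_group Div
  unfolding Div_def by (rule abelian_free_Abelian_group)

lemma H_iff: "D \<in> H \<longleftrightarrow> Poly_Mapping.keys D \<subseteq> points \<and>
    (\<exists>f\<in>L. f \<noteq> 0 \<and> (\<forall>V\<in>points. Poly_Mapping.lookup D V = ord_at V f))"
  by (simp add: H_def principal_divisors_def divisor_group_def points_def)

lemma H_subgroup: "subgroup H Div"
proof (rule Div.subgroupI)
  show "H \<subseteq> carrier Div" by (auto simp: H_iff)
  have "0 \<in> H" unfolding H_iff by (auto intro!: bexI[of _ 1] simp: ord_at_one)
  thus "H \<noteq> {}" by blast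
next
  fix D assume D: "D \<in> H"
  then obtain f where f: "f \<in> L" "f \<noteq> 0" "\<forall>V\<in>points. Poly_Mapping.lookup D V = ord_at V f"
    and k: "Poly_Mapping.keys D \<subseteq> points" unfolding H_iff by blast
  have "\<forall>V\<in>points. Poly_Mapping.lookup (- D) V = ord_at V (inverse f)"
    using f by (simp add: ord_at_inverse)
  hence "- D \<in> H" unfolding H_iff using f k L.inverse_closed[of f]
    by (intro conjI bexI[of _ "inverse f"]) auto
  thus "inv\<^bsub>Div\<^esub> D \<in> H" using k by simp
next
  fix D E assume D: "D \<in> H" "E \<in> H"
  obtain f where f: "f \<in> L" "f \<noteq> 0" "\<forall>V\<in>points. Poly_Mapping.lookup D V = ord_at V f"
    and k: "Poly_Mapping.keys D \<subseteq> points" using D(1) unfolding H_iff by blast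
  obtain g where g: "g \<in> L" "g \<noteq> 0" "\<forall>V\<in>points. Poly_Mapping.lookup E V = ord_at V g"
    and k': "Poly_Mapping.keys E \<subseteq> points" using D(2) unfolding H_iff by blast
  have "\<forall>V\<in>points. Poly_Mapping.lookup (D + E) V = ord_at V (f * g)"
    using f g by (simp add: ord_at_mult lookup_add)
  moreover have "Poly_Mapping.keys (D + E) \<subseteq> points" using keys_add[of D E] k k' by blast
  ultimately have "D + E \<in> H" unfolding H_iff using f(1,2) g(1,2) L.mult_closed[of f g]
    by (intro conjI bexI[of _ "f * g"]) auto
  thus "D \<otimes>\<^bsub>Div\<^esub> E \<in> H" by simp
qed

sublocale H: normal H Div
  by (rule Div.subgroup_imp_normal[OF H_subgroup])

definition cls :: "(ambient set \<Rightarrow>\<^sub>0 int) \<Rightarrow> (ambient set \<Rightarrow>\<^sub>0 int) set"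
  where "cls D = H #>\<^bsub>Div\<^esub> D"

lemma cls_conv: "cls D = (\<lambda>E. E + D) ` H"
  by (auto simp: cls_def r_coset_def)

lemma aut_action:
  assumes "g \<in> auts" "Poly_Mapping.keys D \<subseteq> points"
  shows "Poly_Mapping.keys (divisor_action g D) \<subseteq> points"
  using keys_divisor_action[of g D] aut_point(1)[OF assms(1)] assms(2) by blast

lemma aut_action_inverse:
  assumes "Poly_Mapping.keys D \<subseteq> points" "\<And>f. f \<in> L \<Longrightarrow> g (h f) = f"
  shows "divisor_action g (divisor_action h D) = D"
proof -
  have "g ` h ` V = V" if "V \<in> points" for V
  proof -
    have "g ` h ` V = (\<lambda>f. f) ` V"
      unfolding image_image using pointD(3)[OF that] assms(2) by (intro image_cong) auto
    thus ?thesis by simp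
  qed
  hence "frag_extend (\<lambda>V. frag_of (g ` h ` V)) D = frag_extend frag_of D"
    by (intro frag_extend_eq) (use assms(1) in auto)
  hence "frag_extend (\<lambda>V. frag_of (g ` h ` V)) D = D"
    using frag_expansion[of D] by metis
  thus ?thesis
    using frag_extend_compose[of "\<lambda>V. frag_of (g ` V)" "image h" D] by (simp add: divisor_action_def o_def)
qed

lemma aut_action_principal:
  assumes g: "g \<in> auts" and "D \<in> H"
  shows "divisor_action g D \<in> H"
proof -
  obtain h where h: "h \<in> auts" "\<And>f. f \<in> L \<Longrightarrow> h (g f) = f" "\<And>f. f \<in> L \<Longrightarrow> g (h f) = f"
    using aut_inverse[OF g] by blast
  interpret g: field_embedding g using g by (simp add: auts_def sigmas_def)
  have gL: "g ` L = L" using g by (simp add: auts_def)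
  have inj: "inj g" by (simp add: inj_def)
  obtain f where f: "f \<in> L" "f \<noteq> 0" "\<forall>V\<in>points. Poly_Mapping.lookup D V = ord_at V f"
    and k: "Poly_Mapping.keys D \<subseteq> points" using assms(2) unfolding H_iff by blast
  have "Poly_Mapping.lookup (divisor_action g D) W = ord_at W (g f)" if W: "W \<in> points" for W
  proof -
    have V: "h ` W \<in> points" by (rule aut_point(1)[OF h(1) W])
    have "g ` h ` W = (\<lambda>f. f) ` W"
      unfolding image_image using pointD(3)[OF W] h(3) by (intro image_cong) auto
    hence "g ` h ` W = W" by simp
    thus ?thesis
      using lookup_divisor_action[OF inj, of D "h ` W"] aut_point(2)[OF g V f(1,2)] f(3) V by simp
  qed
  moreover have "g f \<in> L" "g f \<noteq> 0" using f gL by auto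
  ultimately show ?thesis unfolding H_iff using aut_action[OF g k] by blast
qed

lemma aut_action_cls:
  assumes "g \<in> auts" "Poly_Mapping.keys D \<subseteq> points"
  shows "divisor_action g ` cls D = cls (divisor_action g D)"
proof -
  obtain h where h: "h \<in> auts" "\<And>f. f \<in> L \<Longrightarrow> h (g f) = f" "\<And>f. f \<in> L \<Longrightarrow> g (h f) = f"
    using aut_inverse[OF assms(1)] by blast
  have "divisor_action g ` H = H"
  proof
    show "divisor_action g ` H \<subseteq> H" using aut_action_principal[OF assms(1)] by blast
    show "H \<subseteq> divisor_action g ` H"
    proof
      fix E assume E: "E \<in> H"
      have "divisor_action g (divisor_action h E) = E"
        by (rule aut_action_inverse) (use E h(3) in \<open>auto simp: H_iff\<close>)
      thus "E \<in> divisor_action g ` H" using aut_action_principal[OF h(1) E] by (metis imageI)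
    qed
  qed
  moreover have "divisor_action g ` cls D = (\<lambda>E. E + divisor_action g D) ` divisor_action g ` H"
    by (simp add: cls_conv image_image divisor_action_add)
  ultimately show ?thesis by (simp add: cls_conv)
qed

lemma cls_eq: "E \<in> cls D \<Longrightarrow> Poly_Mapping.keys D \<subseteq> points \<Longrightarrow> cls E = cls D"
  unfolding cls_def using Div.repr_independence[OF _ _ H_subgroup] by simp

lemma cls_self: "Poly_Mapping.keys D \<subseteq> points \<Longrightarrow> D \<in> cls D"
  unfolding cls_def using Div.rcos_self[OF _ H_subgroup] by simp

lemma cls_mult: "Poly_Mapping.keys D \<subseteq> points \<Longrightarrow> Poly_Mapping.keys E \<subseteq> points \<Longrightarrow>
    cls D \<otimes>\<^bsub>Div Mod H\<^esub> cls E = cls (D + E)"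
  unfolding cls_def by (simp add: H.rcos_sum)

lemma cls_eq_H_iff: "Poly_Mapping.keys D \<subseteq> points \<Longrightarrow> cls D = H \<longleftrightarrow> D \<in> H"
  unfolding cls_def using Div.coset_join1[OF _ _ H_subgroup] Div.coset_join2[OF _ H_subgroup] by auto

lemma cls_carrier: "Poly_Mapping.keys D \<subseteq> points \<Longrightarrow> cls D \<in> carrier (Div Mod H)"
  unfolding cls_def carrier_FactGroup by auto

lemma cls_zero: "cls 0 = H"
  by (simp add: cls_conv)

lemma cls_inv: "Poly_Mapping.keys D \<subseteq> points \<Longrightarrow> inv\<^bsub>Div Mod H\<^esub> cls D = cls (- D)"
  using H.inv_FactGroup[of "cls D"] cls_carrier[of D] H.rcos_inv[of D] by (simp add: cls_def)

lemma cls_int_pow: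
  assumes "Poly_Mapping.keys D \<subseteq> points"
  shows "cls D [^]\<^bsub>Div Mod H\<^esub> (n :: int) = cls (frag_cmul n D)"
  using H.FactGroup_int_pow[of D n] assms by (simp add: cls_def)

text \<open>Elements of \<open>field_automorphisms\<close> are maps on the whole ambient type with
  prescribed behaviour on \<open>L\<close> only. Points are subsets of \<open>L\<close>, so an
  ambient embedding agreeing with \<open>s\<close> on \<open>L\<close> acts in the same way.\<close>

lemma field_automorphism_action:
  assumes "s \<in> field_automorphisms L (rational_function_field q F)"
  obtains g where "g \<in> auts" "\<And>D. Poly_Mapping.keys D \<subseteq> points \<Longrightarrow> divisor_action s D = divisor_action g D"
proof -
  have "\<exists>g\<in>auts. \<forall>f\<in>L. g f = s f"
    by (rule field_automorphism_aut[OF assms])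
      (auto simp: rational_function_field_def Y_def intro: generate_field.incl)
  then obtain g where g: "g \<in> auts" "\<And>f. f \<in> L \<Longrightarrow> g f = s f" by blast
  have "s ` V = g ` V" if "V \<in> points" for V
    using pointD(3)[OF that] g(2) by (intro image_cong) auto
  hence "divisor_action s D = divisor_action g D" if "Poly_Mapping.keys D \<subseteq> points" for D
    unfolding divisor_action_def using that by (intro frag_extend_eq) auto
  thus thesis using that g(1) by blast
qed

lemma cls_keys: "E \<in> cls D \<Longrightarrow> Poly_Mapping.keys D \<subseteq> points \<Longrightarrow> Poly_Mapping.keys E \<subseteq> points"
proof -
  assume E: "E \<in> cls D" and D: "Poly_Mapping.keys D \<subseteq> points"
  then obtain E' where "E = E' + D" "Poly_Mapping.keys E' \<subseteq> points" by (auto simp: cls_conv H_iff)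
  thus ?thesis using keys_add[of E' D] D by blast
qed

lemma field_automorphism_cls:
  assumes "s \<in> field_automorphisms L (rational_function_field q F)" "Poly_Mapping.keys D \<subseteq> points"
  shows "Poly_Mapping.keys (divisor_action s D) \<subseteq> points"
    and "divisor_action s ` cls D = cls (divisor_action s D)"
proof -
  obtain g where g: "g \<in> auts" "\<And>D. Poly_Mapping.keys D \<subseteq> points \<Longrightarrow> divisor_action s D = divisor_action g D"
    using field_automorphism_action[OF assms(1)] by blast
  show "Poly_Mapping.keys (divisor_action s D) \<subseteq> points"
    unfolding g(2)[OF assms(2)] by (rule aut_action[OF g(1) assms(2)])
  have "divisor_action s ` cls D = divisor_action g ` cls D"
    by (rule image_cong[OF refl]) (rule g(2), erule cls_keys, rule assms(2))
  thus "divisor_action s ` cls D = cls (divisor_action s D)"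
    unfolding g(2)[OF assms(2)] by (simp only: aut_action_cls[OF g(1) assms(2)])
qed

text \<open>The rational points of the Jacobian in terms of representatives of degree 0; invariance
  is required of the class, not of the divisor.\<close>

definition rational_classes :: "(ambient set \<Rightarrow>\<^sub>0 int) set set"
  where "rational_classes = cls ` {D. Poly_Mapping.keys D \<subseteq> points \<and> divisor_degree D = 0 \<and>
    (\<forall>s\<in>field_automorphisms L (rational_function_field q F). cls (divisor_action s D) = cls D)}"

lemma rational_classesE:
  assumes "c \<in> rational_classes"
  obtains D where "c = cls D" "Poly_Mapping.keys D \<subseteq> points" "divisor_degree D = 0"
    "\<And>s. s \<in> field_automorphisms L (rational_function_field q F) \<Longrightarrow> cls (divisor_action s D) = cls D"
  using assms by (auto simp: rational_classes_def)

lemma rational_classesI: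
  assumes "Poly_Mapping.keys D \<subseteq> points" "divisor_degree D = 0"
    "\<And>s. s \<in> field_automorphisms L (rational_function_field q F) \<Longrightarrow> cls (divisor_action s D) = cls D"
  shows "cls D \<in> rational_classes"
  using assms by (auto simp: rational_classes_def)

lemma jacobian_eq: "superelliptic_jacobian q F = (Div Mod H)\<lparr>carrier := rational_classes\<rparr>"
proof -
  let ?S = "field_automorphisms L (rational_function_field q F)"
  have C: "{c \<in> carrier (Div Mod H). (\<exists>D\<in>c. divisor_degree D = 0) \<and> (\<forall>s\<in>?S. divisor_action s ` c = c)} =
      rational_classes" (is "?C = _")
  proof
    show "?C \<subseteq> rational_classes"
    proof
      fix c assume "c \<in> ?C"
      then obtain D' D where c: "c = cls D'" "Poly_Mapping.keys D' \<subseteq> points" "D \<in> c" "divisor_degree D = 0"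
        and inv: "\<And>s. s \<in> ?S \<Longrightarrow> divisor_action s ` c = c"
        by (auto simp: carrier_FactGroup cls_def)
      have D: "Poly_Mapping.keys D \<subseteq> points" "cls D = c" using cls_keys[of D D'] cls_eq[of D D'] c(1-3) by auto
      have "cls (divisor_action s D) = cls D" if s: "s \<in> ?S" for s
        using field_automorphism_cls(2)[OF s D(1)] inv[OF s] D(2) by simp
      thus "c \<in> rational_classes" using rational_classesI[OF D(1) c(4)] D(2) by simp
    qed
    show "rational_classes \<subseteq> ?C"
    proof
      fix c assume "c \<in> rational_classes"
      then obtain D where D: "c = cls D" "Poly_Mapping.keys D \<subseteq> points" "divisor_degree D = 0"
        "\<And>s. s \<in> ?S \<Longrightarrow> cls (divisor_action s D) = cls D" by (rule rational_classesE) blast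
      have "divisor_action s ` c = c" if s: "s \<in> ?S" for s
        unfolding D(1) field_automorphism_cls(2)[OF s D(2)] by (rule D(4)[OF s])
      thus "c \<in> ?C" using cls_carrier[OF D(2)] cls_self[OF D(2)] D(1,3) by blast
    qed
  qed
  have "superelliptic_jacobian q F = (Div Mod H)\<lparr>carrier :=
      {c \<in> {c \<in> carrier (Div Mod H). \<exists>D\<in>c. divisor_degree D = 0}. \<forall>s\<in>?S. divisor_action s ` c = c}\<rparr>"
    unfolding superelliptic_jacobian_def jacobian_rational_points_def Pic0_def divisor_class_group_def
      divisor_group_def geometric_function_field Div_def H_def points_def
    by simp
  also have "{c \<in> {c \<in> carrier (Div Mod H). \<exists>D\<in>c. divisor_degree D = 0}. \<forall>s\<in>?S. divisor_action s ` c = c} =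
      rational_classes"
    unfolding C[symmetric] by blast
  finally show ?thesis .
qed

sublocale Q: comm_group "Div Mod H"
  by (rule Div.abelian_FactGroup[OF H_subgroup])

lemma rational_classes_subgroup: "subgroup rational_classes (Div Mod H)"
proof (rule Q.subgroupI)
  show "rational_classes \<subseteq> carrier (Div Mod H)"
    by (auto simp: rational_classes_def intro: cls_carrier)
  have "cls 0 \<in> rational_classes" by (rule rational_classesI) (auto simp: divisor_action_def)
  thus "rational_classes \<noteq> {}" by blast
next
  fix c assume "c \<in> rational_classes"
  then obtain D where D: "c = cls D" "Poly_Mapping.keys D \<subseteq> points" "divisor_degree D = 0"
    "\<And>s. s \<in> field_automorphisms L (rational_function_field q F) \<Longrightarrow> cls (divisor_action s D) = cls D"
    by (rule rational_classesE) blast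
  have "cls (- D) \<in> rational_classes"
  proof (rule rational_classesI)
    fix s assume s: "s \<in> field_automorphisms L (rational_function_field q F)"
    show "cls (divisor_action s (- D)) = cls (- D)"
      unfolding divisor_action_uminus cls_inv[OF D(2), symmetric]
        cls_inv[OF field_automorphism_cls(1)[OF s D(2)], symmetric] D(4)[OF s] ..
  qed (use D in \<open>simp_all add: divisor_degree_uminus\<close>)
  thus "inv\<^bsub>Div Mod H\<^esub> c \<in> rational_classes" using cls_inv[OF D(2)] D(1) by simp
next
  fix c d assume "c \<in> rational_classes" "d \<in> rational_classes"
  obtain D where D: "c = cls D" "Poly_Mapping.keys D \<subseteq> points" "divisor_degree D = 0"
    "\<And>s. s \<in> field_automorphisms L (rational_function_field q F) \<Longrightarrow> cls (divisor_action s D) = cls D"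
    using \<open>c \<in> rational_classes\<close> by (rule rational_classesE) blast
  obtain E where E: "d = cls E" "Poly_Mapping.keys E \<subseteq> points" "divisor_degree E = 0"
    "\<And>s. s \<in> field_automorphisms L (rational_function_field q F) \<Longrightarrow> cls (divisor_action s E) = cls E"
    using \<open>d \<in> rational_classes\<close> by (rule rational_classesE) blast
  have "cls (D + E) \<in> rational_classes"
  proof (rule rational_classesI)
    show "Poly_Mapping.keys (D + E) \<subseteq> points" using keys_add[of D E] D(2) E(2) by blast
    show "divisor_degree (D + E) = 0" using D(3) E(3) by (simp add: divisor_degree_add)
    fix s assume s: "s \<in> field_automorphisms L (rational_function_field q F)"
    show "cls (divisor_action s (D + E)) = cls (D + E)"
      unfolding divisor_action_add cls_mult[OF D(2) E(2), symmetric] D(4)[OF s] E(4)[OF s]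
        cls_mult[OF field_automorphism_cls(1)[OF s D(2)] field_automorphism_cls(1)[OF s E(2)], symmetric] ..
  qed
  thus "c \<otimes>\<^bsub>Div Mod H\<^esub> d \<in> rational_classes" using cls_mult[OF D(2) E(2)] D(1) E(1) by simp
qed

definition J :: "(ambient set \<Rightarrow>\<^sub>0 int) set monoid"
  where "J = (Div Mod H)\<lparr>carrier := rational_classes\<rparr>"

lemma J_simps [simp]: "carrier J = rational_classes" "monoid.mult J = monoid.mult (Div Mod H)" "\<one>\<^bsub>J\<^esub> = H"
  by (simp_all add: J_def)

sublocale J: comm_group J
proof (rule group.group_comm_groupI)
  show "group J" unfolding J_def
    by (rule subgroup.subgroup_is_group[OF rational_classes_subgroup Q.is_group])
  show "x \<otimes>\<^bsub>J\<^esub> y = y \<otimes>\<^bsub>J\<^esub> x" if "x \<in> carrier J" "y \<in> carrier J" for x y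
    using that Q.m_comm subgroup.subset[OF rational_classes_subgroup] by (auto simp: subset_iff)
qed

lemma J_int_pow_closed: "c \<in> rational_classes \<Longrightarrow> c [^]\<^bsub>J\<^esub> (n :: int) \<in> rational_classes"
  using J.int_pow_closed[of c n] by simp

lemma J_int_pow:
  assumes "Poly_Mapping.keys D \<subseteq> points" "cls D \<in> rational_classes"
  shows "cls D [^]\<^bsub>J\<^esub> (n :: int) = cls (frag_cmul n D)"
  using Q.int_pow_consistent[OF rational_classes_subgroup assms(2), of n] cls_int_pow[OF assms(1), of n]
  by (simp add: J_def)

lemma keys_sum_points:
  "finite I \<Longrightarrow> (\<And>i. i \<in> I \<Longrightarrow> Poly_Mapping.keys (D i) \<subseteq> points) \<Longrightarrow>
    Poly_Mapping.keys (\<Sum>i\<in>I. frag_cmul (b i) (D i)) \<subseteq> points"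
  using sum_closed_free_Abelian_group[of I "\<lambda>i. frag_cmul (b i) (D i)" points] keys_cmul by fastforce

lemma J_finprod:
  assumes "finite I" "\<And>i. i \<in> I \<Longrightarrow> Poly_Mapping.keys (D i) \<subseteq> points"
    and "\<And>i. i \<in> I \<Longrightarrow> cls (D i) \<in> rational_classes"
  shows "finprod J (\<lambda>i. cls (D i) [^]\<^bsub>J\<^esub> (b i :: int)) I = cls (\<Sum>i\<in>I. frag_cmul (b i) (D i))"
  using assms
proof (induction I rule: finite_induct)
  case empty
  thus ?case by (simp add: cls_zero)
next
  case (insert i I)
  have k: "Poly_Mapping.keys (frag_cmul (b i) (D i)) \<subseteq> points"
    using keys_cmul[of "b i" "D i"] insert.prems(1)[of i] by blast
  have k': "Poly_Mapping.keys (\<Sum>i\<in>I. frag_cmul (b i) (D i)) \<subseteq> points"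
    by (rule keys_sum_points[OF insert.hyps(1)]) (rule insert.prems(1), simp)
  have "finprod J (\<lambda>i. cls (D i) [^]\<^bsub>J\<^esub> b i) (insert i I) =
      cls (D i) [^]\<^bsub>J\<^esub> b i \<otimes>\<^bsub>J\<^esub> finprod J (\<lambda>i. cls (D i) [^]\<^bsub>J\<^esub> b i) I"
    using insert.hyps insert.prems(2) by (intro J.finprod_insert) (auto simp: J_int_pow_closed)
  also have "\<dots> = cls (frag_cmul (b i) (D i)) \<otimes>\<^bsub>Div Mod H\<^esub> cls (\<Sum>i\<in>I. frag_cmul (b i) (D i))"
    using insert.IH insert.prems J_int_pow[of "D i" "b i"] by simp
  also have "\<dots> = cls (\<Sum>i\<in>insert i I. frag_cmul (b i) (D i))"
    unfolding cls_mult[OF k k'] using insert.hyps by simp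
  finally show ?case .
qed

text \<open>The coefficients are the orders at the \<open>P i\<close> of a function without further
  affine zeros or poles.\<close>

lemma special_divisor_principal:
  assumes "(\<Sum>i<p. frag_cmul (e i) (frag_of (P i))) \<in> H" "j < p"
  shows "e j = e 0"
proof -
  define D where "D = (\<Sum>i<p. frag_cmul (e i) (frag_of (P i)))"
  have lookup_P: "Poly_Mapping.lookup D (P i) = e i" if "i < p" for i
  proof -
    have "Poly_Mapping.lookup D (P i) = (\<Sum>j<p. if i = j then e j else 0)"
      unfolding D_def lookup_sum using inj_onD[OF P_inj, of i] that by (intro sum.cong) auto
    thus ?thesis using that by simp
  qed
  have lookup_other: "Poly_Mapping.lookup D V = 0" if "V \<notin> P ` {..<p}" for V
    unfolding D_def lookup_sum using that by (intro sum.neutral) auto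
  obtain f where f: "f \<in> L" "f \<noteq> 0" "\<forall>V\<in>points. Poly_Mapping.lookup D V = ord_at V f"
    using assms(1) unfolding H_iff D_def by blast
  have "ord_at (P j) f = ord_at (P 0) f"
    by (rule special_orders_equal) (use f lookup_other assms(2) in auto)
  thus ?thesis using f(3) P_point lookup_P assms(2) p_gt_2 by (metis less_trans zero_less_numeral)
qed

definition D :: "nat \<Rightarrow> ambient set \<Rightarrow>\<^sub>0 int"
  where "D i = frag_of (P i) - frag_of (P (p - 1))"

lemma keys_D: "i < p \<Longrightarrow> Poly_Mapping.keys (D i) \<subseteq> points"
  using keys_diff[of "frag_of (P i)" "frag_of (P (p - 1))"] P_point[of i] P_point[of "p - 1"] p_gt_2
  by (auto simp: D_def)

lemma D_rational:
  assumes "i < p"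
  shows "cls (D i) \<in> rational_classes"
proof (rule rational_classesI[OF keys_D[OF assms]])
  show "divisor_degree (D i) = 0"
    using divisor_degree_add[of "D i" "frag_of (P (p - 1))"] by (simp add: D_def divisor_degree_frag_of)
  fix s assume "s \<in> field_automorphisms L (rational_function_field q F)"
  then obtain g where g: "g \<in> auts" "\<And>D. Poly_Mapping.keys D \<subseteq> points \<Longrightarrow> divisor_action s D = divisor_action g D"
    using field_automorphism_action by blast
  have "divisor_action g (D i) = D i"
    using aut_P[OF g(1)] assms p_gt_2 by (simp add: divisor_action_def D_def frag_extend_diff)
  thus "cls (divisor_action s (D i)) = cls (D i)" using g(2)[OF keys_D[OF assms]] by simp
qed

text \<open>The coefficient of the last point is \<open>- (\<Sum>i<p - 1. a i)\<close>. If all \<open>p\<close> coefficients agree, they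
  vanish, since they sum up to zero.\<close>

lemma D_independent:
  assumes "(\<Sum>i<p - 1. frag_cmul (a i) (D i)) \<in> H" "j < p - 1"
  shows "a j = 0"
proof -
  define e where "e i = (if i < p - 1 then a i else - (\<Sum>i<p - 1. a i))" for i
  have Suc: "{..<p} = insert (p - 1) {..<p - 1}" using p_gt_2 by auto
  have "(\<Sum>i<p. frag_cmul (e i) (frag_of (P i))) =
      (\<Sum>i<p - 1. frag_cmul (a i) (frag_of (P i))) + frag_cmul (- (\<Sum>i<p - 1. a i)) (frag_of (P (p - 1)))"
  proof -
    have "(\<Sum>i<p - 1. frag_cmul (e i) (frag_of (P i))) = (\<Sum>i<p - 1. frag_cmul (a i) (frag_of (P i)))"
      by (intro sum.cong) (auto simp: e_def)
    thus ?thesis unfolding Suc by (simp add: e_def add.commute)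
  qed
  also have "frag_cmul (- (\<Sum>i<p - 1. a i)) E = - (\<Sum>i<p - 1. frag_cmul (a i) E)" for E :: "ambient set \<Rightarrow>\<^sub>0 int"
    by (rule poly_mapping_eqI) (simp add: lookup_sum sum_distrib_right)
  also have "(\<Sum>i<p - 1. frag_cmul (a i) (frag_of (P i))) + - (\<Sum>i<p - 1. frag_cmul (a i) (frag_of (P (p - 1)))) =
      (\<Sum>i<p - 1. frag_cmul (a i) (D i))"
    by (rule poly_mapping_eqI)
      (simp add: lookup_sum lookup_add lookup_minus D_def right_diff_distrib sum_subtractf del: lookup_frag_of)
  finally have "(\<Sum>i<p. frag_cmul (e i) (frag_of (P i))) \<in> H" using assms(1) by simp
  note e = special_divisor_principal[OF this]
  have "(\<Sum>i<p. e i) = (\<Sum>i<p. e 0)" by (intro sum.cong refl) (rule e, simp)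
  hence "(\<Sum>i<p. e i) = int p * e 0" by simp
  moreover have "(\<Sum>i<p. e i) = 0"
  proof -
    have "(\<Sum>i<p - 1. e i) = (\<Sum>i<p - 1. a i)" by (intro sum.cong) (auto simp: e_def)
    thus ?thesis unfolding Suc by (simp add: e_def)
  qed
  ultimately have "e 0 = 0" using p_gt_2 by simp
  hence "e j = 0" using e[of j] assms(2) by simp
  thus ?thesis using assms(2) by (simp add: e_def)
qed

text \<open>Needed to count \<open>p - 1\<close> different classes: a coincidence would be a
  relation with coefficients 1 and -1.\<close>

lemma D_inj: "inj_on (\<lambda>i. cls (D i)) {..<p - 1}"
proof (rule inj_onI, rule ccontr)
  fix i j assume ij: "i \<in> {..<p - 1}" "j \<in> {..<p - 1}" "cls (D i) = cls (D j)" "i \<noteq> j"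
  define a where "a m = (if m = i then 1 else 0) - (if m = j then 1 else 0 :: int)" for m
  have k: "Poly_Mapping.keys (D i) \<subseteq> points" "Poly_Mapping.keys (D j) \<subseteq> points"
    using keys_D[of i] keys_D[of j] ij(1,2) by auto
  have "D i \<in> cls (D j)" using cls_self[OF k(1)] ij(3) by simp
  hence "D i - D j \<in> H" by (auto simp: cls_conv)
  moreover have "(\<Sum>m<p - 1. frag_cmul (a m) (D m)) = D i - D j"
  proof -
    have "frag_cmul (a m) (D m) = (if m = i then D m else 0) - (if m = j then D m else 0)" for m
      using ij(4) by (simp add: a_def)
    thus ?thesis using ij(1,2) by (simp add: sum_subtractf)
  qed
  ultimately have "a i = 0" using D_independent[of a i] ij(1) by simp
  thus False using ij(4) by (simp add: a_def)
qed

lemma rank_ge: "abelian_rank J \<ge> enat (p - 1)"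
proof -
  let ?S = "(\<lambda>i. cls (D i)) ` {..<p - 1}"
  have rat: "cls (D i) \<in> rational_classes" "Poly_Mapping.keys (D i) \<subseteq> points" if "i < p - 1" for i
    using that D_rational[of i] keys_D[of i] by auto
  have "int_independent J ?S" unfolding int_independent_def
  proof (intro conjI allI impI)
    show "?S \<subseteq> carrier J" using rat by auto
    fix a :: "(ambient set \<Rightarrow>\<^sub>0 int) set \<Rightarrow> int"
    assume a: "finprod J (\<lambda>x. x [^]\<^bsub>J\<^esub> a x) ?S = \<one>\<^bsub>J\<^esub>"
    let ?E = "\<Sum>i<p - 1. frag_cmul (a (cls (D i))) (D i)"
    have "finprod J (\<lambda>x. x [^]\<^bsub>J\<^esub> a x) ?S = finprod J (\<lambda>i. cls (D i) [^]\<^bsub>J\<^esub> a (cls (D i))) {..<p - 1}"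
      by (rule J.finprod_reindex[OF _ D_inj]) (use rat in \<open>auto simp: J_int_pow_closed\<close>)
    also have "\<dots> = cls ?E" by (rule J_finprod) (use rat in auto)
    finally have "cls ?E = H" using a by simp
    hence "?E \<in> H" using keys_sum_points[of "{..<p - 1}" D "\<lambda>i. a (cls (D i))"] rat(2) cls_eq_H_iff by auto
    thus "\<forall>x\<in>?S. a x = 0" using D_independent[of "\<lambda>i. a (cls (D i))"] by blast
  qed auto
  hence "?S \<in> {S. int_independent J S}" by simp
  from SUP_upper[OF this, of "\<lambda>S. enat (card S)"]
  show ?thesis unfolding abelian_rank_def using card_image[OF D_inj] by simp
qed

lemma mordell_weil_rank_ge: "mordell_weil_rank q F \<ge> enat (p - 1)"
  using rank_ge unfolding mordell_weil_rank_def jacobian_eq J_def .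

end

theorem theorem2:
  fixes p q :: nat and k :: int
  assumes "prime p" and "odd p"
    and "prime q" and "q dvd p - 1"
    and "\<exists>l :: nat. prime l \<and> l > p \<and> int l dvd k"
    and "\<not> int p dvd k"
  shows "mordell_weil_rank q ((\<Prod>i<p. [:- of_nat i, 1:]) + [:of_int (k ^ q):]) \<ge> enat (p - 1)"
proof -
  interpret curve p q k
    by unfold_locales (use assms in auto)
  show ?thesis
    using mordell_weil_rank_ge unfolding F_def .
qed

end
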